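(* Let $I$ be a small category and let $(\mathcal U_I,\mathcal O_I)$ be an $I$-diagram of ringed spaces in $P(\mathcal C,\mathrm{Grpd})$. Let $\mathcal O$ be a sheaf of rings on $\operatorname{hocolim}\mathcal U_i$ which is isomorphic to $[\mathcal O_I]\in\operatorname{holim}Sh(\mathcal U_i,\mathrm{Ring})$. Then $$\mathcal O\text{-mod}\xrightarrow{\ \sim\ }\operatorname{holim}(\mathcal O_i\text{-mod})$$ is an equivalence of categories, and this equivalence restricts to an equivalence for quasi-coherent modules $$\mathcal O\text{-mod}_{qc}\xrightarrow{\ \sim\ }\operatorname{holim}(\mathcal O_i\text{-mod}_{qc}).$$
   Context: $\mathcal C$ is a small site closed under finite products and pullbacks, with topology given by covering families. $P(\mathcal C,\mathrm{Grpd})$ is the category of presheaves of groupoids on $\mathcal C$; objects of $\mathcal C$ are identified with the presheaves they represent. For $\mathcal M\in P(\mathcal C,\mathrm{Grpd})$ the site $\mathcal C/\mathcal M$ has objects the pairs $(X,f)$ with $X\in\mathcal C$, $f\in\mathrm{ob}\,\mathcal M(X)$ (equivalently $f\colon X\to\mathcal M$), and morphisms $(X,f)\to(X',g)$ the pairs $(h,\alpha)$ with $h\colon X\to X'$ in $\mathcal C$ and $\alpha\colon f\to h^*g$ an isomorphism in $\mathcal M(X)$. Covers are the families of morphisms whose images in $\mathcal C$ are covers. A sheaf on $\mathcal M$ means a sheaf on $\mathcal C/\mathcal M$; $Sh(\mathcal M,\mathrm{Ring})$ is the category of sheaves of rings on it. For $\phi\colon\mathcal M'\to\mathcal M$, $\phi^*$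 is composition with the induced functor $\mathcal C/\mathcal M'\to\mathcal C/\mathcal M$. Modules: for a sheaf of rings $\mathcal O$ on $\mathcal M$, $\mathcal O$-mod is the category of sheaves of $\mathcal O$-modules, and $\mathcal O$-mod$_{qc}$ the full subcategory of quasi-coherent ones, i.e. those $\mathcal F$ such that for every $a\colon X\to\mathcal M$, $X\in\mathcal C$, there exist a cover $\{u_i\colon U_i\to X\}$ and exact sequences $\oplus_{A}(a\circ u_i)^*\mathcal O\to\oplus_{A'}(a\circ u_i)^*\mathcal O\to(a\circ u_i)^*\mathcal F\to0$ of $(a\circ u_i)^*\mathcal O$-modules on $\mathcal C/U_i$ (for some index sets $A,A'$). Diagrams of ringed spaces: a ringed space in $P(\mathcal C,\mathrm{Grpd})$ is a pair $(\mathcal U,\mathcal O_{\mathcal U})$ with $\mathcal U\in P(\mathcal C,\mathrm{Grpd})$ and $\mathcal O_{\mathcal U}$ a sheaf of rings on $\mathcal U$. An $I$-diagram of ringed spaces $(\mathcal U_I,\mathcal O_I)$ is an $I$-diagram $\mathcal U_I$ in $P(\mathcal C,\mathrm{Grpd})$ with sheaves of rings $\mathcal O_i$ on $\mathcal U_i$ and, for each $\phi\colon i\to j$ in $I$, an isomorphism $\alpha_\phi\colon\phi^*\mathcal O_j\to\mathcal O_i$ of sheaves of rings on $\mathcal U_i$, such that $\alpha_{id}=id$ and $\alpha_{\psi\circ\phi}=\alpha_\phi\circ\phi^*(\alpha_\psi)$. This data is an object $[\mathcal O_I]$ of $\operatorname{holim}Sh(\mathcal U_i,\mathrm{Ring})$.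 It gives an $I^{op}$-diagram of categories $i\mapsto\mathcal O_i$-mod, assigning to $\phi\colon i\to j$ the composite $\mathcal O_j\text{-mod}\xrightarrow{\phi^*}\phi^*\mathcal O_j\text{-mod}\cong\mathcal O_i\text{-mod}$, the second functor being transport along $\alpha_\phi$. Restricting $\mathcal O$ along the canonical maps $\mathcal U_i\to\operatorname{hocolim}\mathcal U_i$ gives an object of $\operatorname{holim}Sh(\mathcal U_i,\mathrm{Ring})$, which is what is required to be isomorphic to $[\mathcal O_I]$. Homotopy colimits: for a small category $J$ let $\pi(J)$ be its fundamental groupoid ($J$ with all morphisms inverted). For a diagram of groupoids $\mathcal G_I$, $\operatorname{hocolim}\mathcal G_i$ is the coequalizer of $\coprod_{i\to j}\mathcal G(i)\times\pi(j/I)\rightrightarrows\coprod_{i}\mathcal G(i)\times\pi(i/I)$; in $P(\mathcal C,\mathrm{Grpd})$ it is computed objectwise. Homotopy limits of categories: for a $K$-diagram $\mathcal E$ of categories, up to equivalence, $\operatorname{holim}\mathcal E$ has objects families $(x_k)_{k\in K}$, $x_k\in\mathcal E(k)$, with isomorphisms $\theta_f\colon \mathcal E(f)(x_k)\to x_l$ for each $f\colon k\to l$, such that $\theta_{id}=id$ and $\theta_{gf}=\theta_g\circ\mathcal E(g)(\theta_f)$, and morphisms the families $x_k\to y_k$ compatible with the $\theta$'s. *)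

theory Defs
  imports "HOL-Algebra.Module"
begin

section \<open>Categories, functors, equivalences\<close>

record ('o, 'a) cat =
  Obj :: "'o set"
  Arr :: "'a set"
  Dom :: "'a \<Rightarrow> 'o"
  Cod :: "'a \<Rightarrow> 'o"
  Ident :: "'o \<Rightarrow> 'a"
  Comp :: "'a \<Rightarrow> 'a \<Rightarrow> 'a"  \<comment> \<open>\<open>Comp C g f\<close> is \<open>g\<close> after \<open>f\<close>\<close>

definition Hom :: "('o, 'a, 'z) cat_scheme \<Rightarrow> 'o \<Rightarrow> 'o \<Rightarrow> 'a set" where
  "Hom C x y = {f \<in> Arr C. Dom C f = x \<and> Cod C f = y}"

definition is_category :: "('o, 'a, 'z) cat_scheme \<Rightarrow> bool" where
  "is_category C \<longleftrightarrow>
     (\<forall>f\<in>Arr C. Dom C f \<in> Obj C \<and> Cod C f \<in> Obj C) \<and>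
     (\<forall>x\<in>Obj C. Ident C x \<in> Hom C x x) \<and>
     (\<forall>f\<in>Arr C. \<forall>g\<in>Arr C. Dom C g = Cod C f \<longrightarrow> Comp C g f \<in> Hom C (Dom C f) (Cod C g)) \<and>
     (\<forall>f\<in>Arr C. Comp C f (Ident C (Dom C f)) = f \<and> Comp C (Ident C (Cod C f)) f = f) \<and>
     (\<forall>f\<in>Arr C. \<forall>g\<in>Arr C. \<forall>h\<in>Arr C. Dom C g = Cod C f \<and> Dom C h = Cod C g \<longrightarrow>
        Comp C h (Comp C g f) = Comp C (Comp C h g) f)"

definition is_isomorphism :: "('o, 'a, 'z) cat_scheme \<Rightarrow> 'a \<Rightarrow> bool" where
  "is_isomorphism C f \<longleftrightarrow> f \<in> Arr C \<and>
     (\<exists>g\<in>Hom C (Cod C f) (Dom C f).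
        Comp C g f = Ident C (Dom C f) \<and> Comp C f g = Ident C (Cod C f))"

definition is_groupoid :: "('o, 'a, 'z) cat_scheme \<Rightarrow> bool" where
  "is_groupoid G \<longleftrightarrow> is_category G \<and> (\<forall>f\<in>Arr G. is_isomorphism G f)"

definition op_cat :: "('o, 'a, 'z) cat_scheme \<Rightarrow> ('o, 'a) cat" where
  "op_cat C = \<lparr>Obj = Obj C, Arr = Arr C, Dom = Cod C, Cod = Dom C, Ident = Ident C,
     Comp = (\<lambda>g f. Comp C f g)\<rparr>"

definition full_subcat :: "('o, 'a) cat \<Rightarrow> ('o \<Rightarrow> bool) \<Rightarrow> ('o, 'a) cat" where
  "full_subcat C P = C\<lparr>Obj := {x \<in> Obj C. P x}, Arr := {f \<in> Arr C. P (Dom C f) \<and> P (Cod C f)}\<rparr>"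

record ('o, 'a, 'p, 'b) ftr =
  FOb :: "'o \<Rightarrow> 'p"
  FAr :: "'a \<Rightarrow> 'b"

definition is_functor ::
  "('o, 'a, 'y) cat_scheme \<Rightarrow> ('p, 'b, 'z) cat_scheme \<Rightarrow> ('o, 'a, 'p, 'b) ftr \<Rightarrow> bool" where
  "is_functor A B F \<longleftrightarrow> is_category A \<and> is_category B \<and>
     (\<forall>x\<in>Obj A. FOb F x \<in> Obj B) \<and>
     (\<forall>f\<in>Arr A. FAr F f \<in> Hom B (FOb F (Dom A f)) (FOb F (Cod A f))) \<and>
     (\<forall>x\<in>Obj A. FAr F (Ident A x) = Ident B (FOb F x)) \<and>
     (\<forall>f\<in>Arr A. \<forall>g\<in>Arr A. Dom A g = Cod A f \<longrightarrow>
        FAr F (Comp A g f) = Comp B (FAr F g) (FAr F f))"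

definition ftr_id :: "('o, 'a, 'o, 'a) ftr" where
  "ftr_id = \<lparr>FOb = (\<lambda>x. x), FAr = (\<lambda>f. f)\<rparr>"

definition ftr_comp ::
  "('p, 'b, 'q, 'c) ftr \<Rightarrow> ('o, 'a, 'p, 'b) ftr \<Rightarrow> ('o, 'a, 'q, 'c) ftr" where
  "ftr_comp G F = \<lparr>FOb = (\<lambda>x. FOb G (FOb F x)), FAr = (\<lambda>f. FAr G (FAr F f))\<rparr>"

definition ftr_agree ::
  "('o, 'a, 'y) cat_scheme \<Rightarrow> ('o, 'a, 'p, 'b) ftr \<Rightarrow> ('o, 'a, 'p, 'b) ftr \<Rightarrow> bool" where
  "ftr_agree A F G \<longleftrightarrow>
     (\<forall>x\<in>Obj A. FOb F x = FOb G x) \<and> (\<forall>f\<in>Arr A. FAr F f = FAr G f)"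

definition is_natural_iso ::
  "('o, 'a, 'y) cat_scheme \<Rightarrow> ('p, 'b, 'z) cat_scheme \<Rightarrow>
   ('o, 'a, 'p, 'b) ftr \<Rightarrow> ('o, 'a, 'p, 'b) ftr \<Rightarrow> ('o \<Rightarrow> 'b) \<Rightarrow> bool" where
  "is_natural_iso A B F G t \<longleftrightarrow>
     (\<forall>x\<in>Obj A. t x \<in> Hom B (FOb F x) (FOb G x) \<and> is_isomorphism B (t x)) \<and>
     (\<forall>f\<in>Arr A. Comp B (t (Cod A f)) (FAr F f) = Comp B (FAr G f) (t (Dom A f)))"

definition is_equivalence ::
  "('o, 'a, 'y) cat_scheme \<Rightarrow> ('p, 'b, 'z) cat_scheme \<Rightarrow> ('o, 'a, 'p, 'b) ftr \<Rightarrow> bool" where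
  "is_equivalence A B F \<longleftrightarrow> is_functor A B F \<and>
     (\<exists>G. is_functor B A G \<and>
        (\<exists>t. is_natural_iso A A ftr_id (ftr_comp G F) t) \<and>
        (\<exists>t. is_natural_iso B B (ftr_comp F G) ftr_id t))"


section \<open>Sites\<close>

text \<open>A covering family is given by the set of its members; a family is thus covering if and only
  if the set of its members is.\<close>

record ('o, 'a) site = "('o, 'a) cat" +
  Cov :: "'o \<Rightarrow> 'a set set"

definition is_product :: "('o, 'a, 'z) cat_scheme \<Rightarrow> nat \<Rightarrow> (nat \<Rightarrow> 'o) \<Rightarrow> 'o \<Rightarrow> (nat \<Rightarrow> 'a) \<Rightarrow> bool" where
  "is_product C n X P p \<longleftrightarrow> P \<in> Obj C \<and> (\<forall>k<n. p k \<in> Hom C P (X k)) \<and>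
     (\<forall>T\<in>Obj C. \<forall>q. (\<forall>k<n. q k \<in> Hom C T (X k)) \<longrightarrow>
        (\<exists>!h. h \<in> Hom C T P \<and> (\<forall>k<n. Comp C (p k) h = q k)))"

definition has_finite_products :: "('o, 'a, 'z) cat_scheme \<Rightarrow> bool" where
  "has_finite_products C \<longleftrightarrow> (\<forall>n X. (\<forall>k<n. X k \<in> Obj C) \<longrightarrow> (\<exists>P p. is_product C n X P p))"

text \<open>\<open>is_pullback C f g p q\<close>: the square with \<open>f p = g q\<close> is cartesian.\<close>

definition is_pullback :: "('o, 'a, 'z) cat_scheme \<Rightarrow> 'a \<Rightarrow> 'a \<Rightarrow> 'a \<Rightarrow> 'a \<Rightarrow> bool" where
  "is_pullback C f g p q \<longleftrightarrow>
     f \<in> Arr C \<and> g \<in> Arr C \<and> Cod C f = Cod C g \<and>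
     p \<in> Hom C (Dom C p) (Dom C f) \<and> q \<in> Hom C (Dom C p) (Dom C g) \<and>
     Comp C f p = Comp C g q \<and>
     (\<forall>T\<in>Obj C. \<forall>r\<in>Hom C T (Dom C f). \<forall>s\<in>Hom C T (Dom C g). Comp C f r = Comp C g s \<longrightarrow>
        (\<exists>!h. h \<in> Hom C T (Dom C p) \<and> Comp C p h = r \<and> Comp C q h = s))"

definition has_pullbacks :: "('o, 'a, 'z) cat_scheme \<Rightarrow> bool" where
  "has_pullbacks C \<longleftrightarrow>
     (\<forall>f\<in>Arr C. \<forall>g\<in>Arr C. Cod C f = Cod C g \<longrightarrow> (\<exists>p q. is_pullback C f g p q))"

definition is_site :: "('o, 'a) site \<Rightarrow> bool" where
  "is_site C \<longleftrightarrow> is_category C \<and>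
     (\<forall>X\<in>Obj C. \<forall>c\<in>Cov C X. \<forall>u\<in>c. u \<in> Arr C \<and> Cod C u = X) \<and>
     (\<forall>f. is_isomorphism C f \<longrightarrow> {f} \<in> Cov C (Cod C f)) \<and>
     (\<forall>X\<in>Obj C. \<forall>c\<in>Cov C X. \<forall>g\<in>Arr C. \<forall>p. Cod C g = X \<and>
        (\<forall>u\<in>c. \<exists>q. is_pullback C u g q (p u)) \<longrightarrow> p ` c \<in> Cov C (Dom C g)) \<and>
     (\<forall>X\<in>Obj C. \<forall>c\<in>Cov C X. \<forall>d. (\<forall>u\<in>c. d u \<in> Cov C (Dom C u)) \<longrightarrow>
        {Comp C u v | u v. u \<in> c \<and> v \<in> d u} \<in> Cov C X)"


section \<open>Presheaves of groupoids\<close>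

record ('c, 'a, 'o, 'g) gpsh =
  Val :: "'c \<Rightarrow> ('o, 'g) cat"
  Rst :: "'a \<Rightarrow> ('o, 'g, 'o, 'g) ftr"

definition is_gpsh :: "('c, 'a, 'z) cat_scheme \<Rightarrow> ('c, 'a, 'o, 'g) gpsh \<Rightarrow> bool" where
  "is_gpsh C M \<longleftrightarrow>
     (\<forall>X\<in>Obj C. is_groupoid (Val M X)) \<and>
     (\<forall>h\<in>Arr C. is_functor (Val M (Cod C h)) (Val M (Dom C h)) (Rst M h)) \<and>
     (\<forall>X\<in>Obj C. ftr_agree (Val M X) (Rst M (Ident C X)) ftr_id) \<and>
     (\<forall>h\<in>Arr C. \<forall>k\<in>Arr C. Dom C k = Cod C h \<longrightarrow>
        ftr_agree (Val M (Cod C k)) (Rst M (Comp C k h)) (ftr_comp (Rst M h) (Rst M k)))"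

definition is_gpsh_map ::
  "('c, 'a, 'z) cat_scheme \<Rightarrow> ('c, 'a, 'o, 'g) gpsh \<Rightarrow> ('c, 'a, 'p, 'q) gpsh \<Rightarrow>
   ('c \<Rightarrow> ('o, 'g, 'p, 'q) ftr) \<Rightarrow> bool" where
  "is_gpsh_map C M N \<phi> \<longleftrightarrow>
     (\<forall>X\<in>Obj C. is_functor (Val M X) (Val N X) (\<phi> X)) \<and>
     (\<forall>h\<in>Arr C. ftr_agree (Val M (Cod C h))
        (ftr_comp (\<phi> (Dom C h)) (Rst M h)) (ftr_comp (Rst N h) (\<phi> (Cod C h))))"

text \<open>The presheaf represented by \<open>X\<close>, with values discrete groupoids (the arrow type is the object
  type, every arrow being an identity), and the maps between representables.\<close>

definition rep :: "('c, 'a, 'z) cat_scheme \<Rightarrow> 'c \<Rightarrow> ('c, 'a, 'a, 'a) gpsh" where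
  "rep C X = \<lparr>
     Val = (\<lambda>V. \<lparr>Obj = Hom C V X, Arr = Hom C V X, Dom = (\<lambda>f. f), Cod = (\<lambda>f. f),
                 Ident = (\<lambda>f. f), Comp = (\<lambda>g f. f)\<rparr>),
     Rst = (\<lambda>h. \<lparr>FOb = (\<lambda>f. Comp C f h), FAr = (\<lambda>f. Comp C f h)\<rparr>)\<rparr>"

definition rep_map :: "('c, 'a, 'z) cat_scheme \<Rightarrow> 'a \<Rightarrow> 'c \<Rightarrow> ('a, 'a, 'a, 'a) ftr" where
  "rep_map C u = (\<lambda>V. \<lparr>FOb = (\<lambda>f. Comp C u f), FAr = (\<lambda>f. Comp C u f)\<rparr>)"

text \<open>The map \<open>X \<rightarrow> M\<close> that corresponds, by the Yoneda lemma, to an object \<open>a\<close> of \<open>M(X)\<close>.\<close>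

definition yoneda :: "('c, 'a, 'o, 'g) gpsh \<Rightarrow> 'o \<Rightarrow> 'c \<Rightarrow> ('a, 'a, 'o, 'g) ftr" where
  "yoneda M a = (\<lambda>V. \<lparr>FOb = (\<lambda>f. FOb (Rst M f) a),
                       FAr = (\<lambda>f. Ident (Val M V) (FOb (Rst M f) a))\<rparr>)"


section \<open>The site C/M\<close>

text \<open>Arrows carry their source and target, since \<open>(h, \<alpha>)\<close> does not determine the target.\<close>

type_synonym ('c, 'a, 'o, 'g) sl_arr = "('c \<times> 'o) \<times> ('c \<times> 'o) \<times> 'a \<times> 'g"

definition slice ::
  "('c, 'a) site \<Rightarrow> ('c, 'a, 'o, 'g) gpsh \<Rightarrow> ('c \<times> 'o, ('c, 'a, 'o, 'g) sl_arr) site" where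
  "slice C M = (let
      arrs = {((X, f), (Y, g), h, \<alpha>) | X f Y g h \<alpha>.
                X \<in> Obj C \<and> f \<in> Obj (Val M X) \<and> Y \<in> Obj C \<and> g \<in> Obj (Val M Y) \<and>
                h \<in> Hom C X Y \<and> \<alpha> \<in> Hom (Val M X) f (FOb (Rst M h) g)}
    in \<lparr>Obj = {(X, f). X \<in> Obj C \<and> f \<in> Obj (Val M X)},
        Arr = arrs,
        Dom = (\<lambda>(s, t, h, \<alpha>). s),
        Cod = (\<lambda>(s, t, h, \<alpha>). t),
        Ident = (\<lambda>(X, f). ((X, f), (X, f), Ident C X, Ident (Val M X) f)),
        Comp = (\<lambda>(s', t', k, \<beta>) (s, t, h, \<alpha>).
                  (s, t', Comp C k h, Comp (Val M (fst s)) (FAr (Rst M h) \<beta>) \<alpha>)),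
        Cov = (\<lambda>x. {c. c \<subseteq> {a \<in> arrs. fst (snd a) = x} \<and>
                      (\<lambda>(s, t, h, \<alpha>). h) ` c \<in> Cov C (fst x)})\<rparr>)"

definition slice_map ::
  "('c \<Rightarrow> ('o, 'g, 'p, 'q) ftr) \<Rightarrow>
   ('c \<times> 'o, ('c, 'a, 'o, 'g) sl_arr, 'c \<times> 'p, ('c, 'a, 'p, 'q) sl_arr) ftr" where
  "slice_map \<phi> = \<lparr>
     FOb = (\<lambda>(X, f). (X, FOb (\<phi> X) f)),
     FAr = (\<lambda>((X, f), (Y, g), h, \<alpha>).
              ((X, FOb (\<phi> X) f), (Y, FOb (\<phi> Y) g), h, FAr (\<phi> X) \<alpha>))\<rparr>"


section \<open>Sheaves with algebraic structure\<close>

text \<open>Sections over \<open>x\<close> form a structure with carrier in \<open>'v\<close>; the extension slot \<open>'z\<close> is that of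
  rings or of modules.\<close>

record ('x, 'f, 'v, 'z) psh =
  Sect :: "'x \<Rightarrow> ('v, 'z) partial_object_scheme"
  Restr :: "'f \<Rightarrow> 'v \<Rightarrow> 'v"

abbreviation Sec :: "('x, 'f, 'v, 'z) psh \<Rightarrow> 'x \<Rightarrow> 'v set" where
  "Sec F x \<equiv> carrier (Sect F x)"

text \<open>The values outside the objects and arrows of the site are normalised, so that pullback of
  sheaves is strictly functorial.\<close>

definition is_presheaf :: "('x, 'f, 'y) cat_scheme \<Rightarrow> ('x, 'f, 'v, 'z) psh \<Rightarrow> bool" where
  "is_presheaf S F \<longleftrightarrow>
     Sect F \<in> extensional (Obj S) \<and> Restr F \<in> extensional (Arr S) \<and>
     (\<forall>f\<in>Arr S. Restr F f \<in> Sec F (Cod S f) \<rightarrow> Sec F (Dom S f)) \<and>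
     (\<forall>x\<in>Obj S. \<forall>m\<in>Sec F x. Restr F (Ident S x) m = m) \<and>
     (\<forall>f\<in>Arr S. \<forall>g\<in>Arr S. Dom S g = Cod S f \<longrightarrow>
        (\<forall>m\<in>Sec F (Cod S g). Restr F (Comp S g f) m = Restr F f (Restr F g m)))"

definition is_sheaf :: "('x, 'f) site \<Rightarrow> ('x, 'f, 'v, 'z) psh \<Rightarrow> bool" where
  "is_sheaf S F \<longleftrightarrow> is_presheaf S F \<and>
     (\<forall>x\<in>Obj S. \<forall>c\<in>Cov S x. \<forall>s.
        (\<forall>f\<in>c. s f \<in> Sec F (Dom S f)) \<and>
        (\<forall>f\<in>c. \<forall>g\<in>c. \<forall>h\<in>Arr S. \<forall>k\<in>Arr S.
           Cod S h = Dom S f \<and> Cod S k = Dom S g \<and> Dom S h = Dom S k \<and>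
           Comp S f h = Comp S g k \<longrightarrow> Restr F h (s f) = Restr F k (s g)) \<longrightarrow>
        (\<exists>!m. m \<in> Sec F x \<and> (\<forall>f\<in>c. Restr F f m = s f)))"

definition nat_maps ::
  "('x, 'f, 'y) cat_scheme \<Rightarrow> ('x, 'f, 'v, 'z) psh \<Rightarrow> ('x, 'f, 'w, 'z') psh \<Rightarrow> ('x \<Rightarrow> 'v \<Rightarrow> 'w) set" where
  "nat_maps S F G = {\<eta> \<in> (\<Pi>\<^sub>E x\<in>Obj S. Sec F x \<rightarrow>\<^sub>E Sec G x).
     \<forall>f\<in>Arr S. \<forall>m\<in>Sec F (Cod S f). \<eta> (Dom S f) (Restr F f m) = Restr G f (\<eta> (Cod S f) m)}"

type_synonym ('x, 'f, 'v, 'z) psh_arr =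
  "('x, 'f, 'v, 'z) psh \<times> ('x, 'f, 'v, 'z) psh \<times> ('x \<Rightarrow> 'v \<Rightarrow> 'v)"

definition psh_cat ::
  "('x, 'f, 'y) cat_scheme \<Rightarrow> ('x, 'f, 'v, 'z) psh set \<Rightarrow> ('x, 'f, 'v, 'z) psh_arr set \<Rightarrow>
   (('x, 'f, 'v, 'z) psh, ('x, 'f, 'v, 'z) psh_arr) cat" where
  "psh_cat S Os Hs = \<lparr>
     Obj = Os,
     Arr = {(F, G, \<eta>). F \<in> Os \<and> G \<in> Os \<and> \<eta> \<in> nat_maps S F G \<and> (F, G, \<eta>) \<in> Hs},
     Dom = (\<lambda>(F, G, \<eta>). F),
     Cod = (\<lambda>(F, G, \<eta>). G),
     Ident = (\<lambda>F. (F, F, \<lambda>x\<in>Obj S. \<lambda>m\<in>Sec F x. m)),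
     Comp = (\<lambda>(G', H, \<epsilon>) (F, G, \<eta>). (F, H, \<lambda>x\<in>Obj S. \<lambda>m\<in>Sec F x. \<epsilon> x (\<eta> x m)))\<rparr>"

definition psh_pull ::
  "('x, 'f, 'y) cat_scheme \<Rightarrow> ('x, 'f, 'x', 'f') ftr \<Rightarrow> ('x', 'f', 'v, 'z) psh \<Rightarrow> ('x, 'f, 'v, 'z) psh" where
  "psh_pull S P F = \<lparr>Sect = (\<lambda>x\<in>Obj S. Sect F (FOb P x)), Restr = (\<lambda>f\<in>Arr S. Restr F (FAr P f))\<rparr>"

definition psh_pull_arr ::
  "('x, 'f, 'y) cat_scheme \<Rightarrow> ('x, 'f, 'x', 'f') ftr \<Rightarrow> ('x', 'f', 'v, 'z) psh_arr \<Rightarrow>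
   ('x, 'f, 'v, 'z) psh_arr" where
  "psh_pull_arr S P = (\<lambda>(F, G, \<eta>). (psh_pull S P F, psh_pull S P G, \<lambda>x\<in>Obj S. \<eta> (FOb P x)))"


subsection \<open>Sheaves of rings\<close>

text \<open>Rings are unital and associative, not necessarily commutative; modules are left modules.\<close>

type_synonym ('x, 'f, 'r) rsheaf = "('x, 'f, 'r, ('r, ('r, unit) ring_ext) monoid_ext) psh"
type_synonym ('x, 'f, 'r) rsheaf_arr = "('x, 'f, 'r, ('r, ('r, unit) ring_ext) monoid_ext) psh_arr"

definition is_ring_sheaf :: "('x, 'f) site \<Rightarrow> ('x, 'f, 'r) rsheaf \<Rightarrow> bool" where
  "is_ring_sheaf S R \<longleftrightarrow> is_sheaf S R \<and> (\<forall>x\<in>Obj S. ring (Sect R x)) \<and>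
     (\<forall>f\<in>Arr S. Restr R f \<in> ring_hom (Sect R (Cod S f)) (Sect R (Dom S f)))"

definition ShRing :: "('x, 'f) site \<Rightarrow> (('x, 'f, 'r) rsheaf, ('x, 'f, 'r) rsheaf_arr) cat" where
  "ShRing S = psh_cat S {R. is_ring_sheaf S R}
     {(R, R', \<eta>). \<forall>x\<in>Obj S. \<eta> x \<in> ring_hom (Sect R x) (Sect R' x)}"


subsection \<open>Sheaves of modules\<close>

type_synonym ('x, 'f, 'r, 'm) msheaf =
  "('x, 'f, 'm, ('m, ('m, ('r, 'm, unit) module_ext) ring_ext) monoid_ext) psh"
type_synonym ('x, 'f, 'r, 'm) msheaf_arr =
  "('x, 'f, 'm, ('m, ('m, ('r, 'm, unit) module_ext) ring_ext) monoid_ext) psh_arr"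

text \<open>The library locale \<open>module\<close> is \<open>cring R\<close>, \<open>abelian_group M\<close> and \<open>module_axioms R M\<close>.\<close>

definition left_module :: "'r ring \<Rightarrow> ('r, 'm) module \<Rightarrow> bool" where
  "left_module R M \<longleftrightarrow> ring R \<and> abelian_group M \<and> module_axioms R M"

text \<open>The last clause is a normalisation only: it makes transport along isomorphisms of rings
  strictly functorial.\<close>

definition is_module_sheaf :: "('x, 'f) site \<Rightarrow> ('x, 'f, 'r) rsheaf \<Rightarrow> ('x, 'f, 'r, 'm) msheaf \<Rightarrow> bool" where
  "is_module_sheaf S R F \<longleftrightarrow> is_sheaf S F \<and>
     (\<forall>x\<in>Obj S. left_module (Sect R x) (Sect F x)) \<and>
     (\<forall>f\<in>Arr S. \<forall>m\<in>Sec F (Cod S f).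
        (\<forall>n\<in>Sec F (Cod S f). Restr F f (m \<oplus>\<^bsub>Sect F (Cod S f)\<^esub> n) =
           Restr F f m \<oplus>\<^bsub>Sect F (Dom S f)\<^esub> Restr F f n) \<and>
        (\<forall>r\<in>Sec R (Cod S f). Restr F f (r \<odot>\<^bsub>Sect F (Cod S f)\<^esub> m) =
           Restr R f r \<odot>\<^bsub>Sect F (Dom S f)\<^esub> Restr F f m)) \<and>
     (\<forall>x\<in>Obj S. smult (Sect F x) \<in> extensional (Sec R x))"

definition is_linear ::
  "('x, 'f, 'y) cat_scheme \<Rightarrow> ('x, 'f, 'r) rsheaf \<Rightarrow> ('x, 'f, 'r, 'm) msheaf \<Rightarrow> ('x, 'f, 'r, 'n) msheaf \<Rightarrow>
   ('x \<Rightarrow> 'm \<Rightarrow> 'n) \<Rightarrow> bool" where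
  "is_linear S R F G \<eta> \<longleftrightarrow> (\<forall>x\<in>Obj S. \<forall>m\<in>Sec F x.
     (\<forall>n\<in>Sec F x. \<eta> x (m \<oplus>\<^bsub>Sect F x\<^esub> n) = \<eta> x m \<oplus>\<^bsub>Sect G x\<^esub> \<eta> x n) \<and>
     (\<forall>r\<in>Sec R x. \<eta> x (r \<odot>\<^bsub>Sect F x\<^esub> m) = r \<odot>\<^bsub>Sect G x\<^esub> \<eta> x m))"

definition Mod ::
  "('x, 'f) site \<Rightarrow> ('x, 'f, 'r) rsheaf \<Rightarrow> (('x, 'f, 'r, 'm) msheaf, ('x, 'f, 'r, 'm) msheaf_arr) cat" where
  "Mod S R = psh_cat S {F. is_module_sheaf S R F} {(F, G, \<eta>). is_linear S R F G \<eta>}"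

text \<open>Transport of modules along an isomorphism \<open>\<alpha> : R \<rightarrow> R'\<close>: \<open>R'\<close> acts through \<open>\<alpha>\<inverse>\<close>.\<close>

definition transport ::
  "('x, 'f, 'y) cat_scheme \<Rightarrow> ('x, 'f, 'r) rsheaf_arr \<Rightarrow> ('x, 'f, 'r, 'm) msheaf \<Rightarrow> ('x, 'f, 'r, 'm) msheaf" where
  "transport S = (\<lambda>(R, R', \<alpha>) F. F\<lparr>Sect := (\<lambda>x\<in>Obj S. (Sect F x)
     \<lparr>smult := (\<lambda>r\<in>Sec R' x. smult (Sect F x) (inv_into (Sec R x) (\<alpha> x) r))\<rparr>)\<rparr>)"

definition transport_arr ::
  "('x, 'f, 'y) cat_scheme \<Rightarrow> ('x, 'f, 'r) rsheaf_arr \<Rightarrow> ('x, 'f, 'r, 'm) msheaf_arr \<Rightarrow>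
   ('x, 'f, 'r, 'm) msheaf_arr" where
  "transport_arr S \<alpha> = (\<lambda>(F, G, \<eta>). (transport S \<alpha> F, transport S \<alpha> G, \<eta>))"


subsection \<open>Quasi-coherent modules\<close>

text \<open>The direct sum of copies of \<open>R\<close> indexed by \<open>A\<close>, in sheaves of \<open>R\<close>-modules. The presheaf
  direct sum is separated, being a subpresheaf of the sheaf \<open>\<Prod>\<^sub>A R\<close>, so its sheafification
  consists of the sections of \<open>\<Prod>\<^sub>A R\<close> that lie locally in it, i.e. have locally finite support.\<close>

definition free_sheaf ::
  "('x, 'f) site \<Rightarrow> ('x, 'f, 'r) rsheaf \<Rightarrow> 'k set \<Rightarrow> ('x, 'f, 'r, 'k \<Rightarrow> 'r) msheaf" where
  "free_sheaf S R A = \<lparr>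
     Sect = (\<lambda>x\<in>Obj S. \<lparr>
       carrier = {s \<in> A \<rightarrow>\<^sub>E Sec R x. \<exists>c\<in>Cov S x. \<forall>f\<in>c.
                    finite {a \<in> A. Restr R f (s a) \<noteq> \<zero>\<^bsub>Sect R (Dom S f)\<^esub>}},
       monoid.mult = undefined, one = undefined,
       zero = (\<lambda>a\<in>A. \<zero>\<^bsub>Sect R x\<^esub>),
       add = (\<lambda>s t. \<lambda>a\<in>A. s a \<oplus>\<^bsub>Sect R x\<^esub> t a),
       smult = (\<lambda>r\<in>Sec R x. \<lambda>s. \<lambda>a\<in>A. r \<otimes>\<^bsub>Sect R x\<^esub> s a)\<rparr>),
     Restr = (\<lambda>f\<in>Arr S. \<lambda>s. \<lambda>a\<in>A. Restr R f (s a))\<rparr>"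

text \<open>Exactness of \<open>F \<rightarrow> G \<rightarrow> H \<rightarrow> 0\<close> as sheaves: images are formed locally.\<close>

definition right_exact_seq ::
  "('x, 'f) site \<Rightarrow> ('x, 'f, 'r) rsheaf \<Rightarrow>
   ('x, 'f, 'r, 'l) msheaf \<Rightarrow> ('x, 'f, 'r, 'm) msheaf \<Rightarrow> ('x, 'f, 'r, 'n) msheaf \<Rightarrow>
   ('x \<Rightarrow> 'l \<Rightarrow> 'm) \<Rightarrow> ('x \<Rightarrow> 'm \<Rightarrow> 'n) \<Rightarrow> bool" where
  "right_exact_seq S R F G H p q \<longleftrightarrow>
     p \<in> nat_maps S F G \<and> is_linear S R F G p \<and> q \<in> nat_maps S G H \<and> is_linear S R G H q \<and>
     (\<forall>x\<in>Obj S. \<forall>m\<in>Sec G x.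
        q x m = \<zero>\<^bsub>Sect H x\<^esub> \<longleftrightarrow>
        (\<exists>c\<in>Cov S x. \<forall>f\<in>c. Restr G f m \<in> p (Dom S f) ` Sec F (Dom S f))) \<and>
     (\<forall>x\<in>Obj S. \<forall>m\<in>Sec H x. \<exists>c\<in>Cov S x. \<forall>f\<in>c. Restr H f m \<in> q (Dom S f) ` Sec G (Dom S f))"

text \<open>Index sets are arbitrary subsets of the type \<open>'k\<close>. For given \<open>'r\<close> and \<open>'m\<close> the notion no longer
  depends on \<open>'k\<close> once \<open>'k\<close> is large enough: \<open>A'\<close> may be taken to be a set of sections of \<open>F\<close>,
  and \<open>A\<close> a set of sections of the sum over \<open>A'\<close>.\<close>

definition is_quasi_coherent ::
  "'k itself \<Rightarrow> ('c, 'a) site \<Rightarrow> ('c, 'a, 'o, 'g) gpsh \<Rightarrow>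
   ('c \<times> 'o, ('c, 'a, 'o, 'g) sl_arr, 'r) rsheaf \<Rightarrow>
   ('c \<times> 'o, ('c, 'a, 'o, 'g) sl_arr, 'r, 'm) msheaf \<Rightarrow> bool" where
  "is_quasi_coherent _ C M R F \<longleftrightarrow>
     (\<forall>X\<in>Obj C. \<forall>a\<in>Obj (Val M X). \<exists>c\<in>Cov C X. \<forall>u\<in>c.
        (let S = slice C (rep C (Dom C u));
             P = slice_map (\<lambda>V. ftr_comp (yoneda M a V) (rep_map C u V));
             R\<^sub>u = psh_pull S P R
         in \<exists>(A :: 'k set) (A' :: 'k set) p q.
              right_exact_seq S R\<^sub>u (free_sheaf S R\<^sub>u A) (free_sheaf S R\<^sub>u A') (psh_pull S P F) p q))"


section \<open>Homotopy limits of categories\<close>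

text \<open>A \<open>K\<close>-diagram of categories.\<close>

record ('k, 'f, 'o, 'a) cdiag =
  CatAt :: "'k \<Rightarrow> ('o, 'a) cat"
  FunAt :: "'f \<Rightarrow> ('o, 'a, 'o, 'a) ftr"

definition holim ::
  "('k, 'f, 'z) cat_scheme \<Rightarrow> ('k, 'f, 'o, 'a) cdiag \<Rightarrow>
   (('k \<Rightarrow> 'o) \<times> ('f \<Rightarrow> 'a),
    (('k \<Rightarrow> 'o) \<times> ('f \<Rightarrow> 'a)) \<times> (('k \<Rightarrow> 'o) \<times> ('f \<Rightarrow> 'a)) \<times> ('k \<Rightarrow> 'a)) cat" where
  "holim K E = (let
      obs = {(x, \<theta>).
        x \<in> (\<Pi>\<^sub>E k\<in>Obj K. Obj (CatAt E k)) \<and> \<theta> \<in> extensional (Arr K) \<and>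
        (\<forall>f\<in>Arr K. is_isomorphism (CatAt E (Cod K f)) (\<theta> f) \<and>
           \<theta> f \<in> Hom (CatAt E (Cod K f)) (FOb (FunAt E f) (x (Dom K f))) (x (Cod K f))) \<and>
        (\<forall>k\<in>Obj K. \<theta> (Ident K k) = Ident (CatAt E k) (x k)) \<and>
        (\<forall>f\<in>Arr K. \<forall>g\<in>Arr K. Dom K g = Cod K f \<longrightarrow>
           \<theta> (Comp K g f) = Comp (CatAt E (Cod K g)) (\<theta> g) (FAr (FunAt E g) (\<theta> f)))}
    in \<lparr>Obj = obs,
        Arr = {((x, \<theta>), (y, \<zeta>), u). (x, \<theta>) \<in> obs \<and> (y, \<zeta>) \<in> obs \<and>
          u \<in> (\<Pi>\<^sub>E k\<in>Obj K. Hom (CatAt E k) (x k) (y k)) \<and>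
          (\<forall>f\<in>Arr K. Comp (CatAt E (Cod K f)) (u (Cod K f)) (\<theta> f) =
             Comp (CatAt E (Cod K f)) (\<zeta> f) (FAr (FunAt E f) (u (Dom K f))))},
        Dom = (\<lambda>(s, t, u). s),
        Cod = (\<lambda>(s, t, u). t),
        Ident = (\<lambda>(x, \<theta>). ((x, \<theta>), (x, \<theta>), \<lambda>k\<in>Obj K. Ident (CatAt E k) (x k))),
        Comp = (\<lambda>(s', t', v) (s, t, u). (s, t', \<lambda>k\<in>Obj K. Comp (CatAt E k) (v k) (u k)))\<rparr>)"


section \<open>Homotopy colimits of groupoids\<close>

subsection \<open>Categories presented by generators and relations\<close>

record ('v, 'e) graph =
  Vert :: "'v set"
  Edge :: "'e set"
  Src :: "'e \<Rightarrow> 'v"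
  Tgt :: "'e \<Rightarrow> 'v"

text \<open>A path is given by its source, its edges in the order in which they are traversed, and its
  target.\<close>

type_synonym ('v, 'e) path = "'v \<times> 'e list \<times> 'v"

fun walk :: "('v, 'e) graph \<Rightarrow> 'v \<Rightarrow> 'e list \<Rightarrow> 'v \<Rightarrow> bool" where
  "walk G v [] w \<longleftrightarrow> v \<in> Vert G \<and> v = w"
| "walk G v (e # es) w \<longleftrightarrow> v \<in> Vert G \<and> e \<in> Edge G \<and> Src G e = v \<and> walk G (Tgt G e) es w"

definition paths :: "('v, 'e) graph \<Rightarrow> ('v, 'e) path set" where
  "paths G = {(v, es, w). walk G v es w}"

inductive_set path_cong ::
  "('v, 'e) graph \<Rightarrow> (('v, 'e) path \<times> ('v, 'e) path) set \<Rightarrow> (('v, 'e) path \<times> ('v, 'e) path) set"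
  for G R where
  base: "\<lbrakk>(p, q) \<in> R; p \<in> paths G; q \<in> paths G\<rbrakk> \<Longrightarrow> (p, q) \<in> path_cong G R"
| refl: "p \<in> paths G \<Longrightarrow> (p, p) \<in> path_cong G R"
| sym: "(p, q) \<in> path_cong G R \<Longrightarrow> (q, p) \<in> path_cong G R"
| trans: "\<lbrakk>(p, q) \<in> path_cong G R; (q, r) \<in> path_cong G R\<rbrakk> \<Longrightarrow> (p, r) \<in> path_cong G R"
| append: "\<lbrakk>((u, xs, v), (u, ys, v)) \<in> path_cong G R; ((v, xs', w), (v, ys', w)) \<in> path_cong G R\<rbrakk>
     \<Longrightarrow> ((u, xs @ xs', w), (u, ys @ ys', w)) \<in> path_cong G R"

definition presented_cat ::
  "('v, 'e) graph \<Rightarrow> (('v, 'e) path \<times> ('v, 'e) path) set \<Rightarrow> ('v, ('v, 'e) path set) cat" where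
  "presented_cat G R = \<lparr>
     Obj = Vert G,
     Arr = paths G // path_cong G R,
     Dom = (\<lambda>c. fst (SOME p. p \<in> c)),
     Cod = (\<lambda>c. snd (snd (SOME p. p \<in> c))),
     Ident = (\<lambda>v. path_cong G R `` {(v, [], v)}),
     Comp = (\<lambda>d c. path_cong G R ``
               {(u, xs @ ys, w) | u xs v ys w. (u, xs, v) \<in> c \<and> (v, ys, w) \<in> d})\<rparr>"

definition path_map :: "('v \<Rightarrow> 'w) \<Rightarrow> ('e \<Rightarrow> 'd) \<Rightarrow> ('v, 'e) path \<Rightarrow> ('w, 'd) path" where
  "path_map n m = (\<lambda>(v, es, w). (n v, map m es, n w))"


subsection \<open>The fundamental groupoid\<close>

text \<open>The edge \<open>(f, True)\<close> is \<open>f\<close>, the edge \<open>(f, False)\<close> its formal inverse.\<close>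

definition fund_graph :: "('o, 'a, 'z) cat_scheme \<Rightarrow> ('o, 'a \<times> bool) graph" where
  "fund_graph J = \<lparr>Vert = Obj J, Edge = Arr J \<times> UNIV,
     Src = (\<lambda>(f, b). if b then Dom J f else Cod J f),
     Tgt = (\<lambda>(f, b). if b then Cod J f else Dom J f)\<rparr>"

definition fund_rels ::
  "('o, 'a, 'z) cat_scheme \<Rightarrow> (('o, 'a \<times> bool) path \<times> ('o, 'a \<times> bool) path) set" where
  "fund_rels J =
     {((Dom J f, [(f, True), (g, True)], Cod J g), (Dom J f, [(Comp J g f, True)], Cod J g)) | f g.
        f \<in> Arr J \<and> g \<in> Arr J \<and> Dom J g = Cod J f} \<union>
     {((x, [(Ident J x, True)], x), (x, [], x)) | x. x \<in> Obj J} \<union>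
     {((Dom J f, [(f, True), (f, False)], Dom J f), (Dom J f, [], Dom J f)) | f. f \<in> Arr J} \<union>
     {((Cod J f, [(f, False), (f, True)], Cod J f), (Cod J f, [], Cod J f)) | f. f \<in> Arr J}"

type_synonym ('o, 'a) fund_arr = "('o, 'a \<times> bool) path set"

definition fund_groupoid :: "('o, 'a, 'z) cat_scheme \<Rightarrow> ('o, ('o, 'a) fund_arr) cat" where
  "fund_groupoid J = presented_cat (fund_graph J) (fund_rels J)"

definition fund_gen :: "('o, 'a, 'z) cat_scheme \<Rightarrow> 'a \<Rightarrow> ('o, 'a) fund_arr" where
  "fund_gen J f = path_cong (fund_graph J) (fund_rels J) `` {(Dom J f, [(f, True)], Cod J f)}"

text \<open>\<open>fund_map J' F\<close> is the functor induced on fundamental groupoids by a functor \<open>F\<close> into \<open>J'\<close>.\<close>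

definition fund_map ::
  "('p, 'b, 'z) cat_scheme \<Rightarrow> ('o, 'a, 'p, 'b) ftr \<Rightarrow>
   ('o, ('o, 'a) fund_arr, 'p, ('p, 'b) fund_arr) ftr" where
  "fund_map J' F = \<lparr>FOb = FOb F,
     FAr = (\<lambda>c. path_cong (fund_graph J') (fund_rels J') ``
              (path_map (FOb F) (\<lambda>(f, b). (FAr F f, b)) ` c))\<rparr>"


subsection \<open>Under categories, products, coproducts, coequalizers\<close>

text \<open>The category \<open>i/I\<close>: objects are the arrows out of \<open>i\<close>; an arrow \<open>(\<psi>, \<chi>, k) : \<psi> \<rightarrow> \<chi>\<close> is a \<open>k\<close> with
  \<open>k \<psi> = \<chi>\<close>.\<close>

definition under_cat :: "('i, 'j, 'z) cat_scheme \<Rightarrow> 'i \<Rightarrow> ('j, 'j \<times> 'j \<times> 'j) cat" where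
  "under_cat I i = \<lparr>
     Obj = {\<psi> \<in> Arr I. Dom I \<psi> = i},
     Arr = {(\<psi>, \<chi>, k). \<psi> \<in> Arr I \<and> Dom I \<psi> = i \<and> \<chi> \<in> Arr I \<and> Dom I \<chi> = i \<and>
              k \<in> Hom I (Cod I \<psi>) (Cod I \<chi>) \<and> Comp I k \<psi> = \<chi>},
     Dom = (\<lambda>(\<psi>, \<chi>, k). \<psi>),
     Cod = (\<lambda>(\<psi>, \<chi>, k). \<chi>),
     Ident = (\<lambda>\<psi>. (\<psi>, \<psi>, Ident I (Cod I \<psi>))),
     Comp = (\<lambda>(\<psi>', \<chi>', l) (\<psi>, \<chi>, k). (\<psi>, \<chi>', Comp I l k))\<rparr>"

text \<open>For \<open>\<phi> : i \<rightarrow> j\<close>, the functor \<open>j/I \<rightarrow> i/I\<close>.\<close>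

definition under_map :: "('i, 'j, 'z) cat_scheme \<Rightarrow> 'j \<Rightarrow> ('j, 'j \<times> 'j \<times> 'j, 'j, 'j \<times> 'j \<times> 'j) ftr" where
  "under_map I \<phi> = \<lparr>FOb = (\<lambda>\<psi>. Comp I \<psi> \<phi>),
     FAr = (\<lambda>(\<psi>, \<chi>, k). (Comp I \<psi> \<phi>, Comp I \<chi> \<phi>, k))\<rparr>"

definition prod_cat ::
  "('o, 'a) cat \<Rightarrow> ('p, 'b) cat \<Rightarrow> ('o \<times> 'p, 'a \<times> 'b) cat" where
  "prod_cat A B = \<lparr>
     Obj = Obj A \<times> Obj B,
     Arr = Arr A \<times> Arr B,
     Dom = (\<lambda>(f, g). (Dom A f, Dom B g)),
     Cod = (\<lambda>(f, g). (Cod A f, Cod B g)),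
     Ident = (\<lambda>(x, y). (Ident A x, Ident B y)),
     Comp = (\<lambda>(f', g') (f, g). (Comp A f' f, Comp B g' g))\<rparr>"

definition coprod_cat :: "'k set \<Rightarrow> ('k \<Rightarrow> ('o, 'a) cat) \<Rightarrow> ('k \<times> 'o, 'k \<times> 'a) cat" where
  "coprod_cat K A = \<lparr>
     Obj = Sigma K (\<lambda>k. Obj (A k)),
     Arr = Sigma K (\<lambda>k. Arr (A k)),
     Dom = (\<lambda>(k, f). (k, Dom (A k) f)),
     Cod = (\<lambda>(k, f). (k, Cod (A k) f)),
     Ident = (\<lambda>(k, x). (k, Ident (A k) x)),
     Comp = (\<lambda>(k', g) (k, f). (k, Comp (A k) g f))\<rparr>"

text \<open>The coequalizer of \<open>F, G : A \<rightarrow> B\<close>: objects are classes of objects of \<open>B\<close>, arrows are generated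
  by those of \<open>B\<close>, subject to the relations of \<open>B\<close> and \<open>F a = G a\<close>. For groupoids \<open>A\<close> and \<open>B\<close> this is
  a groupoid.\<close>

definition coeq_class ::
  "('o, 'a) cat \<Rightarrow> ('p, 'b) cat \<Rightarrow> ('o, 'a, 'p, 'b) ftr \<Rightarrow> ('o, 'a, 'p, 'b) ftr \<Rightarrow> 'p \<Rightarrow> 'p set" where
  "coeq_class A B F G x = (let r = {(FOb F a, FOb G a) | a. a \<in> Obj A}
     in {y \<in> Obj B. (x, y) \<in> (r \<union> r\<inverse>)\<^sup>*})"

definition coeq_graph ::
  "('o, 'a) cat \<Rightarrow> ('p, 'b) cat \<Rightarrow> ('o, 'a, 'p, 'b) ftr \<Rightarrow> ('o, 'a, 'p, 'b) ftr \<Rightarrow> ('p set, 'b) graph" where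
  "coeq_graph A B F G = \<lparr>
     Vert = coeq_class A B F G ` Obj B,
     Edge = Arr B,
     Src = (\<lambda>f. coeq_class A B F G (Dom B f)),
     Tgt = (\<lambda>f. coeq_class A B F G (Cod B f))\<rparr>"

definition coeq_rels ::
  "('o, 'a) cat \<Rightarrow> ('p, 'b) cat \<Rightarrow> ('o, 'a, 'p, 'b) ftr \<Rightarrow> ('o, 'a, 'p, 'b) ftr \<Rightarrow>
   (('p set, 'b) path \<times> ('p set, 'b) path) set" where
  "coeq_rels A B F G = (let cl = coeq_class A B F G in
     {((cl (Dom B f), [f, g], cl (Cod B g)), (cl (Dom B f), [Comp B g f], cl (Cod B g))) | f g.
        f \<in> Arr B \<and> g \<in> Arr B \<and> Dom B g = Cod B f} \<union>
     {((cl x, [Ident B x], cl x), (cl x, [], cl x)) | x. x \<in> Obj B} \<union>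
     {((cl (FOb F (Dom A a)), [FAr F a], cl (FOb F (Cod A a))),
       (cl (FOb F (Dom A a)), [FAr G a], cl (FOb F (Cod A a)))) | a. a \<in> Arr A})"

definition coequalizer ::
  "('o, 'a) cat \<Rightarrow> ('p, 'b) cat \<Rightarrow> ('o, 'a, 'p, 'b) ftr \<Rightarrow> ('o, 'a, 'p, 'b) ftr \<Rightarrow>
   ('p set, ('p set, 'b) path set) cat" where
  "coequalizer A B F G = presented_cat (coeq_graph A B F G) (coeq_rels A B F G)"


subsection \<open>The homotopy colimit\<close>

type_synonym ('i, 'j, 'o) hc_ob = "'i \<times> 'o \<times> 'j"
type_synonym ('i, 'j, 'g) hc_edge = "'i \<times> 'g \<times> ('j, 'j \<times> 'j \<times> 'j) fund_arr"
type_synonym ('i, 'j, 'o, 'g) hc_arr = "(('i, 'j, 'o) hc_ob set, ('i, 'j, 'g) hc_edge) path set"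

text \<open>A diagram of groupoids is given by its values \<open>G\<close> and its transition functors \<open>T\<close>.\<close>

definition hc_source ::
  "('i, 'j) cat \<Rightarrow> ('i \<Rightarrow> ('o, 'g) cat) \<Rightarrow> (('j, 'j, 'o) hc_ob, ('j, 'j, 'g) hc_edge) cat" where
  "hc_source I G = coprod_cat (Arr I)
     (\<lambda>\<phi>. prod_cat (G (Dom I \<phi>)) (fund_groupoid (under_cat I (Cod I \<phi>))))"

definition hc_target ::
  "('i, 'j) cat \<Rightarrow> ('i \<Rightarrow> ('o, 'g) cat) \<Rightarrow> (('i, 'j, 'o) hc_ob, ('i, 'j, 'g) hc_edge) cat" where
  "hc_target I G = coprod_cat (Obj I) (\<lambda>i. prod_cat (G i) (fund_groupoid (under_cat I i)))"

definition hc_leg1 ::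
  "('i, 'j) cat \<Rightarrow>
   (('j, 'j, 'o) hc_ob, ('j, 'j, 'g) hc_edge, ('i, 'j, 'o) hc_ob, ('i, 'j, 'g) hc_edge) ftr" where
  "hc_leg1 I = \<lparr>
     FOb = (\<lambda>(\<phi>, x, \<psi>). (Dom I \<phi>, x, FOb (under_map I \<phi>) \<psi>)),
     FAr = (\<lambda>(\<phi>, g, p). (Dom I \<phi>, g, FAr (fund_map (under_cat I (Dom I \<phi>)) (under_map I \<phi>)) p))\<rparr>"

definition hc_leg2 ::
  "('i, 'j) cat \<Rightarrow> ('j \<Rightarrow> ('o, 'g, 'o, 'g) ftr) \<Rightarrow>
   (('j, 'j, 'o) hc_ob, ('j, 'j, 'g) hc_edge, ('i, 'j, 'o) hc_ob, ('i, 'j, 'g) hc_edge) ftr" where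
  "hc_leg2 I T = \<lparr>
     FOb = (\<lambda>(\<phi>, x, \<psi>). (Cod I \<phi>, FOb (T \<phi>) x, \<psi>)),
     FAr = (\<lambda>(\<phi>, g, p). (Cod I \<phi>, FAr (T \<phi>) g, p))\<rparr>"

definition hocolim ::
  "('i, 'j) cat \<Rightarrow> ('i \<Rightarrow> ('o, 'g) cat) \<Rightarrow> ('j \<Rightarrow> ('o, 'g, 'o, 'g) ftr) \<Rightarrow>
   (('i, 'j, 'o) hc_ob set, ('i, 'j, 'o, 'g) hc_arr) cat" where
  "hocolim I G T = coequalizer (hc_source I G) (hc_target I G) (hc_leg1 I) (hc_leg2 I T)"

definition hc_ob_class ::
  "('i, 'j) cat \<Rightarrow> ('i \<Rightarrow> ('o, 'g) cat) \<Rightarrow> ('j \<Rightarrow> ('o, 'g, 'o, 'g) ftr) \<Rightarrow>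
   ('i, 'j, 'o) hc_ob \<Rightarrow> ('i, 'j, 'o) hc_ob set" where
  "hc_ob_class I G T = coeq_class (hc_source I G) (hc_target I G) (hc_leg1 I) (hc_leg2 I T)"

definition hc_cong ::
  "('i, 'j) cat \<Rightarrow> ('i \<Rightarrow> ('o, 'g) cat) \<Rightarrow> ('j \<Rightarrow> ('o, 'g, 'o, 'g) ftr) \<Rightarrow>
   ((('i, 'j, 'o) hc_ob set, ('i, 'j, 'g) hc_edge) path \<times>
    (('i, 'j, 'o) hc_ob set, ('i, 'j, 'g) hc_edge) path) set" where
  "hc_cong I G T = path_cong
     (coeq_graph (hc_source I G) (hc_target I G) (hc_leg1 I) (hc_leg2 I T))
     (coeq_rels (hc_source I G) (hc_target I G) (hc_leg1 I) (hc_leg2 I T))"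

text \<open>The arrow of the homotopy colimit given by an arrow of \<open>\<Coprod>\<^sub>i G(i) \<times> \<pi>(i/I)\<close>.\<close>

definition hc_gen ::
  "('i, 'j) cat \<Rightarrow> ('i \<Rightarrow> ('o, 'g) cat) \<Rightarrow> ('j \<Rightarrow> ('o, 'g, 'o, 'g) ftr) \<Rightarrow>
   ('i, 'j, 'g) hc_edge \<Rightarrow> ('i, 'j, 'o, 'g) hc_arr" where
  "hc_gen I G T e = hc_cong I G T ``
     {(hc_ob_class I G T (Dom (hc_target I G) e), [e], hc_ob_class I G T (Cod (hc_target I G) e))}"

text \<open>The functor induced on homotopy colimits by functors \<open>N i : G i \<rightarrow> G' i\<close> compatible with the
  transition functors.\<close>

definition hc_map ::
  "('i, 'j) cat \<Rightarrow> ('i \<Rightarrow> ('o, 'g) cat) \<Rightarrow> ('j \<Rightarrow> ('o, 'g, 'o, 'g) ftr) \<Rightarrow> ('i \<Rightarrow> ('o, 'g, 'o, 'g) ftr) \<Rightarrow>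
   (('i, 'j, 'o) hc_ob set, ('i, 'j, 'o, 'g) hc_arr,
    ('i, 'j, 'o) hc_ob set, ('i, 'j, 'o, 'g) hc_arr) ftr" where
  "hc_map I G' T' N = (let
      ob = (\<lambda>c. \<Union> (hc_ob_class I G' T' ` ((\<lambda>(i, x, \<psi>). (i, FOb (N i) x, \<psi>)) ` c)))
    in \<lparr>FOb = ob,
        FAr = (\<lambda>c. hc_cong I G' T' `` (path_map ob (\<lambda>(i, g, p). (i, FAr (N i) g, p)) ` c))\<rparr>)"


section \<open>Diagrams of presheaves of groupoids\<close>

record ('i, 'j, 'c, 'a, 'o, 'g) pdiag =
  DOb :: "'i \<Rightarrow> ('c, 'a, 'o, 'g) gpsh"
  DAr :: "'j \<Rightarrow> 'c \<Rightarrow> ('o, 'g, 'o, 'g) ftr"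

definition is_pdiag ::
  "('c, 'a, 'z) cat_scheme \<Rightarrow> ('i, 'j) cat \<Rightarrow> ('i, 'j, 'c, 'a, 'o, 'g) pdiag \<Rightarrow> bool" where
  "is_pdiag C I U \<longleftrightarrow>
     (\<forall>i\<in>Obj I. is_gpsh C (DOb U i)) \<and>
     (\<forall>\<phi>\<in>Arr I. is_gpsh_map C (DOb U (Dom I \<phi>)) (DOb U (Cod I \<phi>)) (DAr U \<phi>)) \<and>
     (\<forall>i\<in>Obj I. \<forall>X\<in>Obj C. ftr_agree (Val (DOb U i) X) (DAr U (Ident I i) X) ftr_id) \<and>
     (\<forall>\<phi>\<in>Arr I. \<forall>\<psi>\<in>Arr I. Dom I \<psi> = Cod I \<phi> \<longrightarrow> (\<forall>X\<in>Obj C.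
        ftr_agree (Val (DOb U (Dom I \<phi>)) X)
          (DAr U (Comp I \<psi> \<phi>) X) (ftr_comp (DAr U \<psi> X) (DAr U \<phi> X))))"

definition hocolim_psh ::
  "('c, 'a, 'z) cat_scheme \<Rightarrow> ('i, 'j) cat \<Rightarrow> ('i, 'j, 'c, 'a, 'o, 'g) pdiag \<Rightarrow>
   ('c, 'a, ('i, 'j, 'o) hc_ob set, ('i, 'j, 'o, 'g) hc_arr) gpsh" where
  "hocolim_psh C I U = \<lparr>
     Val = (\<lambda>X. hocolim I (\<lambda>i. Val (DOb U i) X) (\<lambda>\<phi>. DAr U \<phi> X)),
     Rst = (\<lambda>h. hc_map I (\<lambda>i. Val (DOb U i) (Dom C h)) (\<lambda>\<phi>. DAr U \<phi> (Dom C h))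
                  (\<lambda>i. Rst (DOb U i) h))\<rparr>"

text \<open>Objects and arrows of the site of the homotopy colimit.\<close>

type_synonym ('i, 'j, 'c, 'o) hs_ob = "'c \<times> ('i, 'j, 'o) hc_ob set"
type_synonym ('i, 'j, 'c, 'a, 'o, 'g) hs_arr =
  "('c, 'a, ('i, 'j, 'o) hc_ob set, ('i, 'j, 'o, 'g) hc_arr) sl_arr"

text \<open>The canonical map from \<open>U\<^sub>i\<close> to the homotopy colimit, \<open>x \<mapsto> [x, id\<^sub>i]\<close>.\<close>

definition hc_incl ::
  "('i, 'j) cat \<Rightarrow> ('i, 'j, 'c, 'a, 'o, 'g) pdiag \<Rightarrow> 'i \<Rightarrow>
   'c \<Rightarrow> ('o, 'g, ('i, 'j, 'o) hc_ob set, ('i, 'j, 'o, 'g) hc_arr) ftr" where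
  "hc_incl I U i = (\<lambda>X. let G = (\<lambda>i. Val (DOb U i) X); T = (\<lambda>\<phi>. DAr U \<phi> X) in
     \<lparr>FOb = (\<lambda>x. hc_ob_class I G T (i, x, Ident I i)),
      FAr = (\<lambda>g. hc_gen I G T (i, g, Ident (fund_groupoid (under_cat I i)) (Ident I i)))\<rparr>)"

text \<open>For \<open>\<phi> : i \<rightarrow> j\<close> and \<open>x\<close> in \<open>U\<^sub>i(X)\<close>, the canonical isomorphism \<open>[x, id\<^sub>i] \<rightarrow> [x, \<phi>] = [\<phi> x, id\<^sub>j]\<close>,
  as an arrow over the identity of \<open>X\<close>.\<close>

definition hc_canon ::
  "('c, 'a, 'z) cat_scheme \<Rightarrow> ('i, 'j) cat \<Rightarrow> ('i, 'j, 'c, 'a, 'o, 'g) pdiag \<Rightarrow> 'j \<Rightarrow> 'c \<times> 'o \<Rightarrow>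
   ('i, 'j, 'c, 'a, 'o, 'g) hs_arr" where
  "hc_canon C I U \<phi> = (\<lambda>(X, x). let i = Dom I \<phi>; j = Cod I \<phi> in
     ((X, FOb (hc_incl I U i X) x),
      (X, FOb (hc_incl I U j X) (FOb (DAr U \<phi> X) x)),
      Ident C X,
      hc_gen I (\<lambda>i. Val (DOb U i) X) (\<lambda>\<phi>. DAr U \<phi> X)
        (i, Ident (Val (DOb U i) X) x, fund_gen (under_cat I i) (Ident I i, \<phi>, \<phi>))))"

text \<open>For a sheaf \<open>F\<close> on the homotopy colimit and \<open>\<phi> : i \<rightarrow> j\<close>, the components
  \<open>F(X, \<phi> x) \<rightarrow> F(X, x)\<close> of the canonical isomorphism from the pullback along \<open>\<phi>\<close> of the restriction of
  \<open>F\<close> to \<open>U\<^sub>j\<close> to the restriction of \<open>F\<close> to \<open>U\<^sub>i\<close>.\<close>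

definition canon_map ::
  "('c, 'a) site \<Rightarrow> ('i, 'j) cat \<Rightarrow> ('i, 'j, 'c, 'a, 'o, 'g) pdiag \<Rightarrow>
   (('i, 'j, 'c, 'o) hs_ob, ('i, 'j, 'c, 'a, 'o, 'g) hs_arr, 'v, 'z) psh \<Rightarrow>
   'j \<Rightarrow> 'c \<times> 'o \<Rightarrow> 'v \<Rightarrow> 'v" where
  "canon_map C I U F \<phi> = (\<lambda>x\<in>Obj (slice C (DOb U (Dom I \<phi>))).
     \<lambda>m\<in>Sec F (fst (snd (hc_canon C I U \<phi> x))). Restr F (hc_canon C I U \<phi> x) m)"

definition pull_incl ::
  "('c, 'a) site \<Rightarrow> ('i, 'j) cat \<Rightarrow> ('i, 'j, 'c, 'a, 'o, 'g) pdiag \<Rightarrow> 'i \<Rightarrow>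
   (('i, 'j, 'c, 'o) hs_ob, ('i, 'j, 'c, 'a, 'o, 'g) hs_arr, 'v, 'z) psh \<Rightarrow>
   ('c \<times> 'o, ('c, 'a, 'o, 'g) sl_arr, 'v, 'z) psh" where
  "pull_incl C I U i = psh_pull (slice C (DOb U i)) (slice_map (hc_incl I U i))"


section \<open>Diagrams of ringed spaces\<close>

text \<open>The diagram \<open>i \<mapsto> Sh(U\<^sub>i, Ring)\<close>, indexed by the opposite of \<open>I\<close>.\<close>

definition ShRing_diag ::
  "('c, 'a) site \<Rightarrow> ('i, 'j) cat \<Rightarrow> ('i, 'j, 'c, 'a, 'o, 'g) pdiag \<Rightarrow>
   ('i, 'j, ('c \<times> 'o, ('c, 'a, 'o, 'g) sl_arr, 'r) rsheaf,
            ('c \<times> 'o, ('c, 'a, 'o, 'g) sl_arr, 'r) rsheaf_arr) cdiag" where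
  "ShRing_diag C I U = \<lparr>
     CatAt = (\<lambda>i. ShRing (slice C (DOb U i))),
     FunAt = (\<lambda>\<phi>. \<lparr>FOb = psh_pull (slice C (DOb U (Dom I \<phi>))) (slice_map (DAr U \<phi>)),
                     FAr = psh_pull_arr (slice C (DOb U (Dom I \<phi>))) (slice_map (DAr U \<phi>))\<rparr>)\<rparr>"

text \<open>The structure sheaves \<open>O\<^sub>i\<close> together with the isomorphisms \<open>\<alpha>\<^sub>\<phi>\<close>, each \<open>\<alpha>\<^sub>\<phi>\<close> being an arrow
  \<open>(\<phi>\<^sup>* O\<^sub>j, O\<^sub>i, _)\<close>; this is the object \<open>[O\<^sub>I]\<close>.\<close>

type_synonym ('i, 'j, 'c, 'a, 'o, 'g, 'r) rdata =
  "('i \<Rightarrow> ('c \<times> 'o, ('c, 'a, 'o, 'g) sl_arr, 'r) rsheaf) \<times>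
   ('j \<Rightarrow> ('c \<times> 'o, ('c, 'a, 'o, 'g) sl_arr, 'r) rsheaf_arr)"

definition is_ringed_diag ::
  "('c, 'a) site \<Rightarrow> ('i, 'j) cat \<Rightarrow> ('i, 'j, 'c, 'a, 'o, 'g) pdiag \<Rightarrow>
   ('i, 'j, 'c, 'a, 'o, 'g, 'r) rdata \<Rightarrow> bool" where
  "is_ringed_diag C I U RI \<longleftrightarrow> is_pdiag C I U \<and> RI \<in> Obj (holim (op_cat I) (ShRing_diag C I U))"

text \<open>The object of the homotopy limit given by restricting a sheaf of rings on the homotopy
  colimit.\<close>

definition ring_restr ::
  "('c, 'a) site \<Rightarrow> ('i, 'j) cat \<Rightarrow> ('i, 'j, 'c, 'a, 'o, 'g) pdiag \<Rightarrow>
   (('i, 'j, 'c, 'o) hs_ob, ('i, 'j, 'c, 'a, 'o, 'g) hs_arr, 'r) rsheaf \<Rightarrow>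
   ('i, 'j, 'c, 'a, 'o, 'g, 'r) rdata" where
  "ring_restr C I U R =
     (\<lambda>i\<in>Obj I. pull_incl C I U i R,
      \<lambda>\<phi>\<in>Arr I. (FOb (FunAt (ShRing_diag C I U) \<phi>) (pull_incl C I U (Cod I \<phi>) R),
                 pull_incl C I U (Dom I \<phi>) R,
                 canon_map C I U R \<phi>))"

text \<open>The diagram \<open>i \<mapsto> O\<^sub>i\<close>-mod, indexed by the opposite of \<open>I\<close>, and its quasi-coherent part.\<close>

definition Mod_diag ::
  "('c, 'a) site \<Rightarrow> ('i, 'j) cat \<Rightarrow> ('i, 'j, 'c, 'a, 'o, 'g) pdiag \<Rightarrow>
   ('i, 'j, 'c, 'a, 'o, 'g, 'r) rdata \<Rightarrow>
   ('i, 'j, ('c \<times> 'o, ('c, 'a, 'o, 'g) sl_arr, 'r, 'm) msheaf,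
            ('c \<times> 'o, ('c, 'a, 'o, 'g) sl_arr, 'r, 'm) msheaf_arr) cdiag" where
  "Mod_diag C I U = (\<lambda>(R, \<alpha>). \<lparr>
     CatAt = (\<lambda>i. Mod (slice C (DOb U i)) (R i)),
     FunAt = (\<lambda>\<phi>. let S = slice C (DOb U (Dom I \<phi>)) in ftr_comp
                \<lparr>FOb = transport S (\<alpha> \<phi>), FAr = transport_arr S (\<alpha> \<phi>)\<rparr>
                \<lparr>FOb = psh_pull S (slice_map (DAr U \<phi>)), FAr = psh_pull_arr S (slice_map (DAr U \<phi>))\<rparr>)\<rparr>)"

definition Mod_qc ::
  "'k itself \<Rightarrow> ('c, 'a) site \<Rightarrow> ('c, 'a, 'o, 'g) gpsh \<Rightarrow>
   ('c \<times> 'o, ('c, 'a, 'o, 'g) sl_arr, 'r) rsheaf \<Rightarrow>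
   (('c \<times> 'o, ('c, 'a, 'o, 'g) sl_arr, 'r, 'm) msheaf,
    ('c \<times> 'o, ('c, 'a, 'o, 'g) sl_arr, 'r, 'm) msheaf_arr) cat" where
  "Mod_qc k C M R = full_subcat (Mod (slice C M) R) (is_quasi_coherent k C M R)"

definition Mod_qc_diag ::
  "'k itself \<Rightarrow> ('c, 'a) site \<Rightarrow> ('i, 'j) cat \<Rightarrow> ('i, 'j, 'c, 'a, 'o, 'g) pdiag \<Rightarrow>
   ('i, 'j, 'c, 'a, 'o, 'g, 'r) rdata \<Rightarrow>
   ('i, 'j, ('c \<times> 'o, ('c, 'a, 'o, 'g) sl_arr, 'r, 'm) msheaf,
            ('c \<times> 'o, ('c, 'a, 'o, 'g) sl_arr, 'r, 'm) msheaf_arr) cdiag" where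
  "Mod_qc_diag k C I U RI =
     (Mod_diag C I U RI)\<lparr>CatAt := (\<lambda>i. Mod_qc k C (DOb U i) (fst RI i))\<rparr>"

text \<open>The functor from \<open>R\<close>-modules to the homotopy limit: restrict to the \<open>U\<^sub>i\<close> and transport along
  the components \<open>b i\<close> of an isomorphism from the restriction of \<open>R\<close> to \<open>[O\<^sub>I]\<close>.\<close>

definition descent_functor ::
  "('c, 'a) site \<Rightarrow> ('i, 'j) cat \<Rightarrow> ('i, 'j, 'c, 'a, 'o, 'g) pdiag \<Rightarrow>
   ('i, 'j, 'c, 'a, 'o, 'g, 'r) rdata \<Rightarrow>
   ('i \<Rightarrow> ('c \<times> 'o, ('c, 'a, 'o, 'g) sl_arr, 'r) rsheaf_arr) \<Rightarrow>
   ((('i, 'j, 'c, 'o) hs_ob, ('i, 'j, 'c, 'a, 'o, 'g) hs_arr, 'r, 'm) msheaf,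
    (('i, 'j, 'c, 'o) hs_ob, ('i, 'j, 'c, 'a, 'o, 'g) hs_arr, 'r, 'm) msheaf_arr,
    ('i \<Rightarrow> ('c \<times> 'o, ('c, 'a, 'o, 'g) sl_arr, 'r, 'm) msheaf) \<times>
    ('j \<Rightarrow> ('c \<times> 'o, ('c, 'a, 'o, 'g) sl_arr, 'r, 'm) msheaf_arr),
    (('i \<Rightarrow> ('c \<times> 'o, ('c, 'a, 'o, 'g) sl_arr, 'r, 'm) msheaf) \<times>
     ('j \<Rightarrow> ('c \<times> 'o, ('c, 'a, 'o, 'g) sl_arr, 'r, 'm) msheaf_arr)) \<times>
    (('i \<Rightarrow> ('c \<times> 'o, ('c, 'a, 'o, 'g) sl_arr, 'r, 'm) msheaf) \<times>
     ('j \<Rightarrow> ('c \<times> 'o, ('c, 'a, 'o, 'g) sl_arr, 'r, 'm) msheaf_arr)) \<times>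
    ('i \<Rightarrow> ('c \<times> 'o, ('c, 'a, 'o, 'g) sl_arr, 'r, 'm) msheaf_arr)) ftr" where
  "descent_functor C I U RI b = (let
      tr = (\<lambda>i F. transport (slice C (DOb U i)) (b i) (pull_incl C I U i F));
      ob = (\<lambda>F. (\<lambda>i\<in>Obj I. tr i F,
                 \<lambda>\<phi>\<in>Arr I. (FOb (FunAt (Mod_diag C I U RI) \<phi>) (tr (Cod I \<phi>) F), tr (Dom I \<phi>) F,
                            canon_map C I U F \<phi>)))
    in \<lparr>FOb = ob,
        FAr = (\<lambda>(F, G, \<eta>). (ob F, ob G, \<lambda>i\<in>Obj I.
                 transport_arr (slice C (DOb U i)) (b i)
                   (psh_pull_arr (slice C (DOb U i)) (slice_map (hc_incl I U i)) (F, G, \<eta>))))\<rparr>)"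

end

(*
  An object of hocolim U(X) is represented by a unique (i, x, id) with x in U_i(X), and every arrow is a
  composite of arrows coming from the U_i(X), of canonical arrows x -> phi(x) and of inverses of such
  arrows. The factors pi(i/I) contribute only through the endpoints of their arrows. So a natural family
  over the homotopy colimit is the same as natural families over the U_i that are compatible with the
  canonical arrows: this gives full faithfulness. In the same way an object of the homotopy limit defines
  a presheaf on the homotopy colimit, the canonical arrows acting through the isomorphisms theta. It is a
  sheaf because gluing in a slice C/M only needs to be tested on cartesian lifts of covers of C, and
  these live over a single U_i. Quasi-coherence is tested on objects of the U_i(X) and is invariant under
  semilinear isomorphisms, hence passes through both the equivalence and the homotopy limit.
*)
theory Submission
  imports Defs
begin

section \<open>Elementary category theory: functors, equivalences, full subcategories\<close>

section \<open>Categories\<close>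

text \<open>The obstacle is that arrows of the homotopy colimit are congruence classes of words,
  handled here without a normal form. Statements about all arrows are proved by induction over
  generators (\<open>M_induct\<close>, and \<open>SM_induct\<close> on the site). Inverses of
  canonical arrows are in general not canonical, so this induction has a separate case for inverses,
  and each property proved by it has to pass from an invertible arrow to its inverse. Conversely, an
  operation of arrows has to be defined on every edge \<open>(i, g, p)\<close>, with
  \<open>p\<close> an arbitrary arrow of the fundamental groupoid of \<open>i/I\<close>, and checked
  against three kinds of relations; this is done in the locale \<open>hc_action\<close>.

  Objects behave better: each comes from exactly one \<open>U i\<close>, so sections, scalars and
  natural maps over the homotopy colimit can be prescribed object by object.

  Strictness carries the bookkeeping: the extensionality built into presheaves and scalar
  multiplications makes pullback followed by transport compose on the nose (\<open>pm_Comp\<close>),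
  so that the cocycle conditions of a homotopy limit are equations between arrows with equal
  endpoints.\<close>

lemma cat_dom: "is_category C \<Longrightarrow> f \<in> Arr C \<Longrightarrow> Dom C f \<in> Obj C"
  and cat_cod: "is_category C \<Longrightarrow> f \<in> Arr C \<Longrightarrow> Cod C f \<in> Obj C"
  and cat_ident: "is_category C \<Longrightarrow> x \<in> Obj C \<Longrightarrow> Ident C x \<in> Hom C x x"
  by (auto simp: is_category_def)

lemma cat_comp:
  "is_category C \<Longrightarrow> f \<in> Hom C x y \<Longrightarrow> g \<in> Hom C y z \<Longrightarrow> Comp C g f \<in> Hom C x z"
  by (auto simp: is_category_def Hom_def)

lemma cat_unit_right: "is_category C \<Longrightarrow> f \<in> Hom C x y \<Longrightarrow> Comp C f (Ident C x) = f"
  and cat_unit_left: "is_category C \<Longrightarrow> f \<in> Hom C x y \<Longrightarrow> Comp C (Ident C y) f = f"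
  by (auto simp: is_category_def Hom_def)

lemma cat_assoc:
  "is_category C \<Longrightarrow> f \<in> Hom C x y \<Longrightarrow> g \<in> Hom C y z \<Longrightarrow> h \<in> Hom C z w \<Longrightarrow>
   Comp C h (Comp C g f) = Comp C (Comp C h g) f"
  by (auto simp: is_category_def Hom_def)

lemma cat_assoc_Arr:
  "is_category C \<Longrightarrow> f \<in> Arr C \<Longrightarrow> g \<in> Arr C \<Longrightarrow> h \<in> Arr C \<Longrightarrow> Dom C g = Cod C f \<Longrightarrow>
   Dom C h = Cod C g \<Longrightarrow> Comp C (Comp C h g) f = Comp C h (Comp C g f)"
  by (auto simp: is_category_def)

lemma Hom_objD: "is_category C \<Longrightarrow> f \<in> Hom C x y \<Longrightarrow> x \<in> Obj C \<and> y \<in> Obj C"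
  by (auto simp: is_category_def Hom_def)

lemma HomI: "f \<in> Arr C \<Longrightarrow> Dom C f = x \<Longrightarrow> Cod C f = y \<Longrightarrow> f \<in> Hom C x y"
  and HomD: "f \<in> Hom C x y \<Longrightarrow> f \<in> Arr C \<and> Dom C f = x \<and> Cod C f = y"
  by (auto simp: Hom_def)

lemma Arr_Hom: "f \<in> Arr C \<Longrightarrow> f \<in> Hom C (Dom C f) (Cod C f)"
  by (auto simp: Hom_def)

lemma cat_identD:
  assumes "is_category C" "x \<in> Obj C"
  shows "Ident C x \<in> Arr C" "Dom C (Ident C x) = x" "Cod C (Ident C x) = x"
  using cat_ident[OF assms] by (auto simp: Hom_def)

lemma cat_compD:
  assumes "is_category C" "f \<in> Arr C" "g \<in> Arr C" "Dom C g = Cod C f"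
  shows "Comp C g f \<in> Arr C" "Dom C (Comp C g f) = Dom C f" "Cod C (Comp C g f) = Cod C g"
  using assms by (auto simp: is_category_def Hom_def)

text \<open>The axioms are asked for arrows typed by \<open>Hom\<close>, so that each later category
  can be checked with named sources and targets instead of side conditions on \<open>Dom\<close> and
  \<open>Cod\<close>.\<close>

lemma is_categoryI:
  assumes "\<And>f. f \<in> Arr C \<Longrightarrow> Dom C f \<in> Obj C \<and> Cod C f \<in> Obj C"
    and "\<And>x. x \<in> Obj C \<Longrightarrow> Ident C x \<in> Hom C x x"
    and "\<And>f g x y z. f \<in> Hom C x y \<Longrightarrow> g \<in> Hom C y z \<Longrightarrow> Comp C g f \<in> Hom C x z"
    and "\<And>f x y. f \<in> Hom C x y \<Longrightarrow> Comp C f (Ident C x) = f"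
    and "\<And>f x y. f \<in> Hom C x y \<Longrightarrow> Comp C (Ident C y) f = f"
    and "\<And>f g h x y z w. f \<in> Hom C x y \<Longrightarrow> g \<in> Hom C y z \<Longrightarrow> h \<in> Hom C z w \<Longrightarrow>
       Comp C h (Comp C g f) = Comp C (Comp C h g) f"
  shows "is_category C"
  unfolding is_category_def
  using assms by (auto simp: Hom_def)

lemma is_isomorphismI:
  "f \<in> Hom C x y \<Longrightarrow> g \<in> Hom C y x \<Longrightarrow> Comp C g f = Ident C x \<Longrightarrow> Comp C f g = Ident C y \<Longrightarrow>
   is_isomorphism C f"
  by (auto simp: is_isomorphism_def Hom_def)

lemma is_isomorphismE:
  assumes "is_isomorphism C f" "f \<in> Hom C x y"
  obtains g where "g \<in> Hom C y x" "Comp C g f = Ident C x" "Comp C f g = Ident C y"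
  using assms by (auto simp: is_isomorphism_def Hom_def)

lemma is_isomorphism_Comp:
  assumes "is_category C" "f \<in> Hom C x y" "g \<in> Hom C y z" "is_isomorphism C f" "is_isomorphism C g"
  shows "is_isomorphism C (Comp C g f)"
proof -
  obtain f' where f': "f' \<in> Hom C y x" "Comp C f' f = Ident C x" "Comp C f f' = Ident C y"
    using assms(2,4) by (blast elim: is_isomorphismE)
  obtain g' where g': "g' \<in> Hom C z y" "Comp C g' g = Ident C y" "Comp C g g' = Ident C z"
    using assms(3,5) by (blast elim: is_isomorphismE)
  note c = cat_comp[OF assms(1)]
  have "Comp C (Comp C f' g') (Comp C g f) = Comp C f' (Comp C (Comp C g' g) f)"
    using HomD[OF assms(2)] HomD[OF assms(3)] HomD[OF f'(1)] HomD[OF g'(1)]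
    by (simp add: cat_compD[OF assms(1)] cat_assoc_Arr[OF assms(1)])
  also have "\<dots> = Ident C x"
    using f' g' cat_unit_left[OF assms(1,2)] by simp
  finally have 1: "Comp C (Comp C f' g') (Comp C g f) = Ident C x" .
  have "Comp C (Comp C g f) (Comp C f' g') = Comp C g (Comp C (Comp C f f') g')"
    using HomD[OF assms(2)] HomD[OF assms(3)] HomD[OF f'(1)] HomD[OF g'(1)]
    by (simp add: cat_compD[OF assms(1)] cat_assoc_Arr[OF assms(1)])
  also have "\<dots> = Ident C z"
    using f' g' cat_unit_left[OF assms(1) g'(1)] by simp
  finally have 2: "Comp C (Comp C g f) (Comp C f' g') = Ident C z" .
  show ?thesis
    by (rule is_isomorphismI[OF c[OF assms(2,3)] c[OF g'(1) f'(1)] 1 2])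
qed

lemma groupoid_category: "is_groupoid G \<Longrightarrow> is_category G"
  by (simp add: is_groupoid_def)

lemma groupoid_inverse:
  assumes "is_groupoid G" "f \<in> Hom G x y"
  obtains g where "g \<in> Hom G y x" "Comp G g f = Ident G x" "Comp G f g = Ident G y"
  using assms by (metis HomD is_groupoid_def is_isomorphismE)

lemma functor_category: "is_functor A B F \<Longrightarrow> is_category A" "is_functor A B F \<Longrightarrow> is_category B"
  by (auto simp: is_functor_def)

lemma functor_ob: "is_functor A B F \<Longrightarrow> x \<in> Obj A \<Longrightarrow> FOb F x \<in> Obj B"
  by (auto simp: is_functor_def)

lemma functor_hom:
  "is_functor A B F \<Longrightarrow> f \<in> Hom A x y \<Longrightarrow> FAr F f \<in> Hom B (FOb F x) (FOb F y)"
  by (auto simp: is_functor_def Hom_def)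

lemma functor_ident: "is_functor A B F \<Longrightarrow> x \<in> Obj A \<Longrightarrow> FAr F (Ident A x) = Ident B (FOb F x)"
  by (auto simp: is_functor_def)

lemma functor_comp:
  "is_functor A B F \<Longrightarrow> f \<in> Hom A x y \<Longrightarrow> g \<in> Hom A y z \<Longrightarrow>
   FAr F (Comp A g f) = Comp B (FAr F g) (FAr F f)"
  by (auto simp: is_functor_def Hom_def)

lemma is_functorI:
  assumes "is_category A" "is_category B"
    and "\<And>x. x \<in> Obj A \<Longrightarrow> FOb F x \<in> Obj B"
    and "\<And>f x y. f \<in> Hom A x y \<Longrightarrow> FAr F f \<in> Hom B (FOb F x) (FOb F y)"
    and "\<And>x. x \<in> Obj A \<Longrightarrow> FAr F (Ident A x) = Ident B (FOb F x)"
    and "\<And>f g x y z. f \<in> Hom A x y \<Longrightarrow> g \<in> Hom A y z \<Longrightarrow>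
       FAr F (Comp A g f) = Comp B (FAr F g) (FAr F f)"
  shows "is_functor A B F"
  unfolding is_functor_def using assms by (auto simp: Hom_def)

text \<open>This criterion stands in for \<open>is_equivalence\<close> until the very end: it passes
  to full subcategories by inspection, whereas a quasi-inverse with its natural isomorphisms would
  have to be restricted piece by piece.\<close>

definition ff_ess_surj ::
  "('o, 'a, 'y) cat_scheme \<Rightarrow> ('p, 'b, 'z) cat_scheme \<Rightarrow> ('o, 'a, 'p, 'b) ftr \<Rightarrow> bool" where
  "ff_ess_surj A B F \<longleftrightarrow> is_functor A B F \<and>
     (\<forall>x\<in>Obj A. \<forall>y\<in>Obj A. bij_betw (FAr F) (Hom A x y) (Hom B (FOb F x) (FOb F y))) \<and>
     (\<forall>y\<in>Obj B. \<exists>x\<in>Obj A. \<exists>e\<in>Hom B (FOb F x) y. is_isomorphism B e)"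

text \<open>A quasi-inverse is chosen pointwise: each object of \<open>B\<close> gets a preimage up
  to a chosen isomorphism \<open>e\<close>, and an arrow of \<open>B\<close> is conjugated by these
  isomorphisms and then lifted through the bijection on Hom sets.\<close>

lemma ff_ess_surj_equivalence:
  assumes "ff_ess_surj A B F"
  shows "is_equivalence A B F"
proof -
  have F: "is_functor A B F"
    and ff: "\<And>x y. x \<in> Obj A \<Longrightarrow> y \<in> Obj A \<Longrightarrow> bij_betw (FAr F) (Hom A x y) (Hom B (FOb F x) (FOb F y))"
    using assms by (auto simp: ff_ess_surj_def)
  have "\<forall>y\<in>Obj B. \<exists>t. case t of (x,e,e') \<Rightarrow> x\<in>Obj A \<and> e\<in>Hom B (FOb F x) y \<and> e' \<in> Hom B y (FOb F x) \<and>
      Comp B e' e = Ident B (FOb F x) \<and> Comp B e e' = Ident B y"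
  proof
    fix y assume "y \<in> Obj B"
    then obtain x e where xe: "x\<in>Obj A" "e\<in>Hom B (FOb F x) y" "is_isomorphism B e"
      using assms by (auto simp: ff_ess_surj_def)
    then obtain e' where "e' \<in> Hom B y (FOb F x)" "Comp B e' e = Ident B (FOb F x)" "Comp B e e' = Ident B y"
      by (blast elim: is_isomorphismE)
    with xe show "\<exists>t. case t of (x,e,e') \<Rightarrow> x\<in>Obj A \<and> e\<in>Hom B (FOb F x) y \<and> e' \<in> Hom B y (FOb F x) \<and>
      Comp B e' e = Ident B (FOb F x) \<and> Comp B e e' = Ident B y"
      by (intro exI[of _ "(x,e,e')"]) simp
  qed
  then obtain q where q: "\<forall>y\<in>Obj B. case q y of (x,e,e') \<Rightarrow> x\<in>Obj A \<and> e\<in>Hom B (FOb F x) y \<and> e' \<in> Hom B y (FOb F x) \<and>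
      Comp B e' e = Ident B (FOb F x) \<and> Comp B e e' = Ident B y"
    by (rule bchoice[THEN exE])
  define G0 where "G0 y = fst (q y)" for y
  define e where "e y = fst (snd (q y))" for y
  define e' where "e' y = snd (snd (q y))" for y
  have G0: "G0 y \<in> Obj A" and e: "e y \<in> Hom B (FOb F (G0 y)) y" and e': "e' y \<in> Hom B y (FOb F (G0 y))"
    and e'e: "Comp B (e' y) (e y) = Ident B (FOb F (G0 y))" and ee': "Comp B (e y) (e' y) = Ident B y"
    if "y \<in> Obj B" for y
    using bspec[OF q that] by (simp_all add: G0_def e_def e'_def case_prod_unfold)
  define pre where "pre x y g = inv_into (Hom A x y) (FAr F) g" for x y g
  have pre: "pre x y g \<in> Hom A x y" "FAr F (pre x y g) = g"
    if "x \<in> Obj A" "y \<in> Obj A" "g \<in> Hom B (FOb F x) (FOb F y)" for x y g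
    using ff[OF that(1,2)] that(3) unfolding pre_def bij_betw_def
    by (auto intro: inv_into_into f_inv_into_f)
  \<comment> \<open>Faithfulness reduces every equation between arrows of \<open>A\<close> below to
    one in \<open>B\<close>, where the relations between \<open>e\<close> and \<open>e'\<close> are
    available.\<close>
  have inj: "f = f'" if "f \<in> Hom A x y" "f' \<in> Hom A x y" "FAr F f = FAr F f'" for f f' x y
    using ff that F Hom_objD functor_category(1)[OF F] by (metis bij_betw_def inj_onD)
  note cA = functor_category(1)[OF F] and cB = functor_category(2)[OF F]
  note co = cat_comp[OF cB] and S = cat_compD[OF cB] cat_assoc_Arr[OF cB]
  define G where "G = \<lparr>FOb = G0, FAr = (\<lambda>g. pre (G0 (Dom B g)) (G0 (Cod B g))
     (Comp B (e' (Cod B g)) (Comp B g (e (Dom B g)))))\<rparr>"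
  have Gar: "FAr G g \<in> Hom A (G0 y) (G0 z)" "FAr F (FAr G g) = Comp B (e' z) (Comp B g (e y))"
    if g: "g \<in> Hom B y z" for g y z
  proof -
    have o: "y \<in> Obj B" "z \<in> Obj B" using Hom_objD[OF cB g] by auto
    have "Comp B (e' z) (Comp B g (e y)) \<in> Hom B (FOb F (G0 y)) (FOb F (G0 z))"
      using co co e e' o g by blast
    then show "FAr G g \<in> Hom A (G0 y) (G0 z)" "FAr F (FAr G g) = Comp B (e' z) (Comp B g (e y))"
      using pre G0 o HomD[OF g] by (simp_all add: G_def)
  qed
  have G: "is_functor B A G"
  proof (rule is_functorI[OF cB cA])
    show "FOb G x \<in> Obj A" if "x \<in> Obj B" for x using G0 that by (simp add: G_def)
    show "FAr G f \<in> Hom A (FOb G x) (FOb G y)" if "f \<in> Hom B x y" for f x y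
      using Gar that by (simp add: G_def)
    show "FAr G (Ident B x) = Ident A (FOb G x)" if x: "x \<in> Obj B" for x
    proof (rule inj)
      show "FAr G (Ident B x) \<in> Hom A (G0 x) (G0 x)" using Gar cat_ident[OF cB x] by blast
      show "Ident A (FOb G x) \<in> Hom A (G0 x) (G0 x)" using cat_ident[OF cA] G0 x by (simp add: G_def)
      show "FAr F (FAr G (Ident B x)) = FAr F (Ident A (FOb G x))"
        using Gar(2)[OF cat_ident[OF cB x]] e[OF x] e'e[OF x] functor_ident[OF F] G0[OF x]
         cat_unit_left[OF cB] by (simp add: G_def)
    qed
    show "FAr G (Comp B g f) = Comp A (FAr G g) (FAr G f)"
      if f: "f \<in> Hom B x y" and g: "g \<in> Hom B y z" for f g x y z
    proof (rule inj)
      have o: "x \<in> Obj B" "y \<in> Obj B" "z \<in> Obj B" using Hom_objD[OF cB f] Hom_objD[OF cB g] by auto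
      show "FAr G (Comp B g f) \<in> Hom A (G0 x) (G0 z)" using Gar co f g by blast
      show "Comp A (FAr G g) (FAr G f) \<in> Hom A (G0 x) (G0 z)"
        using Gar f g cat_comp[OF cA] by blast
      have "FAr F (Comp A (FAr G g) (FAr G f)) = Comp B (Comp B (e' z) (Comp B g (e y))) (Comp B (e' y) (Comp B f (e x)))"
        using functor_comp[OF F Gar(1)[OF f] Gar(1)[OF g]] Gar(2) f g by simp
      also have "\<dots> = Comp B (Comp B (e' z) g) (Comp B (Comp B (e y) (e' y)) (Comp B f (e x)))"
        using HomD[OF e[OF o(1)]] HomD[OF e[OF o(2)]] HomD[OF e'[OF o(2)]] HomD[OF e'[OF o(3)]] HomD[OF f] HomD[OF g]
        by (simp add: S)
      also have "\<dots> = Comp B (Comp B (e' z) g) (Comp B f (e x))"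
        using ee'[OF o(2)] cat_unit_left[OF cB co[OF e[OF o(1)] f]] by simp
      also have "\<dots> = Comp B (e' z) (Comp B (Comp B g f) (e x))"
        using HomD[OF e[OF o(1)]] HomD[OF e'[OF o(3)]] HomD[OF f] HomD[OF g] by (simp add: S)
      also have "\<dots> = FAr F (FAr G (Comp B g f))" using Gar(2) co[OF f g] by simp
      finally show "FAr F (FAr G (Comp B g f)) = FAr F (Comp A (FAr G g) (FAr G f))" by simp
    qed
  qed
  \<comment> \<open>The unit is the lift of the inverse of the counit \<open>e\<close> at
    \<open>FOb F x\<close>; lifting \<open>e\<close> in the same way gives its inverse.\<close>
  define t where "t x = pre x (G0 (FOb F x)) (e' (FOb F x))" for x
  have t: "t x \<in> Hom A x (G0 (FOb F x))" "FAr F (t x) = e' (FOb F x)" if "x \<in> Obj A" for x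
    using pre that G0 e' functor_ob[OF F] by (auto simp: t_def)
  have "is_natural_iso A A ftr_id (ftr_comp G F) t"
    unfolding is_natural_iso_def
  proof (intro conjI ballI)
    fix x assume x: "x \<in> Obj A"
    let ?y = "FOb F x"
    have y: "?y \<in> Obj B" using functor_ob[OF F x] .
    show "t x \<in> Hom A (FOb ftr_id x) (FOb (ftr_comp G F) x)"
      using t x by (simp add: ftr_id_def ftr_comp_def G_def)
    define t' where "t' = pre (G0 ?y) x (e ?y)"
    have t': "t' \<in> Hom A (G0 ?y) x" "FAr F t' = e ?y"
      using pre[of "G0 ?y" x "e ?y"] G0 e y x by (auto simp: t'_def)
    show "is_isomorphism A (t x)"
    proof (rule is_isomorphismI[OF t(1)[OF x] t'(1)]; rule inj)
      show "Comp A t' (t x) \<in> Hom A x x" "Ident A x \<in> Hom A x x"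
           "Comp A (t x) t' \<in> Hom A (G0 ?y) (G0 ?y)" "Ident A (G0 ?y) \<in> Hom A (G0 ?y) (G0 ?y)"
        using cat_comp[OF cA] cat_ident[OF cA] t[OF x] t' x G0[OF y] by blast+
      show "FAr F (Comp A t' (t x)) = FAr F (Ident A x)" "FAr F (Comp A (t x) t') = FAr F (Ident A (G0 ?y))"
        using functor_comp[OF F] functor_ident[OF F] t[OF x] t' x G0[OF y] ee'[OF y] e'e[OF y] by simp_all
    qed
  next
    fix f assume f: "f \<in> Arr A"
    let ?x = "Dom A f" and ?y = "Cod A f"
    have fh: "f \<in> Hom A ?x ?y" using Arr_Hom[OF f] .
    have xy: "?x \<in> Obj A" "?y \<in> Obj A" using Hom_objD[OF cA fh] by auto
    have Ff: "FAr F f \<in> Hom B (FOb F ?x) (FOb F ?y)" using functor_hom[OF F fh] .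
    have o: "FOb F ?x \<in> Obj B" "FOb F ?y \<in> Obj B" using functor_ob[OF F] xy by auto
    have "Comp A (t ?y) f = Comp A (FAr G (FAr F f)) (t ?x)"
    proof (rule inj)
      show "Comp A (t ?y) f \<in> Hom A ?x (G0 (FOb F ?y))" "Comp A (FAr G (FAr F f)) (t ?x) \<in> Hom A ?x (G0 (FOb F ?y))"
        using cat_comp[OF cA] fh t xy Gar(1)[OF Ff] by blast+
      have "FAr F (Comp A (FAr G (FAr F f)) (t ?x)) = Comp B (Comp B (e' (FOb F ?y)) (Comp B (FAr F f) (e (FOb F ?x)))) (e' (FOb F ?x))"
        using functor_comp[OF F t(1)[OF xy(1)] Gar(1)[OF Ff]] Gar(2)[OF Ff] t(2)[OF xy(1)] by simp
      also have "\<dots> = Comp B (Comp B (e' (FOb F ?y)) (FAr F f)) (Comp B (e (FOb F ?x)) (e' (FOb F ?x)))"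
        using HomD[OF e[OF o(1)]] HomD[OF e'[OF o(1)]] HomD[OF e'[OF o(2)]] HomD[OF Ff] by (simp add: S)
      also have "\<dots> = Comp B (e' (FOb F ?y)) (FAr F f)"
        using ee'[OF o(1)] cat_unit_right[OF cB] co[OF Ff e'[OF o(2)]] by simp
      also have "\<dots> = FAr F (Comp A (t ?y) f)"
        using functor_comp[OF F fh t(1)[OF xy(2)]] t(2)[OF xy(2)] by simp
      finally show "FAr F (Comp A (t ?y) f) = FAr F (Comp A (FAr G (FAr F f)) (t ?x))" by simp
    qed
    then show "Comp A (t (Cod A f)) (FAr ftr_id f) = Comp A (FAr (ftr_comp G F) f) (t (Dom A f))"
      by (simp add: ftr_id_def ftr_comp_def)
  qed
  moreover have "is_natural_iso B B (ftr_comp F G) ftr_id e"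
    unfolding is_natural_iso_def
  proof (intro conjI ballI)
    fix y assume y: "y \<in> Obj B"
    show "e y \<in> Hom B (FOb (ftr_comp F G) y) (FOb ftr_id y)"
      using e y by (simp add: ftr_id_def ftr_comp_def G_def)
    show "is_isomorphism B (e y)"
      using is_isomorphismI[OF e e' e'e ee'] y by blast
  next
    fix f assume f: "f \<in> Arr B"
    let ?x = "Dom B f" and ?y = "Cod B f"
    have fh: "f \<in> Hom B ?x ?y" using Arr_Hom[OF f] .
    have o: "?x \<in> Obj B" "?y \<in> Obj B" using Hom_objD[OF cB fh] by auto
    have "Comp B (e ?y) (FAr F (FAr G f)) = Comp B (Comp B (e ?y) (e' ?y)) (Comp B f (e ?x))"
      using Gar(2)[OF fh] HomD[OF e[OF o(1)]] HomD[OF e[OF o(2)]] HomD[OF e'[OF o(2)]] HomD[OF fh] by (simp add: S)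
    also have "\<dots> = Comp B f (e ?x)"
      using ee'[OF o(2)] cat_unit_left[OF cB co[OF e[OF o(1)] fh]] by simp
    finally show "Comp B (e (Cod B f)) (FAr (ftr_comp F G) f) = Comp B (FAr ftr_id f) (e (Dom B f))"
      by (simp add: ftr_id_def ftr_comp_def)
  qed
  ultimately show ?thesis
    unfolding is_equivalence_def using F G by blast
qed

lemma full_subcat_sel:
  "Obj (full_subcat C P) = {x \<in> Obj C. P x}"
  "Arr (full_subcat C P) = {f \<in> Arr C. P (Dom C f) \<and> P (Cod C f)}"
  "Dom (full_subcat C P) = Dom C" "Cod (full_subcat C P) = Cod C"
  "Ident (full_subcat C P) = Ident C" "Comp (full_subcat C P) = Comp C"
  by (auto simp: full_subcat_def)

lemma full_subcat_Hom: "P x \<Longrightarrow> P y \<Longrightarrow> Hom (full_subcat C P) x y = Hom C x y"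
  by (auto simp: Hom_def full_subcat_sel)

lemma full_subcat_category: "is_category C \<Longrightarrow> is_category (full_subcat C P)"
  unfolding is_category_def by (auto simp: full_subcat_sel Hom_def)

lemma full_subcat_is_isomorphism:
  "is_isomorphism (full_subcat C P) f \<longleftrightarrow> is_isomorphism C f \<and> P (Dom C f) \<and> P (Cod C f)"
  by (auto simp: is_isomorphism_def full_subcat_sel Hom_def)

text \<open>Fullness of the subcategories leaves the Hom sets unchanged. For essential surjectivity,
  \<open>Q\<close> travels backwards along the isomorphism from \<open>FOb F x\<close> to
  \<open>y\<close>, which places \<open>FOb F x\<close> in the target subcategory and hence
  \<open>x\<close> in the source one.\<close>

lemma ff_ess_surj_full_subcat:
  assumes "ff_ess_surj A B F"
    and PQ: "\<And>x. x \<in> Obj A \<Longrightarrow> P x \<longleftrightarrow> Q (FOb F x)"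
    and Q: "\<And>y y' e. e \<in> Hom B y y' \<Longrightarrow> is_isomorphism B e \<Longrightarrow> Q y' \<Longrightarrow> Q y"
  shows "ff_ess_surj (full_subcat A P) (full_subcat B Q) F"
proof -
  have F: "is_functor A B F"
    and ff: "\<And>x y. x \<in> Obj A \<Longrightarrow> y \<in> Obj A \<Longrightarrow> bij_betw (FAr F) (Hom A x y) (Hom B (FOb F x) (FOb F y))"
    and es: "\<And>y. y\<in>Obj B \<Longrightarrow> \<exists>x\<in>Obj A. \<exists>e\<in>Hom B (FOb F x) y. is_isomorphism B e"
    using assms(1) by (auto simp: ff_ess_surj_def)
  have "is_functor (full_subcat A P) (full_subcat B Q) F"
    using F PQ unfolding is_functor_def
    by (auto simp: full_subcat_category full_subcat_sel Hom_def cat_dom cat_cod)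
  moreover have "bij_betw (FAr F) (Hom (full_subcat A P) x y) (Hom (full_subcat B Q) (FOb F x) (FOb F y))"
    if "x \<in> Obj (full_subcat A P)" "y \<in> Obj (full_subcat A P)" for x y
    using that ff PQ full_subcat_Hom[of P x y A] full_subcat_Hom[of Q "FOb F x" "FOb F y" B]
    by (auto simp: full_subcat_sel)
  moreover have "\<exists>x\<in>Obj (full_subcat A P). \<exists>e\<in>Hom (full_subcat B Q) (FOb F x) y. is_isomorphism (full_subcat B Q) e"
    if y: "y \<in> Obj (full_subcat B Q)" for y
  proof -
    have y': "y \<in> Obj B" "Q y" using y by (auto simp: full_subcat_sel)
    from es[OF this(1)] obtain x e where xe: "x \<in> Obj A" "e \<in> Hom B (FOb F x) y" "is_isomorphism B e" by blast
    have "Q (FOb F x)" using Q xe y' by blast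
    then show ?thesis using xe y' PQ
      by (intro bexI[of _ x] bexI[of _ e]) (auto simp: full_subcat_sel full_subcat_Hom full_subcat_is_isomorphism Hom_def)
  qed
  ultimately show ?thesis by (simp add: ff_ess_surj_def)
qed

section \<open>Categories presented by generators and relations; fundamental groupoids and
  coequalizers as instances\<close>

section \<open>Presented categories\<close>

lemma walk_source: "walk G u xs v \<Longrightarrow> u \<in> Vert G"
  by (cases xs) auto

lemma walk_target: "walk G u xs v \<Longrightarrow> v \<in> Vert G"
  by (induction xs arbitrary: u) auto

lemma walk_append: "walk G u (xs @ ys) w \<longleftrightarrow> (\<exists>v. walk G u xs v \<and> walk G v ys w)"
  by (induction xs arbitrary: u) (auto dest: walk_source)

text \<open>\<open>presented_cat\<close> reads the source and target of a class off an arbitrary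
  representative; parallel relations make the result independent of the representative.\<close>

definition parallel_rels :: "(('v, 'e) path \<times> ('v, 'e) path) set \<Rightarrow> bool" where
  "parallel_rels R \<longleftrightarrow> (\<forall>(p, q)\<in>R. fst p = fst q \<and> snd (snd p) = snd (snd q))"

definition path_class ::
  "('v, 'e) graph \<Rightarrow> (('v, 'e) path \<times> ('v, 'e) path) set \<Rightarrow> ('v, 'e) path \<Rightarrow> ('v, 'e) path set" where
  "path_class G R p = path_cong G R `` {p}"

lemma path_cong_paths: "(p, q) \<in> path_cong G R \<Longrightarrow> p \<in> paths G \<and> q \<in> paths G"
  by (induction rule: path_cong.induct) (auto simp: paths_def walk_append)

lemma path_cong_ends:
  "(p, q) \<in> path_cong G R \<Longrightarrow> parallel_rels R \<Longrightarrow> fst p = fst q \<and> snd (snd p) = snd (snd q)"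
  by (induction rule: path_cong.induct) (auto simp: parallel_rels_def)

lemma path_class_eqI: "(p, q) \<in> path_cong G R \<Longrightarrow> path_class G R p = path_class G R q"
  unfolding path_class_def by (auto intro: path_cong.trans path_cong.sym)

lemma path_class_self: "p \<in> paths G \<Longrightarrow> p \<in> path_class G R p"
  unfolding path_class_def by (auto intro: path_cong.refl)

lemma path_class_memD: "q \<in> path_class G R p \<Longrightarrow> (p, q) \<in> path_cong G R"
  unfolding path_class_def by auto

lemma presented_sel:
  "Obj (presented_cat G R) = Vert G"
  "Arr (presented_cat G R) = {path_class G R (u, xs, v) | u xs v. walk G u xs v}"
  "Ident (presented_cat G R) u = path_class G R (u, [], u)"
  by (auto simp: presented_cat_def quotient_def path_class_def paths_def)

lemma path_class_some:
  assumes "parallel_rels R" "walk G u xs v"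
  obtains ys where "(SOME p. p \<in> path_class G R (u, xs, v)) = (u, ys, v)"
proof -
  have "(u, xs, v) \<in> path_class G R (u, xs, v)" using path_class_self assms(2) by (auto simp: paths_def)
  then have "(SOME p. p \<in> path_class G R (u, xs, v)) \<in> path_class G R (u, xs, v)" by (rule someI)
  from path_cong_ends[OF path_class_memD[OF this] assms(1)] that show ?thesis
    by (metis fst_conv snd_conv prod.exhaust_sel)
qed

lemma presented_Dom: "parallel_rels R \<Longrightarrow> walk G u xs v \<Longrightarrow> Dom (presented_cat G R) (path_class G R (u, xs, v)) = u"
  and presented_Cod: "parallel_rels R \<Longrightarrow> walk G u xs v \<Longrightarrow> Cod (presented_cat G R) (path_class G R (u, xs, v)) = v"
  by (auto simp: presented_cat_def elim: path_class_some)

lemma presented_Hom: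
  "parallel_rels R \<Longrightarrow> walk G u xs v \<Longrightarrow> path_class G R (u, xs, v) \<in> Hom (presented_cat G R) u v"
  by (auto simp: Hom_def presented_Dom presented_Cod presented_sel)

lemma presented_HomE:
  assumes "f \<in> Hom (presented_cat G R) u v" "parallel_rels R"
  obtains xs where "walk G u xs v" "f = path_class G R (u, xs, v)"
proof -
  from assms(1) obtain u' xs v' where *: "walk G u' xs v'" "f = path_class G R (u', xs, v')"
    by (auto simp: Hom_def presented_sel)
  with assms have "u' = u" "v' = v" by (auto simp: Hom_def presented_Dom presented_Cod)
  with * that show ?thesis by blast
qed

text \<open>The definition of composition saturates the set of all concatenations of
  representatives. The rule \<open>append\<close> makes these congruent to each other, so one pair
  of representatives determines the composite.\<close>

lemma presented_Comp:
  assumes "parallel_rels R" "walk G u xs v" "walk G v ys w"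
  shows "Comp (presented_cat G R) (path_class G R (v, ys, w)) (path_class G R (u, xs, v)) =
    path_class G R (u, xs @ ys, w)"
proof -
  let ?S = "{(u', xs' @ ys', w') | u' xs' v' ys' w'.
     (u', xs', v') \<in> path_class G R (u, xs, v) \<and> (v', ys', w') \<in> path_class G R (v, ys, w)}"
  have 1: "((u, xs @ ys, w), p) \<in> path_cong G R" if "p \<in> ?S" for p
  proof -
    from that obtain u' xs' v' ys' w' where p: "p = (u', xs' @ ys', w')"
      and a: "((u, xs, v), (u', xs', v')) \<in> path_cong G R" and b: "((v, ys, w), (v', ys', w')) \<in> path_cong G R"
      using path_class_memD by blast
    have "u' = u" "v' = v" "w' = w" using path_cong_ends[OF a assms(1)] path_cong_ends[OF b assms(1)] by auto
    with p a b show ?thesis by (auto intro: path_cong.append)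
  qed
  moreover have "(u, xs @ ys, w) \<in> ?S"
    using assms path_class_self[of "(u, xs, v)" G R] path_class_self[of "(v, ys, w)" G R]
    by (auto simp: paths_def)
  ultimately have "path_cong G R `` ?S = path_class G R (u, xs @ ys, w)"
    unfolding path_class_def by (blast intro: path_cong.trans path_cong.sym)
  then show ?thesis by (simp add: presented_cat_def)
qed

text \<open>After passing to representatives, the unit and associativity laws are those of list
  concatenation.\<close>

lemma presented_category:
  assumes R: "parallel_rels R"
  shows "is_category (presented_cat G R)" (is "is_category ?P")
proof (rule is_categoryI)
  fix f assume "f \<in> Arr ?P"
  then show "Dom ?P f \<in> Obj ?P \<and> Cod ?P f \<in> Obj ?P"
    using R by (auto simp: presented_sel presented_Dom presented_Cod walk_source walk_target)
next
  fix x assume "x \<in> Obj ?P"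
  then show "Ident ?P x \<in> Hom ?P x x"
    using R by (simp add: presented_sel presented_Hom)
next
  fix f g x y z assume "f \<in> Hom ?P x y" "g \<in> Hom ?P y z"
  then show "Comp ?P g f \<in> Hom ?P x z"
    using R by (auto elim!: presented_HomE simp: presented_Comp intro!: presented_Hom walk_append[THEN iffD2])
next
  fix f x y assume "f \<in> Hom ?P x y"
  then show "Comp ?P f (Ident ?P x) = f"
    "Comp ?P (Ident ?P y) f = f"
    using R by (auto elim!: presented_HomE simp: presented_Comp presented_sel walk_source walk_target)
next
  fix f g h x y z w
  assume "f \<in> Hom ?P x y" "g \<in> Hom ?P y z" "h \<in> Hom ?P z w"
  then obtain xs ys zs where w: "walk G x xs y" "walk G y ys z" "walk G z zs w"
    and e: "f = path_class G R (x, xs, y)" "g = path_class G R (y, ys, z)" "h = path_class G R (z, zs, w)"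
    using R by (auto elim!: presented_HomE)
  have "walk G x (xs @ ys) z" "walk G y (ys @ zs) w" using w by (auto simp: walk_append)
  then show "Comp ?P h (Comp ?P g f) = Comp ?P (Comp ?P h g) f"
    using w R unfolding e by (simp add: presented_Comp)
qed

definition edge_arr ::
  "('v, 'e) graph \<Rightarrow> (('v, 'e) path \<times> ('v, 'e) path) set \<Rightarrow> 'e \<Rightarrow> ('v, 'e) path set" where
  "edge_arr G R e = path_class G R (Src G e, [e], Tgt G e)"

lemma edge_arr_Hom:
  assumes "parallel_rels R" "e \<in> Edge G" "Src G e \<in> Vert G" "Tgt G e \<in> Vert G"
  shows "edge_arr G R e \<in> Hom (presented_cat G R) (Src G e) (Tgt G e)"
  unfolding edge_arr_def by (rule presented_Hom) (use assms in auto)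

text \<open>Splitting the first edge off a representing list writes a class as a composite of
  one-edge classes. The induction principle for arrows of a homotopy colimit starts from
  this.\<close>

lemma presented_induct [consumes 2, case_names Ident Comp Edge]:
  assumes "f \<in> Arr (presented_cat G R)" and R: "parallel_rels R"
    and I: "\<And>v. v \<in> Vert G \<Longrightarrow> P (Ident (presented_cat G R) v)"
    and C: "\<And>f g u v w. f \<in> Hom (presented_cat G R) u v \<Longrightarrow> g \<in> Hom (presented_cat G R) v w \<Longrightarrow> P f \<Longrightarrow> P g \<Longrightarrow>
       P (Comp (presented_cat G R) g f)"
    and E: "\<And>e. e \<in> Edge G \<Longrightarrow> Src G e \<in> Vert G \<Longrightarrow> Tgt G e \<in> Vert G \<Longrightarrow> P (edge_arr G R e)"
  shows "P f"
proof -
  have "P (path_class G R (u, xs, v))" if "walk G u xs v" for u xs v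
    using that
  proof (induction xs arbitrary: u)
    case Nil
    then show ?case using I[of u] by (auto simp: presented_sel)
  next
    case (Cons e xs)
    then have w: "walk G u [e] (Tgt G e)" "walk G (Tgt G e) xs v" by (auto dest: walk_source)
    then have "path_class G R (u, e # xs, v) = Comp (presented_cat G R) (path_class G R (Tgt G e, xs, v)) (path_class G R (u, [e], Tgt G e))"
      using presented_Comp[OF R w] by simp
    then show ?case
      using C presented_Hom[OF R w(1)] presented_Hom[OF R w(2)] E[of e] Cons.IH[OF w(2)] w(1)
      by (auto simp: edge_arr_def)
  qed
  then show ?thesis using assms(1) by (auto simp: presented_sel)
qed

text \<open>Identities are invertible and isomorphisms compose, so invertible generators
  suffice.\<close>

lemma presented_groupoid:
  assumes R: "parallel_rels R"
    and "\<And>e. e \<in> Edge G \<Longrightarrow> Src G e \<in> Vert G \<Longrightarrow> Tgt G e \<in> Vert G \<Longrightarrow> is_isomorphism (presented_cat G R) (edge_arr G R e)"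
  shows "is_groupoid (presented_cat G R)"
  unfolding is_groupoid_def
proof (intro conjI ballI)
  show c: "is_category (presented_cat G R)" by (rule presented_category[OF R])
  fix f assume "f \<in> Arr (presented_cat G R)"
  then show "is_isomorphism (presented_cat G R) f" using R
  proof (induction rule: presented_induct)
    case (Ident v)
    then show ?case using c cat_ident[OF c, of v] cat_unit_left[OF c]
      by (intro is_isomorphismI[of _ _ v v]) (auto simp: presented_sel(1))
  next
    case (Comp f g u v w)
    then show ?case using is_isomorphism_Comp[OF c] by blast
  next
    case (Edge e)
    then show ?case using assms by blast
  qed
qed

text \<open>An edge can occur in a walk only if both its endpoints are vertices; the guards restrict
  the conditions to such edges.\<close>

definition graph_map :: "('v, 'e) graph \<Rightarrow> ('w, 'd) graph \<Rightarrow> ('v \<Rightarrow> 'w) \<Rightarrow> ('e \<Rightarrow> 'd) \<Rightarrow> bool" where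
  "graph_map G G' n m \<longleftrightarrow> (\<forall>v\<in>Vert G. n v \<in> Vert G') \<and>
     (\<forall>e\<in>Edge G. Src G e \<in> Vert G \<longrightarrow> Tgt G e \<in> Vert G \<longrightarrow>
        m e \<in> Edge G' \<and> Src G' (m e) = n (Src G e) \<and> Tgt G' (m e) = n (Tgt G e))"

definition respects_rels ::
  "('v, 'e) graph \<Rightarrow> (('v, 'e) path \<times> ('v, 'e) path) set \<Rightarrow>
   ('w, 'd) graph \<Rightarrow> (('w, 'd) path \<times> ('w, 'd) path) set \<Rightarrow> ('v \<Rightarrow> 'w) \<Rightarrow> ('e \<Rightarrow> 'd) \<Rightarrow> bool" where
  "respects_rels G R G' R' n m \<longleftrightarrow> (\<forall>p q. (p, q) \<in> R \<longrightarrow> p \<in> paths G \<longrightarrow> q \<in> paths G \<longrightarrow>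
     (path_map n m p, path_map n m q) \<in> path_cong G' R')"

lemma path_map_walk:
  assumes "graph_map G G' n m" and "walk G u xs v"
  shows "walk G' (n u) (map m xs) (n v)"
  using assms(2) by (induction xs arbitrary: u) (use assms(1) in \<open>auto simp: graph_map_def walk_source\<close>)

lemma path_map_paths: "graph_map G G' n m \<Longrightarrow> p \<in> paths G \<Longrightarrow> path_map n m p \<in> paths G'"
  by (auto simp: paths_def path_map_def intro: path_map_walk)

lemma path_map_cong:
  assumes "graph_map G G' n m" and "respects_rels G R G' R' n m" and "(p, q) \<in> path_cong G R"
  shows "(path_map n m p, path_map n m q) \<in> path_cong G' R'"
  using assms(3)
proof (induction rule: path_cong.induct)
  case (refl p)
  then show ?case using path_map_paths[OF assms(1)] by (blast intro: path_cong.refl)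
next
  case (append u xs v ys xs' w ys')
  then show ?case by (auto simp: path_map_def intro: path_cong.append)
qed (use assms(2) in \<open>auto simp: respects_rels_def intro: path_cong.sym path_cong.trans\<close>)

text \<open>\<open>fund_map\<close> and \<open>hc_map\<close> send a class to the saturation of its
  image under \<open>path_map\<close>. Since congruent paths have congruent images, this is the
  class of the image of any one representative.\<close>

lemma path_map_class:
  assumes "graph_map G G' n m" and "respects_rels G R G' R' n m" and w: "walk G u xs v"
  shows "path_cong G' R' `` (path_map n m ` path_class G R (u, xs, v)) = path_class G' R' (n u, map m xs, n v)"
proof -
  have *: "(n u, map m xs, n v) = path_map n m (u, xs, v)" by (simp add: path_map_def)
  have "(u, xs, v) \<in> path_class G R (u, xs, v)" using path_class_self w by (auto simp: paths_def)
  moreover have "(path_map n m (u, xs, v), path_map n m q) \<in> path_cong G' R'" if "q \<in> path_class G R (u, xs, v)" for q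
    using path_map_cong[OF assms(1,2) path_class_memD[OF that]] .
  ultimately show ?thesis unfolding * path_class_def[of G' R']
    by (blast intro: path_cong.trans path_cong.sym)
qed

lemma path_map_functor:
  assumes m: "graph_map G G' n m" and r: "respects_rels G R G' R' n m"
    and R: "parallel_rels R" "parallel_rels R'"
    and F: "FOb F = n" "FAr F = (\<lambda>c. path_cong G' R' `` (path_map n m ` c))"
  shows "is_functor (presented_cat G R) (presented_cat G' R') F"
proof (rule is_functorI)
  note pm = path_map_class[OF m r] and pw = path_map_walk[OF m]
  show "is_category (presented_cat G R)" "is_category (presented_cat G' R')"
    by (simp_all add: presented_category R)
  show "FOb F x \<in> Obj (presented_cat G' R')" if "x \<in> Obj (presented_cat G R)" for x
    using that m F by (simp add: presented_sel graph_map_def)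
  show "FAr F f \<in> Hom (presented_cat G' R') (FOb F x) (FOb F y)" if f: "f \<in> Hom (presented_cat G R) x y" for f x y
  proof -
    from presented_HomE[OF f R(1)] obtain xs where xs: "walk G x xs y" "f = path_class G R (x, xs, y)" by blast
    show ?thesis unfolding F xs(2) pm[OF xs(1)] by (rule presented_Hom[OF R(2) pw[OF xs(1)]])
  qed
  show "FAr F (Ident (presented_cat G R) x) = Ident (presented_cat G' R') (FOb F x)"
    if "x \<in> Obj (presented_cat G R)" for x
    using pm[of x "[]" x] that by (simp add: F presented_sel)
  show "FAr F (Comp (presented_cat G R) g f) = Comp (presented_cat G' R') (FAr F g) (FAr F f)"
    if f: "f \<in> Hom (presented_cat G R) x y" and g: "g \<in> Hom (presented_cat G R) y z" for f g x y z
  proof -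
    from presented_HomE[OF f R(1)] obtain xs where xs: "walk G x xs y" "f = path_class G R (x, xs, y)" by blast
    from presented_HomE[OF g R(1)] obtain ys where ys: "walk G y ys z" "g = path_class G R (y, ys, z)" by blast
    have "walk G x (xs @ ys) z" using xs ys by (auto simp: walk_append)
    then show ?thesis unfolding F xs(2) ys(2) presented_Comp[OF R(1) xs(1) ys(1)]
      by (simp add: pm xs(1) ys(1) presented_Comp[OF R(2) pw[OF xs(1)] pw[OF ys(1)]])
  qed
qed

lemma path_map_edge_arr:
  assumes m: "graph_map G G' n m" and r: "respects_rels G R G' R' n m"
    and e: "e \<in> Edge G" "Src G e \<in> Vert G" "Tgt G e \<in> Vert G"
  shows "path_cong G' R' `` (path_map n m ` edge_arr G R e) = edge_arr G' R' (m e)"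
  using path_map_class[OF m r, of "Src G e" "[e]" "Tgt G e"] m e by (auto simp: edge_arr_def graph_map_def)

section \<open>Fundamental groupoids\<close>

lemma fund_rels_parallel: "parallel_rels (fund_rels J)"
  by (auto simp: parallel_rels_def fund_rels_def)

lemma fund_graph_sel [simp]:
  "Vert (fund_graph J) = Obj J" "Edge (fund_graph J) = Arr J \<times> UNIV"
  "Src (fund_graph J) (f, b) = (if b then Dom J f else Cod J f)"
  "Tgt (fund_graph J) (f, b) = (if b then Cod J f else Dom J f)"
  by (auto simp: fund_graph_def)

lemma fund_gen_edge: "fund_gen J f = edge_arr (fund_graph J) (fund_rels J) (f, True)"
  by (simp add: fund_gen_def edge_arr_def path_class_def)

lemma fund_gen_Hom:
  assumes "is_category J" "f \<in> Hom J x y"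
  shows "fund_gen J f \<in> Hom (fund_groupoid J) x y"
  using edge_arr_Hom[OF fund_rels_parallel[of J], where e = "(f, True)" and G = "fund_graph J"] HomD[OF assms(2)] Hom_objD[OF assms]
  unfolding fund_gen_edge fund_groupoid_def by auto

definition fund_inv :: "('o, 'a, 'z) cat_scheme \<Rightarrow> 'a \<Rightarrow> ('o, 'a) fund_arr" where
  "fund_inv J f = edge_arr (fund_graph J) (fund_rels J) (f, False)"

lemma fund_inv_Hom:
  assumes "is_category J" "f \<in> Hom J x y"
  shows "fund_inv J f \<in> Hom (fund_groupoid J) y x"
  using edge_arr_Hom[OF fund_rels_parallel[of J], where e = "(f, False)" and G = "fund_graph J"] HomD[OF assms(2)] Hom_objD[OF assms]
  unfolding fund_inv_def fund_groupoid_def by auto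

lemma fund_gen_inv:
  assumes J: "is_category J" and "f \<in> Hom J x y"
  shows "Comp (fund_groupoid J) (fund_inv J f) (fund_gen J f) = Ident (fund_groupoid J) x"
    and "Comp (fund_groupoid J) (fund_gen J f) (fund_inv J f) = Ident (fund_groupoid J) y"
proof -
  have f: "f \<in> Arr J" "Dom J f = x" "Cod J f = y" "x \<in> Obj J" "y \<in> Obj J"
    using HomD[OF assms(2)] Hom_objD[OF assms] by auto
  have 1: "((x, [(f, True), (f, False)], x), (x, [], x)) \<in> path_cong (fund_graph J) (fund_rels J)"
    by (rule path_cong.base) (use f in \<open>auto simp: fund_rels_def paths_def\<close>)
  have 2: "((y, [(f, False), (f, True)], y), (y, [], y)) \<in> path_cong (fund_graph J) (fund_rels J)"
    by (rule path_cong.base) (use f in \<open>auto simp: fund_rels_def paths_def\<close>)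
  show "Comp (fund_groupoid J) (fund_inv J f) (fund_gen J f) = Ident (fund_groupoid J) x"
    using presented_Comp[OF fund_rels_parallel[of J], of "fund_graph J" x "[(f, True)]" y "[(f, False)]" x] path_class_eqI[OF 1] f
    by (simp add: fund_gen_edge fund_inv_def edge_arr_def fund_groupoid_def presented_sel)
  show "Comp (fund_groupoid J) (fund_gen J f) (fund_inv J f) = Ident (fund_groupoid J) y"
    using presented_Comp[OF fund_rels_parallel[of J], of "fund_graph J" y "[(f, False)]" x "[(f, True)]" y] path_class_eqI[OF 2] f
    by (simp add: fund_gen_edge fund_inv_def edge_arr_def fund_groupoid_def presented_sel)
qed

text \<open>The edges \<open>(f, True)\<close> and \<open>(f, False)\<close> are mutually inverse by
  the last two kinds of relations, so every generator is invertible.\<close>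

lemma fund_groupoid_groupoid:
  assumes J: "is_category J"
  shows "is_groupoid (fund_groupoid J)"
  unfolding fund_groupoid_def
proof (rule presented_groupoid[OF fund_rels_parallel])
  fix e assume "e \<in> Edge (fund_graph J)"
  then obtain f b where e: "e = (f, b)" "f \<in> Arr J" by auto
  note h = fund_gen_Hom[OF J Arr_Hom[OF e(2)]] fund_inv_Hom[OF J Arr_Hom[OF e(2)]]
    fund_gen_inv[OF J Arr_Hom[OF e(2)]]
  show "is_isomorphism (presented_cat (fund_graph J) (fund_rels J)) (edge_arr (fund_graph J) (fund_rels J) e)"
  proof (cases b)
    case True
    then show ?thesis using is_isomorphismI[OF h(1) h(2) h(3) h(4)] by (simp add: e fund_gen_edge fund_groupoid_def)
  next
    case False
    then show ?thesis using is_isomorphismI[OF h(2) h(1) h(4) h(3)] by (simp add: e fund_inv_def fund_groupoid_def)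
  qed
qed

lemma fund_groupoid_Obj [simp]: "Obj (fund_groupoid J) = Obj J"
  by (simp add: fund_groupoid_def presented_sel)

lemma fund_gen_Ident:
  assumes J: "is_category J" "x \<in> Obj J"
  shows "fund_gen J (Ident J x) = Ident (fund_groupoid J) x"
proof -
  have "((x, [(Ident J x, True)], x), (x, [], x)) \<in> path_cong (fund_graph J) (fund_rels J)"
    by (rule path_cong.base) (use J cat_identD[OF J] in \<open>auto simp: fund_rels_def paths_def\<close>)
  from path_class_eqI[OF this] show ?thesis
    using cat_identD[OF J] by (simp add: fund_gen_edge edge_arr_def fund_groupoid_def presented_sel)
qed

lemma fund_gen_Comp:
  assumes J: "is_category J" and f: "f \<in> Hom J x y" and g: "g \<in> Hom J y z"
  shows "fund_gen J (Comp J g f) = Comp (fund_groupoid J) (fund_gen J g) (fund_gen J f)"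
proof -
  note h = HomD[OF f] HomD[OF g] HomD[OF cat_comp[OF J f g]] Hom_objD[OF J f] Hom_objD[OF J g]
  have "((x, [(f, True), (g, True)], z), (x, [(Comp J g f, True)], z)) \<in> path_cong (fund_graph J) (fund_rels J)"
    by (rule path_cong.base) (use h in \<open>auto simp: fund_rels_def paths_def\<close>)
  from path_class_eqI[OF this] show ?thesis
    using presented_Comp[OF fund_rels_parallel[of J], of "fund_graph J" x "[(f, True)]" y "[(g, True)]" z] h
    by (simp add: fund_gen_edge edge_arr_def fund_groupoid_def)
qed

lemma
  assumes F: "is_functor J J' F"
  shows fund_map_graph_map: "graph_map (fund_graph J) (fund_graph J') (FOb F) (\<lambda>(f, b). (FAr F f, b))"
    and fund_map_respects: "respects_rels (fund_graph J) (fund_rels J) (fund_graph J') (fund_rels J') (FOb F) (\<lambda>(f, b). (FAr F f, b))"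
proof -
  let ?pm = "path_map (FOb F) (\<lambda>(f, b). (FAr F f, b))"
  have F': "FAr F f \<in> Arr J'" "Dom J' (FAr F f) = FOb F (Dom J f)" "Cod J' (FAr F f) = FOb F (Cod J f)"
    if "f \<in> Arr J" for f
    using HomD[OF functor_hom[OF F Arr_Hom[OF that]]] by auto
  have Fc: "FAr F (Comp J g f) = Comp J' (FAr F g) (FAr F f)" if "f \<in> Arr J" "g \<in> Arr J" "Dom J g = Cod J f" for f g
    using functor_comp[OF F Arr_Hom[OF that(1)], of g "Cod J g"] that by (auto simp: Hom_def)
  show 1: "graph_map (fund_graph J) (fund_graph J') (FOb F) (\<lambda>(f, b). (FAr F f, b))"
    using F' functor_ob[OF F] by (auto simp: graph_map_def)
  \<comment> \<open>A functor carries each of the four kinds of relations to a relation of the same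
    kind.\<close>
  have "(?pm p, ?pm q) \<in> fund_rels J'" if "(p, q) \<in> fund_rels J" for p q
  proof -
    consider (c) f g where "p = (Dom J f, [(f, True), (g, True)], Cod J g)" "q = (Dom J f, [(Comp J g f, True)], Cod J g)"
        "f \<in> Arr J" "g \<in> Arr J" "Dom J g = Cod J f"
      | (i) x where "p = (x, [(Ident J x, True)], x)" "q = (x, [], x)" "x \<in> Obj J"
      | (l) f where "p = (Dom J f, [(f, True), (f, False)], Dom J f)" "q = (Dom J f, [], Dom J f)" "f \<in> Arr J"
      | (r) f where "p = (Cod J f, [(f, False), (f, True)], Cod J f)" "q = (Cod J f, [], Cod J f)" "f \<in> Arr J"
      using \<open>(p, q) \<in> fund_rels J\<close> unfolding fund_rels_def by blast
    then show ?thesis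
    proof cases
      case c
      then show ?thesis using F' Fc unfolding fund_rels_def
        by (intro UnI1 CollectI exI[of _ "FAr F f"] exI[of _ "FAr F g"]) (simp add: path_map_def)
    next
      case i
      then show ?thesis using functor_ob[OF F] functor_ident[OF F] unfolding fund_rels_def
        by (intro UnI1[OF UnI1] UnI2 CollectI exI[of _ "FOb F x"]) (simp add: path_map_def)
    next
      case l
      then show ?thesis using F' unfolding fund_rels_def
        by (intro UnI1[OF UnI2] CollectI exI[of _ "FAr F f"]) (simp add: path_map_def)
    next
      case r
      then show ?thesis using F' unfolding fund_rels_def
        by (intro UnI2 CollectI exI[of _ "FAr F f"]) (simp add: path_map_def)
    qed
  qed
  then show "respects_rels (fund_graph J) (fund_rels J) (fund_graph J') (fund_rels J') (FOb F) (\<lambda>(f, b). (FAr F f, b))"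
    unfolding respects_rels_def using path_map_paths[OF 1] by (blast intro: path_cong.base)
qed

lemma fund_map_functor:
  assumes F: "is_functor J J' F"
  shows "is_functor (fund_groupoid J) (fund_groupoid J') (fund_map J' F)"
  unfolding fund_groupoid_def
  by (rule path_map_functor[OF fund_map_graph_map[OF F] fund_map_respects[OF F] fund_rels_parallel fund_rels_parallel])
    (simp_all add: fund_map_def)

text \<open>Applied to \<open>under_map\<close>, this is what moves canonical arrows between the
  categories \<open>i/I\<close>.\<close>

lemma fund_map_gen:
  assumes F: "is_functor J J' F" and f: "f \<in> Arr J"
  shows "FAr (fund_map J' F) (fund_gen J f) = fund_gen J' (FAr F f)"
  using path_map_edge_arr[OF fund_map_graph_map[OF F] fund_map_respects[OF F], of "(f, True)"] f
    cat_dom[OF functor_category(1)[OF F]] cat_cod[OF functor_category(1)[OF F]]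
  by (simp add: fund_map_def fund_gen_edge)

section \<open>Products, coproducts, coequalizers\<close>

lemma prod_cat_groupoid:
  assumes "is_groupoid A" "is_groupoid B"
  shows "is_groupoid (prod_cat A B)"
  unfolding is_groupoid_def
proof (intro conjI ballI)
  have AB: "is_category A" "is_category B" using assms by (auto simp: is_groupoid_def)
  then show "is_category (prod_cat A B)"
    unfolding is_category_def by (auto simp: prod_cat_def Hom_def)
  fix f assume "f \<in> Arr (prod_cat A B)"
  then obtain a b where f: "f = (a, b)" "a \<in> Arr A" "b \<in> Arr B" by (auto simp: prod_cat_def)
  obtain a' where "a' \<in> Hom A (Cod A a) (Dom A a)" "Comp A a' a = Ident A (Dom A a)" "Comp A a a' = Ident A (Cod A a)"
    using groupoid_inverse[OF assms(1) Arr_Hom[OF f(2)]] by blast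
  moreover obtain b' where "b' \<in> Hom B (Cod B b) (Dom B b)" "Comp B b' b = Ident B (Dom B b)" "Comp B b b' = Ident B (Cod B b)"
    using groupoid_inverse[OF assms(2) Arr_Hom[OF f(3)]] by blast
  ultimately show "is_isomorphism (prod_cat A B) f"
    using f by (intro is_isomorphismI[of f _ "(Dom A a, Dom B b)" "(Cod A a, Cod B b)" "(a', b')"])
      (auto simp: prod_cat_def Hom_def)
qed

lemma coprod_cat_groupoid:
  assumes "\<And>k. k \<in> K \<Longrightarrow> is_groupoid (A k)"
  shows "is_groupoid (coprod_cat K A)"
  unfolding is_groupoid_def
proof (intro conjI ballI)
  have A: "is_category (A k)" if "k \<in> K" for k using assms that by (auto simp: is_groupoid_def)
  show "is_category (coprod_cat K A)"
    unfolding is_category_def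
    by (auto simp: coprod_cat_def Hom_def cat_dom[OF A] cat_cod[OF A] cat_identD[OF A] cat_compD[OF A]
      cat_unit_left[OF A Arr_Hom] cat_unit_right[OF A Arr_Hom] cat_assoc_Arr[OF A])
  fix f assume "f \<in> Arr (coprod_cat K A)"
  then obtain k a where f: "f = (k, a)" "k \<in> K" "a \<in> Arr (A k)" by (auto simp: coprod_cat_def)
  obtain a' where "a' \<in> Hom (A k) (Cod (A k) a) (Dom (A k) a)" "Comp (A k) a' a = Ident (A k) (Dom (A k) a)" "Comp (A k) a a' = Ident (A k) (Cod (A k) a)"
    using groupoid_inverse[OF assms[OF f(2)] Arr_Hom[OF f(3)]] by blast
  then show "is_isomorphism (coprod_cat K A) f"
    using f by (intro is_isomorphismI[of f _ "(k, Dom (A k) a)" "(k, Cod (A k) a)" "(k, a')"])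
      (auto simp: coprod_cat_def Hom_def)
qed

lemma coeq_rels_parallel: "parallel_rels (coeq_rels A B F G)"
  by (auto simp: parallel_rels_def coeq_rels_def Let_def)

lemma coeq_graph_sel:
  "Vert (coeq_graph A B F G) = coeq_class A B F G ` Obj B" "Edge (coeq_graph A B F G) = Arr B"
  "Src (coeq_graph A B F G) f = coeq_class A B F G (Dom B f)"
  "Tgt (coeq_graph A B F G) f = coeq_class A B F G (Cod B f)"
  by (auto simp: coeq_graph_def)

lemma coequalizer_gen_Hom:
  assumes "is_category B" "f \<in> Hom B x y"
  shows "edge_arr (coeq_graph A B F G) (coeq_rels A B F G) f \<in>
    Hom (coequalizer A B F G) (coeq_class A B F G x) (coeq_class A B F G y)"
  unfolding coequalizer_def
  using edge_arr_Hom[OF coeq_rels_parallel[of A B F G], where e = f and G = "coeq_graph A B F G"] Hom_objD[OF assms] HomD[OF assms(2)]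
  by (auto simp: coeq_graph_sel)

lemma coequalizer_gen_Comp:
  assumes B: "is_category B" and f: "f \<in> Hom B x y" and g: "g \<in> Hom B y z"
  shows "edge_arr (coeq_graph A B F G) (coeq_rels A B F G) (Comp B g f) =
    Comp (coequalizer A B F G) (edge_arr (coeq_graph A B F G) (coeq_rels A B F G) g) (edge_arr (coeq_graph A B F G) (coeq_rels A B F G) f)"
proof -
  note h = HomD[OF f] HomD[OF g] HomD[OF cat_comp[OF B f g]] Hom_objD[OF B f] Hom_objD[OF B g]
  let ?c = "coeq_class A B F G"
  have "((?c x, [f, g], ?c z), (?c x, [Comp B g f], ?c z)) \<in> path_cong (coeq_graph A B F G) (coeq_rels A B F G)"
    by (rule path_cong.base) (use h in \<open>auto simp: coeq_rels_def Let_def paths_def coeq_graph_sel\<close>)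
  from path_class_eqI[OF this] show ?thesis
    using presented_Comp[OF coeq_rels_parallel[of A B F G], of "coeq_graph A B F G" "?c x" "[f]" "?c y" "[g]" "?c z"] h
    by (simp add: edge_arr_def coequalizer_def coeq_graph_sel)
qed

lemma coequalizer_gen_Ident:
  assumes B: "is_category B" and x: "x \<in> Obj B"
  shows "edge_arr (coeq_graph A B F G) (coeq_rels A B F G) (Ident B x) = Ident (coequalizer A B F G) (coeq_class A B F G x)"
proof -
  let ?c = "coeq_class A B F G"
  have "((?c x, [Ident B x], ?c x), (?c x, [], ?c x)) \<in> path_cong (coeq_graph A B F G) (coeq_rels A B F G)"
    by (rule path_cong.base) (use x cat_identD[OF B x] in \<open>auto simp: coeq_rels_def Let_def paths_def coeq_graph_sel\<close>)
  from path_class_eqI[OF this] show ?thesis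
    using cat_identD[OF B x] by (simp add: edge_arr_def coequalizer_def coeq_graph_sel presented_sel)
qed

text \<open>The defining relation writes both edges between the classes of the endpoints of
  \<open>F a\<close>. The last two assumptions identify these with the classes of the endpoints of
  \<open>G a\<close>, so that the edge \<open>G a\<close> is a path between them.\<close>

lemma coequalizer_gen_eq:
  assumes a: "a \<in> Arr A" and "FAr F a \<in> Hom B (FOb F (Dom A a)) (FOb F (Cod A a))" "FAr G a \<in> Hom B (FOb G (Dom A a)) (FOb G (Cod A a))"
    and B: "is_category B"
    and c: "coeq_class A B F G (FOb F (Dom A a)) = coeq_class A B F G (FOb G (Dom A a))"
      "coeq_class A B F G (FOb F (Cod A a)) = coeq_class A B F G (FOb G (Cod A a))"
  shows "edge_arr (coeq_graph A B F G) (coeq_rels A B F G) (FAr F a) = edge_arr (coeq_graph A B F G) (coeq_rels A B F G) (FAr G a)"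
proof -
  let ?c = "coeq_class A B F G"
  note h = HomD[OF assms(2)] HomD[OF assms(3)] Hom_objD[OF B assms(2)] Hom_objD[OF B assms(3)]
  have "((?c (FOb F (Dom A a)), [FAr F a], ?c (FOb F (Cod A a))), (?c (FOb F (Dom A a)), [FAr G a], ?c (FOb F (Cod A a))))
     \<in> path_cong (coeq_graph A B F G) (coeq_rels A B F G)"
    by (rule path_cong.base) (use a h c in \<open>auto simp: coeq_rels_def Let_def paths_def coeq_graph_sel\<close>)
  from path_class_eqI[OF this] show ?thesis
    using h c by (simp add: edge_arr_def coeq_graph_sel)
qed

text \<open>The inverse of an arrow in \<open>B\<close> remains inverse to it in the coequalizer, by
  the relations for composites and identities, and the arrows of \<open>B\<close> generate.\<close>

lemma coequalizer_groupoid: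
  assumes "is_groupoid B"
  shows "is_groupoid (coequalizer A B F G)"
  unfolding coequalizer_def
proof (rule presented_groupoid[OF coeq_rels_parallel])
  note B = groupoid_category[OF assms]
  fix e assume "e \<in> Edge (coeq_graph A B F G)"
  then have e: "e \<in> Hom B (Dom B e) (Cod B e)" by (auto simp: coeq_graph_sel Hom_def)
  obtain e' where e': "e' \<in> Hom B (Cod B e) (Dom B e)" "Comp B e' e = Ident B (Dom B e)" "Comp B e e' = Ident B (Cod B e)"
    using groupoid_inverse[OF assms e] by blast
  have o: "Dom B e \<in> Obj B" "Cod B e \<in> Obj B" using Hom_objD[OF B e] by auto
  show "is_isomorphism (presented_cat (coeq_graph A B F G) (coeq_rels A B F G)) (edge_arr (coeq_graph A B F G) (coeq_rels A B F G) e)"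
    unfolding coequalizer_def[symmetric]
    by (rule is_isomorphismI[OF coequalizer_gen_Hom[OF B e] coequalizer_gen_Hom[OF B e'(1)]])
      (simp_all add: coequalizer_gen_Comp[OF B e e'(1), symmetric] coequalizer_gen_Comp[OF B e'(1) e, symmetric] e'
        coequalizer_gen_Ident[OF B] o)
qed

section \<open>Homotopy colimits of groupoids: objects, generating arrows, actions,
  functoriality\<close>

section \<open>Homotopy colimits of groupoids\<close>

lemma ftr_agree_ob: "ftr_agree A F G \<Longrightarrow> x \<in> Obj A \<Longrightarrow> FOb F x = FOb G x"
  and ftr_agree_ar: "ftr_agree A F G \<Longrightarrow> f \<in> Arr A \<Longrightarrow> FAr F f = FAr G f"
  by (auto simp: ftr_agree_def)

lemma under_cat_Obj: "\<psi> \<in> Obj (under_cat I i) \<longleftrightarrow> \<psi> \<in> Arr I \<and> Dom I \<psi> = i"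
  by (simp add: under_cat_def)

lemma under_cat_Hom:
  "f \<in> Hom (under_cat I i) \<psi> \<chi> \<longleftrightarrow>
    (\<exists>k. f = (\<psi>, \<chi>, k) \<and> \<psi> \<in> Arr I \<and> Dom I \<psi> = i \<and> k \<in> Hom I (Cod I \<psi>) (Cod I \<chi>) \<and> Comp I k \<psi> = \<chi> \<and> \<chi> \<in> Arr I \<and> Dom I \<chi> = i)"
  by (auto simp: under_cat_def Hom_def)

lemma under_cat_Comp: "Comp (under_cat I i) (\<psi>', \<chi>', l) (\<psi>, \<chi>, k) = (\<psi>, \<chi>', Comp I l k)"
  and under_cat_Ident: "Ident (under_cat I i) \<psi> = (\<psi>, \<psi>, Ident I (Cod I \<psi>))"
  by (simp_all add: under_cat_def)

lemma under_cat_category: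
  assumes I: "is_category I"
  shows "is_category (under_cat I i)" (is "is_category ?U")
proof (rule is_categoryI)
  show "Dom ?U f \<in> Obj ?U \<and> Cod ?U f \<in> Obj ?U"
    if "f \<in> Arr ?U" for f using that by (auto simp: under_cat_def)
  show "Ident ?U x \<in> Hom ?U x x" if "x \<in> Obj ?U" for x
    using that cat_ident[OF I cat_cod[OF I]] cat_unit_left[OF I Arr_Hom]
    by (simp add: under_cat_Obj under_cat_Hom under_cat_Ident)
  show "Comp ?U g f \<in> Hom ?U x z"
    if f: "f \<in> Hom ?U x y" and g: "g \<in> Hom ?U y z" for f g x y z
  proof -
    from f g obtain k l where *: "f = (x, y, k)" "g = (y, z, l)" "x \<in> Arr I" "Dom I x = i" "z \<in> Arr I" "Dom I z = i"
      "k \<in> Hom I (Cod I x) (Cod I y)" "Comp I k x = y" "l \<in> Hom I (Cod I y) (Cod I z)" "Comp I l y = z"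
      unfolding under_cat_Hom by blast
    have "Comp I (Comp I l k) x = z"
      using cat_assoc[OF I Arr_Hom[OF *(3)] *(7) *(9)] * by simp
    then show ?thesis using cat_comp[OF I *(7) *(9)] * by (simp add: under_cat_Hom under_cat_Comp)
  qed
  show "Comp ?U f (Ident ?U x) = f" "Comp ?U (Ident ?U y) f = f"
    if "f \<in> Hom ?U x y" for f x y
    using that cat_unit_left[OF I] cat_unit_right[OF I]
    unfolding under_cat_Hom by (auto simp: under_cat_Comp under_cat_Ident)
  show "Comp ?U h (Comp ?U g f) = Comp ?U (Comp ?U h g) f"
    if f: "f \<in> Hom ?U x y" and g: "g \<in> Hom ?U y z" and h: "h \<in> Hom ?U z w"
    for f g h x y z w
  proof -
    from f g h obtain k l m where *: "f = (x, y, k)" "g = (y, z, l)" "h = (z, w, m)"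
      "k \<in> Hom I (Cod I x) (Cod I y)" "l \<in> Hom I (Cod I y) (Cod I z)" "m \<in> Hom I (Cod I z) (Cod I w)"
      unfolding under_cat_Hom by blast
    then show ?thesis using cat_assoc[OF I *(4-6)] by (simp add: under_cat_Comp)
  qed
qed

lemma under_map_functor:
  assumes I: "is_category I" and \<phi>: "\<phi> \<in> Hom I i j"
  shows "is_functor (under_cat I j) (under_cat I i) (under_map I \<phi>)"
proof (rule is_functorI[OF under_cat_category[OF I] under_cat_category[OF I]])
  have S: "Comp I x \<phi> \<in> Arr I" "Dom I (Comp I x \<phi>) = i" "Cod I (Comp I x \<phi>) = Cod I x"
    if "x \<in> Arr I" "Dom I x = j" for x
    using cat_compD[OF I _ that(1), of \<phi>] HomD[OF \<phi>] that by auto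
  show "FOb (under_map I \<phi>) x \<in> Obj (under_cat I i)" if "x \<in> Obj (under_cat I j)" for x
    using that S by (simp add: under_cat_Obj under_map_def)
  show "FAr (under_map I \<phi>) f \<in> Hom (under_cat I i) (FOb (under_map I \<phi>) x) (FOb (under_map I \<phi>) y)"
    if f: "f \<in> Hom (under_cat I j) x y" for f x y
  proof -
    from f obtain k where *: "f = (x, y, k)" "x \<in> Arr I" "Dom I x = j" "y \<in> Arr I" "Dom I y = j"
      "k \<in> Hom I (Cod I x) (Cod I y)" "Comp I k x = y" unfolding under_cat_Hom by blast
    have "Comp I k (Comp I x \<phi>) = Comp I y \<phi>"
      using cat_assoc[OF I \<phi> HomI[OF *(2,3) HOL.refl] *(6)] * by simp
    then show ?thesis using S[OF *(2,3)] S[OF *(4,5)] * by (simp add: under_cat_Hom under_map_def)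
  qed
  show "FAr (under_map I \<phi>) (Ident (under_cat I j) x) = Ident (under_cat I i) (FOb (under_map I \<phi>) x)"
    if "x \<in> Obj (under_cat I j)" for x
    using that S by (simp add: under_cat_Obj under_cat_Ident under_map_def)
  show "FAr (under_map I \<phi>) (Comp (under_cat I j) g f) = Comp (under_cat I i) (FAr (under_map I \<phi>) g) (FAr (under_map I \<phi>) f)"
    if "f \<in> Hom (under_cat I j) x y" "g \<in> Hom (under_cat I j) y z" for f g x y z
  proof -
    from that obtain k l where "f = (x, y, k)" "g = (y, z, l)" unfolding under_cat_Hom by blast
    then show ?thesis by (simp add: under_cat_Comp under_map_def)
  qed
qed

locale hc_diagram =
  fixes I :: "('i, 'j) cat" and G :: "'i \<Rightarrow> ('o, 'g) cat" and T :: "'j \<Rightarrow> ('o, 'g, 'o, 'g) ftr"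
  assumes I: "is_category I"
    and G_groupoid: "\<And>i. i \<in> Obj I \<Longrightarrow> is_groupoid (G i)"
    and T_functor: "\<And>\<phi>. \<phi> \<in> Arr I \<Longrightarrow> is_functor (G (Dom I \<phi>)) (G (Cod I \<phi>)) (T \<phi>)"
    and T_Ident: "\<And>i. i \<in> Obj I \<Longrightarrow> ftr_agree (G i) (T (Ident I i)) ftr_id"
    and T_Comp: "\<And>\<phi> \<psi>. \<phi> \<in> Arr I \<Longrightarrow> \<psi> \<in> Arr I \<Longrightarrow> Dom I \<psi> = Cod I \<phi> \<Longrightarrow>
      ftr_agree (G (Dom I \<phi>)) (T (Comp I \<psi> \<phi>)) (ftr_comp (T \<psi>) (T \<phi>))"
begin

abbreviation "M \<equiv> hocolim I G T"
abbreviation "E \<equiv> hc_target I G"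
abbreviation leg1 :: "(('j, 'j, 'o) hc_ob, ('j, 'j, 'g) hc_edge, ('i, 'j, 'o) hc_ob, ('i, 'j, 'g) hc_edge) ftr"
  where "leg1 \<equiv> hc_leg1 I"
abbreviation "cl \<equiv> hc_ob_class I G T"
abbreviation "gen \<equiv> hc_gen I G T"
abbreviation "pi i \<equiv> fund_groupoid (under_cat I i)"

definition hob :: "'i \<Rightarrow> 'o \<Rightarrow> ('i, 'j, 'o) hc_ob set" where
  "hob i x = cl (i, x, Ident I i)"

definition hinc :: "'i \<Rightarrow> 'g \<Rightarrow> ('i, 'j, 'o, 'g) hc_arr" where
  "hinc i g = gen (i, g, Ident (pi i) (Ident I i))"

text \<open>The canonical arrow from \<open>x\<close> to its image under \<open>\<phi>\<close>: the
  component in the fundamental groupoid is the arrow of \<open>i/I\<close> from the identity of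
  \<open>i\<close> to \<open>\<phi>\<close>, whose underlying arrow of \<open>I\<close> is
  \<open>\<phi>\<close> again.\<close>

definition hcan :: "'j \<Rightarrow> 'o \<Rightarrow> ('i, 'j, 'o, 'g) hc_arr" where
  "hcan \<phi> x = gen (Dom I \<phi>, Ident (G (Dom I \<phi>)) x, fund_gen (under_cat I (Dom I \<phi>)) (Ident I (Dom I \<phi>), \<phi>, \<phi>))"

lemma G_category: "i \<in> Obj I \<Longrightarrow> is_category (G i)"
  using G_groupoid groupoid_category by blast

lemma T_ob: "\<phi> \<in> Hom I i j \<Longrightarrow> x \<in> Obj (G i) \<Longrightarrow> FOb (T \<phi>) x \<in> Obj (G j)"
  using functor_ob[OF T_functor] by (auto simp: Hom_def)

lemma T_hom: "\<phi> \<in> Hom I i j \<Longrightarrow> g \<in> Hom (G i) x y \<Longrightarrow> FAr (T \<phi>) g \<in> Hom (G j) (FOb (T \<phi>) x) (FOb (T \<phi>) y)"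
  using functor_hom[OF T_functor] by (auto simp: Hom_def)

lemma T_Ident_ob: "i \<in> Obj I \<Longrightarrow> x \<in> Obj (G i) \<Longrightarrow> FOb (T (Ident I i)) x = x"
  using ftr_agree_ob[OF T_Ident] by (simp add: ftr_id_def)

lemma T_Comp_ob: "\<phi> \<in> Hom I i j \<Longrightarrow> \<psi> \<in> Hom I j k \<Longrightarrow> x \<in> Obj (G i) \<Longrightarrow>
    FOb (T (Comp I \<psi> \<phi>)) x = FOb (T \<psi>) (FOb (T \<phi>) x)"
  using ftr_agree_ob[OF T_Comp] by (simp add: ftr_comp_def Hom_def)

lemma T_identity: "\<phi> \<in> Hom I i j \<Longrightarrow> x \<in> Obj (G i) \<Longrightarrow> FAr (T \<phi>) (Ident (G i) x) = Ident (G j) (FOb (T \<phi>) x)"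
  using functor_ident[OF T_functor] by (auto simp: Hom_def)

lemma E_groupoid: "is_groupoid E"
  unfolding hc_target_def
  by (intro coprod_cat_groupoid prod_cat_groupoid G_groupoid fund_groupoid_groupoid under_cat_category I)

lemma E_category: "is_category E"
  by (rule groupoid_category[OF E_groupoid])

lemma M_groupoid: "is_groupoid M"
  unfolding hocolim_def by (rule coequalizer_groupoid[OF E_groupoid])

lemma M_category: "is_category M"
  by (rule groupoid_category[OF M_groupoid])

lemma E_Obj: "(i, x, \<psi>) \<in> Obj E \<longleftrightarrow> i \<in> Obj I \<and> x \<in> Obj (G i) \<and> \<psi> \<in> Arr I \<and> Dom I \<psi> = i"
  by (auto simp: hc_target_def coprod_cat_def prod_cat_def under_cat_Obj)

lemma E_Hom: "(i, g, p) \<in> Hom E (i1, x, \<psi>) (i2, y, \<chi>) \<longleftrightarrow>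
   i1 = i \<and> i2 = i \<and> i \<in> Obj I \<and> g \<in> Hom (G i) x y \<and> p \<in> Hom (pi i) \<psi> \<chi>"
  by (auto simp: hc_target_def coprod_cat_def prod_cat_def Hom_def)

lemma E_HomE:
  assumes "e \<in> Arr E"
  obtains i g p x y \<psi> \<chi> where "e = (i, g, p)" "i \<in> Obj I" "g \<in> Hom (G i) x y" "p \<in> Hom (pi i) \<psi> \<chi>"
    "Dom E e = (i, x, \<psi>)" "Cod E e = (i, y, \<chi>)"
  using assms by (auto simp: hc_target_def coprod_cat_def prod_cat_def Hom_def)

lemma E_Comp: "Comp E (i, g', p') (i, g, p) = (i, Comp (G i) g' g, Comp (pi i) p' p)"
  and E_Ident: "Ident E (i, x, \<psi>) = (i, Ident (G i) x, Ident (pi i) \<psi>)"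
  by (auto simp: hc_target_def coprod_cat_def prod_cat_def)

text \<open>The relation identifies \<open>(i, x, \<psi>)\<close> with \<open>(cod \<psi>, \<psi> x, id)\<close>, so this normal form is a complete
  invariant of the classes.\<close>

definition hnf :: "('i, 'j, 'o) hc_ob \<Rightarrow> 'i \<times> 'o" where
  "hnf = (\<lambda>(i, x, \<psi>). (Cod I \<psi>, FOb (T \<psi>) x))"

text \<open>The normal form is constant along the generating relation, so it separates classes. Each
  triple is one step away from its normal form, so two triples with the same normal form are joined
  by two steps.\<close>

lemma cl_eq:
  assumes e: "e \<in> Obj E"
  shows "cl e = {e' \<in> Obj E. hnf e' = hnf e}"
proof -
  define r where "r = {(FOb leg1 a, FOb (hc_leg2 I T) a) | a. a \<in> Obj (hc_source I G)}"
  have r: "(e, e') \<in> r \<longleftrightarrow> (\<exists>\<phi> x \<psi>. e = (Dom I \<phi>, x, Comp I \<psi> \<phi>) \<and> e' = (Cod I \<phi>, FOb (T \<phi>) x, \<psi>) \<and>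
      \<phi> \<in> Arr I \<and> x \<in> Obj (G (Dom I \<phi>)) \<and> \<psi> \<in> Arr I \<and> Dom I \<psi> = Cod I \<phi>)" for e e'
    by (auto simp: r_def hc_source_def coprod_cat_def prod_cat_def under_cat_Obj hc_leg1_def hc_leg2_def under_map_def)
  have 1: "hnf e = hnf e'" if "(e, e') \<in> r" for e e'
    using that cat_compD[OF I] T_Comp_ob[OF HomI HomI] by (auto simp: r hnf_def)
  have 2: "hnf e = hnf e'" if "(e, e') \<in> (r \<union> r\<inverse>)\<^sup>*" for e e'
    using that by (induction rule: rtrancl_induct) (auto dest: 1)
  \<comment> \<open>The generating pair for the arrow \<open>\<psi>\<close>, with the identity of
    \<open>Cod I \<psi>\<close> as object of the under category, leads from
    \<open>(i, x, \<psi>)\<close> to its normal form.\<close>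
  have 3: "(e, (fst (hnf e), snd (hnf e), Ident I (fst (hnf e)))) \<in> r" if "e \<in> Obj E" for e
  proof -
    obtain i x \<psi> where e: "e = (i, x, \<psi>)" by (cases e)
    with that have a: "i \<in> Obj I" "x \<in> Obj (G i)" "\<psi> \<in> Arr I" "Dom I \<psi> = i" by (auto simp: E_Obj)
    show ?thesis unfolding r
      using a cat_unit_left[OF I Arr_Hom[OF a(3)]] cat_identD[OF I cat_cod[OF I a(3)]]
      by (intro exI[of _ \<psi>] exI[of _ x] exI[of _ "Ident I (Cod I \<psi>)"]) (auto simp: e hnf_def)
  qed
  have "(e, e') \<in> (r \<union> r\<inverse>)\<^sup>*" if "e' \<in> Obj E" "hnf e' = hnf e" for e'
  proof -
    let ?n = "(fst (hnf e), snd (hnf e), Ident I (fst (hnf e)))"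
    have "(e, ?n) \<in> r \<union> r\<inverse>" "(?n, e') \<in> r \<union> r\<inverse>" using 3[OF e] 3[OF that(1)] that(2) by auto
    then show ?thesis by (meson r_into_rtrancl rtrancl_trans)
  qed
  then have "{y \<in> Obj E. (e, y) \<in> (r \<union> r\<inverse>)\<^sup>*} = {e' \<in> Obj E. hnf e' = hnf e}"
    by (intro Collect_cong) (metis 2)
  then show ?thesis
    unfolding hc_ob_class_def coeq_class_def Let_def r_def .
qed

lemma cl_eq_iff: "e \<in> Obj E \<Longrightarrow> e' \<in> Obj E \<Longrightarrow> cl e = cl e' \<longleftrightarrow> hnf e = hnf e'"
  using cl_eq by auto

lemma hnf_Ident: "i \<in> Obj I \<Longrightarrow> x \<in> Obj (G i) \<Longrightarrow> hnf (i, x, Ident I i) = (i, x)"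
  by (simp add: hnf_def cat_identD[OF I] T_Ident_ob)

lemma hob_E: "i \<in> Obj I \<Longrightarrow> x \<in> Obj (G i) \<Longrightarrow> (i, x, Ident I i) \<in> Obj E"
  by (simp add: E_Obj cat_identD[OF I])

lemma cl_hob:
  assumes "i \<in> Obj I" "x \<in> Obj (G i)" "\<psi> \<in> Hom I i j"
  shows "cl (i, x, \<psi>) = hob j (FOb (T \<psi>) x)"
proof -
  have j: "j \<in> Obj I" "FOb (T \<psi>) x \<in> Obj (G j)" using assms Hom_objD[OF I assms(3)] T_ob by auto
  then show ?thesis unfolding hob_def
    using cl_eq_iff[of "(i, x, \<psi>)" "(j, FOb (T \<psi>) x, Ident I j)"] assms hob_E[OF j] hnf_Ident[OF j]
    by (auto simp: E_Obj hnf_def Hom_def)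
qed

lemma M_Obj: "Obj M = {hob i x | i x. i \<in> Obj I \<and> x \<in> Obj (G i)}"
proof -
  have "Obj M = cl ` Obj E"
    by (simp add: hocolim_def coequalizer_def presented_sel coeq_graph_sel hc_ob_class_def)
  moreover have "cl e \<in> {hob i x | i x. i \<in> Obj I \<and> x \<in> Obj (G i)}" if "e \<in> Obj E" for e
  proof -
    obtain i x \<psi> where e: "e = (i, x, \<psi>)" by (cases e)
    with that have a: "i \<in> Obj I" "x \<in> Obj (G i)" "\<psi> \<in> Hom I i (Cod I \<psi>)" by (auto simp: E_Obj Hom_def)
    show ?thesis unfolding e cl_hob[OF a] using T_ob[OF a(3,2)] Hom_objD[OF I a(3)] by auto
  qed
  ultimately show ?thesis using hob_E by (auto simp: hob_def)
qed

lemma hob_Obj: "i \<in> Obj I \<Longrightarrow> x \<in> Obj (G i) \<Longrightarrow> hob i x \<in> Obj M"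
  by (auto simp: M_Obj)

text \<open>A retraction of \<open>hob\<close>, independent of the choice because \<open>hnf\<close>
  is constant on classes. It allows data over the homotopy colimit to be prescribed object by object
  from data over the \<open>G i\<close>.\<close>

definition hrep :: "('i, 'j, 'o) hc_ob set \<Rightarrow> 'i \<times> 'o" where
  "hrep c = hnf (SOME e. e \<in> c)"

lemma hrep_cl: "e \<in> Obj E \<Longrightarrow> hrep (cl e) = hnf e"
  unfolding hrep_def using someI[of "\<lambda>e'. e' \<in> cl e" e] cl_eq[of e] by auto

lemma hrep_hob: "i \<in> Obj I \<Longrightarrow> x \<in> Obj (G i) \<Longrightarrow> hrep (hob i x) = (i, x)"
  using hrep_cl[OF hob_E] by (simp add: hob_def hnf_Ident)

lemma gen_edge_arr:
  "gen e = edge_arr (coeq_graph (hc_source I G) E (hc_leg1 I) (hc_leg2 I T)) (coeq_rels (hc_source I G) E (hc_leg1 I) (hc_leg2 I T)) e"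
  by (simp add: hc_gen_def edge_arr_def path_class_def hc_cong_def hc_ob_class_def coeq_graph_sel)

lemma gen_Hom: "e \<in> Hom E a b \<Longrightarrow> gen e \<in> Hom M (cl a) (cl b)"
  unfolding gen_edge_arr hocolim_def hc_ob_class_def by (rule coequalizer_gen_Hom[OF E_category])

lemma gen_Comp: "e \<in> Hom E a b \<Longrightarrow> e' \<in> Hom E b c \<Longrightarrow> gen (Comp E e' e) = Comp M (gen e') (gen e)"
  unfolding gen_edge_arr hocolim_def by (rule coequalizer_gen_Comp[OF E_category])

lemma gen_Ident: "a \<in> Obj E \<Longrightarrow> gen (Ident E a) = Ident M (cl a)"
  unfolding gen_edge_arr hocolim_def hc_ob_class_def by (rule coequalizer_gen_Ident[OF E_category])

text \<open>This is the coequalizer relation for arrows. Its two sides have the same endpoints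
  because \<open>T\<close> turns the composite of \<open>\<psi>\<close> and \<open>\<phi>\<close>
  into the composite of the two functors.\<close>

lemma gen_eq:
  assumes \<phi>: "\<phi> \<in> Hom I i j" and g: "g \<in> Hom (G i) x y" and p: "p \<in> Hom (pi j) \<psi> \<chi>"
  shows "gen (i, g, FAr (fund_map (under_cat I i) (under_map I \<phi>)) p) = gen (j, FAr (T \<phi>) g, p)"
proof -
  let ?a = "(\<phi>, g, p)"
  have ij: "i \<in> Obj I" "j \<in> Obj I" "\<phi> \<in> Arr I" "Dom I \<phi> = i" "Cod I \<phi> = j" using Hom_objD[OF I \<phi>] HomD[OF \<phi>] by auto
  have xy: "x \<in> Obj (G i)" "y \<in> Obj (G i)" using Hom_objD[OF G_category[OF ij(1)] g] by auto
  have pi: "is_category (pi j)" by (rule groupoid_category[OF fund_groupoid_groupoid[OF under_cat_category[OF I]]])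
  have pc: "\<psi> \<in> Hom I j (Cod I \<psi>)" "\<chi> \<in> Hom I j (Cod I \<chi>)"
    using Hom_objD[OF pi p] by (auto simp: under_cat_Obj Hom_def)
  have um: "FAr (fund_map (under_cat I i) (under_map I \<phi>)) p \<in> Hom (pi i) (Comp I \<psi> \<phi>) (Comp I \<chi> \<phi>)"
    using functor_hom[OF fund_map_functor[OF under_map_functor[OF I \<phi>]] p] by (simp add: fund_map_def under_map_def)
  have a: "?a \<in> Arr (hc_source I G)" "Dom (hc_source I G) ?a = (\<phi>, x, \<psi>)" "Cod (hc_source I G) ?a = (\<phi>, y, \<chi>)"
    using ij HomD[OF g] HomD[OF p] by (auto simp: hc_source_def coprod_cat_def prod_cat_def)
  have l1: "FAr leg1 ?a = (i, g, FAr (fund_map (under_cat I i) (under_map I \<phi>)) p)"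
      "FOb leg1 (\<phi>, x, \<psi>) = (i, x, Comp I \<psi> \<phi>)" "FOb leg1 (\<phi>, y, \<chi>) = (i, y, Comp I \<chi> \<phi>)"
      "FAr (hc_leg2 I T) ?a = (j, FAr (T \<phi>) g, p)"
      "FOb (hc_leg2 I T) (\<phi>, x, \<psi>) = (j, FOb (T \<phi>) x, \<psi>)" "FOb (hc_leg2 I T) (\<phi>, y, \<chi>) = (j, FOb (T \<phi>) y, \<chi>)"
    using ij by (auto simp: hc_leg1_def hc_leg2_def under_map_def)
  have cls: "cl (i, x, Comp I \<psi> \<phi>) = cl (j, FOb (T \<phi>) x, \<psi>)" "cl (i, y, Comp I \<chi> \<phi>) = cl (j, FOb (T \<phi>) y, \<chi>)"
    using cl_hob[OF ij(1) xy(1) cat_comp[OF I \<phi> pc(1)]] cl_hob[OF ij(2) T_ob[OF \<phi> xy(1)] pc(1)]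
      cl_hob[OF ij(1) xy(2) cat_comp[OF I \<phi> pc(2)]] cl_hob[OF ij(2) T_ob[OF \<phi> xy(2)] pc(2)]
      T_Comp_ob[OF \<phi> pc(1) xy(1)] T_Comp_ob[OF \<phi> pc(2) xy(2)] by simp_all
  show ?thesis
    unfolding gen_edge_arr l1(1,4)[symmetric]
    by (rule coequalizer_gen_eq[OF a(1) _ _ E_category])
      (use a l1 cls um ij g p T_hom[OF \<phi> g] in \<open>auto simp: E_Hom hc_ob_class_def\<close>)
qed

lemma pi_category: "is_category (pi i)"
  by (rule groupoid_category[OF fund_groupoid_groupoid[OF under_cat_category[OF I]]])

lemma pi_Ident_Hom: "\<psi> \<in> Hom I i j \<Longrightarrow> Ident (pi i) \<psi> \<in> Hom (pi i) \<psi> \<psi>"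
  using cat_ident[OF pi_category, of \<psi> i] HomD[of \<psi> I i j] by (simp add: under_cat_Obj)

lemma hinc_Hom:
  assumes "i \<in> Obj I" "g \<in> Hom (G i) x y"
  shows "hinc i g \<in> Hom M (hob i x) (hob i y)"
  unfolding hinc_def hob_def
  by (rule gen_Hom) (use assms pi_Ident_Hom[OF cat_ident[OF I assms(1)]] in \<open>simp add: E_Hom\<close>)

lemma hinc_Comp:
  assumes i: "i \<in> Obj I" and g: "g \<in> Hom (G i) x y" and g': "g' \<in> Hom (G i) y z"
  shows "hinc i (Comp (G i) g' g) = Comp M (hinc i g') (hinc i g)"
proof -
  let ?p = "Ident (pi i) (Ident I i)"
  have p: "?p \<in> Hom (pi i) (Ident I i) (Ident I i)" using pi_Ident_Hom[OF cat_ident[OF I i]] .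
  show ?thesis unfolding hinc_def
    using gen_Comp[of "(i, g, ?p)" "(i, x, Ident I i)" "(i, y, Ident I i)" "(i, g', ?p)" "(i, z, Ident I i)"]
      assms p cat_unit_left[OF pi_category p] by (simp add: E_Hom E_Comp)
qed

lemma hinc_Ident: "i \<in> Obj I \<Longrightarrow> x \<in> Obj (G i) \<Longrightarrow> hinc i (Ident (G i) x) = Ident M (hob i x)"
  using gen_Ident[OF hob_E] by (simp add: hinc_def hob_def E_Ident)

lemma under_arr: "\<phi> \<in> Hom I i j \<Longrightarrow> k \<in> Hom I j l \<Longrightarrow> (\<phi>, Comp I k \<phi>, k) \<in> Hom (under_cat I i) \<phi> (Comp I k \<phi>)"
  using HomD[OF cat_comp[OF I]] HomD[of \<phi> I i j] HomD[of k I j l] by (simp add: under_cat_Hom)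

lemma under_arr_id: "\<phi> \<in> Hom I i j \<Longrightarrow> (Ident I i, \<phi>, \<phi>) \<in> Hom (under_cat I i) (Ident I i) \<phi>"
  using under_arr[OF cat_ident[OF I], of i \<phi> j] Hom_objD[OF I] cat_unit_right[OF I] by fastforce

text \<open>The arrow of \<open>i/I\<close> from \<open>\<phi>\<close> to its composite with
  \<open>k\<close> is the image, under the functor from \<open>j/I\<close> to \<open>i/I\<close>, of
  the arrow from the identity to \<open>k\<close>. The coequalizer relation therefore moves this
  generator from \<open>i\<close> to \<open>j\<close>, where it is canonical.\<close>

lemma gen_can:
  assumes \<phi>: "\<phi> \<in> Hom I i j" and k: "k \<in> Hom I j l" and x: "x \<in> Obj (G i)"
  shows "gen (i, Ident (G i) x, fund_gen (under_cat I i) (\<phi>, Comp I k \<phi>, k)) = hcan k (FOb (T \<phi>) x)"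
proof -
  have i: "i \<in> Obj I" "j \<in> Obj I" using Hom_objD[OF I \<phi>] by auto
  have "gen (i, Ident (G i) x, FAr (fund_map (under_cat I i) (under_map I \<phi>)) (fund_gen (under_cat I j) (Ident I j, k, k))) =
     gen (j, FAr (T \<phi>) (Ident (G i) x), fund_gen (under_cat I j) (Ident I j, k, k))"
    by (rule gen_eq[OF \<phi> cat_ident[OF G_category[OF i(1)] x] fund_gen_Hom[OF under_cat_category[OF I] under_arr_id[OF k]]])
  moreover have "FAr (fund_map (under_cat I i) (under_map I \<phi>)) (fund_gen (under_cat I j) (Ident I j, k, k)) =
     fund_gen (under_cat I i) (\<phi>, Comp I k \<phi>, k)"
    using fund_map_gen[OF under_map_functor[OF I \<phi>], of "(Ident I j, k, k)"] HomD[OF under_arr_id[OF k]]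
      cat_unit_left[OF I \<phi>] by (simp add: under_map_def)
  ultimately show ?thesis using T_identity[OF \<phi> x] HomD[OF k] by (simp add: hcan_def)
qed

text \<open>The identity of \<open>\<phi>\<close> in \<open>i/I\<close> is the image of the identity
  of \<open>Ident I j\<close> in \<open>j/I\<close>, so the coequalizer relation moves the generator
  from \<open>i\<close> to \<open>j\<close>.\<close>

lemma gen_inc:
  assumes \<phi>: "\<phi> \<in> Hom I i j" and g: "g \<in> Hom (G i) x y"
  shows "gen (i, g, Ident (pi i) \<phi>) = hinc j (FAr (T \<phi>) g)"
proof -
  have i: "i \<in> Obj I" "j \<in> Obj I" using Hom_objD[OF I \<phi>] by auto
  note F = fund_map_functor[OF under_map_functor[OF I \<phi>]]
  have "gen (i, g, FAr (fund_map (under_cat I i) (under_map I \<phi>)) (Ident (pi j) (Ident I j))) =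
     gen (j, FAr (T \<phi>) g, Ident (pi j) (Ident I j))"
    by (rule gen_eq[OF \<phi> g pi_Ident_Hom[OF cat_ident[OF I i(2)]]])
  moreover have "FAr (fund_map (under_cat I i) (under_map I \<phi>)) (Ident (pi j) (Ident I j)) = Ident (pi i) \<phi>"
    using functor_ident[OF F, of "Ident I j"] cat_identD[OF I i(2)] cat_unit_left[OF I \<phi>]
    by (simp add: under_cat_Obj) (simp add: fund_map_def under_map_def)
  ultimately show ?thesis by (simp add: hinc_def)
qed

lemma hcan_Hom:
  assumes \<phi>: "\<phi> \<in> Hom I i j" and x: "x \<in> Obj (G i)"
  shows "hcan \<phi> x \<in> Hom M (hob i x) (hob j (FOb (T \<phi>) x))"
proof -
  have i: "i \<in> Obj I" using Hom_objD[OF I \<phi>] by auto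
  have "gen (i, Ident (G i) x, fund_gen (under_cat I i) (Ident I i, \<phi>, \<phi>)) \<in> Hom M (cl (i, x, Ident I i)) (cl (i, x, \<phi>))"
    using fund_gen_Hom[OF under_cat_category[OF I] under_arr_id[OF \<phi>]] cat_ident[OF G_category[OF i] x] i
    by (intro gen_Hom) (simp add: E_Hom)
  then show ?thesis using HomD[OF \<phi>] cl_hob[OF i x \<phi>] by (simp add: hcan_def hob_def)
qed

text \<open>The two components of an edge multiply independently, so both composites are the
  generator of the one edge with components \<open>g\<close> and the arrow from the identity to
  \<open>\<phi>\<close>.\<close>

lemma hcan_natural:
  assumes \<phi>: "\<phi> \<in> Hom I i j" and g: "g \<in> Hom (G i) x y"
  shows "Comp M (hinc j (FAr (T \<phi>) g)) (hcan \<phi> x) = Comp M (hcan \<phi> y) (hinc i g)"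
proof -
  have i: "i \<in> Obj I" using Hom_objD[OF I \<phi>] by auto
  have xy: "x \<in> Obj (G i)" "y \<in> Obj (G i)" using Hom_objD[OF G_category[OF i] g] by auto
  let ?p = "fund_gen (under_cat I i) (Ident I i, \<phi>, \<phi>)"
  have p: "?p \<in> Hom (pi i) (Ident I i) \<phi>" by (rule fund_gen_Hom[OF under_cat_category[OF I] under_arr_id[OF \<phi>]])
  note id = cat_ident[OF G_category[OF i]] and ii = pi_Ident_Hom[OF cat_ident[OF I i]]
  have h: "hcan \<phi> z = gen (i, Ident (G i) z, ?p)" for z using HomD[OF \<phi>] by (simp add: hcan_def)
  have "Comp M (hinc j (FAr (T \<phi>) g)) (hcan \<phi> x) = gen (i, g, ?p)"
    unfolding h gen_inc[OF \<phi> g, symmetric]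
    using gen_Comp[of "(i, Ident (G i) x, ?p)" "(i, x, Ident I i)" "(i, x, \<phi>)" "(i, g, Ident (pi i) \<phi>)" "(i, y, \<phi>)"]
      i id[OF xy(1)] g p pi_Ident_Hom[OF \<phi>] cat_unit_left[OF pi_category p] cat_unit_right[OF G_category[OF i] g]
    by (simp add: E_Hom E_Comp)
  moreover have "Comp M (hcan \<phi> y) (hinc i g) = gen (i, g, ?p)"
    unfolding h hinc_def
    using gen_Comp[of "(i, g, Ident (pi i) (Ident I i))" "(i, x, Ident I i)" "(i, y, Ident I i)" "(i, Ident (G i) y, ?p)" "(i, y, \<phi>)"]
      i id[OF xy(2)] g p ii cat_unit_right[OF pi_category p] cat_unit_left[OF G_category[OF i] g]
    by (simp add: E_Hom E_Comp)
  ultimately show ?thesis by simp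
qed

lemma hcan_Ident: "i \<in> Obj I \<Longrightarrow> x \<in> Obj (G i) \<Longrightarrow> hcan (Ident I i) x = Ident M (hob i x)"
proof -
  assume i: "i \<in> Obj I" and x: "x \<in> Obj (G i)"
  have "(Ident I i, Ident I i, Ident I i) = Ident (under_cat I i) (Ident I i)"
    using cat_identD[OF I i] by (simp add: under_cat_def)
  then show ?thesis
    using fund_gen_Ident[OF under_cat_category[OF I], of "Ident I i" i] cat_identD[OF I i] hinc_Ident[OF i x]
    by (simp add: hcan_def hinc_def under_cat_Obj)
qed

text \<open>By \<open>gen_can\<close> the second factor also comes from index \<open>i\<close>.
  There the identity goes to \<open>\<phi>\<close> and then to the composite of
  \<open>\<psi>\<close> and \<open>\<phi>\<close>, and the composite of these two arrows of
  \<open>i/I\<close> defines the left-hand side.\<close>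

lemma hcan_Comp:
  assumes \<phi>: "\<phi> \<in> Hom I i j" and \<psi>: "\<psi> \<in> Hom I j k" and x: "x \<in> Obj (G i)"
  shows "hcan (Comp I \<psi> \<phi>) x = Comp M (hcan \<psi> (FOb (T \<phi>) x)) (hcan \<phi> x)"
proof -
  have i: "i \<in> Obj I" using Hom_objD[OF I \<phi>] by auto
  have c: "Comp I \<psi> \<phi> \<in> Hom I i k" by (rule cat_comp[OF I \<phi> \<psi>])
  let ?u = "under_cat I i"
  let ?p = "(Ident I i, \<phi>, \<phi>)" and ?q = "(\<phi>, Comp I \<psi> \<phi>, \<psi>)"
  have p: "fund_gen ?u ?p \<in> Hom (pi i) (Ident I i) \<phi>" and q: "fund_gen ?u ?q \<in> Hom (pi i) \<phi> (Comp I \<psi> \<phi>)"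
    using fund_gen_Hom[OF under_cat_category[OF I]] under_arr_id[OF \<phi>] under_arr[OF \<phi> \<psi>] by blast+
  note id = cat_ident[OF G_category[OF i] x]
  have cq: "Comp (pi i) (fund_gen ?u ?q) (fund_gen ?u ?p) = fund_gen ?u (Ident I i, Comp I \<psi> \<phi>, Comp I \<psi> \<phi>)"
    using fund_gen_Comp[OF under_cat_category[OF I] under_arr_id[OF \<phi>] under_arr[OF \<phi> \<psi>]]
    by (simp add: under_cat_def)
  show ?thesis
    unfolding gen_can[OF \<phi> \<psi> x, symmetric]
    using gen_Comp[of "(i, Ident (G i) x, fund_gen ?u ?p)" "(i, x, Ident I i)" "(i, x, \<phi>)" "(i, Ident (G i) x, fund_gen ?u ?q)" "(i, x, Comp I \<psi> \<phi>)"]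
      i id p q cq HomD[OF \<phi>] HomD[OF c] cat_unit_left[OF G_category[OF i] id]
    by (simp add: E_Hom E_Comp hcan_def)
qed

text \<open>An edge \<open>(i, g, p)\<close> is \<open>(i, g, id)\<close> followed by
  \<open>(i, id, p)\<close>. The first is an \<open>hinc\<close> by \<open>gen_inc\<close>. In the
  second, \<open>p\<close> is a word in arrows of \<open>i/I\<close> and their formal inverses, and
  each letter gives an \<open>hcan\<close> by \<open>gen_can\<close>, or the inverse of one.\<close>

lemma M_induct [consumes 1, case_names Comp inverse hinc hcan]:
  assumes f: "f \<in> Arr M"
    and C: "\<And>f g a b c. f \<in> Hom M a b \<Longrightarrow> g \<in> Hom M b c \<Longrightarrow> P f \<Longrightarrow> P g \<Longrightarrow> P (Comp M g f)"
    and V: "\<And>f g a b. f \<in> Hom M a b \<Longrightarrow> g \<in> Hom M b a \<Longrightarrow> Comp M g f = Ident M a \<Longrightarrow> Comp M f g = Ident M b \<Longrightarrow> P f \<Longrightarrow> P g"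
    and N: "\<And>i g x y. i \<in> Obj I \<Longrightarrow> g \<in> Hom (G i) x y \<Longrightarrow> P (hinc i g)"
    and K: "\<And>\<phi> i j x. \<phi> \<in> Hom I i j \<Longrightarrow> x \<in> Obj (G i) \<Longrightarrow> P (hcan \<phi> x)"
  shows "P f"
proof -
  \<comment> \<open>Edges with an identity in the groupoid component: the other component
    \<open>p\<close> is itself an arrow of a presented category, so a second induction runs over
    it.\<close>
  have p: "P (gen (i, Ident (G i) x, p))" if i: "i \<in> Obj I" and x: "x \<in> Obj (G i)" and p: "p \<in> Arr (pi i)" for i x p
  proof -
    note id = cat_ident[OF G_category[OF i] x]
    have idc: "Comp (G i) (Ident (G i) x) (Ident (G i) x) = Ident (G i) x" by (rule cat_unit_left[OF G_category[OF i] id])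
    have gI: "P (gen (i, Ident (G i) x, Ident (pi i) \<psi>))" if "\<psi> \<in> Obj (under_cat I i)" for \<psi>
    proof -
      have \<psi>: "\<psi> \<in> Hom I i (Cod I \<psi>)" using that by (auto simp: under_cat_Obj Hom_def)
      show ?thesis unfolding gen_inc[OF \<psi> id] using N T_hom[OF \<psi> id] Hom_objD[OF I \<psi>] by blast
    qed
    show ?thesis
      using p unfolding fund_groupoid_def
    proof (induction p rule: presented_induct[OF _ fund_rels_parallel, consumes 1, case_names 1 2 3])
      case (1 \<psi>)
      then show ?case using gI by (simp add: fund_groupoid_def)
    next
      case (2 p q \<psi> \<chi> \<omega>)
      note 2 = 2[folded fund_groupoid_def]
      have e: "(i, Ident (G i) x, p) \<in> Hom E (i, x, \<psi>) (i, x, \<chi>)" "(i, Ident (G i) x, q) \<in> Hom E (i, x, \<chi>) (i, x, \<omega>)"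
        using 2 i id by (auto simp: E_Hom)
      show ?case using C[OF gen_Hom[OF e(1)] gen_Hom[OF e(2)] 2(3,4)] gen_Comp[OF e] idc by (simp add: E_Comp fund_groupoid_def)
    next
      case (3 k)
      then obtain f b where k: "k = (f, b)" "f \<in> Arr (under_cat I i)" by auto
      obtain \<psi> \<chi> h where f: "f = (\<psi>, \<chi>, h)" by (cases f)
      have fh: "f \<in> Hom (under_cat I i) \<psi> \<chi>" using k f by (auto simp: under_cat_def Hom_def)
      have \<psi>: "\<psi> \<in> Hom I i (Cod I \<psi>)" and h: "h \<in> Hom I (Cod I \<psi>) (Cod I \<chi>)" and c: "Comp I h \<psi> = \<chi>"
        using fh unfolding under_cat_Hom f by (auto simp: Hom_def)
      have 1: "P (gen (i, Ident (G i) x, fund_gen (under_cat I i) f))"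
        using gen_can[OF \<psi> h x] K[OF h T_ob[OF \<psi> x]] by (simp add: f c)
      note g = fund_gen_Hom[OF under_cat_category[OF I] fh] fund_inv_Hom[OF under_cat_category[OF I] fh]
      have e: "(i, Ident (G i) x, fund_gen (under_cat I i) f) \<in> Hom E (i, x, \<psi>) (i, x, \<chi>)"
         "(i, Ident (G i) x, fund_inv (under_cat I i) f) \<in> Hom E (i, x, \<chi>) (i, x, \<psi>)"
        using g i id by (auto simp: E_Hom)
      have o: "(i, x, \<psi>) \<in> Obj E" "(i, x, \<chi>) \<in> Obj E" using Hom_objD[OF E_category e(1)] by auto
      \<comment> \<open>The formal inverse yields the inverse of the generator just treated; this is
        where closure of \<open>P\<close> under inverses enters.\<close>
      have 2: "P (gen (i, Ident (G i) x, fund_inv (under_cat I i) f))"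
        by (rule V[OF gen_Hom[OF e(1)] gen_Hom[OF e(2)] _ _ 1])
          (simp_all add: gen_Comp[OF e(1,2), symmetric] gen_Comp[OF e(2,1), symmetric] E_Comp idc
            fund_gen_inv[OF under_cat_category[OF I] fh] E_Ident[symmetric] gen_Ident o)
      show ?case using 1 2 by (cases b) (auto simp: k fund_gen_edge fund_inv_def)
    qed
  qed
  show ?thesis
    using f unfolding hocolim_def coequalizer_def
  proof (induction f rule: presented_induct[OF _ coeq_rels_parallel, consumes 1, case_names 1 2 3])
    case (1 v)
    then obtain i x where ix: "i \<in> Obj I" "x \<in> Obj (G i)" "v = hob i x"
      using M_Obj by (auto simp: hocolim_def coequalizer_def presented_sel)
    show ?case using N[OF ix(1) cat_ident[OF G_category[OF ix(1)] ix(2)]] hinc_Ident[OF ix(1,2)]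
      by (simp add: ix hocolim_def coequalizer_def)
  next
    case (2 f g u v w)
    then show ?case using C by (simp add: hocolim_def coequalizer_def)
  next
    case (3 e)
    then have "e \<in> Arr E" by (simp add: coeq_graph_sel)
    from E_HomE[OF this] obtain i g p x y \<psi> \<chi> where e: "e = (i, g, p)" "i \<in> Obj I" "g \<in> Hom (G i) x y" "p \<in> Hom (pi i) \<psi> \<chi>" .
    have y: "y \<in> Obj (G i)" using Hom_objD[OF G_category[OF e(2)] e(3)] by auto
    have \<psi>: "\<psi> \<in> Hom I i (Cod I \<psi>)" using Hom_objD[OF pi_category e(4)] by (auto simp: under_cat_Obj Hom_def)
    note id = cat_ident[OF G_category[OF e(2)] y]
    have h: "(i, g, Ident (pi i) \<psi>) \<in> Hom E (i, x, \<psi>) (i, y, \<psi>)" "(i, Ident (G i) y, p) \<in> Hom E (i, y, \<psi>) (i, y, \<chi>)"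
      using e id pi_Ident_Hom[OF \<psi>] by (auto simp: E_Hom)
    \<comment> \<open>An edge factors as its groupoid component followed by its component in the
      fundamental groupoid.\<close>
    have "gen e = Comp M (gen (i, Ident (G i) y, p)) (gen (i, g, Ident (pi i) \<psi>))"
      using gen_Comp[OF h] cat_unit_left[OF G_category[OF e(2)] e(3)] cat_unit_right[OF pi_category e(4)]
      by (simp add: e E_Comp)
    moreover have "P (gen (i, g, Ident (pi i) \<psi>))"
      unfolding gen_inc[OF \<psi> e(3)] using N T_hom[OF \<psi> e(3)] Hom_objD[OF I \<psi>] by blast
    moreover have "P (gen (i, Ident (G i) y, p))" using p e y by (auto simp: Hom_def)
    ultimately show ?case using C[OF gen_Hom[OF h(1)] gen_Hom[OF h(2)]] by (simp add: gen_edge_arr)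
  qed
qed

text \<open>Inverses are unique, so functors that agree on an invertible arrow and on its endpoints
  agree on the inverse.\<close>

lemma functor_inverse_eq:
  assumes F: "is_functor M B F" "is_functor M B F'"
    and f: "f \<in> Hom M a b" "g \<in> Hom M b a" "Comp M g f = Ident M a" "Comp M f g = Ident M b"
    and e: "FAr F f = FAr F' f" "FOb F a = FOb F' a" "FOb F b = FOb F' b"
  shows "FAr F g = FAr F' g"
proof -
  have B: "is_category B" by (rule functor_category(2)[OF F(1)])
  have o: "a \<in> Obj M" "b \<in> Obj M" using Hom_objD[OF M_category f(1)] by auto
  note h = functor_hom[OF F(1) f(1)] functor_hom[OF F(1) f(2)] functor_hom[OF F(2) f(1)] functor_hom[OF F(2) f(2)]
  have "FAr F g = Comp B (FAr F g) (Comp B (FAr F' f) (FAr F' g))"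
    using cat_unit_right[OF B h(2)] functor_comp[OF F(2) f(2,1)] functor_ident[OF F(2) o(2)] f(4) e by simp
  also have "\<dots> = Comp B (Comp B (FAr F g) (FAr F f)) (FAr F' g)"
    using cat_assoc[OF B h(4) h(3), of "FAr F g"] h(2) e by simp
  also have "\<dots> = FAr F' g"
    using functor_comp[OF F(1) f(1,2)] functor_ident[OF F(1) o(1)] f(3) cat_unit_left[OF B h(4)] e by simp
  finally show ?thesis .
qed

text \<open>Equality of the images of an arrow passes to composites and inverses, so
  \<open>M_induct\<close> applies. The purpose is to verify that the restriction maps between
  homotopy colimits compose strictly.\<close>

lemma functor_eqI:
  assumes F: "is_functor M B F" "is_functor M B F'"
    and ob: "\<And>i x. i \<in> Obj I \<Longrightarrow> x \<in> Obj (G i) \<Longrightarrow> FOb F (hob i x) = FOb F' (hob i x)"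
    and inc: "\<And>i g x y. i \<in> Obj I \<Longrightarrow> g \<in> Hom (G i) x y \<Longrightarrow> FAr F (hinc i g) = FAr F' (hinc i g)"
    and can: "\<And>\<phi> i j x. \<phi> \<in> Hom I i j \<Longrightarrow> x \<in> Obj (G i) \<Longrightarrow> FAr F (hcan \<phi> x) = FAr F' (hcan \<phi> x)"
  shows "ftr_agree M F F'"
proof -
  have o: "FOb F a = FOb F' a" if "a \<in> Obj M" for a using that ob by (auto simp: M_Obj)
  have "FAr F f = FAr F' f" if "f \<in> Arr M" for f
    using that
  proof (induction rule: M_induct)
    case (Comp f g a b c)
    then show ?case using functor_comp[OF F(1) Comp(1,2)] functor_comp[OF F(2) Comp(1,2)] by simp
  next
    case (inverse f g a b)
    then show ?case using functor_inverse_eq[OF F inverse(1-5)] o Hom_objD[OF M_category inverse(1)] by simp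
  qed (use inc can in auto)
  with o show ?thesis by (auto simp: ftr_agree_def)
qed

end

subsection \<open>Actions of a homotopy colimit\<close>

lemma path_class_eqD: "path_class G R p = path_class G R q \<Longrightarrow> q \<in> paths G \<Longrightarrow> (p, q) \<in> path_cong G R"
  using path_class_self path_class_memD by metis

context hc_diagram
begin

abbreviation "Gr \<equiv> coeq_graph (hc_source I G) E leg1 (hc_leg2 I T)"
abbreviation "Rl \<equiv> coeq_rels (hc_source I G) E leg1 (hc_leg2 I T)"

lemma coeq_rels_cases:
  assumes "(p, q) \<in> Rl"
  obtains (c) e e' where "e \<in> Arr E" "e' \<in> Arr E" "Dom E e' = Cod E e" "p = (cl (Dom E e), [e, e'], cl (Cod E e'))"
      "q = (cl (Dom E e), [Comp E e' e], cl (Cod E e'))"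
    | (i) a where "a \<in> Obj E" "p = (cl a, [Ident E a], cl a)" "q = (cl a, [], cl a)"
    | (r) i j \<phi> g x y f \<psi> \<chi> where "\<phi> \<in> Hom I i j" "g \<in> Hom (G i) x y" "f \<in> Hom (pi j) \<psi> \<chi>"
      "p = (cl (i, x, Comp I \<psi> \<phi>), [(i, g, FAr (fund_map (under_cat I i) (under_map I \<phi>)) f)], cl (i, y, Comp I \<chi> \<phi>))"
      "q = (cl (i, x, Comp I \<psi> \<phi>), [(j, FAr (T \<phi>) g, f)], cl (i, y, Comp I \<chi> \<phi>))"
proof -
  from assms consider (1) e e' where "e \<in> Arr E" "e' \<in> Arr E" "Dom E e' = Cod E e" "p = (cl (Dom E e), [e, e'], cl (Cod E e'))"
      "q = (cl (Dom E e), [Comp E e' e], cl (Cod E e'))"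
    | (2) a where "a \<in> Obj E" "p = (cl a, [Ident E a], cl a)" "q = (cl a, [], cl a)"
    | (3) a where "a \<in> Arr (hc_source I G)"
      "p = (cl (FOb leg1 (Dom (hc_source I G) a)), [FAr leg1 a], cl (FOb leg1 (Cod (hc_source I G) a)))"
      "q = (cl (FOb leg1 (Dom (hc_source I G) a)), [FAr (hc_leg2 I T) a], cl (FOb leg1 (Cod (hc_source I G) a)))"
    unfolding coeq_rels_def Let_def hc_ob_class_def[symmetric] by blast
  then show thesis
  proof cases
    case 3
    obtain \<phi> g f where a: "a = (\<phi>, g, f)" by (cases a)
    have *: "\<phi> \<in> Hom I (Dom I \<phi>) (Cod I \<phi>)" "g \<in> Hom (G (Dom I \<phi>)) (Dom (G (Dom I \<phi>)) g) (Cod (G (Dom I \<phi>)) g)"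
      "f \<in> Hom (pi (Cod I \<phi>)) (Dom (pi (Cod I \<phi>)) f) (Cod (pi (Cod I \<phi>)) f)"
      using 3(1) by (auto simp: a hc_source_def coprod_cat_def prod_cat_def Hom_def)
    show thesis
      by (rule r[OF *]) (simp_all add: 3 a hc_leg1_def hc_leg2_def under_map_def hc_source_def coprod_cat_def prod_cat_def)
  qed (use c i in blast)+
qed

end

text \<open>The trace of a descent datum over one fixed object of the base. \<open>Sx i x\<close>
  plays the sections over \<open>x\<close>, \<open>\<rho>\<close> the restriction along arrows of
  \<open>G i\<close>, and \<open>\<theta> \<phi> x\<close> the transition map, which goes from the
  fibre at the image of \<open>x\<close> back to the fibre at \<open>x\<close>, like restriction
  along a canonical arrow.\<close>

locale hc_action = hc_diagram I G T
  for I :: "('i, 'j) cat" and G :: "'i \<Rightarrow> ('o, 'g) cat" and T :: "'j \<Rightarrow> ('o, 'g, 'o, 'g) ftr" +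
  fixes Sx :: "'i \<Rightarrow> 'o \<Rightarrow> 'm set" and \<rho> :: "'i \<Rightarrow> 'g \<Rightarrow> 'm \<Rightarrow> 'm" and \<theta> :: "'j \<Rightarrow> 'o \<Rightarrow> 'm \<Rightarrow> 'm"
  assumes \<rho>_closed: "\<And>i g x y s. i \<in> Obj I \<Longrightarrow> g \<in> Hom (G i) x y \<Longrightarrow> s \<in> Sx i y \<Longrightarrow> \<rho> i g s \<in> Sx i x"
    and \<rho>_Ident: "\<And>i x s. i \<in> Obj I \<Longrightarrow> x \<in> Obj (G i) \<Longrightarrow> s \<in> Sx i x \<Longrightarrow> \<rho> i (Ident (G i) x) s = s"
    and \<rho>_Comp: "\<And>i g g' x y z s. i \<in> Obj I \<Longrightarrow> g \<in> Hom (G i) x y \<Longrightarrow> g' \<in> Hom (G i) y z \<Longrightarrow> s \<in> Sx i z \<Longrightarrow>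
      \<rho> i (Comp (G i) g' g) s = \<rho> i g (\<rho> i g' s)"
    and \<theta>_bij: "\<And>\<phi> i j x. \<phi> \<in> Hom I i j \<Longrightarrow> x \<in> Obj (G i) \<Longrightarrow> bij_betw (\<theta> \<phi> x) (Sx j (FOb (T \<phi>) x)) (Sx i x)"
    and \<theta>_natural: "\<And>\<phi> i j g x y s. \<phi> \<in> Hom I i j \<Longrightarrow> g \<in> Hom (G i) x y \<Longrightarrow> s \<in> Sx j (FOb (T \<phi>) y) \<Longrightarrow>
      \<theta> \<phi> x (\<rho> j (FAr (T \<phi>) g) s) = \<rho> i g (\<theta> \<phi> y s)"
    and \<theta>_Ident: "\<And>i x s. i \<in> Obj I \<Longrightarrow> x \<in> Obj (G i) \<Longrightarrow> s \<in> Sx i x \<Longrightarrow> \<theta> (Ident I i) x s = s"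
    and \<theta>_Comp: "\<And>\<phi> \<psi> i j k x s. \<phi> \<in> Hom I i j \<Longrightarrow> \<psi> \<in> Hom I j k \<Longrightarrow> x \<in> Obj (G i) \<Longrightarrow>
      s \<in> Sx k (FOb (T \<psi>) (FOb (T \<phi>) x)) \<Longrightarrow> \<theta> (Comp I \<psi> \<phi>) x s = \<theta> \<phi> x (\<theta> \<psi> (FOb (T \<phi>) x) s)"
begin

definition SE :: "('i, 'j, 'o) hc_ob \<Rightarrow> 'm set" where
  "SE e = Sx (fst (hnf e)) (snd (hnf e))"

definition SM :: "('i, 'j, 'o) hc_ob set \<Rightarrow> 'm set" where
  "SM c = Sx (fst (hrep c)) (snd (hrep c))"

text \<open>The component in \<open>\<pi>(i/I)\<close> acts only through its endpoints: \<open>\<theta>\<close> trivialises the dependence of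
  \<open>(i, x, \<psi>)\<close> on \<open>\<psi>\<close>.\<close>

definition eact :: "('i, 'j, 'g) hc_edge \<Rightarrow> 'm \<Rightarrow> 'm" where
  "eact = (\<lambda>(i, g, p) s. inv_into (SE (i, Dom (G i) g, Dom (pi i) p)) (\<theta> (Dom (pi i) p) (Dom (G i) g))
     (\<rho> i g (\<theta> (Cod (pi i) p) (Cod (G i) g) s)))"

text \<open>Restriction is contravariant, so the last edge of a path acts first; hence
  \<open>foldr\<close>.\<close>

definition hact :: "('i, 'j, 'o, 'g) hc_arr \<Rightarrow> 'm \<Rightarrow> 'm" where
  "hact f = foldr eact (fst (snd (SOME p. p \<in> f)))"

lemma SM_cl: "e \<in> Obj E \<Longrightarrow> SM (cl e) = SE e"
  by (simp add: SM_def SE_def hrep_cl)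

lemma SM_hob: "i \<in> Obj I \<Longrightarrow> x \<in> Obj (G i) \<Longrightarrow> SM (hob i x) = Sx i x"
  by (simp add: SM_def hrep_hob)

lemma SE_eq: "\<psi> \<in> Hom I i j \<Longrightarrow> SE (i, x, \<psi>) = Sx j (FOb (T \<psi>) x)"
  by (auto simp: SE_def hnf_def Hom_def)

lemma \<theta>_bijSE: "i \<in> Obj I \<Longrightarrow> x \<in> Obj (G i) \<Longrightarrow> \<psi> \<in> Hom I i j \<Longrightarrow> bij_betw (\<theta> \<psi> x) (SE (i, x, \<psi>)) (Sx i x)"
  using \<theta>_bij by (simp add: SE_eq)

lemma bij_inv: 
  assumes "bij_betw f A B"
  shows "s \<in> A \<Longrightarrow> f s \<in> B" "s \<in> A \<Longrightarrow> inv_into A f (f s) = s" "t \<in> B \<Longrightarrow> inv_into A f t \<in> A" "t \<in> B \<Longrightarrow> f (inv_into A f t) = t"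
  using assms by (auto simp: bij_betw_def inv_into_into f_inv_into_f)

lemma pi_HomD: "p \<in> Hom (pi i) \<psi> \<chi> \<Longrightarrow> \<psi> \<in> Hom I i (Cod I \<psi>) \<and> \<chi> \<in> Hom I i (Cod I \<chi>)"
  using Hom_objD[OF pi_category] by (auto simp: under_cat_Obj Hom_def)

lemma eact_eq: "g \<in> Hom (G i) x y \<Longrightarrow> p \<in> Hom (pi i) \<psi> \<chi> \<Longrightarrow>
    eact (i, g, p) s = inv_into (SE (i, x, \<psi>)) (\<theta> \<psi> x) (\<rho> i g (\<theta> \<chi> y s))"
  by (auto simp: eact_def Hom_def)

lemma E_HomE':
  assumes "e \<in> Hom E a b"
  obtains i g p x y \<psi> \<chi> where "e = (i, g, p)" "i \<in> Obj I" "g \<in> Hom (G i) x y" "p \<in> Hom (pi i) \<psi> \<chi>"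
    "a = (i, x, \<psi>)" "b = (i, y, \<chi>)"
  using assms by (cases e; cases a; cases b) (simp add: E_Hom)

lemma eact_closed:
  assumes "e \<in> Hom E a b" "s \<in> SE b"
  shows "eact e s \<in> SE a"
proof -
  obtain i g p x y \<psi> \<chi> where e: "e = (i, g, p)" "i \<in> Obj I" "g \<in> Hom (G i) x y" "p \<in> Hom (pi i) \<psi> \<chi>" "a = (i, x, \<psi>)" "b = (i, y, \<chi>)"
    using E_HomE'[OF assms(1)] .
  have o: "x \<in> Obj (G i)" "y \<in> Obj (G i)" using Hom_objD[OF G_category[OF e(2)] e(3)] by auto
  note b1 = \<theta>_bijSE[OF e(2) o(1) pi_HomD[OF e(4), THEN conjunct1]] and b2 = \<theta>_bijSE[OF e(2) o(2) pi_HomD[OF e(4), THEN conjunct2]]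
  show ?thesis unfolding e(1) eact_eq[OF e(3,4)] using bij_inv[OF b1] bij_inv[OF b2] assms(2) e \<rho>_closed by blast
qed

text \<open>At the middle object the inverse of \<open>\<theta>\<close> from one factor cancels the
  \<open>\<theta>\<close> of the other, which leaves the composition law of
  \<open>\<rho>\<close>.\<close>

lemma eact_Comp:
  assumes "e \<in> Hom E a b" "e' \<in> Hom E b c" "s \<in> SE c"
  shows "eact (Comp E e' e) s = eact e (eact e' s)"
proof -
  obtain i g p x y \<psi> \<chi> where e: "e = (i, g, p)" "i \<in> Obj I" "g \<in> Hom (G i) x y" "p \<in> Hom (pi i) \<psi> \<chi>" "a = (i, x, \<psi>)" "b = (i, y, \<chi>)"
    using E_HomE'[OF assms(1)] .
  obtain i' g' p' y' z \<chi>' \<omega> where e'': "e' = (i', g', p')" "i' \<in> Obj I" "g' \<in> Hom (G i') y' z" "p' \<in> Hom (pi i') \<chi>' \<omega>"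
    "b = (i', y', \<chi>')" "c = (i', z, \<omega>)" using E_HomE'[OF assms(2)] .
  have "i' = i" "y' = y" "\<chi>' = \<chi>" using e(6) e''(5) by auto
  then have e': "e' = (i, g', p')" "g' \<in> Hom (G i) y z" "p' \<in> Hom (pi i) \<chi> \<omega>" "c = (i, z, \<omega>)"
    using e'' by auto
  have o: "x \<in> Obj (G i)" "y \<in> Obj (G i)" "z \<in> Obj (G i)"
    using Hom_objD[OF G_category[OF e(2)] e(3)] Hom_objD[OF G_category[OF e(2)] e'(2)] by auto
  note b2 = bij_inv[OF \<theta>_bijSE[OF e(2) o(2) pi_HomD[OF e(4), THEN conjunct2]]]
    and b3 = bij_inv[OF \<theta>_bijSE[OF e(2) o(3) pi_HomD[OF e'(3), THEN conjunct2]]]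
  have s: "\<theta> \<omega> z s \<in> Sx i z" using assms(3) e' b3 by simp
  show ?thesis
    unfolding e(1) e'(1) E_Comp eact_eq[OF e(3,4)] eact_eq[OF e'(2,3)]
      eact_eq[OF cat_comp[OF G_category[OF e(2)] e(3) e'(2)] cat_comp[OF pi_category e(4) e'(3)]]
    using b2(4)[OF \<rho>_closed[OF e(2) e'(2) s]] \<rho>_Comp[OF e(2,3) e'(2) s] by simp
qed

lemma eact_Ident:
  assumes "a \<in> Obj E" "s \<in> SE a"
  shows "eact (Ident E a) s = s"
proof -
  obtain i x \<psi> where a: "a = (i, x, \<psi>)" by (cases a)
  with assms have o: "i \<in> Obj I" "x \<in> Obj (G i)" "\<psi> \<in> Hom I i (Cod I \<psi>)" by (auto simp: E_Obj Hom_def)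
  note b = bij_inv[OF \<theta>_bijSE[OF o]]
  show ?thesis unfolding a E_Ident eact_eq[OF cat_ident[OF G_category[OF o(1)] o(2)] pi_Ident_Hom[OF o(3)]]
    using \<rho>_Ident[OF o(1,2) b(1)] b(2) assms(2) a by simp
qed

text \<open>By \<open>\<theta>_Comp\<close> the trivialisation at a composite is the one at
  \<open>\<psi>\<close> or \<open>\<chi>\<close> followed by \<open>\<theta> \<phi>\<close>, and by
  \<open>\<theta>_natural\<close> the map \<open>\<theta> \<phi>\<close> moves past
  \<open>\<rho>\<close>. It then occurs on the outside on both ends and cancels.\<close>

lemma eact_rel:
  assumes \<phi>: "\<phi> \<in> Hom I i j" and g: "g \<in> Hom (G i) x y" and p: "p \<in> Hom (pi j) \<psi> \<chi>"
    and s: "s \<in> SE (j, FOb (T \<phi>) y, \<chi>)"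
  shows "eact (i, g, FAr (fund_map (under_cat I i) (under_map I \<phi>)) p) s = eact (j, FAr (T \<phi>) g, p) s"
proof -
  have ij: "i \<in> Obj I" "j \<in> Obj I" using Hom_objD[OF I \<phi>] by auto
  have xy: "x \<in> Obj (G i)" "y \<in> Obj (G i)" using Hom_objD[OF G_category[OF ij(1)] g] by auto
  have pc: "\<psi> \<in> Hom I j (Cod I \<psi>)" "\<chi> \<in> Hom I j (Cod I \<chi>)" using pi_HomD[OF p] by auto
  have um: "FAr (fund_map (under_cat I i) (under_map I \<phi>)) p \<in> Hom (pi i) (Comp I \<psi> \<phi>) (Comp I \<chi> \<phi>)"
    using functor_hom[OF fund_map_functor[OF under_map_functor[OF I \<phi>]] p] by (simp add: fund_map_def under_map_def)
  note c = cat_comp[OF I \<phi> pc(1)] cat_comp[OF I \<phi> pc(2)]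
  note Tg = T_hom[OF \<phi> g] and To = T_ob[OF \<phi> xy(1)] T_ob[OF \<phi> xy(2)]
  have sx: "s \<in> Sx (Cod I \<chi>) (FOb (T \<chi>) (FOb (T \<phi>) y))" using s SE_eq[OF pc(2)] by simp
  note bc = bij_inv[OF \<theta>_bijSE[OF ij(1) xy(1) c(1)]] and bp = bij_inv[OF \<theta>_bijSE[OF ij(2) To(1) pc(1)]]
  have t0: "\<theta> \<chi> (FOb (T \<phi>) y) s \<in> Sx j (FOb (T \<phi>) y)"
    using bij_inv(1)[OF \<theta>_bijSE[OF ij(2) To(2) pc(2)]] s by simp
  define t where "t = \<rho> j (FAr (T \<phi>) g) (\<theta> \<chi> (FOb (T \<phi>) y) s)"
  have t: "t \<in> Sx j (FOb (T \<phi>) x)" unfolding t_def by (rule \<rho>_closed[OF ij(2) Tg t0])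
  \<comment> \<open>The value of the right-hand side. For the left-hand side it is enough that
    \<open>\<theta> (Comp I \<psi> \<phi>) x\<close> sends it to the result of
    \<open>\<rho> i g\<close>, since \<open>eact\<close> ends with the inverse of that map.\<close>
  define r where "r = inv_into (SE (j, FOb (T \<phi>) x, \<psi>)) (\<theta> \<psi> (FOb (T \<phi>) x)) t"
  have r: "r \<in> SE (j, FOb (T \<phi>) x, \<psi>)" "\<theta> \<psi> (FOb (T \<phi>) x) r = t" using bp t by (auto simp: r_def)
  then have r': "r \<in> SE (i, x, Comp I \<psi> \<phi>)" using SE_eq[OF pc(1)] SE_eq[OF c(1)] T_Comp_ob[OF \<phi> pc(1) xy(1)] by simp
  have "\<rho> i g (\<theta> (Comp I \<chi> \<phi>) y s) = \<theta> \<phi> x t"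
    unfolding t_def using \<theta>_Comp[OF \<phi> pc(2) xy(2) sx] \<theta>_natural[OF \<phi> g t0] by simp
  also have "\<dots> = \<theta> (Comp I \<psi> \<phi>) x r"
    using \<theta>_Comp[OF \<phi> pc(1) xy(1), of r] r SE_eq[OF pc(1)] by simp
  finally have "eact (i, g, FAr (fund_map (under_cat I i) (under_map I \<phi>)) p) s = r"
    unfolding eact_eq[OF g um] using bc(2)[OF r'] by simp
  then show ?thesis unfolding eact_eq[OF Tg p] by (simp add: r_def t_def)
qed

lemma foldr_eact_closed: "walk Gr u es v \<Longrightarrow> s \<in> SM v \<Longrightarrow> foldr eact es s \<in> SM u"
proof (induction es arbitrary: u)
  case (Cons e es)
  then have e: "e \<in> Arr E" "u = cl (Dom E e)" "walk Gr (cl (Cod E e)) es v"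
    by (auto simp: coeq_graph_sel hc_ob_class_def)
  have "foldr eact es s \<in> SM (cl (Cod E e))" using Cons e(3) by blast
  then have "eact e (foldr eact es s) \<in> SE (Dom E e)"
    using eact_closed[OF Arr_Hom[OF e(1)]] SM_cl[OF cat_cod[OF E_category e(1)]] by simp
  then show ?case using SM_cl[OF cat_dom[OF E_category e(1)]] e(2) by simp
qed auto

text \<open>This makes \<open>hact\<close> independent of the representative. The three kinds of
  relations are \<open>eact_Comp\<close>, \<open>eact_Ident\<close> and \<open>eact_rel\<close>;
  concatenation is harmless because the fold over a concatenated list is the composite of the
  folds.\<close>

lemma foldr_eact_cong:
  "(p, q) \<in> path_cong Gr Rl \<Longrightarrow> s \<in> SM (snd (snd p)) \<Longrightarrow> foldr eact (fst (snd p)) s = foldr eact (fst (snd q)) s"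
proof (induction arbitrary: s rule: path_cong.induct)
  case (base p q)
  from base(1) show ?case
  proof (cases rule: coeq_rels_cases)
    case (c e e')
    have "s \<in> SE (Cod E e')" using base c SM_cl[OF cat_cod[OF E_category c(2)]] by simp
    then show ?thesis using eact_Comp[OF Arr_Hom[OF c(1)], of e' "Cod E e'" s] c by (simp add: Hom_def)
  next
    case (i a)
    then show ?thesis using eact_Ident base SM_cl by simp
  next
    case (r i j \<phi> g x y f \<psi> \<chi>)
    have ij: "i \<in> Obj I" "j \<in> Obj I" using Hom_objD[OF I r(1)] by auto
    have xy: "x \<in> Obj (G i)" "y \<in> Obj (G i)" using Hom_objD[OF G_category[OF ij(1)] r(2)] by auto
    have pc: "\<chi> \<in> Hom I j (Cod I \<chi>)" using pi_HomD[OF r(3)] by auto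
    note c = cat_comp[OF I r(1) pc]
    have "SM (cl (i, y, Comp I \<chi> \<phi>)) = SE (i, y, Comp I \<chi> \<phi>)"
      by (rule SM_cl) (use ij xy HomD[OF c] in \<open>simp add: E_Obj\<close>)
    also have "\<dots> = SE (j, FOb (T \<phi>) y, \<chi>)" using SE_eq[OF c] SE_eq[OF pc] T_Comp_ob[OF r(1) pc xy(2)] by simp
    finally show ?thesis using eact_rel[OF r(1-3)] base r by simp
  qed
next
  case (sym p q)
  then show ?case using path_cong_ends[OF sym(1) coeq_rels_parallel] by simp
next
  case (trans p q r)
  then show ?case using path_cong_ends[OF trans(1) coeq_rels_parallel] by simp
next
  case (append u xs v ys xs' w ys')
  have w: "walk Gr v xs' w" using path_cong_paths[OF append(2)] by (auto simp: paths_def)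
  have s: "s \<in> SM w" using append by simp
  have "foldr eact xs' s \<in> SM v" by (rule foldr_eact_closed[OF w s])
  then show ?case using append(3)[of "foldr eact xs' s"] append(4)[of s] s by simp
qed auto

lemma hact_eq:
  assumes "walk Gr u es v" "s \<in> SM v"
  shows "hact (path_class Gr Rl (u, es, v)) s = foldr eact es s"
proof -
  have "(u, es, v) \<in> path_class Gr Rl (u, es, v)" using path_class_self assms(1) by (auto simp: paths_def)
  then have "(SOME p. p \<in> path_class Gr Rl (u, es, v)) \<in> path_class Gr Rl (u, es, v)" by (rule someI)
  from foldr_eact_cong[OF path_class_memD[OF this]] assms(2) show ?thesis by (simp add: hact_def)
qed

lemma M_HomE:
  assumes "f \<in> Hom M a b"
  obtains es where "walk Gr a es b" "f = path_class Gr Rl (a, es, b)"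
  using presented_HomE[OF assms[unfolded hocolim_def coequalizer_def] coeq_rels_parallel] .

lemma hact_closed: "f \<in> Hom M a b \<Longrightarrow> s \<in> SM b \<Longrightarrow> hact f s \<in> SM a"
  by (metis M_HomE hact_eq foldr_eact_closed)

lemma hact_Comp:
  assumes f: "f \<in> Hom M a b" and g: "g \<in> Hom M b c" and s: "s \<in> SM c"
  shows "hact (Comp M g f) s = hact f (hact g s)"
proof -
  obtain xs where xs: "walk Gr a xs b" "f = path_class Gr Rl (a, xs, b)" using M_HomE[OF f] .
  obtain ys where ys: "walk Gr b ys c" "g = path_class Gr Rl (b, ys, c)" using M_HomE[OF g] .
  have "walk Gr a (xs @ ys) c" using xs ys by (auto simp: walk_append)
  moreover have "Comp M g f = path_class Gr Rl (a, xs @ ys, c)"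
    unfolding hocolim_def coequalizer_def xs(2) ys(2) by (rule presented_Comp[OF coeq_rels_parallel xs(1) ys(1)])
  ultimately show ?thesis
    using hact_eq[OF xs(1) foldr_eact_closed[OF ys(1) s]] hact_eq[OF ys(1) s] s by (simp add: hact_eq xs(2) ys(2))
qed

lemma hact_Ident: "a \<in> Obj M \<Longrightarrow> s \<in> SM a \<Longrightarrow> hact (Ident M a) s = s"
  using hact_eq[of a "[]" a s] by (simp add: hocolim_def coequalizer_def presented_sel)

lemma hact_gen:
  assumes e: "e \<in> Hom E a b" and s: "s \<in> SM (cl b)"
  shows "hact (gen e) s = eact e s"
proof -
  have "walk Gr (cl a) [e] (cl b)" 
    using HomD[OF e] Hom_objD[OF E_category e] by (auto simp: coeq_graph_sel hc_ob_class_def)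
  from hact_eq[OF this s] show ?thesis
    using HomD[OF e] by (simp add: gen_edge_arr edge_arr_def coeq_graph_sel hc_ob_class_def)
qed

text \<open>Both ends sit at the identity of \<open>i\<close>, where the trivialisation
  \<open>\<theta>\<close> is the identity, so only \<open>\<rho>\<close> remains.\<close>

lemma hact_hinc:
  assumes i: "i \<in> Obj I" and g: "g \<in> Hom (G i) x y" and s: "s \<in> Sx i y"
  shows "hact (hinc i g) s = \<rho> i g s"
proof -
  have o: "x \<in> Obj (G i)" "y \<in> Obj (G i)" using Hom_objD[OF G_category[OF i] g] by auto
  note id = cat_ident[OF I i]
  note p = pi_Ident_Hom[OF id]
  have e: "(i, g, Ident (pi i) (Ident I i)) \<in> Hom E (i, x, Ident I i) (i, y, Ident I i)" using i g p by (simp add: E_Hom)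
  have SEi: "SE (i, x, Ident I i) = Sx i x" using SE_eq[OF id] T_Ident_ob[OF i] o by simp
  have r: "\<rho> i g s \<in> Sx i x" using \<rho>_closed[OF i g s] .
  have "hact (hinc i g) s = eact (i, g, Ident (pi i) (Ident I i)) s"
    unfolding hinc_def using hact_gen[OF e] s SM_hob[OF i o(2)] by (simp add: hob_def)
  also have "\<dots> = inv_into (Sx i x) (\<theta> (Ident I i) x) (\<rho> i g s)"
    unfolding eact_eq[OF g p] SEi using \<theta>_Ident[OF i o(2) s] by simp
  also have "\<dots> = \<rho> i g s"
    using bij_inv(2)[OF \<theta>_bijSE[OF i o(1) id], of "\<rho> i g s"] \<theta>_Ident[OF i o(1) r] r SEi by simp
  finally show ?thesis .
qed

text \<open>At the source the trivialisation is \<open>\<theta>\<close> at an identity, at the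
  target it is \<open>\<theta> \<phi>\<close>, and \<open>\<rho>\<close> acts by an identity;
  exactly \<open>\<theta> \<phi> x\<close> survives.\<close>

lemma hact_hcan:
  assumes \<phi>: "\<phi> \<in> Hom I i j" and x: "x \<in> Obj (G i)" and s: "s \<in> Sx j (FOb (T \<phi>) x)"
  shows "hact (hcan \<phi> x) s = \<theta> \<phi> x s"
proof -
  have i: "i \<in> Obj I" using Hom_objD[OF I \<phi>] by auto
  note id = cat_ident[OF I i] and gid = cat_ident[OF G_category[OF i] x]
  note p = fund_gen_Hom[OF under_cat_category[OF I] under_arr_id[OF \<phi>]]
  have e: "(i, Ident (G i) x, fund_gen (under_cat I i) (Ident I i, \<phi>, \<phi>)) \<in> Hom E (i, x, Ident I i) (i, x, \<phi>)" 
    using i gid p by (simp add: E_Hom)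
  have SEi: "SE (i, x, Ident I i) = Sx i x" using SE_eq[OF id] T_Ident_ob[OF i] x by simp
  have SMc: "s \<in> SM (cl (i, x, \<phi>))" using SM_cl[of "(i, x, \<phi>)"] SE_eq[OF \<phi>] s i x HomD[OF \<phi>] by (simp add: E_Obj)
  have r: "\<theta> \<phi> x s \<in> Sx i x" using bij_inv(1)[OF \<theta>_bij[OF \<phi> x] s] .
  have "hact (hcan \<phi> x) s = eact (i, Ident (G i) x, fund_gen (under_cat I i) (Ident I i, \<phi>, \<phi>)) s"
    using hact_gen[OF e SMc] HomD[OF \<phi>] by (simp add: hcan_def)
  also have "\<dots> = inv_into (Sx i x) (\<theta> (Ident I i) x) (\<theta> \<phi> x s)"
    unfolding eact_eq[OF gid p] SEi using \<rho>_Ident[OF i x r] by simp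
  also have "\<dots> = \<theta> \<phi> x s"
    using bij_inv(2)[OF \<theta>_bijSE[OF i x id], of "\<theta> \<phi> x s"] \<theta>_Ident[OF i x r] r SEi by simp
  finally show ?thesis .
qed

end

subsection \<open>Functoriality of the homotopy colimit\<close>

locale hc_transformation = D: hc_diagram I G T + D': hc_diagram I G' T'
  for I :: "('i, 'j) cat" and G :: "'i \<Rightarrow> ('o, 'g) cat" and T :: "'j \<Rightarrow> ('o, 'g, 'o, 'g) ftr"
    and G' :: "'i \<Rightarrow> ('o, 'g) cat" and T' :: "'j \<Rightarrow> ('o, 'g, 'o, 'g) ftr" +
  fixes N :: "'i \<Rightarrow> ('o, 'g, 'o, 'g) ftr"
  assumes N_functor: "\<And>i. i \<in> Obj I \<Longrightarrow> is_functor (G i) (G' i) (N i)"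
    and N_natural: "\<And>\<phi>. \<phi> \<in> Arr I \<Longrightarrow>
      ftr_agree (G (Dom I \<phi>)) (ftr_comp (T' \<phi>) (N (Dom I \<phi>))) (ftr_comp (N (Cod I \<phi>)) (T \<phi>))"
begin

definition nob :: "('i, 'j, 'o) hc_ob \<Rightarrow> ('i, 'j, 'o) hc_ob" where
  "nob = (\<lambda>(i, x, \<psi>). (i, FOb (N i) x, \<psi>))"

definition nar :: "('i, 'j, 'g) hc_edge \<Rightarrow> ('i, 'j, 'g) hc_edge" where
  "nar = (\<lambda>(i, g, p). (i, FAr (N i) g, p))"

abbreviation "F \<equiv> hc_map I G' T' N"

lemma N_ob: "\<phi> \<in> Hom I i j \<Longrightarrow> x \<in> Obj (G i) \<Longrightarrow> FOb (T' \<phi>) (FOb (N i) x) = FOb (N j) (FOb (T \<phi>) x)"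
  using ftr_agree_ob[OF N_natural] by (auto simp: Hom_def ftr_comp_def)

lemma N_ar: "\<phi> \<in> Hom I i j \<Longrightarrow> g \<in> Hom (G i) x y \<Longrightarrow> FAr (T' \<phi>) (FAr (N i) g) = FAr (N j) (FAr (T \<phi>) g)"
  using ftr_agree_ar[OF N_natural] by (auto simp: Hom_def ftr_comp_def)

lemma nob_Obj: "e \<in> Obj D.E \<Longrightarrow> nob e \<in> Obj D'.E"
  by (cases e) (auto simp: nob_def D.E_Obj D'.E_Obj intro: functor_ob[OF N_functor])

lemma nar_Hom: "e \<in> Hom D.E a b \<Longrightarrow> nar e \<in> Hom D'.E (nob a) (nob b)"
  by (cases e; cases a; cases b) (auto simp: nar_def nob_def D.E_Hom D'.E_Hom intro: functor_hom[OF N_functor])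

lemma hnf_nob:
  assumes "e \<in> Obj D.E"
  shows "D'.hnf (nob e) = (fst (D.hnf e), FOb (N (fst (D.hnf e))) (snd (D.hnf e)))"
proof -
  obtain i x \<psi> where e: "e = (i, x, \<psi>)" by (cases e)
  with assms have "i \<in> Obj I" "x \<in> Obj (G i)" "\<psi> \<in> Hom I i (Cod I \<psi>)" by (auto simp: D.E_Obj Hom_def)
  then show ?thesis using N_ob by (simp add: e nob_def D.hnf_def D'.hnf_def)
qed

text \<open>\<open>hc_map\<close> takes the union of the classes of the images of all members. By
  \<open>hnf_nob\<close> these images share one normal form, so the union is a single class.\<close>

lemma F_ob_cl:
  assumes e: "e \<in> Obj D.E"
  shows "FOb F (D.cl e) = D'.cl (nob e)"
proof -
  have 1: "D'.cl (nob e') = D'.cl (nob e)" if "e' \<in> D.cl e" for e'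
  proof -
    have e': "e' \<in> Obj D.E" "D.hnf e' = D.hnf e" using that unfolding D.cl_eq[OF e] by auto
    show ?thesis by (rule D'.cl_eq_iff[OF nob_Obj[OF e'(1)] nob_Obj[OF e], THEN iffD2]) (simp only: hnf_nob e e')
  qed
  have 2: "e \<in> D.cl e" unfolding D.cl_eq[OF e] using e by simp
  have "FOb F c = \<Union> ((\<lambda>e. D'.cl (nob e)) ` c)" for c
    unfolding hc_map_def Let_def nob_def by (simp add: image_image)
  then show ?thesis using 1 2 by blast
qed

abbreviation "Gr \<equiv> D.Gr"
abbreviation "Rl \<equiv> D.Rl"
abbreviation "Gr' \<equiv> D'.Gr"
abbreviation "Rl' \<equiv> D'.Rl"

lemma F_graph_map: "graph_map Gr Gr' (FOb F) nar"
proof -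
  have "nar e \<in> Arr D'.E \<and> Dom D'.E (nar e) = nob (Dom D.E e) \<and> Cod D'.E (nar e) = nob (Cod D.E e)" if "e \<in> Arr D.E" for e
    using HomD[OF nar_Hom[OF Arr_Hom[OF that]]] .
  then show ?thesis
    unfolding graph_map_def coeq_graph_sel hc_ob_class_def[symmetric]
    using F_ob_cl nob_Obj cat_dom[OF D.E_category] cat_cod[OF D.E_category] by auto
qed

lemma um_natural:
  assumes \<phi>: "\<phi> \<in> Hom I i j" and p: "p \<in> Hom (D.pi j) \<psi> \<chi>"
  shows "FAr (fund_map (under_cat I i) (under_map I \<phi>)) p \<in> Hom (D.pi i) (Comp I \<psi> \<phi>) (Comp I \<chi> \<phi>)"
  using functor_hom[OF fund_map_functor[OF under_map_functor[OF D.I \<phi>]] p] by (simp add: fund_map_def under_map_def)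

lemma pi_HomD: "p \<in> Hom (D.pi i) \<psi> \<chi> \<Longrightarrow> \<psi> \<in> Hom I i (Cod I \<psi>) \<and> \<chi> \<in> Hom I i (Cod I \<chi>)"
  using Hom_objD[OF D.pi_category] by (auto simp: under_cat_Obj Hom_def)

lemma path_class_gen':
  "e \<in> Hom D'.E a b \<Longrightarrow> path_class Gr' Rl' (D'.cl a, [e], D'.cl b) = D'.gen e"
  using HomD[of e D'.E a b] by (simp add: D'.gen_edge_arr edge_arr_def coeq_graph_sel hc_ob_class_def)

text \<open>Each relation is verified as an equality of arrows of the target, where the composition,
  identity and coequalizer laws for \<open>gen\<close> are available; \<open>path_class_eqD\<close>
  turns the equality back into a congruence.\<close>

lemma F_respects: "respects_rels Gr Rl Gr' Rl' (FOb F) nar"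
  unfolding respects_rels_def
proof (intro allI impI)
  fix p q assume pq: "(p, q) \<in> Rl" "p \<in> paths Gr" "q \<in> paths Gr"
  let ?pm = "path_map (FOb F) nar"
  have P: "?pm p \<in> paths Gr'" "?pm q \<in> paths Gr'" using path_map_paths[OF F_graph_map] pq by auto
  note narc = nar_Hom[OF Arr_Hom]
  from pq(1) have "path_class Gr' Rl' (?pm p) = path_class Gr' Rl' (?pm q)"
  proof (cases rule: D.coeq_rels_cases)
    case (c e e')
    have o: "Dom D.E e \<in> Obj D.E" "Cod D.E e' \<in> Obj D.E"
      using c cat_dom[OF D.E_category] cat_cod[OF D.E_category] by auto
    have e: "e \<in> Hom D.E (Dom D.E e) (Dom D.E e')" "e' \<in> Hom D.E (Dom D.E e') (Cod D.E e')" using c by (auto simp: Hom_def)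
    have n: "nar (Comp D.E e' e) = Comp D'.E (nar e') (nar e)"
    proof -
      obtain i g f x y \<psi> \<chi> where 1: "e = (i, g, f)" "i \<in> Obj I" "g \<in> Hom (G i) x y" "f \<in> Hom (D.pi i) \<psi> \<chi>"
        "Dom D.E e = (i, x, \<psi>)" "Dom D.E e' = (i, y, \<chi>)" using D.E_HomE[OF c(1)] c(3) by metis
      obtain i' g' f' x' y' \<psi>' \<chi>' where 2: "e' = (i', g', f')" "i' \<in> Obj I" "g' \<in> Hom (G i') x' y'" 
        "Dom D.E e' = (i', x', \<psi>')" using D.E_HomE[OF c(2)] by metis
      have "i' = i" "x' = y" using 1(6) 2(4) by auto
      then show ?thesis using functor_comp[OF N_functor[OF 1(2)] 1(3), of g' y'] 2
        by (simp add: 1(1) D.E_Comp D'.E_Comp nar_def)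
    qed
    have "path_class Gr' Rl' (D'.cl (nob (Dom D.E e)), [nar e] @ [nar e'], D'.cl (nob (Cod D.E e'))) =
      Comp D'.M (D'.gen (nar e')) (D'.gen (nar e))"
      unfolding path_class_gen'[OF nar_Hom[OF e(1)], symmetric] path_class_gen'[OF nar_Hom[OF e(2)], symmetric] hocolim_def coequalizer_def
      by (rule presented_Comp[OF coeq_rels_parallel, symmetric])
        (use HomD[OF nar_Hom[OF e(1)]] HomD[OF nar_Hom[OF e(2)]] Hom_objD[OF D'.E_category nar_Hom[OF e(1)]] Hom_objD[OF D'.E_category nar_Hom[OF e(2)]]
          in \<open>auto simp: coeq_graph_sel hc_ob_class_def\<close>)
    moreover have "path_class Gr' Rl' (D'.cl (nob (Dom D.E e)), [nar (Comp D.E e' e)], D'.cl (nob (Cod D.E e'))) =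
       D'.gen (nar (Comp D.E e' e))"
      by (rule path_class_gen'[OF nar_Hom[OF cat_comp[OF D.E_category e]]])
    ultimately show ?thesis
      using D'.gen_Comp[OF nar_Hom[OF e(1)] nar_Hom[OF e(2)]] c o by (simp add: path_map_def F_ob_cl n)
  next
    case (i a)
    have na: "nar (Ident D.E a) = Ident D'.E (nob a)"
    proof -
      obtain j x \<psi> where a: "a = (j, x, \<psi>)" by (cases a)
      with i show ?thesis using functor_ident[OF N_functor] by (simp add: D.E_Obj nar_def nob_def D.E_Ident D'.E_Ident)
    qed
    have "path_class Gr' Rl' (D'.cl (nob a), [Ident D'.E (nob a)], D'.cl (nob a)) = Ident D'.M (D'.cl (nob a))"
      using path_class_gen'[OF cat_ident[OF D'.E_category nob_Obj[OF i(1)]]] D'.gen_Ident[OF nob_Obj[OF i(1)]] by simp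
    then show ?thesis using i by (simp add: path_map_def F_ob_cl na hocolim_def coequalizer_def presented_sel)
  next
    case (r i j \<phi> g x y f \<psi> \<chi>)
    let ?um = "FAr (fund_map (under_cat I i) (under_map I \<phi>)) f"
    have ij: "i \<in> Obj I" "j \<in> Obj I" using Hom_objD[OF D.I r(1)] by auto
    have xy: "x \<in> Obj (G i)" "y \<in> Obj (G i)" using Hom_objD[OF D.G_category[OF ij(1)] r(2)] by auto
    note c = pi_HomD[OF r(3)]
    note h = D.E_Hom[of i g ?um i x "Comp I \<psi> \<phi>" i y "Comp I \<chi> \<phi>", THEN iffD2]
      D.E_Hom[of j "FAr (T \<phi>) g" f j "FOb (T \<phi>) x" \<psi> j "FOb (T \<phi>) y" \<chi>, THEN iffD2]
    have h: "(i, g, ?um) \<in> Hom D.E (i, x, Comp I \<psi> \<phi>) (i, y, Comp I \<chi> \<phi>)"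
      "(j, FAr (T \<phi>) g, f) \<in> Hom D.E (j, FOb (T \<phi>) x, \<psi>) (j, FOb (T \<phi>) y, \<chi>)"
      using r ij um_natural[OF r(1,3)] D.T_hom[OF r(1,2)] by (simp_all add: D.E_Hom)
    note o = Hom_objD[OF D.E_category h(1)] Hom_objD[OF D.E_category h(2)]
    have cc: "Comp I \<psi> \<phi> \<in> Hom I i (Cod I \<psi>)" "Comp I \<chi> \<phi> \<in> Hom I i (Cod I \<chi>)" using cat_comp[OF D.I r(1)] c by auto
    have cls: "D'.cl (nob (i, x, Comp I \<psi> \<phi>)) = D'.cl (nob (j, FOb (T \<phi>) x, \<psi>))"
       "D'.cl (nob (i, y, Comp I \<chi> \<phi>)) = D'.cl (nob (j, FOb (T \<phi>) y, \<chi>))"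
      using o D'.cl_eq_iff[OF nob_Obj nob_Obj] hnf_nob D.T_Comp_ob[OF r(1) c[THEN conjunct1] xy(1)] D.T_Comp_ob[OF r(1) c[THEN conjunct2] xy(2)] HomD[OF cc(1)] HomD[OF cc(2)]
      by (simp_all add: D.hnf_def)
    have "D'.gen (nar (i, g, ?um)) = D'.gen (nar (j, FAr (T \<phi>) g, f))"
      using D'.gen_eq[OF r(1) functor_hom[OF N_functor[OF ij(1)] r(2)] r(3)] N_ar[OF r(1,2)] by (simp add: nar_def)
    then show ?thesis
      using path_class_gen'[OF nar_Hom[OF h(1)]] path_class_gen'[OF nar_Hom[OF h(2)]] o cls r
      by (simp add: path_map_def F_ob_cl)
  qed
  then show "(?pm p, ?pm q) \<in> path_cong Gr' Rl'" using path_class_eqD P by blast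
qed

lemma F_FAr: "FAr F = (\<lambda>c. path_cong Gr' Rl' `` (path_map (FOb F) nar ` c))"
  by (simp add: hc_map_def Let_def hc_cong_def nar_def)

lemma F_functor: "is_functor D.M D'.M F"
  unfolding hocolim_def coequalizer_def
  by (rule path_map_functor[OF F_graph_map F_respects coeq_rels_parallel coeq_rels_parallel _ F_FAr]) simp

lemma F_gen: "e \<in> Hom D.E a b \<Longrightarrow> FAr F (D.gen e) = D'.gen (nar e)"
  unfolding F_FAr D.gen_edge_arr D'.gen_edge_arr
  by (rule path_map_edge_arr[OF F_graph_map F_respects])
    (use HomD[of e D.E a b] Hom_objD[OF D.E_category, of e a b] in \<open>auto simp: coeq_graph_sel\<close>)

lemma F_hob: "i \<in> Obj I \<Longrightarrow> x \<in> Obj (G i) \<Longrightarrow> FOb F (D.hob i x) = D'.hob i (FOb (N i) x)"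
  using F_ob_cl[OF D.hob_E] by (simp add: D.hob_def D'.hob_def nob_def)

lemma F_hinc:
  assumes i: "i \<in> Obj I" and g: "g \<in> Hom (G i) x y"
  shows "FAr F (D.hinc i g) = D'.hinc i (FAr (N i) g)"
  unfolding D.hinc_def D'.hinc_def
  using F_gen[of "(i, g, Ident (D.pi i) (Ident I i))" "(i, x, Ident I i)" "(i, y, Ident I i)"] i g
    D.pi_Ident_Hom[OF cat_ident[OF D.I i]] by (simp add: D.E_Hom nar_def)

lemma F_hcan:
  assumes \<phi>: "\<phi> \<in> Hom I i j" and x: "x \<in> Obj (G i)"
  shows "FAr F (D.hcan \<phi> x) = D'.hcan \<phi> (FOb (N i) x)"
proof -
  have i: "i \<in> Obj I" using Hom_objD[OF D.I \<phi>] by auto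
  show ?thesis
    using F_gen[of "(i, Ident (G i) x, fund_gen (under_cat I i) (Ident I i, \<phi>, \<phi>))" "(i, x, Ident I i)" "(i, x, \<phi>)"] i
      cat_ident[OF D.G_category[OF i] x] fund_gen_Hom[OF under_cat_category[OF D.I] D.under_arr_id[OF \<phi>]]
      functor_ident[OF N_functor[OF i] x] HomD[OF \<phi>]
    by (simp add: D.E_Hom nar_def D.hcan_def D'.hcan_def)
qed

end

section \<open>The presheaf of homotopy colimits and the inclusions of the diagram\<close>

section \<open>Homotopy colimits of presheaves of groupoids\<close>

lemma gpsh_id: "is_gpsh C N \<Longrightarrow> X \<in> Obj C \<Longrightarrow> ftr_agree (Val N X) (Rst N (Ident C X)) ftr_id"
  and gpsh_comp: "is_gpsh C N \<Longrightarrow> h \<in> Hom C X Y \<Longrightarrow> k \<in> Hom C Y Z \<Longrightarrow>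
     ftr_agree (Val N Z) (Rst N (Comp C k h)) (ftr_comp (Rst N h) (Rst N k))"
  and gpsh_functor: "is_gpsh C N \<Longrightarrow> h \<in> Hom C X Y \<Longrightarrow> is_functor (Val N Y) (Val N X) (Rst N h)"
  by (auto simp: is_gpsh_def Hom_def)

locale pdiagram =
  fixes C :: "('c, 'a) site" and I :: "('i, 'j) cat" and U :: "('i, 'j, 'c, 'a, 'o, 'g) pdiag"
  assumes C: "is_category C" and I: "is_category I" and U: "is_pdiag C I U"
begin

abbreviation "GX X \<equiv> (\<lambda>i. Val (DOb U i) X)"
abbreviation "TX X \<equiv> (\<lambda>\<phi>. DAr U \<phi> X)"
abbreviation "MM \<equiv> hocolim_psh C I U"

lemma U_gpsh: "i \<in> Obj I \<Longrightarrow> is_gpsh C (DOb U i)"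
  using U by (simp add: is_pdiag_def)

lemma U_map: "\<phi> \<in> Hom I i j \<Longrightarrow> is_gpsh_map C (DOb U i) (DOb U j) (DAr U \<phi>)"
  using U by (auto simp: is_pdiag_def Hom_def)

lemma hc: "X \<in> Obj C \<Longrightarrow> hc_diagram I (GX X) (TX X)"
  using U I unfolding is_pdiag_def is_gpsh_def is_gpsh_map_def by unfold_locales auto

lemma hct: "h \<in> Hom C X Y \<Longrightarrow> hc_transformation I (GX Y) (TX Y) (GX X) (TX X) (\<lambda>i. Rst (DOb U i) h)"
proof (intro hc_transformation.intro hc_transformation_axioms.intro hc)
  assume h: "h \<in> Hom C X Y"
  show "Y \<in> Obj C" "X \<in> Obj C" using Hom_objD[OF C h] by auto
  show "is_functor (Val (DOb U i) Y) (Val (DOb U i) X) (Rst (DOb U i) h)" if "i \<in> Obj I" for i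
    using U_gpsh[OF that] h by (auto simp: is_gpsh_def Hom_def)
  show "ftr_agree (Val (DOb U (Dom I \<phi>)) Y) (ftr_comp (DAr U \<phi> X) (Rst (DOb U (Dom I \<phi>)) h))
      (ftr_comp (Rst (DOb U (Cod I \<phi>)) h) (DAr U \<phi> Y))" if "\<phi> \<in> Arr I" for \<phi>
    using U_map[OF Arr_Hom[OF that]] h by (auto simp: is_gpsh_map_def Hom_def)
qed

abbreviation "hobX X \<equiv> hc_diagram.hob I (GX X) (TX X)"
abbreviation "hincX X \<equiv> hc_diagram.hinc I (GX X) (TX X)"
abbreviation "hcanX X \<equiv> hc_diagram.hcan I (GX X) (TX X)"

lemma MM_sel: "Val MM X = hocolim I (GX X) (TX X)"
  "h \<in> Hom C X Y \<Longrightarrow> Rst MM h = hc_map I (GX X) (TX X) (\<lambda>i. Rst (DOb U i) h)"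
  by (auto simp: hocolim_psh_def Hom_def)

lemma ftr_id_functor: "is_category A \<Longrightarrow> is_functor A A ftr_id"
  by (simp add: is_functor_def ftr_id_def Arr_Hom)

lemma ftr_comp_functor: "is_functor A B F \<Longrightarrow> is_functor B D G \<Longrightarrow> is_functor A D (ftr_comp G F)"
  unfolding is_functor_def by (auto simp: ftr_comp_def Hom_def)

lemma MM_functor:
  assumes h: "h \<in> Hom C X Y"
  shows "is_functor (Val MM Y) (Val MM X) (Rst MM h)"
  using hc_transformation.F_functor[OF hct[OF h]] by (simp add: MM_sel(1) MM_sel(2)[OF h])

text \<open>The identity and composition laws are equalities of functors out of a homotopy colimit.
  By \<open>functor_eqI\<close> they need to be tested on generators only, where they become the
  laws of the individual \<open>U i\<close>.\<close>

lemma MM_gpsh: "is_gpsh C MM"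
  unfolding is_gpsh_def
proof (intro conjI ballI impI)
  fix X assume X: "X \<in> Obj C"
  interpret D: hc_diagram I "GX X" "TX X" by (rule hc[OF X])
  show "is_groupoid (Val MM X)" using D.M_groupoid by (simp add: MM_sel)
  note id = cat_ident[OF C X]
  interpret T: hc_transformation I "GX X" "TX X" "GX X" "TX X" "\<lambda>i. Rst (DOb U i) (Ident C X)" by (rule hct[OF id])
  note ag = ftr_agree_ob[OF gpsh_id[OF U_gpsh X]] ftr_agree_ar[OF gpsh_id[OF U_gpsh X]]
  show "ftr_agree (Val MM X) (Rst MM (Ident C X)) ftr_id"
    unfolding MM_sel(1) MM_sel(2)[OF id]
  proof (rule D.functor_eqI[OF T.F_functor ftr_id_functor[OF D.M_category]])
    show "FOb T.F (D.hob i x) = FOb ftr_id (D.hob i x)" if "i \<in> Obj I" "x \<in> Obj (GX X i)" for i x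
      using T.F_hob[OF that] ag(1)[OF that] by (simp add: ftr_id_def)
    show "FAr T.F (D.hinc i g) = FAr ftr_id (D.hinc i g)" if "i \<in> Obj I" "g \<in> Hom (GX X i) x y" for i g x y
      using T.F_hinc[OF that] ag(2)[OF that(1)] HomD[OF that(2)] by (simp add: ftr_id_def)
    show "FAr T.F (D.hcan \<phi> x) = FAr ftr_id (D.hcan \<phi> x)" if "\<phi> \<in> Hom I i j" "x \<in> Obj (GX X i)" for \<phi> i j x
      using T.F_hcan[OF that] ag(1)[OF _ that(2)] Hom_objD[OF I that(1)] by (simp add: ftr_id_def)
  qed
next
  fix h assume "h \<in> Arr C"
  then show "is_functor (Val MM (Cod C h)) (Val MM (Dom C h)) (Rst MM h)" using MM_functor[OF Arr_Hom] by blast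
next
  fix h k assume "h \<in> Arr C" "k \<in> Arr C" "Dom C k = Cod C h"
  then obtain X Y Z where h: "h \<in> Hom C X Y" and k: "k \<in> Hom C Y Z" and Z: "Cod C k = Z" by (auto simp: Hom_def)
  note kh = cat_comp[OF C h k]
  have o: "X \<in> Obj C" "Y \<in> Obj C" "Z \<in> Obj C" using Hom_objD[OF C h] Hom_objD[OF C k] by auto
  interpret DX: hc_diagram I "GX X" "TX X" by (rule hc[OF o(1)])
  interpret DY: hc_diagram I "GX Y" "TX Y" by (rule hc[OF o(2)])
  interpret D: hc_diagram I "GX Z" "TX Z" by (rule hc[OF o(3)])
  interpret H: hc_transformation I "GX Y" "TX Y" "GX X" "TX X" "\<lambda>i. Rst (DOb U i) h" by (rule hct[OF h])
  interpret K: hc_transformation I "GX Z" "TX Z" "GX Y" "TX Y" "\<lambda>i. Rst (DOb U i) k" by (rule hct[OF k])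
  interpret KH: hc_transformation I "GX Z" "TX Z" "GX X" "TX X" "\<lambda>i. Rst (DOb U i) (Comp C k h)" by (rule hct[OF kh])
  have ago: "FOb (Rst (DOb U i) (Comp C k h)) x = FOb (Rst (DOb U i) h) (FOb (Rst (DOb U i) k) x)"
    if "i \<in> Obj I" "x \<in> Obj (GX Z i)" for i x
    using ftr_agree_ob[OF gpsh_comp[OF U_gpsh[OF that(1)] h k] that(2)] by (simp add: ftr_comp_def)
  have aga: "FAr (Rst (DOb U i) (Comp C k h)) x = FAr (Rst (DOb U i) h) (FAr (Rst (DOb U i) k) x)"
    if "i \<in> Obj I" "x \<in> Arr (GX Z i)" for i x
    using ftr_agree_ar[OF gpsh_comp[OF U_gpsh[OF that(1)] h k] that(2)] by (simp add: ftr_comp_def)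
  note ko = functor_ob[OF K.N_functor] and kha = functor_hom[OF K.N_functor]
  show "ftr_agree (Val MM (Cod C k)) (Rst MM (Comp C k h)) (ftr_comp (Rst MM h) (Rst MM k))"
    unfolding Z MM_sel(1) MM_sel(2)[OF kh] MM_sel(2)[OF h] MM_sel(2)[OF k]
  proof (rule D.functor_eqI[OF KH.F_functor ftr_comp_functor[OF K.F_functor H.F_functor]])
    show "FOb KH.F (D.hob i x) = FOb (ftr_comp H.F K.F) (D.hob i x)" if "i \<in> Obj I" "x \<in> Obj (GX Z i)" for i x
      using KH.F_hob[OF that] K.F_hob[OF that] H.F_hob[OF that(1) ko[OF that]] ago[OF that] by (simp add: ftr_comp_def)
    show "FAr KH.F (D.hinc i g) = FAr (ftr_comp H.F K.F) (D.hinc i g)" if "i \<in> Obj I" "g \<in> Hom (GX Z i) x y" for i g x y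
      using KH.F_hinc[OF that] K.F_hinc[OF that] H.F_hinc[OF that(1) kha[OF that]] aga[OF that(1)] HomD[OF that(2)]
      by (simp add: ftr_comp_def)
    show "FAr KH.F (D.hcan \<phi> x) = FAr (ftr_comp H.F K.F) (D.hcan \<phi> x)" if "\<phi> \<in> Hom I i j" "x \<in> Obj (GX Z i)" for \<phi> i j x
    proof -
      have i: "i \<in> Obj I" using Hom_objD[OF I that(1)] by auto
      show ?thesis using KH.F_hcan[OF that] K.F_hcan[OF that] H.F_hcan[OF that(1) ko[OF i that(2)]] ago[OF i that(2)]
        by (simp add: ftr_comp_def)
    qed
  qed
qed

lemma incl_sel: "FOb (hc_incl I U i X) x = hobX X i x" "FAr (hc_incl I U i X) g = hincX X i g" if "X \<in> Obj C"
proof -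
  interpret D: hc_diagram I "GX X" "TX X" by (rule hc[OF that])
  show "FOb (hc_incl I U i X) x = hobX X i x" "FAr (hc_incl I U i X) g = hincX X i g"
    by (simp_all add: hc_incl_def Let_def D.hob_def D.hinc_def)
qed

lemma incl_gpsh_map:
  assumes i: "i \<in> Obj I"
  shows "is_gpsh_map C (DOb U i) MM (hc_incl I U i)"
  unfolding is_gpsh_map_def
proof (intro conjI ballI)
  fix X assume X: "X \<in> Obj C"
  interpret D: hc_diagram I "GX X" "TX X" by (rule hc[OF X])
  show "is_functor (Val (DOb U i) X) (Val MM X) (hc_incl I U i X)"
    unfolding MM_sel
    by (rule is_functorI[OF D.G_category[OF i] D.M_category])
      (simp_all add: incl_sel[OF X] D.hob_Obj[OF i] D.hinc_Hom[OF i] D.hinc_Ident[OF i] D.hinc_Comp[OF i])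
next
  fix h assume "h \<in> Arr C"
  then obtain X Y where h: "h \<in> Hom C X Y" and hXY: "Dom C h = X" "Cod C h = Y" by (auto simp: Hom_def)
  have o: "X \<in> Obj C" "Y \<in> Obj C" using Hom_objD[OF C h] by auto
  interpret H: hc_transformation I "GX Y" "TX Y" "GX X" "TX X" "\<lambda>i. Rst (DOb U i) h" by (rule hct[OF h])
  show "ftr_agree (Val (DOb U i) (Cod C h)) (ftr_comp (hc_incl I U i (Dom C h)) (Rst (DOb U i) h))
      (ftr_comp (Rst MM h) (hc_incl I U i (Cod C h)))"
    unfolding hXY MM_sel(2)[OF h] ftr_agree_def
    by (simp add: ftr_comp_def incl_sel o H.F_hob[OF i] H.F_hinc[OF i Arr_Hom])
qed

end

section \<open>Slice sites, cartesian arrows and the sheaf condition\<close>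

section \<open>Slices and sheaves on them\<close>

lemma slice_sel:
  "Obj (slice C N) = {(X, x). X \<in> Obj C \<and> x \<in> Obj (Val N X)}"
  "Dom (slice C N) (s, t, h, \<alpha>) = s" "Cod (slice C N) (s, t, h, \<alpha>) = t"
  "Ident (slice C N) (X, x) = ((X, x), (X, x), Ident C X, Ident (Val N X) x)"
  "Comp (slice C N) (s', t', k, \<beta>) ((X, x), t, h, \<alpha>) =
    ((X, x), t', Comp C k h, Comp (Val N X) (FAr (Rst N h) \<beta>) \<alpha>)"
  by (simp_all add: slice_def Let_def)

lemma slice_Hom:
  "e \<in> Hom (slice C N) (X, x) (Y, y) \<longleftrightarrow> (\<exists>h \<alpha>. e = ((X, x), (Y, y), h, \<alpha>) \<and>
     X \<in> Obj C \<and> x \<in> Obj (Val N X) \<and> Y \<in> Obj C \<and> y \<in> Obj (Val N Y) \<and>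
     h \<in> Hom C X Y \<and> \<alpha> \<in> Hom (Val N X) x (FOb (Rst N h) y))"
  by (auto simp: slice_def Let_def Hom_def)

lemma slice_HomE:
  assumes "e \<in> Hom (slice C N) (X, x) (Y, y)"
  obtains h \<alpha> where "e = ((X, x), (Y, y), h, \<alpha>)" "X \<in> Obj C" "x \<in> Obj (Val N X)" "Y \<in> Obj C" "y \<in> Obj (Val N Y)"
     "h \<in> Hom C X Y" "\<alpha> \<in> Hom (Val N X) x (FOb (Rst N h) y)"
  using assms unfolding slice_Hom by blast

lemma slice_ArrE:
  assumes "e \<in> Arr (slice C N)"
  obtains X x Y y where "e \<in> Hom (slice C N) (X, x) (Y, y)"
  using assms by (auto simp: slice_def Let_def Hom_def)

lemma slice_Cov: "c \<in> Cov (slice C N) (X, x) \<longleftrightarrow>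
    (\<forall>e\<in>c. e \<in> Arr (slice C N) \<and> Cod (slice C N) e = (X, x)) \<and> (\<lambda>(s, t, h, \<alpha>). h) ` c \<in> Cov C X"
  by (auto simp: slice_def Let_def)

lemma slice_map_sel:
  "FOb (slice_map \<phi>) (X, x) = (X, FOb (\<phi> X) x)"
  "FAr (slice_map \<phi>) ((X, x), (Y, y), h, \<alpha>) = ((X, FOb (\<phi> X) x), (Y, FOb (\<phi> Y) y), h, FAr (\<phi> X) \<alpha>)"
  by (simp_all add: slice_map_def)

text \<open>The chosen cartesian lift of \<open>h\<close> with target \<open>y\<close>, for the
  projection of the slice to \<open>C\<close>. The choice is split: by \<open>cart_Comp\<close> and
  \<open>cart_Ident\<close> the lifts compose strictly.\<close>

definition cart :: "('c, 'a, 'z) cat_scheme \<Rightarrow> ('c, 'a, 'o, 'g) gpsh \<Rightarrow> 'a \<Rightarrow> 'o \<Rightarrow> ('c, 'a, 'o, 'g) sl_arr" where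
  "cart C N h y = ((Dom C h, FOb (Rst N h) y), (Cod C h, y), h, Ident (Val N (Dom C h)) (FOb (Rst N h) y))"

text \<open>Arrows over an identity of \<open>C\<close>. They are invertible because the fibres are
  groupoids, and every arrow of the slice is a vertical arrow followed by a cartesian one
  (\<open>cart_vert\<close>).\<close>

definition vert :: "('c, 'a, 'z) cat_scheme \<Rightarrow> ('c, 'a, 'o, 'g) gpsh \<Rightarrow> 'c \<Rightarrow> 'g \<Rightarrow> ('c, 'a, 'o, 'g) sl_arr" where
  "vert C N X \<alpha> = ((X, Dom (Val N X) \<alpha>), (X, Cod (Val N X) \<alpha>), Ident C X, \<alpha>)"

locale gpsh_on =
  fixes C :: "('c, 'a) site" and N :: "('c, 'a, 'o, 'g) gpsh"
  assumes C: "is_category C" and N: "is_gpsh C N"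
begin

abbreviation "S \<equiv> slice C N"

lemma V_groupoid: "X \<in> Obj C \<Longrightarrow> is_groupoid (Val N X)"
  using N by (simp add: is_gpsh_def)

lemma V_category: "X \<in> Obj C \<Longrightarrow> is_category (Val N X)"
  by (rule groupoid_category[OF V_groupoid])

lemma R_functor: "h \<in> Hom C X Y \<Longrightarrow> is_functor (Val N Y) (Val N X) (Rst N h)"
  by (rule gpsh_functor[OF N])

lemma R_ob: "h \<in> Hom C X Y \<Longrightarrow> y \<in> Obj (Val N Y) \<Longrightarrow> FOb (Rst N h) y \<in> Obj (Val N X)"
  by (rule functor_ob[OF R_functor])

lemma R_id: "X \<in> Obj C \<Longrightarrow> ftr_agree (Val N X) (Rst N (Ident C X)) ftr_id"
  and R_comp: "h \<in> Hom C X Y \<Longrightarrow> k \<in> Hom C Y Z \<Longrightarrow>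
     ftr_agree (Val N Z) (Rst N (Comp C k h)) (ftr_comp (Rst N h) (Rst N k))"
  by (rule gpsh_id[OF N], assumption) (rule gpsh_comp[OF N])

lemma R_id_ob: "X \<in> Obj C \<Longrightarrow> x \<in> Obj (Val N X) \<Longrightarrow> FOb (Rst N (Ident C X)) x = x"
  and R_id_ar: "X \<in> Obj C \<Longrightarrow> a \<in> Arr (Val N X) \<Longrightarrow> FAr (Rst N (Ident C X)) a = a"
  using ftr_agree_ob[OF R_id] ftr_agree_ar[OF R_id] by (simp_all add: ftr_id_def)

lemma R_comp_ob: "h \<in> Hom C X Y \<Longrightarrow> k \<in> Hom C Y Z \<Longrightarrow> z \<in> Obj (Val N Z) \<Longrightarrow>
    FOb (Rst N (Comp C k h)) z = FOb (Rst N h) (FOb (Rst N k) z)"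
  and R_comp_ar: "h \<in> Hom C X Y \<Longrightarrow> k \<in> Hom C Y Z \<Longrightarrow> a \<in> Arr (Val N Z) \<Longrightarrow>
    FAr (Rst N (Comp C k h)) a = FAr (Rst N h) (FAr (Rst N k) a)"
  using ftr_agree_ob[OF R_comp] ftr_agree_ar[OF R_comp] by (simp_all add: ftr_comp_def)

lemma slice_category: "is_category S"
proof (rule is_categoryI)
  show "Dom S f \<in> Obj S \<and> Cod S f \<in> Obj S" if f0: "f \<in> Arr S" for f
  proof -
    obtain X x Y y where f: "f \<in> Hom S (X, x) (Y, y)" by (rule slice_ArrE[OF f0])
    then show ?thesis using HomD[OF f] unfolding slice_Hom by (auto simp: slice_sel)
  qed
  show "Ident S x \<in> Hom S x x" if x: "x \<in> Obj S" for x
  proof -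
    obtain X y where x': "x = (X, y)" "X \<in> Obj C" "y \<in> Obj (Val N X)" using x by (auto simp: slice_sel)
    show ?thesis unfolding x' slice_sel slice_Hom
      using x' cat_ident[OF C x'(2)] cat_ident[OF V_category x'(3)] R_id_ob by simp
  qed
  show "Comp S g f \<in> Hom S x z" if f: "f \<in> Hom S x y" and g: "g \<in> Hom S y z" for f g x y z
  proof -
    obtain X x' Y y' Z z' where xyz: "x = (X, x')" "y = (Y, y')" "z = (Z, z')" by (metis prod.exhaust)
    obtain h \<alpha> where ff: "f = ((X, x'), (Y, y'), h, \<alpha>)" "X \<in> Obj C" "x' \<in> Obj (Val N X)" "Y \<in> Obj C" "y' \<in> Obj (Val N Y)" "h \<in> Hom C X Y" "\<alpha> \<in> Hom (Val N X) x' (FOb (Rst N h) y')"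
      by (rule slice_HomE[OF f[unfolded xyz]])
    obtain k \<beta> where gg: "g = ((Y, y'), (Z, z'), k, \<beta>)" "Y \<in> Obj C" "y' \<in> Obj (Val N Y)" "Z \<in> Obj C" "z' \<in> Obj (Val N Z)" "k \<in> Hom C Y Z" "\<beta> \<in> Hom (Val N Y) y' (FOb (Rst N k) z')"
      by (rule slice_HomE[OF g[unfolded xyz]])
    note f' = ff(1,2,3,6,7) and g' = gg(1,4,5,6,7)
    have "FAr (Rst N h) \<beta> \<in> Hom (Val N X) (FOb (Rst N h) y') (FOb (Rst N (Comp C k h)) z')"
      using functor_hom[OF R_functor[OF f'(4)] g'(5)] R_comp_ob[OF f'(4) g'(4,3)] by simp
    then show ?thesis unfolding xyz slice_Hom f'(1) g'(1) slice_sel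
      by (simp add: f' g' cat_comp[OF C f'(4) g'(4)] cat_comp[OF V_category[OF f'(2)] f'(5)])
  qed
  show "Comp S f (Ident S x) = f" "Comp S (Ident S y) f = f" if f: "f \<in> Hom S x y" for f x y
  proof -
    obtain X x' Y y' where xyz: "x = (X, x')" "y = (Y, y')" by (metis prod.exhaust)
    obtain h \<alpha> where ff: "f = ((X, x'), (Y, y'), h, \<alpha>)" "X \<in> Obj C" "x' \<in> Obj (Val N X)" "Y \<in> Obj C" "y' \<in> Obj (Val N Y)" "h \<in> Hom C X Y" "\<alpha> \<in> Hom (Val N X) x' (FOb (Rst N h) y')"
      by (rule slice_HomE[OF f[unfolded xyz]])
    note f' = ff(1,2,3,6,7,4,5)
    show "Comp S f (Ident S x) = f" "Comp S (Ident S y) f = f"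
      unfolding xyz f'(1) slice_sel
      using R_id_ar[OF f'(2)] HomD[OF f'(5)] cat_unit_right[OF C f'(4)] cat_unit_left[OF C f'(4)]
        cat_unit_right[OF V_category[OF f'(2)] f'(5)] cat_unit_left[OF V_category[OF f'(2)] f'(5)]
        functor_ident[OF R_functor[OF f'(4)] f'(7)] by simp_all
  qed
  show "Comp S h (Comp S g f) = Comp S (Comp S h g) f"
    if f: "f \<in> Hom S x y" and g: "g \<in> Hom S y z" and h: "h \<in> Hom S z w" for f g h x y z w
  proof -
    obtain X x' Y y' Z z' W w' where xyz: "x = (X, x')" "y = (Y, y')" "z = (Z, z')" "w = (W, w')" by (metis prod.exhaust)
    obtain h0 \<alpha> where ff: "f = ((X, x'), (Y, y'), h0, \<alpha>)" "X \<in> Obj C" "x' \<in> Obj (Val N X)" "Y \<in> Obj C" "y' \<in> Obj (Val N Y)" "h0 \<in> Hom C X Y" "\<alpha> \<in> Hom (Val N X) x' (FOb (Rst N h0) y')"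
      by (rule slice_HomE[OF f[unfolded xyz]])
    obtain k \<beta> where gg: "g = ((Y, y'), (Z, z'), k, \<beta>)" "Y \<in> Obj C" "y' \<in> Obj (Val N Y)" "Z \<in> Obj C" "z' \<in> Obj (Val N Z)" "k \<in> Hom C Y Z" "\<beta> \<in> Hom (Val N Y) y' (FOb (Rst N k) z')"
      by (rule slice_HomE[OF g[unfolded xyz]])
    obtain l \<gamma> where hh: "h = ((Z, z'), (W, w'), l, \<gamma>)" "Z \<in> Obj C" "z' \<in> Obj (Val N Z)" "W \<in> Obj C" "w' \<in> Obj (Val N W)" "l \<in> Hom C Z W" "\<gamma> \<in> Hom (Val N Z) z' (FOb (Rst N l) w')"
      by (rule slice_HomE[OF h[unfolded xyz]])
    note f' = ff(1,2,6,7) and g' = gg(1,2,6,7,5) and h' = hh(1,6,7,5)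
    note Rh = R_functor[OF f'(3)] and Rk = R_functor[OF g'(3)]
    have 1: "FAr (Rst N (Comp C k h0)) \<gamma> = FAr (Rst N h0) (FAr (Rst N k) \<gamma>)"
      using R_comp_ar[OF f'(3) g'(3)] HomD[OF h'(3)] by simp
    have 2: "FAr (Rst N h0) (Comp (Val N Y) (FAr (Rst N k) \<gamma>) \<beta>) = Comp (Val N X) (FAr (Rst N h0) (FAr (Rst N k) \<gamma>)) (FAr (Rst N h0) \<beta>)"
      by (rule functor_comp[OF Rh g'(4) functor_hom[OF Rk h'(3)]])
    show ?thesis unfolding f'(1) g'(1) h'(1) slice_sel 1 2
      using cat_assoc[OF C f'(3) g'(3) h'(2)]
        cat_assoc[OF V_category[OF f'(2)] f'(4) functor_hom[OF Rh g'(4)] functor_hom[OF Rh functor_hom[OF Rk h'(3)]]]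
      by simp
  qed
qed

lemma cart_Hom: "h \<in> Hom C X Y \<Longrightarrow> y \<in> Obj (Val N Y) \<Longrightarrow> cart C N h y \<in> Hom S (X, FOb (Rst N h) y) (Y, y)"
  using HomD[of h C X Y] Hom_objD[OF C, of h X Y] cat_ident[OF V_category, of X "FOb (Rst N h) y"] R_ob[of h X Y y]
  by (simp add: cart_def slice_Hom)

lemma vert_Hom: "X \<in> Obj C \<Longrightarrow> \<alpha> \<in> Hom (Val N X) x x' \<Longrightarrow> vert C N X \<alpha> \<in> Hom S (X, x) (X, x')"
  using HomD[of \<alpha> "Val N X" x x'] Hom_objD[OF V_category, of X \<alpha> x x'] cat_ident[OF C] R_id_ob[of X x']
  by (simp add: vert_def slice_Hom)

lemma vert_Comp:
  assumes "X \<in> Obj C" "\<alpha> \<in> Hom (Val N X) x y" "\<beta> \<in> Hom (Val N X) y z"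
  shows "Comp S (vert C N X \<beta>) (vert C N X \<alpha>) = vert C N X (Comp (Val N X) \<beta> \<alpha>)"
  using assms HomD[OF assms(2)] HomD[OF assms(3)] HomD[OF cat_comp[OF V_category assms(2,3)]] R_id_ar
    cat_unit_left[OF C cat_ident[OF C assms(1)]]
  by (simp add: vert_def slice_sel)

lemma vert_Ident: "X \<in> Obj C \<Longrightarrow> x \<in> Obj (Val N X) \<Longrightarrow> vert C N X (Ident (Val N X) x) = Ident S (X, x)"
  using cat_identD[OF V_category] by (simp add: vert_def slice_sel)

lemma cart_vert:
  assumes "((X, x), (Y, y), h, \<alpha>) \<in> Hom S (X, x) (Y, y)"
  shows "Comp S (cart C N h y) (vert C N X \<alpha>) = ((X, x), (Y, y), h, \<alpha>)"
proof -
  have a: "X \<in> Obj C" "y \<in> Obj (Val N Y)" "h \<in> Hom C X Y" "\<alpha> \<in> Hom (Val N X) x (FOb (Rst N h) y)"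
    using assms by (auto simp: slice_Hom)
  show ?thesis
    using a HomD[OF a(3)] HomD[OF a(4)] cat_unit_right[OF C a(3)] cat_unit_left[OF V_category a(4)]
      cat_identD[OF V_category R_ob[OF a(3,2)]] R_id_ar
    by (simp add: vert_def cart_def slice_sel)
qed

lemma cart_Comp:
  assumes h: "h \<in> Hom C X Y" and k: "k \<in> Hom C Y Z" and z: "z \<in> Obj (Val N Z)"
  shows "Comp S (cart C N k z) (cart C N h (FOb (Rst N k) z)) = cart C N (Comp C k h) z"
proof -
  have o: "X \<in> Obj C" using Hom_objD[OF C h] by auto
  note w = R_ob[OF h R_ob[OF k z]]
  show ?thesis
    using HomD[OF h] HomD[OF k] HomD[OF cat_comp[OF C h k]] functor_ident[OF R_functor[OF h] R_ob[OF k z]]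
      R_comp_ob[OF h k z] cat_unit_left[OF V_category[OF o] cat_ident[OF V_category[OF o] w]]
    by (simp add: cart_def slice_sel)
qed

text \<open>The exchange law behind the composition of factored arrows: a vertical arrow moves past
  a cartesian one by being restricted along \<open>h\<close>.\<close>

lemma vert_cart:
  assumes h: "h \<in> Hom C X Y" and \<beta>: "\<beta> \<in> Hom (Val N Y) y y'"
  shows "Comp S (vert C N Y \<beta>) (cart C N h y) = Comp S (cart C N h y') (vert C N X (FAr (Rst N h) \<beta>))"
proof -
  have o: "X \<in> Obj C" "Y \<in> Obj C" using Hom_objD[OF C h] by auto
  have y: "y \<in> Obj (Val N Y)" "y' \<in> Obj (Val N Y)" using Hom_objD[OF V_category[OF o(2)] \<beta>] by auto
  note b = functor_hom[OF R_functor[OF h] \<beta>]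
  show ?thesis
    using HomD[OF h] HomD[OF \<beta>] HomD[OF b] cat_unit_left[OF C h] cat_unit_right[OF C h]
      cat_unit_right[OF V_category[OF o(1)] b] cat_unit_left[OF V_category[OF o(1)] b]
      R_id_ar[OF o(1)] cat_identD[OF V_category[OF o(1)] R_ob[OF h y(2)]]
    by (simp add: cart_def vert_def slice_sel)
qed

lemma cart_Ident: "X \<in> Obj C \<Longrightarrow> x \<in> Obj (Val N X) \<Longrightarrow> cart C N (Ident C X) x = Ident S (X, x)"
  using cat_identD[OF C] R_id_ob by (simp add: cart_def slice_sel)

end

lemma psh_Restr_Comp: "is_presheaf S F \<Longrightarrow> f \<in> Hom S x y \<Longrightarrow> g \<in> Hom S y z \<Longrightarrow> m \<in> Sec F z \<Longrightarrow>
    Restr F (Comp S g f) m = Restr F f (Restr F g m)"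
  and psh_Restr_closed: "is_presheaf S F \<Longrightarrow> f \<in> Hom S x y \<Longrightarrow> m \<in> Sec F y \<Longrightarrow> Restr F f m \<in> Sec F x"
  and psh_Restr_Ident: "is_presheaf S F \<Longrightarrow> x \<in> Obj S \<Longrightarrow> m \<in> Sec F x \<Longrightarrow> Restr F (Ident S x) m = m"
  by (auto simp: is_presheaf_def Hom_def Pi_iff)

lemma is_sheafD:
  assumes "is_sheaf S F" "x \<in> Obj S" "c \<in> Cov S x" "\<And>f. f \<in> c \<Longrightarrow> s f \<in> Sec F (Dom S f)"
    and "\<And>f g h k. f \<in> c \<Longrightarrow> g \<in> c \<Longrightarrow> h \<in> Arr S \<Longrightarrow> k \<in> Arr S \<Longrightarrow>
           Cod S h = Dom S f \<and> Cod S k = Dom S g \<and> Dom S h = Dom S k \<and> Comp S f h = Comp S g k \<Longrightarrow>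
           Restr F h (s f) = Restr F k (s g)"
  shows "\<exists>!m. m \<in> Sec F x \<and> (\<forall>f\<in>c. Restr F f m = s f)"
proof -
  note * = bspec[OF bspec[OF conjunct2[OF assms(1)[unfolded is_sheaf_def]] assms(2)] assms(3), THEN spec, of s]
  show ?thesis by (rule mp[OF *]) (rule conjI; intro ballI allI impI; rule assms(4,5); assumption)
qed

text \<open>The sheaf condition at \<open>(X, x)\<close> in which both the cover and the test arrows
  are chosen cartesian lifts. Slice maps preserve these lifts strictly, so this form of the
  condition transfers along them.\<close>

definition cart_glues ::
  "('c, 'a) site \<Rightarrow> ('c, 'a, 'o, 'g) gpsh \<Rightarrow> ('c \<times> 'o, ('c, 'a, 'o, 'g) sl_arr, 'v, 'z) psh \<Rightarrow> 'c \<Rightarrow> 'o \<Rightarrow> bool" where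
  "cart_glues C N F X x \<longleftrightarrow> (\<forall>c\<in>Cov C X. \<forall>s.
     (\<forall>u\<in>c. s u \<in> Sec F (Dom C u, FOb (Rst N u) x)) \<and>
     (\<forall>u\<in>c. \<forall>v\<in>c. \<forall>h k W. h \<in> Hom C W (Dom C u) \<and> k \<in> Hom C W (Dom C v) \<and> Comp C u h = Comp C v k \<longrightarrow>
        Restr F (cart C N h (FOb (Rst N u) x)) (s u) = Restr F (cart C N k (FOb (Rst N v) x)) (s v)) \<longrightarrow>
     (\<exists>!m. m \<in> Sec F (X, x) \<and> (\<forall>u\<in>c. Restr F (cart C N u x) m = s u)))"

lemma cart_gluesD:
  assumes "cart_glues C N F X x" "c \<in> Cov C X" "\<And>u. u \<in> c \<Longrightarrow> s u \<in> Sec F (Dom C u, FOb (Rst N u) x)"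
    and "\<And>u v h k W. u \<in> c \<Longrightarrow> v \<in> c \<Longrightarrow> h \<in> Hom C W (Dom C u) \<and> k \<in> Hom C W (Dom C v) \<and> Comp C u h = Comp C v k \<Longrightarrow>
        Restr F (cart C N h (FOb (Rst N u) x)) (s u) = Restr F (cart C N k (FOb (Rst N v) x)) (s v)"
  shows "\<exists>!m. m \<in> Sec F (X, x) \<and> (\<forall>u\<in>c. Restr F (cart C N u x) m = s u)"
proof -
  note * = bspec[OF assms(1)[unfolded cart_glues_def] assms(2), THEN spec, of s]
  show ?thesis by (rule mp[OF *]) (rule conjI; intro ballI allI impI; rule assms(3,4); assumption)
qed

lemma site_cover_Hom: "is_site C \<Longrightarrow> X \<in> Obj C \<Longrightarrow> c \<in> Cov C X \<Longrightarrow> u \<in> c \<Longrightarrow> u \<in> Hom C (Dom C u) X"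
  by (auto simp: is_site_def Hom_def)

locale gpsh_on_site = gpsh_on C N for C :: "('c, 'a) site" and N :: "('c, 'a, 'o, 'g) gpsh" +
  assumes Cov_arr: "\<And>X c u. X \<in> Obj C \<Longrightarrow> c \<in> Cov C X \<Longrightarrow> u \<in> c \<Longrightarrow> u \<in> Hom C (Dom C u) X"
begin

text \<open>An arbitrary test arrow is a vertical arrow followed by a cartesian one. Over an overlap
  of cartesian lifts the two test arrows have the same vertical part, so compatibility on cartesian
  test arrows gives it on all.\<close>

lemma sheaf_cart_glues:
  assumes F: "is_sheaf S F" and X: "X \<in> Obj C" and x: "x \<in> Obj (Val N X)"
  shows "cart_glues C N F X x"
  unfolding cart_glues_def
proof (intro ballI allI impI, elim conjE)
  fix c s assume c: "c \<in> Cov C X" and s: "\<forall>u\<in>c. s u \<in> Sec F (Dom C u, FOb (Rst N u) x)"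
    and compat: "\<forall>u\<in>c. \<forall>v\<in>c. \<forall>h k W. h \<in> Hom C W (Dom C u) \<and> k \<in> Hom C W (Dom C v) \<and> Comp C u h = Comp C v k \<longrightarrow>
        Restr F (cart C N h (FOb (Rst N u) x)) (s u) = Restr F (cart C N k (FOb (Rst N v) x)) (s v)"
  have P: "is_presheaf S F" using F by (simp add: is_sheaf_def)
  let ?c = "(\<lambda>u. cart C N u x) ` c"
  let ?s = "\<lambda>(t, t', h, \<alpha>). s h"
  have cu: "cart C N u x \<in> Hom S (Dom C u, FOb (Rst N u) x) (X, x)" if "u \<in> c" for u
    using cart_Hom[OF Cov_arr[OF X c that] x] .
  have su: "?s (cart C N u x) = s u" for u by (simp add: cart_def)
  have im: "(\<lambda>(s, t, h, \<alpha>). h) ` ?c = c" by (force simp: cart_def)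
  have cov: "?c \<in> Cov S (X, x)" unfolding slice_Cov im using c HomD[OF cu] by auto
  have "\<exists>!m. m \<in> Sec F (X, x) \<and> (\<forall>f\<in>?c. Restr F f m = ?s f)"
  proof (rule is_sheafD[OF F _ cov])
    show "(X, x) \<in> Obj S" using X x by (simp add: slice_sel)
    show "?s f \<in> Sec F (Dom S f)" if "f \<in> ?c" for f
    proof -
      from that obtain u where u: "u \<in> c" "f = cart C N u x" by blast
      then show ?thesis using s su HomD[OF cu[OF u(1)]] by simp
    qed
    fix f g h' k'
    assume "f \<in> ?c" "g \<in> ?c" and hk: "h' \<in> Arr S" "k' \<in> Arr S"
      and e: "Cod S h' = Dom S f \<and> Cod S k' = Dom S g \<and> Dom S h' = Dom S k' \<and> Comp S f h' = Comp S g k'"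
    then obtain u v where u: "u \<in> c" "f = cart C N u x" and v: "v \<in> c" "g = cart C N v x" by blast
    obtain W w where Ww: "Dom S h' = (W, w)" by (cases "Dom S h'")
    have h': "h' \<in> Hom S (W, w) (Dom C u, FOb (Rst N u) x)" using e u hk Ww HomD[OF cu[OF u(1)]] by (simp add: Hom_def)
    have k': "k' \<in> Hom S (W, w) (Dom C v, FOb (Rst N v) x)" using e v hk Ww HomD[OF cu[OF v(1)]] by (simp add: Hom_def)
    obtain h \<alpha> where h: "h' = ((W, w), (Dom C u, FOb (Rst N u) x), h, \<alpha>)" "W \<in> Obj C" "h \<in> Hom C W (Dom C u)" "\<alpha> \<in> Hom (Val N W) w (FOb (Rst N h) (FOb (Rst N u) x))"
      using h' unfolding slice_Hom by blast
    obtain k \<beta> where k: "k' = ((W, w), (Dom C v, FOb (Rst N v) x), k, \<beta>)" "k \<in> Hom C W (Dom C v)" "\<beta> \<in> Hom (Val N W) w (FOb (Rst N k) (FOb (Rst N v) x))"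
      using k' unfolding slice_Hom by blast
    note uh = Cov_arr[OF X c u(1)] and vh = Cov_arr[OF X c v(1)]
    \<comment> \<open>Cartesian lifts have identities as vertical components, so equality of the
      composites forces equality of \<open>\<alpha>\<close> and \<open>\<beta>\<close>.\<close>
    have "Comp C u h = Comp C v k" and ab: "\<alpha> = \<beta>"
      using e unfolding u v h(1) k(1) cart_def slice_sel
      using functor_ident[OF R_functor[OF h(3)] R_ob[OF uh x]] functor_ident[OF R_functor[OF k(2)] R_ob[OF vh x]]
        cat_unit_left[OF V_category[OF h(2)] h(4)] cat_unit_left[OF V_category[OF h(2)] k(3)] by auto
    then have eq: "Restr F (cart C N h (FOb (Rst N u) x)) (s u) = Restr F (cart C N k (FOb (Rst N v) x)) (s v)"
      using compat u v h k by blast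
    have "Restr F h' (s u) = Restr F (vert C N W \<alpha>) (Restr F (cart C N h (FOb (Rst N u) x)) (s u))"
      using psh_Restr_Comp[OF P vert_Hom[OF h(2,4)] cart_Hom[OF h(3) R_ob[OF uh x]]] s u
        cart_vert[OF h'[unfolded h(1)]] h(1) by simp
    moreover have "Restr F k' (s v) = Restr F (vert C N W \<beta>) (Restr F (cart C N k (FOb (Rst N v) x)) (s v))"
      using psh_Restr_Comp[OF P vert_Hom[OF h(2) k(3)] cart_Hom[OF k(2) R_ob[OF vh x]]] s v
        cart_vert[OF k'[unfolded k(1)]] k(1) by simp
    ultimately show "Restr F h' (?s f) = Restr F k' (?s g)" using eq ab u v su by simp
  qed
  then show "\<exists>!m. m \<in> Sec F (X, x) \<and> (\<forall>u\<in>c. Restr F (cart C N u x) m = s u)" by (simp add: su)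
qed

text \<open>A cover of the slice may contain several arrows over the same arrow of \<open>C\<close>,
  and they may all fail to be chosen lifts. The family is therefore first moved to the cartesian
  lifts, along the inverses of the vertical parts, then glued there and compared with the original
  family.\<close>

lemma sheafI_cart_glues:
  assumes P: "is_presheaf S F" and L: "\<And>X x. X \<in> Obj C \<Longrightarrow> x \<in> Obj (Val N X) \<Longrightarrow> cart_glues C N F X x"
  shows "is_sheaf S F"
  unfolding is_sheaf_def
proof (intro conjI P ballI allI impI, elim conjE)
  fix xx c s assume xx: "xx \<in> Obj S" and c: "c \<in> Cov S xx" and s: "\<forall>f\<in>c. s f \<in> Sec F (Dom S f)"
    and compat: "\<forall>f\<in>c. \<forall>g\<in>c. \<forall>h\<in>Arr S. \<forall>k\<in>Arr S.
           Cod S h = Dom S f \<and> Cod S k = Dom S g \<and> Dom S h = Dom S k \<and>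
           Comp S f h = Comp S g k \<longrightarrow> Restr F h (s f) = Restr F k (s g)"
  obtain X x where Xx: "xx = (X, x)" "X \<in> Obj C" "x \<in> Obj (Val N X)" using xx by (auto simp: slice_sel)
  let ?V = "\<lambda>u. Val N (Dom C u)" and ?v = "\<lambda>u. vert C N (Dom C u)" and ?x = "\<lambda>u. FOb (Rst N u) x" and ?h = "\<lambda>(s, t, h, \<alpha>). h"
  define c0 where "c0 = ?h ` c"
  have c0: "c0 \<in> Cov C X" using c unfolding Xx slice_Cov c0_def by blast
  note ua = Cov_arr[OF Xx(2) c0]
  have eE: "\<exists>v u \<alpha> \<beta>. e = ((Dom C u, v), (X, x), u, \<alpha>) \<and> u \<in> c0 \<and> e \<in> Hom S (Dom C u, v) (X, x) \<and> Dom C u \<in> Obj C \<and>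
     \<alpha> \<in> Hom (?V u) v (?x u) \<and> \<beta> \<in> Hom (?V u) (?x u) v \<and>
     Comp (?V u) \<alpha> \<beta> = Ident (?V u) (?x u) \<and> Comp (?V u) \<beta> \<alpha> = Ident (?V u) v"
    if e: "e \<in> c" for e
  proof -
    have e': "e \<in> Arr S" "Cod S e = (X, x)" using c e unfolding Xx slice_Cov by auto
    obtain V v where eh: "e \<in> Hom S (V, v) (X, x)" using slice_ArrE[OF e'(1)] e'(2) HomD by metis
    then obtain u \<alpha> where u: "e = ((V, v), (X, x), u, \<alpha>)" "V \<in> Obj C" "u \<in> Hom C V X" "\<alpha> \<in> Hom (Val N V) v (?x u)"
      unfolding slice_Hom by blast
    have V: "Dom C u = V" using HomD[OF u(3)] by simp
    have "u \<in> c0" using e u(1) by (force simp: c0_def)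
    with groupoid_inverse[OF V_groupoid[OF u(2)] u(4)] u eh V show ?thesis by metis
  qed
  \<comment> \<open>All members of the cover over \<open>u\<close>, once moved to the cartesian lift
    of \<open>u\<close>, have to give the same section \<open>t\<close>.\<close>
  define good where "good u t \<longleftrightarrow> (\<forall>e v \<alpha> \<beta>. e \<in> c \<longrightarrow> e = ((Dom C u, v), (X, x), u, \<alpha>) \<longrightarrow>
     \<beta> \<in> Hom (?V u) (?x u) v \<longrightarrow> Comp (?V u) \<alpha> \<beta> = Ident (?V u) (?x u) \<longrightarrow>
     Restr F (?v u \<beta>) (s e) = t)" for u t
  \<comment> \<open>This uses the factorisation of \<open>e\<close> into \<open>vert\<close> of
    \<open>\<alpha>\<close> and the cartesian lift of \<open>u\<close>, with \<open>\<beta>\<close>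
    a right inverse of \<open>\<alpha>\<close>.\<close>
  have cc: "cart C N u x = Comp S e (?v u \<beta>)"
    if "e \<in> c" "e = ((Dom C u, v), (X, x), u, \<alpha>)" "\<beta> \<in> Hom (?V u) (?x u) v"
      "Comp (?V u) \<alpha> \<beta> = Ident (?V u) (?x u)" for e u v \<alpha> \<beta>
  proof -
    from eE[OF that(1)] that(2) have 1: "u \<in> c0" "Dom C u \<in> Obj C" "e \<in> Hom S (Dom C u, v) (X, x)"
      and 2: "\<alpha> \<in> Hom (?V u) v (?x u)" by auto
    note uh = ua[OF 1(1)]
    have "Comp S e (?v u \<beta>) = Comp S (Comp S (cart C N u x) (?v u \<alpha>)) (?v u \<beta>)"
      using cart_vert[OF 1(3)[unfolded that(2)]] that(2) by simp
    also have "\<dots> = Comp S (cart C N u x) (Ident S (Dom C u, ?x u))"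
      using cat_assoc[OF slice_category vert_Hom[OF 1(2) that(3)] vert_Hom[OF 1(2) 2] cart_Hom[OF uh Xx(3)]]
        vert_Comp[OF 1(2) that(3) 2] vert_Ident[OF 1(2) R_ob[OF uh Xx(3)]] that(4) by simp
    also have "\<dots> = cart C N u x" by (rule cat_unit_right[OF slice_category cart_Hom[OF uh Xx(3)]])
    finally show ?thesis by simp
  qed
  have "\<exists>t. \<forall>u\<in>c0. good u (t u) \<and> t u \<in> Sec F (Dom C u, ?x u)"
  proof (rule bchoice, rule ballI)
    fix u assume "u \<in> c0"
    then obtain e where e: "e \<in> c" "u = ?h e" unfolding c0_def by blast
    from eE[OF e(1)] obtain v u' \<alpha> \<beta> where e': "e = ((Dom C u', v), (X, x), u', \<alpha>)" "u' \<in> c0" "e \<in> Hom S (Dom C u', v) (X, x)"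
      "Dom C u' \<in> Obj C" "\<alpha> \<in> Hom (?V u') v (?x u')" "\<beta> \<in> Hom (?V u') (?x u') v"
      "Comp (?V u') \<alpha> \<beta> = Ident (?V u') (?x u')" by blast
    have u': "u' = u" using e(2) e'(1) by simp
    note e' = e'[unfolded u']
    let ?t = "Restr F (?v u \<beta>) (s e)"
    have se: "s e \<in> Sec F (Dom C u, v)" using s e(1) HomD[OF e'(3)] by auto
    have "?t \<in> Sec F (Dom C u, ?x u)" using psh_Restr_closed[OF P vert_Hom[OF e'(4,6)] se] .
    moreover have "good u ?t" unfolding good_def
    proof (intro allI impI)
      fix f v' \<alpha>' \<beta>' assume f: "f \<in> c" "f = ((Dom C u, v'), (X, x), u, \<alpha>')" "\<beta>' \<in> Hom (?V u) (?x u) v'"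
        "Comp (?V u) \<alpha>' \<beta>' = Ident (?V u) (?x u)"
      \<comment> \<open>By \<open>cc\<close>, both members of the cover become the cartesian lift of
        \<open>u\<close> after the two vertical arrows, so compatibility applies with these as test
        arrows.\<close>
      show "Restr F (?v u \<beta>') (s f) = ?t"
      proof (rule compat[rule_format, OF f(1) e(1)])
        have f': "f \<in> Hom S (Dom C u, v') (X, x)" using eE[OF f(1)] f(2) by auto
        note v = HomD[OF vert_Hom[OF e'(4,6)]] HomD[OF vert_Hom[OF e'(4) f(3)]] HomD[OF f'] HomD[OF e'(3)]
        show "?v u \<beta>' \<in> Arr S" "?v u \<beta> \<in> Arr S" using v by auto
        show "Cod S (?v u \<beta>') = Dom S f \<and> Cod S (?v u \<beta>) = Dom S e \<and>
          Dom S (?v u \<beta>') = Dom S (?v u \<beta>) \<and>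
          Comp S f (?v u \<beta>') = Comp S e (?v u \<beta>)"
          using v cc[OF e(1) e'(1,6,7)] cc[OF f] by simp
      qed
    qed
    ultimately show "\<exists>t. good u t \<and> t \<in> Sec F (Dom C u, ?x u)" by blast
  qed
  then obtain t where t: "\<And>u. u \<in> c0 \<Longrightarrow> good u (t u)" "\<And>u. u \<in> c0 \<Longrightarrow> t u \<in> Sec F (Dom C u, ?x u)" by blast
  have te: "\<exists>v \<alpha> \<beta>. e = ((Dom C u, v), (X, x), u, \<alpha>) \<and> e \<in> Hom S (Dom C u, v) (X, x) \<and>
     Dom C u \<in> Obj C \<and> \<alpha> \<in> Hom (?V u) v (?x u) \<and> \<beta> \<in> Hom (?V u) (?x u) v \<and>
     Comp (?V u) \<beta> \<alpha> = Ident (?V u) v \<and>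
     cart C N u x = Comp S e (?v u \<beta>) \<and> Restr F (?v u \<beta>) (s e) = t u \<and> s e \<in> Sec F (Dom C u, v)"
    if e: "e \<in> c" and u: "u = ?h e" for e u
  proof -
    from eE[OF e] obtain v u' \<alpha> \<beta> where e': "e = ((Dom C u', v), (X, x), u', \<alpha>)" "u' \<in> c0" "e \<in> Hom S (Dom C u', v) (X, x)"
      "Dom C u' \<in> Obj C" "\<alpha> \<in> Hom (?V u') v (?x u')" "\<beta> \<in> Hom (?V u') (?x u') v"
      "Comp (?V u') \<alpha> \<beta> = Ident (?V u') (?x u')" "Comp (?V u') \<beta> \<alpha> = Ident (?V u') v"
      by blast
    have u': "u' = u" using u e'(1) by simp
    note e' = e'[unfolded u']
    have "Restr F (?v u \<beta>) (s e) = t u" using t(1)[OF e'(2)] e e' unfolding good_def by blast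
    moreover have "s e \<in> Sec F (Dom C u, v)" using s e HomD[OF e'(3)] by auto
    ultimately show ?thesis using e' cc[OF e e'(1,6,7)] by blast
  qed
  \<comment> \<open>Vertical arrows being invertible, a section restricts correctly along
    \<open>e\<close> exactly when it restricts correctly along the cartesian lift of the arrow of
    \<open>C\<close> under \<open>e\<close>.\<close>
  have iff: "(\<forall>e\<in>c. Restr F e m = s e) \<longleftrightarrow> (\<forall>u\<in>c0. Restr F (cart C N u x) m = t u)" if m: "m \<in> Sec F (X, x)" for m
  proof -
    have "Restr F e m = s e \<longleftrightarrow> Restr F (cart C N (?h e) x) m = t (?h e)" if e: "e \<in> c" for e
    proof -
      define u where "u = ?h e"
      from te[OF e u_def] obtain v \<alpha> \<beta> where a: "e = ((Dom C u, v), (X, x), u, \<alpha>)" "e \<in> Hom S (Dom C u, v) (X, x)"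
         "Dom C u \<in> Obj C" "\<alpha> \<in> Hom (?V u) v (?x u)" "\<beta> \<in> Hom (?V u) (?x u) v"
         "Comp (?V u) \<beta> \<alpha> = Ident (?V u) v"
         "cart C N u x = Comp S e (?v u \<beta>)" "Restr F (?v u \<beta>) (s e) = t u" "s e \<in> Sec F (Dom C u, v)" by blast
      have "u \<in> c0" using e u_def c0_def by blast
      note uh = ua[OF this]
      have v: "v \<in> Obj (?V u)" using Hom_objD[OF V_category[OF a(3)] a(4)] by auto
      have 1: "Restr F (cart C N u x) m = Restr F (?v u \<beta>) (Restr F e m)"
        unfolding a(7) by (rule psh_Restr_Comp[OF P vert_Hom[OF a(3,5)] a(2) m])
      have bk: "Restr F (?v u \<alpha>) (Restr F (?v u \<beta>) r) = r" if r: "r \<in> Sec F (Dom C u, v)" for r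
        using psh_Restr_Comp[OF P vert_Hom[OF a(3,4)] vert_Hom[OF a(3,5)] r] vert_Comp[OF a(3,4,5)] a(6) vert_Ident[OF a(3) v]
          psh_Restr_Ident[OF P, of "(Dom C u, v)"] a(3) v r by (simp add: slice_sel)
      have "Restr F e m \<in> Sec F (Dom C u, v)" using psh_Restr_closed[OF P a(2) m] .
      then show ?thesis unfolding u_def[symmetric] 1 using a(8,9) bk by metis
    qed
    then show ?thesis unfolding c0_def by auto
  qed
  have "\<exists>!m. m \<in> Sec F (X, x) \<and> (\<forall>u\<in>c0. Restr F (cart C N u x) m = t u)"
  proof (rule cart_gluesD[OF L[OF Xx(2,3)] c0])
    show "t u \<in> Sec F (Dom C u, ?x u)" if "u \<in> c0" for u using t(2) that by blast
    fix u v h k W assume uv: "u \<in> c0" "v \<in> c0" and "h \<in> Hom C W (Dom C u) \<and> k \<in> Hom C W (Dom C v) \<and> Comp C u h = Comp C v k"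
    then have hk: "h \<in> Hom C W (Dom C u)" "k \<in> Hom C W (Dom C v)" "Comp C u h = Comp C v k" by auto
    have step: "\<exists>e \<beta> q. e \<in> c \<and> ?v u \<beta> \<in> Hom S (Dom C u, ?x u) q \<and> e \<in> Hom S q (X, x) \<and>
        cart C N u x = Comp S e (?v u \<beta>) \<and> Restr F (?v u \<beta>) (s e) = t u \<and> s e \<in> Sec F q" if "u \<in> c0" for u
    proof -
      from that obtain e where e: "e \<in> c" "u = ?h e" unfolding c0_def by blast
      from te[OF e] show ?thesis using e(1) vert_Hom by blast
    qed
    from step[OF uv(1)] obtain e \<beta> q where e: "e \<in> c" "?v u \<beta> \<in> Hom S (Dom C u, ?x u) q" "e \<in> Hom S q (X, x)"
        "cart C N u x = Comp S e (?v u \<beta>)" "Restr F (?v u \<beta>) (s e) = t u" "s e \<in> Sec F q" by blast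
    from step[OF uv(2)] obtain f \<gamma> r where f: "f \<in> c" "?v v \<gamma> \<in> Hom S (Dom C v, ?x v) r" "f \<in> Hom S r (X, x)"
        "cart C N v x = Comp S f (?v v \<gamma>)" "Restr F (?v v \<gamma>) (s f) = t v" "s f \<in> Sec F r" by blast
    note uh = ua[OF uv(1)] and vh = ua[OF uv(2)]
    note ch = cart_Hom[OF hk(1) R_ob[OF uh Xx(3)]] and ck = cart_Hom[OF hk(2) R_ob[OF vh Xx(3)]]
    let ?h = "Comp S (?v u \<beta>) (cart C N h (?x u))"
    let ?k = "Comp S (?v v \<gamma>) (cart C N k (?x v))"
    have hh: "?h \<in> Hom S (W, FOb (Rst N h) (?x u)) q" and kk: "?k \<in> Hom S (W, FOb (Rst N k) (?x v)) r"
      using cat_comp[OF slice_category ch e(2)] cat_comp[OF slice_category ck f(2)] by auto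
    \<comment> \<open>Composed with the members of the cover, both test arrows become the cartesian
      lift of the common composite in \<open>C\<close>, so the compatibility of the original family
      applies to them.\<close>
    have "Comp S e ?h = cart C N (Comp C u h) x"
      using cat_assoc[OF slice_category ch e(2,3)] e(4) cart_Comp[OF hk(1) uh Xx(3)] by simp
    moreover have "Comp S f ?k = cart C N (Comp C v k) x"
      using cat_assoc[OF slice_category ck f(2,3)] f(4) cart_Comp[OF hk(2) vh Xx(3)] by simp
    moreover have "FOb (Rst N h) (?x u) = FOb (Rst N k) (?x v)"
      using R_comp_ob[OF hk(1) uh Xx(3)] R_comp_ob[OF hk(2) vh Xx(3)] hk(3) by simp
    ultimately have "Restr F ?h (s e) = Restr F ?k (s f)"
      using compat[rule_format, OF e(1) f(1), of ?h ?k] HomD[OF hh] HomD[OF kk] HomD[OF e(3)] HomD[OF f(3)] hk(3) by simp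
    then show "Restr F (cart C N h (?x u)) (t u) = Restr F (cart C N k (?x v)) (t v)"
      using psh_Restr_Comp[OF P ch e(2,6)] psh_Restr_Comp[OF P ck f(2,6)] e(5) f(5) by simp
  qed
  then show "\<exists>!m. m \<in> Sec F xx \<and> (\<forall>f\<in>c. Restr F f m = s f)" unfolding Xx(1) using iff by metis
qed

end

lemma psh_pull_sel:
  "z \<in> Obj S \<Longrightarrow> Sect (psh_pull S P F) z = Sect F (FOb P z)"
  "f \<in> Arr S \<Longrightarrow> Restr (psh_pull S P F) f = Restr F (FAr P f)"
  by (simp_all add: psh_pull_def)

lemma psh_pull_presheaf:
  assumes P: "is_functor S S' P" and F: "is_presheaf S' F"
  shows "is_presheaf S (psh_pull S P F)"
  unfolding is_presheaf_def
proof (intro conjI ballI impI)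
  note S = functor_category(1)[OF P]
  show "Sect (psh_pull S P F) \<in> extensional (Obj S)" "Restr (psh_pull S P F) \<in> extensional (Arr S)"
    by (simp_all add: psh_pull_def)
  show "Restr (psh_pull S P F) f \<in> Sec (psh_pull S P F) (Cod S f) \<rightarrow> Sec (psh_pull S P F) (Dom S f)"
    if f: "f \<in> Arr S" for f
    using psh_Restr_closed[OF F functor_hom[OF P Arr_Hom[OF f]]] f cat_dom[OF S f] cat_cod[OF S f]
    by (simp add: psh_pull_sel)
  show "Restr (psh_pull S P F) (Ident S x) m = m" if x: "x \<in> Obj S" and m: "m \<in> Sec (psh_pull S P F) x" for x m
    using psh_Restr_Ident[OF F functor_ob[OF P x]] m cat_identD[OF S x] functor_ident[OF P x] x
    by (simp add: psh_pull_sel)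
  show "Restr (psh_pull S P F) (Comp S g f) m = Restr (psh_pull S P F) f (Restr (psh_pull S P F) g m)"
    if fg: "f \<in> Arr S" "g \<in> Arr S" "Dom S g = Cod S f" and m: "m \<in> Sec (psh_pull S P F) (Cod S g)" for f g m
  proof -
    have g: "g \<in> Hom S (Cod S f) (Cod S g)" using fg by (simp add: Hom_def)
    show ?thesis
      using psh_Restr_Comp[OF F functor_hom[OF P Arr_Hom[OF fg(1)]] functor_hom[OF P g]] m fg
        functor_comp[OF P Arr_Hom[OF fg(1)] g] cat_compD[OF S fg] cat_cod[OF S fg(2)]
      by (simp add: psh_pull_sel)
  qed
qed

locale gpsh_hom = N: gpsh_on C N + M: gpsh_on C M
  for C :: "('c, 'a) site" and N :: "('c, 'a, 'o, 'g) gpsh" and M :: "('c, 'a, 'p, 'q) gpsh" +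
  fixes \<phi> :: "'c \<Rightarrow> ('o, 'g, 'p, 'q) ftr"
  assumes \<phi>: "is_gpsh_map C N M \<phi>"
begin

lemma \<phi>_functor: "X \<in> Obj C \<Longrightarrow> is_functor (Val N X) (Val M X) (\<phi> X)"
  using \<phi> unfolding is_gpsh_map_def by simp

lemma \<phi>_natural: "h \<in> Hom C X Y \<Longrightarrow> ftr_agree (Val N Y) (ftr_comp (\<phi> X) (Rst N h)) (ftr_comp (Rst M h) (\<phi> Y))"
  using \<phi> HomD[of h C X Y] unfolding is_gpsh_map_def by auto

lemma \<phi>_ob: "h \<in> Hom C X Y \<Longrightarrow> y \<in> Obj (Val N Y) \<Longrightarrow> FOb (\<phi> X) (FOb (Rst N h) y) = FOb (Rst M h) (FOb (\<phi> Y) y)"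
  and \<phi>_ar: "h \<in> Hom C X Y \<Longrightarrow> a \<in> Arr (Val N Y) \<Longrightarrow> FAr (\<phi> X) (FAr (Rst N h) a) = FAr (Rst M h) (FAr (\<phi> Y) a)"
  using ftr_agree_ob[OF \<phi>_natural] ftr_agree_ar[OF \<phi>_natural] by (simp_all add: ftr_comp_def)

lemma slice_map_functor: "is_functor (slice C N) (slice C M) (slice_map \<phi>)"
proof (rule is_functorI[OF N.slice_category M.slice_category])
  show "FOb (slice_map \<phi>) x \<in> Obj (slice C M)" if x: "x \<in> Obj (slice C N)" for x
    using x functor_ob[OF \<phi>_functor] by (auto simp: slice_sel slice_map_sel)
  show "FAr (slice_map \<phi>) f \<in> Hom (slice C M) (FOb (slice_map \<phi>) x) (FOb (slice_map \<phi>) y)"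
    if f: "f \<in> Hom (slice C N) x y" for f x y
  proof -
    obtain X x' where x: "x = (X, x')" by (rule prod.exhaust)
    obtain Y y' where y: "y = (Y, y')" by (rule prod.exhaust)
    obtain h \<alpha> where a: "f = ((X, x'), (Y, y'), h, \<alpha>)" "X \<in> Obj C" "x' \<in> Obj (Val N X)" "Y \<in> Obj C" "y' \<in> Obj (Val N Y)"
       "h \<in> Hom C X Y" "\<alpha> \<in> Hom (Val N X) x' (FOb (Rst N h) y')" by (rule slice_HomE[OF f[unfolded x y]])
    show ?thesis unfolding x y a(1) slice_map_sel slice_Hom
      using a functor_ob[OF \<phi>_functor[OF a(2)] a(3)] functor_ob[OF \<phi>_functor[OF a(4)] a(5)]
        functor_hom[OF \<phi>_functor[OF a(2)] a(7)] \<phi>_ob[OF a(6,5)] by simp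
  qed
  show "FAr (slice_map \<phi>) (Ident (slice C N) x) = Ident (slice C M) (FOb (slice_map \<phi>) x)"
    if x: "x \<in> Obj (slice C N)" for x
    using x functor_ident[OF \<phi>_functor] by (auto simp: slice_sel slice_map_sel)
  show "FAr (slice_map \<phi>) (Comp (slice C N) g f) = Comp (slice C M) (FAr (slice_map \<phi>) g) (FAr (slice_map \<phi>) f)"
    if f: "f \<in> Hom (slice C N) x y" and g: "g \<in> Hom (slice C N) y z" for f g x y z
  proof -
    obtain X x' where x: "x = (X, x')" by (rule prod.exhaust)
    obtain Y y' where y: "y = (Y, y')" by (rule prod.exhaust)
    obtain Z z' where z: "z = (Z, z')" by (rule prod.exhaust)
    obtain h \<alpha> where a: "f = ((X, x'), (Y, y'), h, \<alpha>)" "X \<in> Obj C" "x' \<in> Obj (Val N X)" "Y \<in> Obj C" "y' \<in> Obj (Val N Y)"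
       "h \<in> Hom C X Y" "\<alpha> \<in> Hom (Val N X) x' (FOb (Rst N h) y')" by (rule slice_HomE[OF f[unfolded x y]])
    obtain k \<beta> where b: "g = ((Y, y'), (Z, z'), k, \<beta>)" "Y \<in> Obj C" "y' \<in> Obj (Val N Y)" "Z \<in> Obj C" "z' \<in> Obj (Val N Z)"
       "k \<in> Hom C Y Z" "\<beta> \<in> Hom (Val N Y) y' (FOb (Rst N k) z')" by (rule slice_HomE[OF g[unfolded y z]])
    show ?thesis unfolding a(1) b(1) slice_map_sel slice_sel
      using functor_comp[OF \<phi>_functor[OF a(2)] a(7) functor_hom[OF N.R_functor[OF a(6)] b(7)]] \<phi>_ar[OF a(6)] HomD[OF b(7)]
      by simp
  qed
qed

lemma slice_map_cart:
  assumes h: "h \<in> Hom C X Y" and y: "y \<in> Obj (Val N Y)"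
  shows "FAr (slice_map \<phi>) (cart C N h y) = cart C M h (FOb (\<phi> Y) y)"
  using HomD[OF h] Hom_objD[OF N.C h] \<phi>_ob[OF h y] functor_ident[OF \<phi>_functor N.R_ob[OF h y]]
  by (simp add: cart_def slice_map_sel)

lemma slice_map_vert:
  assumes X: "X \<in> Obj C" and a: "\<alpha> \<in> Hom (Val N X) x y"
  shows "FAr (slice_map \<phi>) (vert C N X \<alpha>) = vert C M X (FAr (\<phi> X) \<alpha>)"
  using HomD[OF a] HomD[OF functor_hom[OF \<phi>_functor[OF X] a]] by (simp add: vert_def slice_map_sel)

text \<open>Chosen lifts go to chosen lifts, so the two conditions speak of the same sets of
  sections and the same maps between them. \<open>F'\<close> is any presheaf that agrees with
  \<open>F\<close> along the slice map; this covers a pullback, where \<open>F\<close> is given, and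
  a glued sheaf, where \<open>F'\<close> is.\<close>

lemma cart_glues_iff:
  assumes Cov: "\<And>c u. c \<in> Cov C X \<Longrightarrow> u \<in> c \<Longrightarrow> u \<in> Hom C (Dom C u) X"
    and x: "X \<in> Obj C" "x \<in> Obj (Val N X)"
    and ob: "\<And>z. z \<in> Obj (slice C N) \<Longrightarrow> Sec F' z = Sec F (FOb (slice_map \<phi>) z)"
    and ar: "\<And>e z w m. e \<in> Hom (slice C N) z w \<Longrightarrow> m \<in> Sec F' w \<Longrightarrow> Restr F' e m = Restr F (FAr (slice_map \<phi>) e) m"
  shows "cart_glues C N F' X x \<longleftrightarrow> cart_glues C M F X (FOb (\<phi> X) x)"
proof -
  have so: "Sec F' (V, v) = Sec F (V, FOb (\<phi> V) v)" if "V \<in> Obj C" "v \<in> Obj (Val N V)" for V v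
    using ob[of "(V, v)"] that by (simp add: slice_sel slice_map_sel)
  have co: "Restr F' (cart C N h y) m = Restr F (cart C M h (FOb (\<phi> Y) y)) m"
    if "h \<in> Hom C V Y" "y \<in> Obj (Val N Y)" "m \<in> Sec F' (Y, y)" for h V Y y m
    using ar[OF N.cart_Hom[OF that(1,2)] that(3)] slice_map_cart[OF that(1,2)] by simp
  show ?thesis
    unfolding cart_glues_def
  proof (intro ball_cong HOL.refl all_cong1)
    fix c s assume c: "c \<in> Cov C X"
    note u = Cov[OF c]
    have uo: "Dom C u \<in> Obj C" if "u \<in> c" for u using Hom_objD[OF N.C u[OF that]] by simp
    have su: "Sec F' (Dom C u, FOb (Rst N u) x) = Sec F (Dom C u, FOb (Rst M u) (FOb (\<phi> X) x))" if "u \<in> c" for u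
      using so[OF uo[OF that] N.R_ob[OF u[OF that] x(2)]] \<phi>_ob[OF u[OF that] x(2)] by simp
    have 1: "(\<forall>u\<in>c. s u \<in> Sec F' (Dom C u, FOb (Rst N u) x)) \<longleftrightarrow> (\<forall>u\<in>c. s u \<in> Sec F (Dom C u, FOb (Rst M u) (FOb (\<phi> X) x)))"
      using su by simp
    have 2: "Restr F' (cart C N h (FOb (Rst N u) x)) (s u) = Restr F (cart C M h (FOb (Rst M u) (FOb (\<phi> X) x))) (s u)"
      if "u \<in> c" "h \<in> Hom C W (Dom C u)" "s u \<in> Sec F' (Dom C u, FOb (Rst N u) x)" for u h W
      using co[OF that(2) N.R_ob[OF u[OF that(1)] x(2)] that(3)] \<phi>_ob[OF u[OF that(1)] x(2)] by simp
    have 3: "m \<in> Sec F' (X, x) \<and> (\<forall>u\<in>c. Restr F' (cart C N u x) m = s u) \<longleftrightarrow>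
       m \<in> Sec F (X, FOb (\<phi> X) x) \<and> (\<forall>u\<in>c. Restr F (cart C M u (FOb (\<phi> X) x)) m = s u)" for m
      using so[OF x] co[OF u x(2), of _ m] by auto
    show "((\<forall>u\<in>c. s u \<in> Sec F' (Dom C u, FOb (Rst N u) x)) \<and>
     (\<forall>u\<in>c. \<forall>v\<in>c. \<forall>h k W. h \<in> Hom C W (Dom C u) \<and> k \<in> Hom C W (Dom C v) \<and> Comp C u h = Comp C v k \<longrightarrow>
        Restr F' (cart C N h (FOb (Rst N u) x)) (s u) = Restr F' (cart C N k (FOb (Rst N v) x)) (s v)) \<longrightarrow>
     (\<exists>!m. m \<in> Sec F' (X, x) \<and> (\<forall>u\<in>c. Restr F' (cart C N u x) m = s u))) =
    ((\<forall>u\<in>c. s u \<in> Sec F (Dom C u, FOb (Rst M u) (FOb (\<phi> X) x))) \<and>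
     (\<forall>u\<in>c. \<forall>v\<in>c. \<forall>h k W. h \<in> Hom C W (Dom C u) \<and> k \<in> Hom C W (Dom C v) \<and> Comp C u h = Comp C v k \<longrightarrow>
        Restr F (cart C M h (FOb (Rst M u) (FOb (\<phi> X) x))) (s u) = Restr F (cart C M k (FOb (Rst M v) (FOb (\<phi> X) x))) (s v)) \<longrightarrow>
     (\<exists>!m. m \<in> Sec F (X, FOb (\<phi> X) x) \<and> (\<forall>u\<in>c. Restr F (cart C M u (FOb (\<phi> X) x)) m = s u)))"
    \<comment> \<open>Restrictions of \<open>F'\<close> and \<open>F\<close> are known to agree only
      on sections. For a family that does not consist of sections, both implications hold
      vacuously.\<close>
    proof (cases "\<forall>u\<in>c. s u \<in> Sec F' (Dom C u, FOb (Rst N u) x)")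
      case True
      have "(\<forall>u\<in>c. \<forall>v\<in>c. \<forall>h k W. h \<in> Hom C W (Dom C u) \<and> k \<in> Hom C W (Dom C v) \<and> Comp C u h = Comp C v k \<longrightarrow>
        Restr F' (cart C N h (FOb (Rst N u) x)) (s u) = Restr F' (cart C N k (FOb (Rst N v) x)) (s v)) \<longleftrightarrow>
        (\<forall>u\<in>c. \<forall>v\<in>c. \<forall>h k W. h \<in> Hom C W (Dom C u) \<and> k \<in> Hom C W (Dom C v) \<and> Comp C u h = Comp C v k \<longrightarrow>
        Restr F (cart C M h (FOb (Rst M u) (FOb (\<phi> X) x))) (s u) = Restr F (cart C M k (FOb (Rst M v) (FOb (\<phi> X) x))) (s v))"
        by (intro ball_cong HOL.refl all_cong1 imp_cong arg_cong2[of _ _ _ _ "(=)"]) (use 2 True in auto)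
      then show ?thesis unfolding 1 3 by simp
    next
      case False
      then show ?thesis using 1 by blast
    qed
  qed
qed

end

locale gpsh_hom_site = gpsh_hom C N M \<phi> + N': gpsh_on_site C N + M': gpsh_on_site C M
  for C :: "('c, 'a) site" and N :: "('c, 'a, 'o, 'g) gpsh" and M :: "('c, 'a, 'p, 'q) gpsh" and \<phi>
begin

text \<open>Composition with a slice map preserves sheaves without any sheafification: covers and
  their cartesian lifts are the same on both sides.\<close>

lemma psh_pull_sheaf:
  assumes F: "is_sheaf (slice C M) F"
  shows "is_sheaf (slice C N) (psh_pull (slice C N) (slice_map \<phi>) F)"
proof (rule N'.sheafI_cart_glues)
  have P: "is_presheaf (slice C M) F" using F by (simp add: is_sheaf_def)
  show "is_presheaf (slice C N) (psh_pull (slice C N) (slice_map \<phi>) F)"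
    by (rule psh_pull_presheaf[OF slice_map_functor P])
  show "cart_glues C N (psh_pull (slice C N) (slice_map \<phi>) F) X x" if X: "X \<in> Obj C" "x \<in> Obj (Val N X)" for X x
  proof (rule cart_glues_iff[OF N'.Cov_arr[OF X(1)] X, THEN iffD2])
    show "cart_glues C M F X (FOb (\<phi> X) x)"
      by (rule M'.sheaf_cart_glues[OF F X(1) functor_ob[OF \<phi>_functor[OF X(1)] X(2)]])
    show "Restr (psh_pull (slice C N) (slice_map \<phi>) F) e m = Restr F (FAr (slice_map \<phi>) e) m"
      if "e \<in> Hom (slice C N) z w" for e z w m
      using HomD[OF that] by (simp add: psh_pull_sel)
  qed (simp_all add: psh_pull_sel)
qed

end

section \<open>The site of the homotopy colimit and its generating arrows\<close>

section \<open>The site of a homotopy colimit\<close>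

context pdiagram
begin

abbreviation "Si i \<equiv> slice C (DOb U i)"
abbreviation "SM \<equiv> slice C MM"
abbreviation Jm :: "'i \<Rightarrow> ('c \<times> 'o, ('c, 'a, 'o, 'g) sl_arr, ('i, 'j, 'c, 'o) hs_ob, ('i, 'j, 'c, 'a, 'o, 'g) hs_arr) ftr"
  where "Jm i \<equiv> slice_map (hc_incl I U i)"
abbreviation Tm :: "'j \<Rightarrow> ('c \<times> 'o, ('c, 'a, 'o, 'g) sl_arr, 'c \<times> 'o, ('c, 'a, 'o, 'g) sl_arr) ftr"
  where "Tm \<phi> \<equiv> slice_map (DAr U \<phi>)"
abbreviation "can \<phi> \<equiv> hc_canon C I U \<phi>"

lemma MM_on: "gpsh_on C MM"
  by unfold_locales (rule C, rule MM_gpsh)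

lemma U_on: "i \<in> Obj I \<Longrightarrow> gpsh_on C (DOb U i)"
  by unfold_locales (rule C, rule U_gpsh)

lemma incl_hom: "i \<in> Obj I \<Longrightarrow> gpsh_hom C (DOb U i) MM (hc_incl I U i)"
  by (intro gpsh_hom.intro gpsh_hom_axioms.intro U_on MM_on incl_gpsh_map)

lemma DAr_hom: "\<phi> \<in> Hom I i j \<Longrightarrow> gpsh_hom C (DOb U i) (DOb U j) (DAr U \<phi>)"
  by (intro gpsh_hom.intro gpsh_hom_axioms.intro U_on U_map) (use Hom_objD[OF I] in auto)

lemmas Jm_functor = gpsh_hom.slice_map_functor[OF incl_hom]
lemmas Tm_functor = gpsh_hom.slice_map_functor[OF DAr_hom]
lemmas SM_category = gpsh_on.slice_category[OF MM_on]
lemmas Si_category = gpsh_on.slice_category[OF U_on]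

lemma Jm_ob: "X \<in> Obj C \<Longrightarrow> FOb (Jm i) (X, x) = (X, hobX X i x)"
  by (simp add: slice_map_sel incl_sel)

lemma MM_ObE:
  assumes "X \<in> Obj C" "c \<in> Obj (Val MM X)"
  obtains i x where "i \<in> Obj I" "x \<in> Obj (GX X i)" "c = hobX X i x"
  using assms hc_diagram.M_Obj[OF hc[OF assms(1)]] by (auto simp: MM_sel)

lemma SM_ObjE:
  assumes "z \<in> Obj SM"
  obtains i w where "i \<in> Obj I" "w \<in> Obj (Si i)" "z = FOb (Jm i) w"
proof -
  obtain X c where z: "z = (X, c)" "X \<in> Obj C" "c \<in> Obj (Val MM X)" using assms by (auto simp: slice_sel)
  obtain i x where "i \<in> Obj I" "x \<in> Obj (GX X i)" "c = hobX X i x" by (rule MM_ObE[OF z(2,3)])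
  then show thesis using that[of i "(X, x)"] z by (simp add: Jm_ob slice_sel)
qed

lemma can_vert:
  assumes \<phi>: "\<phi> \<in> Hom I i j" and X: "X \<in> Obj C" and x: "x \<in> Obj (GX X i)"
  shows "can \<phi> (X, x) = vert C MM X (hcanX X \<phi> x)"
proof -
  interpret D: hc_diagram I "GX X" "TX X" by (rule hc[OF X])
  show ?thesis
    using HomD[OF D.hcan_Hom[OF \<phi> x]] HomD[OF \<phi>]
    by (simp add: hc_canon_def vert_def MM_sel incl_sel[OF X] Let_def) (simp add: D.hcan_def)
qed

lemma Tm_ob: "FOb (Tm \<phi>) (X, x) = (X, FOb (TX X \<phi>) x)"
  by (simp add: slice_map_sel)

lemma can_Hom:
  assumes \<phi>: "\<phi> \<in> Hom I i j" and z: "z \<in> Obj (Si i)"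
  shows "can \<phi> z \<in> Hom SM (FOb (Jm i) z) (FOb (Jm j) (FOb (Tm \<phi>) z))"
proof -
  obtain X x where w: "z = (X, x)" "X \<in> Obj C" "x \<in> Obj (GX X i)" using z by (auto simp: slice_sel)
  show ?thesis unfolding w(1) can_vert[OF \<phi> w(2,3)] Tm_ob Jm_ob[OF w(2)]
    by (rule gpsh_on.vert_Hom[OF MM_on w(2)], unfold MM_sel, rule hc_diagram.hcan_Hom[OF hc[OF w(2)] \<phi> w(3)])
qed

text \<open>The arrow \<open>f\<close> has a component in \<open>C\<close> and a vertical one. The
  first is handled by the compatibility of canonical arrows with restriction
  (\<open>F_hcan\<close>), the second by their naturality over the fixed object \<open>X\<close>
  (\<open>hcan_natural\<close>).\<close>

lemma can_natural:
  assumes \<phi>: "\<phi> \<in> Hom I i j" and f: "f \<in> Hom (Si i) z w"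
  shows "Comp SM (FAr (Jm j) (FAr (Tm \<phi>) f)) (can \<phi> z) = Comp SM (can \<phi> w) (FAr (Jm i) f)"
proof -
  have ij: "i \<in> Obj I" "j \<in> Obj I" using Hom_objD[OF I \<phi>] by auto
  obtain X x where z: "z = (X, x)" by (rule prod.exhaust)
  obtain Y y where w: "w = (Y, y)" by (rule prod.exhaust)
  obtain h \<alpha> where a: "f = ((X, x), (Y, y), h, \<alpha>)" "X \<in> Obj C" "x \<in> Obj (GX X i)" "Y \<in> Obj C" "y \<in> Obj (GX Y i)"
       "h \<in> Hom C X Y" "\<alpha> \<in> Hom (GX X i) x (FOb (Rst (DOb U i) h) y)" by (rule slice_HomE[OF f[unfolded z w]])
  interpret D: hc_diagram I "GX X" "TX X" by (rule hc[OF a(2)])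
  interpret DY: hc_diagram I "GX Y" "TX Y" by (rule hc[OF a(4)])
  interpret H: hc_transformation I "GX Y" "TX Y" "GX X" "TX X" "\<lambda>i. Rst (DOb U i) h" by (rule hct[OF a(6)])
  interpret M: gpsh_on C MM by (rule MM_on)
  have hinc: "D.hinc j (FAr (TX X \<phi>) \<alpha>) \<in> Arr (Val MM X)"
    using HomD[OF D.hinc_Hom[OF ij(2) D.T_hom[OF \<phi> a(7)]]] by (simp add: MM_sel)
  have 1: "FAr (Rst MM (Ident C X)) (D.hinc j (FAr (TX X \<phi>) \<alpha>)) = D.hinc j (FAr (TX X \<phi>) \<alpha>)"
    by (rule M.R_id_ar[OF a(2) hinc])
  have 2: "FAr (Rst MM h) (hcanX Y \<phi> y) = hcanX X \<phi> (FOb (Rst (DOb U i) h) y)"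
    using H.F_hcan[OF \<phi> a(5)] MM_sel(2)[OF a(6)] by simp
  note n = D.hcan_natural[OF \<phi> a(7)]
  show ?thesis
    unfolding z w a(1) can_vert[OF \<phi> a(2,3)] can_vert[OF \<phi> a(4,5)] vert_def slice_map_sel slice_sel
    using HomD[OF D.hcan_Hom[OF \<phi> a(3)]] HomD[OF DY.hcan_Hom[OF \<phi> a(5)]] 1 2 n
      cat_unit_left[OF C a(6)] cat_unit_right[OF C a(6)]
    by (simp add: MM_sel(1) incl_sel a(2,4) slice_sel)
qed

lemma can_Ident:
  assumes i: "i \<in> Obj I" and z: "z \<in> Obj (Si i)"
  shows "can (Ident I i) z = Ident SM (FOb (Jm i) z)"
proof -
  obtain X x where w: "z = (X, x)" "X \<in> Obj C" "x \<in> Obj (GX X i)" using z by (auto simp: slice_sel)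
  interpret D: hc_diagram I "GX X" "TX X" by (rule hc[OF w(2)])
  show ?thesis
    using gpsh_on.vert_Ident[OF MM_on w(2), of "D.hob i x"] D.hob_Obj[OF i w(3)] can_vert[OF cat_ident[OF I i] w(2,3)]
      D.hcan_Ident[OF i w(3)] by (simp add: w(1) Jm_ob[OF w(2)] MM_sel)
qed

lemma can_Comp:
  assumes \<phi>: "\<phi> \<in> Hom I i j" and \<psi>: "\<psi> \<in> Hom I j k" and z: "z \<in> Obj (Si i)"
  shows "can (Comp I \<psi> \<phi>) z = Comp SM (can \<psi> (FOb (Tm \<phi>) z)) (can \<phi> z)"
proof -
  obtain X x where w: "z = (X, x)" "X \<in> Obj C" "x \<in> Obj (GX X i)" using z by (auto simp: slice_sel)
  interpret D: hc_diagram I "GX X" "TX X" by (rule hc[OF w(2)])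
  note o = D.T_ob[OF \<phi> w(3)]
  have h: "D.hcan \<phi> x \<in> Hom (Val MM X) (D.hob i x) (D.hob j (FOb (TX X \<phi>) x))"
    "D.hcan \<psi> (FOb (TX X \<phi>) x) \<in> Hom (Val MM X) (D.hob j (FOb (TX X \<phi>) x)) (D.hob k (FOb (TX X \<psi>) (FOb (TX X \<phi>) x)))"
    unfolding MM_sel by (rule D.hcan_Hom[OF \<phi> w(3)], rule D.hcan_Hom[OF \<psi> o])
  show ?thesis
    using gpsh_on.vert_Comp[OF MM_on w(2) h] D.hcan_Comp[OF \<phi> \<psi> w(3)]
    by (simp add: w(1) Tm_ob can_vert[OF \<phi> w(2,3)] can_vert[OF \<psi> w(2) o] can_vert[OF cat_comp[OF I \<phi> \<psi>] w(2,3)] MM_sel)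
qed

lemma vert_inverse:
  assumes X: "X \<in> Obj C" and a: "\<alpha> \<in> Hom (Val MM X) x y"
  obtains \<beta> where "\<beta> \<in> Hom (Val MM X) y x" "Comp SM (vert C MM X \<beta>) (vert C MM X \<alpha>) = Ident SM (X, x)"
    "Comp SM (vert C MM X \<alpha>) (vert C MM X \<beta>) = Ident SM (X, y)"
proof -
  interpret M: gpsh_on C MM by (rule MM_on)
  obtain \<beta> where b: "\<beta> \<in> Hom (Val MM X) y x" "Comp (Val MM X) \<beta> \<alpha> = Ident (Val MM X) x" "Comp (Val MM X) \<alpha> \<beta> = Ident (Val MM X) y"
    by (rule groupoid_inverse[OF M.V_groupoid[OF X] a])
  note o = Hom_objD[OF M.V_category[OF X] a]
  show thesis
    by (rule that[OF b(1)]) (use M.vert_Comp[OF X a b(1)] M.vert_Comp[OF X b(1) a] M.vert_Ident[OF X] o b in auto)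
qed

lemma can_inverse:
  assumes \<phi>: "\<phi> \<in> Hom I i j" and z: "z \<in> Obj (Si i)"
  obtains e where "e \<in> Hom SM (FOb (Jm j) (FOb (Tm \<phi>) z)) (FOb (Jm i) z)" "Comp SM e (can \<phi> z) = Ident SM (FOb (Jm i) z)"
    "Comp SM (can \<phi> z) e = Ident SM (FOb (Jm j) (FOb (Tm \<phi>) z))"
proof -
  obtain X x where w: "z = (X, x)" "X \<in> Obj C" "x \<in> Obj (GX X i)" using z by (auto simp: slice_sel)
  have h: "hcanX X \<phi> x \<in> Hom (Val MM X) (hobX X i x) (hobX X j (FOb (TX X \<phi>) x))"
    unfolding MM_sel by (rule hc_diagram.hcan_Hom[OF hc[OF w(2)] \<phi> w(3)])
  obtain \<beta> where b: "\<beta> \<in> Hom (Val MM X) (hobX X j (FOb (TX X \<phi>) x)) (hobX X i x)"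
    "Comp SM (vert C MM X \<beta>) (vert C MM X (hcanX X \<phi> x)) = Ident SM (X, hobX X i x)"
    "Comp SM (vert C MM X (hcanX X \<phi> x)) (vert C MM X \<beta>) = Ident SM (X, hobX X j (FOb (TX X \<phi>) x))"
    by (rule vert_inverse[OF w(2) h])
  show thesis
    by (rule that[of "vert C MM X \<beta>"])
      (use b gpsh_on.vert_Hom[OF MM_on w(2) b(1)] in \<open>simp_all add: w(1) Tm_ob Jm_ob[OF w(2)] can_vert[OF \<phi> w(2,3)]\<close>)
qed

text \<open>An arrow is a vertical one followed by a cartesian one. The cartesian part lies over a
  single \<open>U i\<close>, and the vertical part is an arrow of the homotopy colimit at
  \<open>X\<close>, to which \<open>M_induct\<close> applies.\<close>

lemma SM_induct [consumes 1, case_names Comp inverse incl canon]: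
  assumes e: "e \<in> Arr SM"
    and Cc: "\<And>f g a b c. f \<in> Hom SM a b \<Longrightarrow> g \<in> Hom SM b c \<Longrightarrow> P f \<Longrightarrow> P g \<Longrightarrow> P (Comp SM g f)"
    and V: "\<And>f g a b. f \<in> Hom SM a b \<Longrightarrow> g \<in> Hom SM b a \<Longrightarrow> Comp SM g f = Ident SM a \<Longrightarrow> Comp SM f g = Ident SM b \<Longrightarrow> P f \<Longrightarrow> P g"
    and N: "\<And>i f z w. i \<in> Obj I \<Longrightarrow> f \<in> Hom (Si i) z w \<Longrightarrow> P (FAr (Jm i) f)"
    and K: "\<And>\<phi> i j z. \<phi> \<in> Hom I i j \<Longrightarrow> z \<in> Obj (Si i) \<Longrightarrow> P (can \<phi> z)"
  shows "P e"
proof -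
  interpret M: gpsh_on C MM by (rule MM_on)
  obtain X x Y y where e': "e \<in> Hom SM (X, x) (Y, y)" by (rule slice_ArrE[OF e])
  obtain h \<alpha> where a: "e = ((X, x), (Y, y), h, \<alpha>)" "X \<in> Obj C" "x \<in> Obj (Val MM X)" "Y \<in> Obj C" "y \<in> Obj (Val MM Y)"
     "h \<in> Hom C X Y" "\<alpha> \<in> Hom (Val MM X) x (FOb (Rst MM h) y)" by (rule slice_HomE[OF e'])
  obtain i y' where y: "i \<in> Obj I" "y' \<in> Obj (GX Y i)" "y = hobX Y i y'" by (rule MM_ObE[OF a(4,5)])
  \<comment> \<open>The target is the image of an object of a single \<open>Si i\<close>, and the
    inclusion preserves the chosen lifts.\<close>
  have c: "P (cart C MM h y)"
    using N[OF y(1) gpsh_on.cart_Hom[OF U_on[OF y(1)] a(6) y(2)]] gpsh_hom.slice_map_cart[OF incl_hom[OF y(1)] a(6) y(2)]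
    by (simp add: y(3) incl_sel[OF a(4)])
  interpret D: hc_diagram I "GX X" "TX X" by (rule hc[OF a(2)])
  have "\<alpha> \<in> Arr D.M" using HomD[OF a(7)] by (simp add: MM_sel)
  then have v: "P (vert C MM X \<alpha>)"
  proof (induction \<alpha> rule: D.M_induct)
    case (Comp f g a' b' c')
    then have fg: "f \<in> Hom (Val MM X) a' b'" "g \<in> Hom (Val MM X) b' c'" by (simp_all add: MM_sel)
    show ?case
      using Cc[OF M.vert_Hom[OF a(2) fg(1)] M.vert_Hom[OF a(2) fg(2)] Comp(3,4)] M.vert_Comp[OF a(2) fg] by (simp add: MM_sel)
  next
    case (inverse f g a' b')
    then have fg: "f \<in> Hom (Val MM X) a' b'" "g \<in> Hom (Val MM X) b' a'" by (simp_all add: MM_sel)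
    have o: "a' \<in> Obj (Val MM X)" "b' \<in> Obj (Val MM X)" using Hom_objD[OF M.V_category[OF a(2)] fg(1)] by auto
    show ?case
      by (rule V[OF M.vert_Hom[OF a(2) fg(1)] M.vert_Hom[OF a(2) fg(2)] _ _ inverse(5)])
        (use M.vert_Comp[OF a(2) fg] M.vert_Comp[OF a(2) fg(2,1)] inverse(3,4) M.vert_Ident[OF a(2)] o in \<open>auto simp: MM_sel\<close>)
  next
    case (hinc i g x' y')
    show ?case
      using N[OF hinc(1) gpsh_on.vert_Hom[OF U_on[OF hinc(1)] a(2) hinc(2)]] gpsh_hom.slice_map_vert[OF incl_hom[OF hinc(1)] a(2) hinc(2)]
      by (simp add: incl_sel[OF a(2)])
  next
    case (hcan \<phi> i j x')
    show ?case using K[OF hcan(1), of "(X, x')"] can_vert[OF hcan(1) a(2) hcan(2)] a(2) hcan(2) by (simp add: slice_sel)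
  qed
  have "e = Comp SM (cart C MM h y) (vert C MM X \<alpha>)" using M.cart_vert[OF e'[unfolded a(1)]] a(1) by simp
  then show ?thesis using Cc[OF M.vert_Hom[OF a(2,7)] M.cart_Hom[OF a(6,5)] v c] by simp
qed

lemma Tm_Ident_ob: "i \<in> Obj I \<Longrightarrow> z \<in> Obj (Si i) \<Longrightarrow> FOb (Tm (Ident I i)) z = z"
  using hc_diagram.T_Ident_ob[OF hc] by (auto simp: slice_sel Tm_ob)

lemma Tm_Comp_ob: "\<phi> \<in> Hom I i j \<Longrightarrow> \<psi> \<in> Hom I j k \<Longrightarrow> z \<in> Obj (Si i) \<Longrightarrow>
    FOb (Tm (Comp I \<psi> \<phi>)) z = FOb (Tm \<psi>) (FOb (Tm \<phi>) z)"
  using hc_diagram.T_Comp_ob[OF hc] by (auto simp: slice_sel Tm_ob)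

lemma Tm_Ident_ar:
  assumes i: "i \<in> Obj I" and f: "f \<in> Hom (Si i) z w"
  shows "FAr (Tm (Ident I i)) f = f"
proof -
  obtain X x where z: "z = (X, x)" by (rule prod.exhaust)
  obtain Y y where w: "w = (Y, y)" by (rule prod.exhaust)
  obtain h \<alpha> where a: "f = ((X, x), (Y, y), h, \<alpha>)" "X \<in> Obj C" "x \<in> Obj (GX X i)" "Y \<in> Obj C" "y \<in> Obj (GX Y i)"
       "h \<in> Hom C X Y" "\<alpha> \<in> Hom (GX X i) x (FOb (Rst (DOb U i) h) y)" by (rule slice_HomE[OF f[unfolded z w]])
  show ?thesis
    using hc_diagram.T_Ident_ob[OF hc[OF a(2)] i a(3)] hc_diagram.T_Ident_ob[OF hc[OF a(4)] i a(5)]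
      ftr_agree_ar[OF hc_diagram.T_Ident[OF hc[OF a(2)] i], of \<alpha>] HomD[OF a(7)]
    by (simp add: a(1) slice_map_sel ftr_id_def)
qed

lemma Tm_Comp_ar:
  assumes \<phi>: "\<phi> \<in> Hom I i j" and \<psi>: "\<psi> \<in> Hom I j k" and f: "f \<in> Hom (Si i) z w"
  shows "FAr (Tm (Comp I \<psi> \<phi>)) f = FAr (Tm \<psi>) (FAr (Tm \<phi>) f)"
proof -
  obtain X x where z: "z = (X, x)" by (rule prod.exhaust)
  obtain Y y where w: "w = (Y, y)" by (rule prod.exhaust)
  obtain h \<alpha> where a: "f = ((X, x), (Y, y), h, \<alpha>)" "X \<in> Obj C" "x \<in> Obj (GX X i)" "Y \<in> Obj C" "y \<in> Obj (GX Y i)"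
       "h \<in> Hom C X Y" "\<alpha> \<in> Hom (GX X i) x (FOb (Rst (DOb U i) h) y)" by (rule slice_HomE[OF f[unfolded z w]])
  have "FAr (TX X (Comp I \<psi> \<phi>)) \<alpha> = FAr (TX X \<psi>) (FAr (TX X \<phi>) \<alpha>)"
    using ftr_agree_ar[OF hc_diagram.T_Comp[OF hc[OF a(2)], of \<phi> \<psi>], of \<alpha>] HomD[OF \<phi>] HomD[OF \<psi>] HomD[OF a(7)]
    by (simp add: ftr_comp_def)
  then show ?thesis
    using hc_diagram.T_Comp_ob[OF hc[OF a(2)] \<phi> \<psi> a(3)] hc_diagram.T_Comp_ob[OF hc[OF a(4)] \<phi> \<psi> a(5)]
    by (simp add: a(1) slice_map_sel)
qed

end

section \<open>Sheaves of modules: isomorphisms, change of rings, pullback\<close>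

section \<open>Categories of sheaves\<close>

text \<open>\<open>nat_maps\<close> consists of functions that are extensional both in the object
  and in the section; this cuts an arbitrary formula down to that form.\<close>

definition norm_map :: "('x, 'f, 'y) cat_scheme \<Rightarrow> ('x, 'f, 'v, 'z) psh \<Rightarrow> ('x \<Rightarrow> 'v \<Rightarrow> 'w) \<Rightarrow> 'x \<Rightarrow> 'v \<Rightarrow> 'w" where
  "norm_map S F \<eta> = (\<lambda>x\<in>Obj S. \<lambda>m\<in>Sec F x. \<eta> x m)"

lemma norm_map_apply [simp]: "x \<in> Obj S \<Longrightarrow> m \<in> Sec F x \<Longrightarrow> norm_map S F \<eta> x m = \<eta> x m"
  by (simp add: norm_map_def)

lemma norm_map_cong:
  "(\<And>x m. x \<in> Obj S \<Longrightarrow> m \<in> Sec F x \<Longrightarrow> \<eta> x m = \<zeta> x m) \<Longrightarrow> norm_map S F \<eta> = norm_map S F \<zeta>"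
  unfolding norm_map_def by (intro restrict_ext) auto

lemma nat_mapsD:
  assumes "\<eta> \<in> nat_maps S F G"
  shows "x \<in> Obj S \<Longrightarrow> m \<in> Sec F x \<Longrightarrow> \<eta> x m \<in> Sec G x"
    and "f \<in> Hom S z w \<Longrightarrow> m \<in> Sec F w \<Longrightarrow> \<eta> z (Restr F f m) = Restr G f (\<eta> w m)"
  using assms by (auto simp: nat_maps_def Hom_def)

lemma nat_maps_eqI:
  assumes "\<eta> \<in> nat_maps S F G" "\<zeta> \<in> nat_maps S F G" "\<And>x m. x \<in> Obj S \<Longrightarrow> m \<in> Sec F x \<Longrightarrow> \<eta> x m = \<zeta> x m"
  shows "\<eta> = \<zeta>"
proof
  fix x
  show "\<eta> x = \<zeta> x"
  proof (cases "x \<in> Obj S")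
    case True
    then have "\<eta> x \<in> Sec F x \<rightarrow>\<^sub>E Sec G x" "\<zeta> x \<in> Sec F x \<rightarrow>\<^sub>E Sec G x" using assms by (auto simp: nat_maps_def)
    then show ?thesis using assms(3)[OF True] by (intro PiE_ext)
  next
    case False
    then show ?thesis using assms by (auto simp: nat_maps_def PiE_def extensional_def)
  qed
qed

lemma nat_mapsI_closed:
  assumes S: "is_category S" and F: "\<And>f z w m. f \<in> Hom S z w \<Longrightarrow> m \<in> Sec F w \<Longrightarrow> Restr F f m \<in> Sec F z"
    and c: "\<And>x m. x \<in> Obj S \<Longrightarrow> m \<in> Sec F x \<Longrightarrow> \<eta> x m \<in> Sec G x"
    and n: "\<And>f z w m. f \<in> Hom S z w \<Longrightarrow> m \<in> Sec F w \<Longrightarrow> \<eta> z (Restr F f m) = Restr G f (\<eta> w m)"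
  shows "norm_map S F \<eta> \<in> nat_maps S F G"
  unfolding nat_maps_def
proof (intro CollectI conjI ballI)
  show "norm_map S F \<eta> \<in> (\<Pi>\<^sub>E x\<in>Obj S. Sec F x \<rightarrow>\<^sub>E Sec G x)" using c by (auto simp: norm_map_def)
  fix f m assume f: "f \<in> Arr S" and m: "m \<in> Sec F (Cod S f)"
  then show "norm_map S F \<eta> (Dom S f) (Restr F f m) = Restr G f (norm_map S F \<eta> (Cod S f) m)"
    using n[OF Arr_Hom[OF f] m] F[OF Arr_Hom[OF f] m] cat_dom[OF S f] cat_cod[OF S f] by simp
qed

lemma nat_mapsI:
  assumes S: "is_category S" and F: "is_presheaf S F"
    and c: "\<And>x m. x \<in> Obj S \<Longrightarrow> m \<in> Sec F x \<Longrightarrow> \<eta> x m \<in> Sec G x"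
    and n: "\<And>f z w m. f \<in> Hom S z w \<Longrightarrow> m \<in> Sec F w \<Longrightarrow> \<eta> z (Restr F f m) = Restr G f (\<eta> w m)"
  shows "norm_map S F \<eta> \<in> nat_maps S F G"
  by (rule nat_mapsI_closed[OF S psh_Restr_closed[OF F] c n])

lemma psh_cat_sel:
  "Obj (psh_cat S Os Hs) = Os"
  "Ident (psh_cat S Os Hs) F = (F, F, norm_map S F (\<lambda>x m. m))"
  "Comp (psh_cat S Os Hs) (G', H, \<epsilon>) (F, G, \<eta>) = (F, H, norm_map S F (\<lambda>x m. \<epsilon> x (\<eta> x m)))"
  by (simp_all add: psh_cat_def norm_map_def)

lemma psh_cat_Hom: "(F', G', \<eta>) \<in> Hom (psh_cat S Os Hs) F G \<longleftrightarrow>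
    F' = F \<and> G' = G \<and> F \<in> Os \<and> G \<in> Os \<and> \<eta> \<in> nat_maps S F G \<and> (F, G, \<eta>) \<in> Hs"
  by (auto simp: psh_cat_def Hom_def)

lemma psh_cat_HomE:
  assumes "a \<in> Hom (psh_cat S Os Hs) F G"
  obtains \<eta> where "a = (F, G, \<eta>)" "F \<in> Os" "G \<in> Os" "\<eta> \<in> nat_maps S F G" "(F, G, \<eta>) \<in> Hs"
  using assms by (cases a) (simp add: psh_cat_Hom)

lemma psh_cat_category:
  assumes S: "is_category S" and P: "\<And>F. F \<in> Os \<Longrightarrow> is_presheaf S F"
    and I: "\<And>F. F \<in> Os \<Longrightarrow> (F, F, norm_map S F (\<lambda>x m. m)) \<in> Hs"
    and C: "\<And>F G H \<eta> \<epsilon>. F \<in> Os \<Longrightarrow> G \<in> Os \<Longrightarrow> H \<in> Os \<Longrightarrow> \<eta> \<in> nat_maps S F G \<Longrightarrow> \<epsilon> \<in> nat_maps S G H \<Longrightarrow>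
       (F, G, \<eta>) \<in> Hs \<Longrightarrow> (G, H, \<epsilon>) \<in> Hs \<Longrightarrow> (F, H, norm_map S F (\<lambda>x m. \<epsilon> x (\<eta> x m))) \<in> Hs"
  shows "is_category (psh_cat S Os Hs)"
proof (rule is_categoryI)
  let ?C = "psh_cat S Os Hs"
  have cn: "norm_map S F (\<lambda>x m. \<epsilon> x (\<eta> x m)) \<in> nat_maps S F H"
    if F: "F \<in> Os" and e: "\<eta> \<in> nat_maps S F G" "\<epsilon> \<in> nat_maps S G H" for F G H \<eta> \<epsilon>
    by (rule nat_mapsI[OF S P[OF F]])
      (use nat_mapsD[OF e(1)] nat_mapsD[OF e(2)] Hom_objD[OF S] in \<open>simp_all\<close>)
  show "Dom ?C f \<in> Obj ?C \<and> Cod ?C f \<in> Obj ?C" if "f \<in> Arr ?C" for f using that by (auto simp: psh_cat_def)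
  show "Ident ?C F \<in> Hom ?C F F" if "F \<in> Obj ?C" for F
    using that I nat_mapsI[OF S P, of F "\<lambda>x m. m" F] by (simp add: psh_cat_sel psh_cat_Hom)
  show "Comp ?C g f \<in> Hom ?C x z" if f: "f \<in> Hom ?C x y" and g: "g \<in> Hom ?C y z" for f g x y z
    by (rule psh_cat_HomE[OF f]; rule psh_cat_HomE[OF g]) (simp add: psh_cat_sel psh_cat_Hom cn C)
  show "Comp ?C f (Ident ?C x) = f" if f: "f \<in> Hom ?C x y" for f x y
  proof (rule psh_cat_HomE[OF f])
    fix \<eta> assume a: "f = (x, y, \<eta>)" "x \<in> Os" "y \<in> Os" "\<eta> \<in> nat_maps S x y"
    have "norm_map S x (\<lambda>z m. \<eta> z (norm_map S x (\<lambda>x m. m) z m)) = \<eta>"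
      by (rule nat_maps_eqI[OF cn[OF a(2) nat_mapsI[OF S P[OF a(2)]] a(4)] a(4)]) auto
    then show ?thesis by (simp add: a(1) psh_cat_sel)
  qed
  show "Comp ?C (Ident ?C y) f = f" if f: "f \<in> Hom ?C x y" for f x y
  proof (rule psh_cat_HomE[OF f])
    fix \<eta> assume a: "f = (x, y, \<eta>)" "x \<in> Os" "y \<in> Os" "\<eta> \<in> nat_maps S x y"
    have "norm_map S x (\<lambda>z m. norm_map S y (\<lambda>x m. m) z (\<eta> z m)) = \<eta>"
      by (rule nat_maps_eqI[OF cn[OF a(2,4) nat_mapsI[OF S P[OF a(3)]]] a(4)]) (use nat_mapsD(1)[OF a(4)] in auto)
    then show ?thesis by (simp add: a(1) psh_cat_sel)
  qed
  show "Comp ?C h (Comp ?C g f) = Comp ?C (Comp ?C h g) f"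
    if f: "f \<in> Hom ?C x y" and g: "g \<in> Hom ?C y z" and h: "h \<in> Hom ?C z w" for f g h x y z w
  proof (rule psh_cat_HomE[OF f], rule psh_cat_HomE[OF g], rule psh_cat_HomE[OF h])
    fix \<eta> \<epsilon> \<zeta> assume a: "f = (x, y, \<eta>)" "x \<in> Os" "y \<in> Os" "\<eta> \<in> nat_maps S x y" and b: "g = (y, z, \<epsilon>)" "\<epsilon> \<in> nat_maps S y z"
      and c: "h = (z, w, \<zeta>)" "\<zeta> \<in> nat_maps S z w"
    show ?thesis unfolding a b c psh_cat_sel
      by (simp, rule nat_maps_eqI[OF cn[OF a(2) cn[OF a(2,4) b(2)] c(2)] cn[OF a(2,4) cn[OF a(3) b(2) c(2)]]])
        (use nat_mapsD(1)[OF a(4)] in simp)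
  qed
qed

lemma psh_cat_iso_bij:
  assumes i: "is_isomorphism (psh_cat S Os Hs) (F, G, \<eta>)" and x: "x \<in> Obj S"
  shows "bij_betw (\<eta> x) (Sec F x) (Sec G x)"
proof -
  have h: "(F, G, \<eta>) \<in> Hom (psh_cat S Os Hs) F G" using i by (auto simp: is_isomorphism_def Hom_def psh_cat_def)
  obtain g where g: "g \<in> Hom (psh_cat S Os Hs) G F" "Comp (psh_cat S Os Hs) g (F, G, \<eta>) = Ident (psh_cat S Os Hs) F"
    "Comp (psh_cat S Os Hs) (F, G, \<eta>) g = Ident (psh_cat S Os Hs) G" by (rule is_isomorphismE[OF i h])
  obtain \<epsilon> where e: "g = (G, F, \<epsilon>)" "\<epsilon> \<in> nat_maps S G F" by (rule psh_cat_HomE[OF g(1)])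
  have n: "\<eta> \<in> nat_maps S F G" using h by (simp add: psh_cat_Hom)
  have "norm_map S F (\<lambda>x m. \<epsilon> x (\<eta> x m)) = norm_map S F (\<lambda>x m. m)" "norm_map S G (\<lambda>x m. \<eta> x (\<epsilon> x m)) = norm_map S G (\<lambda>x m. m)"
    using g(2,3) by (auto simp: e(1) psh_cat_sel)
  note eqs = this
  have "\<epsilon> x (\<eta> x m) = m" if "m \<in> Sec F x" for m
    using fun_cong[OF fun_cong[OF eqs(1)], of x m] x that by simp
  moreover have "\<eta> x (\<epsilon> x m) = m" if "m \<in> Sec G x" for m
    using fun_cong[OF fun_cong[OF eqs(2)], of x m] x that by simp
  ultimately show ?thesis using nat_mapsD(1)[OF n x] nat_mapsD(1)[OF e(2) x]
    by (intro bij_betw_byWitness[of _ "\<epsilon> x"]) auto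
qed

subsection \<open>Sheaves of modules\<close>

lemma module_sheaf_presheaf: "is_module_sheaf S R F \<Longrightarrow> is_presheaf S F"
  by (simp add: is_module_sheaf_def is_sheaf_def)

lemma module_sheafD:
  assumes "is_module_sheaf S R F"
  shows "is_sheaf S F" "x \<in> Obj S \<Longrightarrow> left_module (Sect R x) (Sect F x)"
    "f \<in> Hom S z w \<Longrightarrow> m \<in> Sec F w \<Longrightarrow> n \<in> Sec F w \<Longrightarrow>
      Restr F f (m \<oplus>\<^bsub>Sect F w\<^esub> n) = Restr F f m \<oplus>\<^bsub>Sect F z\<^esub> Restr F f n"
    "f \<in> Hom S z w \<Longrightarrow> m \<in> Sec F w \<Longrightarrow> r \<in> Sec R w \<Longrightarrow>
      Restr F f (r \<odot>\<^bsub>Sect F w\<^esub> m) = Restr R f r \<odot>\<^bsub>Sect F z\<^esub> Restr F f m"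
    "x \<in> Obj S \<Longrightarrow> smult (Sect F x) \<in> extensional (Sec R x)"
  using assms by (auto simp: is_module_sheaf_def Hom_def)

lemma module_sheafI:
  assumes "is_sheaf S F" "\<And>x. x \<in> Obj S \<Longrightarrow> left_module (Sect R x) (Sect F x)"
    "\<And>f z w m n. f \<in> Hom S z w \<Longrightarrow> m \<in> Sec F w \<Longrightarrow> n \<in> Sec F w \<Longrightarrow>
      Restr F f (m \<oplus>\<^bsub>Sect F w\<^esub> n) = Restr F f m \<oplus>\<^bsub>Sect F z\<^esub> Restr F f n"
    "\<And>f z w m r. f \<in> Hom S z w \<Longrightarrow> m \<in> Sec F w \<Longrightarrow> r \<in> Sec R w \<Longrightarrow>
      Restr F f (r \<odot>\<^bsub>Sect F w\<^esub> m) = Restr R f r \<odot>\<^bsub>Sect F z\<^esub> Restr F f m"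
    "\<And>x. x \<in> Obj S \<Longrightarrow> smult (Sect F x) \<in> extensional (Sec R x)"
  shows "is_module_sheaf S R F"
  using assms unfolding is_module_sheaf_def by (auto simp: Hom_def)

lemma left_moduleD:
  assumes "left_module R M"
  shows "ring R" "abelian_group M" "r \<in> carrier R \<Longrightarrow> m \<in> carrier M \<Longrightarrow> r \<odot>\<^bsub>M\<^esub> m \<in> carrier M"
    "m \<in> carrier M \<Longrightarrow> n \<in> carrier M \<Longrightarrow> m \<oplus>\<^bsub>M\<^esub> n \<in> carrier M"
  using assms by (auto simp: left_module_def module_axioms_def abelian_groupE(1))

definition mod_hom ::
  "('x, 'f) site \<Rightarrow> ('x, 'f, 'r) rsheaf \<Rightarrow> ('x, 'f, 'r, 'm) msheaf \<Rightarrow> ('x, 'f, 'r, 'n) msheaf \<Rightarrow> ('x \<Rightarrow> 'm \<Rightarrow> 'n) \<Rightarrow> bool" where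
  "mod_hom S R F G \<eta> \<longleftrightarrow> \<eta> \<in> nat_maps S F G \<and> is_linear S R F G \<eta>"

lemma mod_homD:
  assumes "mod_hom S R F G \<eta>"
  shows "\<eta> \<in> nat_maps S F G" "x \<in> Obj S \<Longrightarrow> m \<in> Sec F x \<Longrightarrow> \<eta> x m \<in> Sec G x"
    "f \<in> Hom S z w \<Longrightarrow> m \<in> Sec F w \<Longrightarrow> \<eta> z (Restr F f m) = Restr G f (\<eta> w m)"
    "x \<in> Obj S \<Longrightarrow> m \<in> Sec F x \<Longrightarrow> n \<in> Sec F x \<Longrightarrow> \<eta> x (m \<oplus>\<^bsub>Sect F x\<^esub> n) = \<eta> x m \<oplus>\<^bsub>Sect G x\<^esub> \<eta> x n"
    "x \<in> Obj S \<Longrightarrow> m \<in> Sec F x \<Longrightarrow> r \<in> Sec R x \<Longrightarrow> \<eta> x (r \<odot>\<^bsub>Sect F x\<^esub> m) = r \<odot>\<^bsub>Sect G x\<^esub> \<eta> x m"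
  using assms nat_mapsD[of \<eta> S F G] by (auto simp: mod_hom_def is_linear_def)

lemma mod_homI:
  assumes "\<eta> \<in> nat_maps S F G"
    "\<And>x m n. x \<in> Obj S \<Longrightarrow> m \<in> Sec F x \<Longrightarrow> n \<in> Sec F x \<Longrightarrow> \<eta> x (m \<oplus>\<^bsub>Sect F x\<^esub> n) = \<eta> x m \<oplus>\<^bsub>Sect G x\<^esub> \<eta> x n"
    "\<And>x m r. x \<in> Obj S \<Longrightarrow> m \<in> Sec F x \<Longrightarrow> r \<in> Sec R x \<Longrightarrow> \<eta> x (r \<odot>\<^bsub>Sect F x\<^esub> m) = r \<odot>\<^bsub>Sect G x\<^esub> \<eta> x m"
  shows "mod_hom S R F G \<eta>"
  using assms by (auto simp: mod_hom_def is_linear_def)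

lemma mod_hom_norm:
  assumes S: "is_category S" and F: "is_module_sheaf S R F"
    and "\<And>x m. x \<in> Obj S \<Longrightarrow> m \<in> Sec F x \<Longrightarrow> \<eta> x m \<in> Sec G x"
    and "\<And>f z w m. f \<in> Hom S z w \<Longrightarrow> m \<in> Sec F w \<Longrightarrow> \<eta> z (Restr F f m) = Restr G f (\<eta> w m)"
    and "\<And>x m n. x \<in> Obj S \<Longrightarrow> m \<in> Sec F x \<Longrightarrow> n \<in> Sec F x \<Longrightarrow> \<eta> x (m \<oplus>\<^bsub>Sect F x\<^esub> n) = \<eta> x m \<oplus>\<^bsub>Sect G x\<^esub> \<eta> x n"
    and "\<And>x m r. x \<in> Obj S \<Longrightarrow> m \<in> Sec F x \<Longrightarrow> r \<in> Sec R x \<Longrightarrow> \<eta> x (r \<odot>\<^bsub>Sect F x\<^esub> m) = r \<odot>\<^bsub>Sect G x\<^esub> \<eta> x m"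
  shows "mod_hom S R F G (norm_map S F \<eta>)"
  by (rule mod_homI[OF nat_mapsI[OF S module_sheaf_presheaf[OF F]]])
    (use assms(3-) left_moduleD[OF module_sheafD(2)[OF F]] in simp_all)

lemma Mod_Obj [simp]: "F \<in> Obj (Mod S R) \<longleftrightarrow> is_module_sheaf S R F"
  by (simp add: Mod_def psh_cat_sel)

lemma Mod_Hom: "(F', G', \<eta>) \<in> Hom (Mod S R) F G \<longleftrightarrow>
    F' = F \<and> G' = G \<and> is_module_sheaf S R F \<and> is_module_sheaf S R G \<and> mod_hom S R F G \<eta>"
  by (auto simp: Mod_def psh_cat_Hom mod_hom_def)

lemma Mod_HomE:
  assumes "a \<in> Hom (Mod S R) F G"
  obtains \<eta> where "a = (F, G, \<eta>)" "is_module_sheaf S R F" "is_module_sheaf S R G" "mod_hom S R F G \<eta>"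
  using assms by (cases a) (simp add: Mod_Hom)

lemma Mod_sel:
  "Ident (Mod S R) F = (F, F, norm_map S F (\<lambda>x m. m))"
  "Comp (Mod S R) (G', H, \<epsilon>) (F, G, \<eta>) = (F, H, norm_map S F (\<lambda>x m. \<epsilon> x (\<eta> x m)))"
  by (simp_all add: Mod_def psh_cat_sel)

lemma Mod_category:
  assumes S: "is_category S"
  shows "is_category (Mod S R)"
  unfolding Mod_def
proof (rule psh_cat_category[OF S])
  fix F assume "F \<in> {F. is_module_sheaf S R F}"
  then have F: "is_module_sheaf S R F" by simp
  then show "is_presheaf S F" by (rule module_sheaf_presheaf)
  show "(F, F, norm_map S F (\<lambda>x m. m)) \<in> {(F, G, \<eta>). is_linear S R F G \<eta>}"
    using left_moduleD[OF module_sheafD(2)[OF F]] by (simp add: is_linear_def)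
next
  fix F G H \<eta> \<epsilon> assume F: "F \<in> {F. is_module_sheaf S R F}" and e: "\<eta> \<in> nat_maps S F G" "\<epsilon> \<in> nat_maps S G H"
    and l: "(F, G, \<eta>) \<in> {(F, G, \<eta>). is_linear S R F G \<eta>}" "(G, H, \<epsilon>) \<in> {(F, G, \<eta>). is_linear S R F G \<eta>}"
  have F': "is_module_sheaf S R F" using F by simp
  show "(F, H, norm_map S F (\<lambda>x m. \<epsilon> x (\<eta> x m))) \<in> {(F, G, \<eta>). is_linear S R F G \<eta>}"
    using left_moduleD[OF module_sheafD(2)[OF F']] l nat_mapsD(1)[OF e(1)] by (simp add: is_linear_def)
qed

text \<open>Componentwise inverses are automatically natural and linear: each law is checked after
  applying \<open>\<eta>\<close>, which is injective on sections.\<close>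

lemma Mod_iso_iff:
  assumes S: "is_category S" and h: "(F, G, \<eta>) \<in> Hom (Mod S R) F G"
  shows "is_isomorphism (Mod S R) (F, G, \<eta>) \<longleftrightarrow> (\<forall>x\<in>Obj S. bij_betw (\<eta> x) (Sec F x) (Sec G x))"
proof
  assume "is_isomorphism (Mod S R) (F, G, \<eta>)"
  then show "\<forall>x\<in>Obj S. bij_betw (\<eta> x) (Sec F x) (Sec G x)" unfolding Mod_def by (intro ballI) (rule psh_cat_iso_bij)
next
  assume bij: "\<forall>x\<in>Obj S. bij_betw (\<eta> x) (Sec F x) (Sec G x)"
  have F: "is_module_sheaf S R F" and G: "is_module_sheaf S R G" and e: "mod_hom S R F G \<eta>" using h by (auto simp: Mod_Hom)
  note PF = module_sheaf_presheaf[OF F] and PG = module_sheaf_presheaf[OF G]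
  define \<epsilon> where "\<epsilon> = (\<lambda>x. inv_into (Sec F x) (\<eta> x))"
  have 1: "\<epsilon> x m \<in> Sec F x" "\<eta> x (\<epsilon> x m) = m" if "x \<in> Obj S" "m \<in> Sec G x" for x m
    using bij that by (auto simp: \<epsilon>_def bij_betw_def inv_into_into f_inv_into_f)
  have 2: "\<epsilon> x (\<eta> x m) = m" if "x \<in> Obj S" "m \<in> Sec F x" for x m
    using bij that by (auto simp: \<epsilon>_def bij_betw_def)
  have inj: "m = n" if "x \<in> Obj S" "m \<in> Sec F x" "n \<in> Sec F x" "\<eta> x m = \<eta> x n" for x m n
    using 2 that by metis
  have h': "mod_hom S R G F (norm_map S G \<epsilon>)"
  proof (rule mod_hom_norm[OF S G])
    show "\<epsilon> x m \<in> Sec F x" if "x \<in> Obj S" "m \<in> Sec G x" for x m using 1 that by simp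
    show "\<epsilon> z (Restr G f m) = Restr F f (\<epsilon> w m)" if f: "f \<in> Hom S z w" and m: "m \<in> Sec G w" for f z w m
    proof -
      have o: "z \<in> Obj S" "w \<in> Obj S" using Hom_objD[OF S f] by auto
      show ?thesis
        by (rule inj[OF o(1)]) (use 1 o m psh_Restr_closed[OF PG f m] psh_Restr_closed[OF PF f] mod_homD(3)[OF e f] in simp_all)
    qed
    show "\<epsilon> x (m \<oplus>\<^bsub>Sect G x\<^esub> n) = \<epsilon> x m \<oplus>\<^bsub>Sect F x\<^esub> \<epsilon> x n" if o: "x \<in> Obj S" "m \<in> Sec G x" "n \<in> Sec G x" for x m n
      by (rule inj[OF o(1)])
        (use 1 o left_moduleD[OF module_sheafD(2)[OF F o(1)]] left_moduleD[OF module_sheafD(2)[OF G o(1)]] mod_homD(4)[OF e o(1)] in simp_all)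
    show "\<epsilon> x (r \<odot>\<^bsub>Sect G x\<^esub> m) = r \<odot>\<^bsub>Sect F x\<^esub> \<epsilon> x m" if o: "x \<in> Obj S" "m \<in> Sec G x" "r \<in> Sec R x" for x m r
      by (rule inj[OF o(1)])
        (use 1 o left_moduleD[OF module_sheafD(2)[OF F o(1)]] left_moduleD[OF module_sheafD(2)[OF G o(1)]] mod_homD(5)[OF e o(1)] in simp_all)
  qed
  have g: "(G, F, norm_map S G \<epsilon>) \<in> Hom (Mod S R) G F" using h' F G by (simp add: Mod_Hom)
  show "is_isomorphism (Mod S R) (F, G, \<eta>)"
  proof (rule is_isomorphismI[OF h g])
    show "Comp (Mod S R) (G, F, norm_map S G \<epsilon>) (F, G, \<eta>) = Ident (Mod S R) F"
      unfolding Mod_sel using norm_map_cong[of S F "\<lambda>x m. norm_map S G \<epsilon> x (\<eta> x m)"] 2 mod_homD(2)[OF e] by simp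
    show "Comp (Mod S R) (F, G, \<eta>) (G, F, norm_map S G \<epsilon>) = Ident (Mod S R) G"
      unfolding Mod_sel using norm_map_cong[of S G "\<lambda>x m. \<eta> x (norm_map S G \<epsilon> x m)"] 1 by simp
  qed
qed

subsection \<open>Transport and pullback of modules\<close>

definition ring_sheaf_iso :: "('x, 'f) site \<Rightarrow> ('x, 'f, 'r) rsheaf \<Rightarrow> ('x, 'f, 'r) rsheaf \<Rightarrow> ('x \<Rightarrow> 'r \<Rightarrow> 'r) \<Rightarrow> bool" where
  "ring_sheaf_iso S R R' \<alpha> \<longleftrightarrow> is_ring_sheaf S R \<and> is_ring_sheaf S R' \<and> \<alpha> \<in> nat_maps S R R' \<and>
     (\<forall>x\<in>Obj S. \<alpha> x \<in> ring_hom (Sect R x) (Sect R' x) \<and> bij_betw (\<alpha> x) (Sec R x) (Sec R' x))"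

lemma ShRing_isoE:
  assumes "is_isomorphism (ShRing S) a" "a \<in> Hom (ShRing S) R R'"
  obtains \<alpha> where "a = (R, R', \<alpha>)" "ring_sheaf_iso S R R' \<alpha>"
proof -
  obtain \<alpha> where a: "a = (R, R', \<alpha>)" "is_ring_sheaf S R" "is_ring_sheaf S R'" "\<alpha> \<in> nat_maps S R R'"
    "\<forall>x\<in>Obj S. \<alpha> x \<in> ring_hom (Sect R x) (Sect R' x)"
    using assms(2) by (cases a) (auto simp: ShRing_def psh_cat_Hom)
  have "bij_betw (\<alpha> x) (Sec R x) (Sec R' x)" if "x \<in> Obj S" for x
    by (rule psh_cat_iso_bij[OF assms(1)[unfolded ShRing_def a(1)] that])
  with a that show thesis by (simp add: ring_sheaf_iso_def)
qed

lemma ring_sheaf_isoD: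
  assumes "ring_sheaf_iso S R R' \<alpha>"
  shows "x \<in> Obj S \<Longrightarrow> ring (Sect R x)" "x \<in> Obj S \<Longrightarrow> ring (Sect R' x)"
    "x \<in> Obj S \<Longrightarrow> \<alpha> x \<in> ring_hom (Sect R x) (Sect R' x)"
    "x \<in> Obj S \<Longrightarrow> bij_betw (\<alpha> x) (Sec R x) (Sec R' x)"
    "\<alpha> \<in> nat_maps S R R'" "is_ring_sheaf S R" "is_ring_sheaf S R'"
  using assms by (auto simp: ring_sheaf_iso_def is_ring_sheaf_def)

lemma ring_sheaf_presheaf: "is_ring_sheaf S R \<Longrightarrow> is_presheaf S R"
  by (simp add: is_ring_sheaf_def is_sheaf_def)

lemma transport_sel:
  "Restr (transport S (R, R', \<alpha>) F) = Restr F"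
  "x \<in> Obj S \<Longrightarrow> Sect (transport S (R, R', \<alpha>) F) x = (Sect F x)
     \<lparr>smult := (\<lambda>r\<in>Sec R' x. smult (Sect F x) (inv_into (Sec R x) (\<alpha> x) r))\<rparr>"
  by (simp_all add: transport_def)

lemma transport_carrier:
  "x \<in> Obj S \<Longrightarrow> Sec (transport S (R, R', \<alpha>) F) x = Sec F x"
  "x \<in> Obj S \<Longrightarrow> add (Sect (transport S (R, R', \<alpha>) F) x) = add (Sect F x)"
  "x \<in> Obj S \<Longrightarrow> zero (Sect (transport S (R, R', \<alpha>) F) x) = zero (Sect F x)"
  by (simp_all add: transport_sel)

lemma transport_smult:
  assumes "ring_sheaf_iso S R R' \<alpha>" "x \<in> Obj S" "r \<in> Sec R x"
  shows "smult (Sect (transport S (R, R', \<alpha>) F) x) (\<alpha> x r) = smult (Sect F x) r"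
  using ring_sheaf_isoD(4)[OF assms(1,2)] assms(2,3) by (auto simp: transport_sel bij_betw_def)

lemma ring_iso_surj:
  assumes "ring_sheaf_iso S R R' \<alpha>" "x \<in> Obj S" "r' \<in> Sec R' x"
  obtains r where "r \<in> Sec R x" "r' = \<alpha> x r"
  using ring_sheaf_isoD(4)[OF assms(1,2)] assms(3) unfolding bij_betw_def by blast

text \<open>Applied in two directions: along the inverse of a ring isomorphism for
  \<open>transport\<close>, and along \<open>rb i w\<close> for the glued sheaf.\<close>

lemma left_module_restrict_scalars:
  assumes M: "left_module R' M" and R: "ring R" and h: "\<alpha> \<in> ring_hom R R'"
  shows "left_module R (M\<lparr>smult := (\<lambda>r\<in>carrier R. smult M (\<alpha> r))\<rparr>)" (is "left_module R ?M")
proof -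
  interpret R: ring R by (rule R)
  have ax: "module_axioms R' M" and ab: "abelian_group M" using M by (auto simp: left_module_def)
  have 1: "abelian_group ?M"
    using ab unfolding abelian_group_def abelian_group_axioms_def abelian_monoid_def by simp
  have "module_axioms R ?M"
    using ax h unfolding module_axioms_def by (simp add: ring_hom_closed ring_hom_add ring_hom_mult ring_hom_one)
  with 1 R show ?thesis by (simp add: left_module_def)
qed

lemma ring_hom_inv_into:
  assumes R: "ring R" and h: "h \<in> ring_hom R R'" and b: "bij_betw h (carrier R) (carrier R')"
  shows "inv_into (carrier R) h \<in> ring_hom R' R" (is "?i \<in> _")
proof -
  interpret ring R by (rule R)
  have c: "?i r \<in> carrier R" "h (?i r) = r" if "r \<in> carrier R'" for r
    using bij_betwE[OF bij_betw_inv_into[OF b]] bij_betw_inv_into_right[OF b] that by auto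
  have i: "?i (h r) = r" if "r \<in> carrier R" for r by (rule inv_into_f_f[OF bij_betw_imp_inj_on[OF b] that])
  show ?thesis
  proof (rule ring_hom_memI)
    fix r s assume rs: "r \<in> carrier R'" "s \<in> carrier R'"
    note c' = c[OF rs(1)] c[OF rs(2)]
    show "?i (r \<otimes>\<^bsub>R'\<^esub> s) = ?i r \<otimes>\<^bsub>R\<^esub> ?i s" using i[OF m_closed[OF c'(1,3)]] ring_hom_mult[OF h c'(1,3)] c' by simp
    show "?i (r \<oplus>\<^bsub>R'\<^esub> s) = ?i r \<oplus>\<^bsub>R\<^esub> ?i s" using i[OF a_closed[OF c'(1,3)]] ring_hom_add[OF h c'(1,3)] c' by simp
  qed (use c i[OF one_closed] ring_hom_one[OF h] in simp_all)
qed

lemma left_module_transport: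
  assumes M: "left_module R M" and R': "ring R'" and h: "\<alpha> \<in> ring_hom R R'" and b: "bij_betw \<alpha> (carrier R) (carrier R')"
  shows "left_module R' (M\<lparr>smult := (\<lambda>r\<in>carrier R'. smult M (inv_into (carrier R) \<alpha> r))\<rparr>)"
  by (rule left_module_restrict_scalars[OF M R' ring_hom_inv_into[OF left_moduleD(1)[OF M] h b]])

text \<open>The sheaf condition sees only carriers and restriction maps, so a change of the scalar
  multiplication leaves it intact.\<close>

lemma is_sheaf_cong:
  assumes F: "is_sheaf S F" and r: "Restr F' = Restr F" and s: "\<And>x. Sec F' x = Sec F x" and e: "Sect F' \<in> extensional (Obj S)"
  shows "is_sheaf S F'"
  using F e unfolding is_sheaf_def is_presheaf_def r s by (elim conjE) (intro conjI; assumption)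

lemma transport_module_sheaf:
  assumes i: "ring_sheaf_iso S R R' \<alpha>" and F: "is_module_sheaf S R F" and S: "is_category S"
  shows "is_module_sheaf S R' (transport S (R, R', \<alpha>) F)"
proof (rule module_sheafI)
  let ?T = "transport S (R, R', \<alpha>)"
  have ext: "Sect F \<in> extensional (Obj S)" using module_sheaf_presheaf[OF F] by (simp add: is_presheaf_def)
  have "Sec (?T F) x = Sec F x" for x
    using ext by (cases "x \<in> Obj S") (auto simp: transport_carrier(1) transport_def extensional_def)
  then show "is_sheaf S (?T F)"
    by (rule is_sheaf_cong[OF module_sheafD(1)[OF F] transport_sel(1)]) (simp add: transport_def)
  show "left_module (Sect R' x) (Sect (?T F) x)" if x: "x \<in> Obj S" for x
    unfolding transport_sel(2)[OF x]
    by (rule left_module_transport[OF module_sheafD(2)[OF F x] ring_sheaf_isoD(2)[OF i x] ring_sheaf_isoD(3)[OF i x] ring_sheaf_isoD(4)[OF i x]])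
  show "smult (Sect (?T F) x) \<in> extensional (Sec R' x)" if x: "x \<in> Obj S" for x
    using x by (simp add: transport_sel)
  fix f z w m assume f: "f \<in> Hom S z w" and m': "m \<in> Sec (?T F) w"
  have o: "z \<in> Obj S" "w \<in> Obj S" using Hom_objD[OF S f] by auto
  have m: "m \<in> Sec F w" using m' o transport_carrier(1) by metis
  show "Restr (?T F) f (m \<oplus>\<^bsub>Sect (?T F) w\<^esub> n) =
      Restr (?T F) f m \<oplus>\<^bsub>Sect (?T F) z\<^esub> Restr (?T F) f n"
    if "n \<in> Sec (?T F) w" for n
    using module_sheafD(3)[OF F f m] that o by (simp add: transport_carrier transport_sel(1))
  \<comment> \<open>Scalars of \<open>R'\<close> are written as images under
    \<open>\<alpha>\<close>, on which the transported action is the original one.\<close>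
  fix r' assume "r' \<in> Sec R' w"
  then obtain r where r: "r \<in> Sec R w" "r' = \<alpha> w r" by (rule ring_iso_surj[OF i o(2)])
  have "Restr R' f r' = \<alpha> z (Restr R f r)" using nat_mapsD(2)[OF ring_sheaf_isoD(5)[OF i] f r(1)] r(2) by simp
  moreover have "Restr R f r \<in> Sec R z"
    by (rule psh_Restr_closed[OF ring_sheaf_presheaf[OF ring_sheaf_isoD(6)[OF i]] f r(1)])
  ultimately show "Restr (?T F) f (r' \<odot>\<^bsub>Sect (?T F) w\<^esub> m) =
      Restr R' f r' \<odot>\<^bsub>Sect (?T F) z\<^esub> Restr (?T F) f m"
    using module_sheafD(4)[OF F f m r(1)] r o by (simp add: transport_sel(1) transport_smult[OF i])
qed

lemma nat_maps_cong:
  assumes "\<And>x. x \<in> Obj S \<Longrightarrow> Sec F' x = Sec F x" "\<And>x. x \<in> Obj S \<Longrightarrow> Sec G' x = Sec G x"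
    "Restr F' = Restr F" "Restr G' = Restr G" and S: "is_category S"
  shows "nat_maps S F' G' = nat_maps S F G"
proof -
  have "(\<Pi>\<^sub>E x\<in>Obj S. Sec F' x \<rightarrow>\<^sub>E Sec G' x) = (\<Pi>\<^sub>E x\<in>Obj S. Sec F x \<rightarrow>\<^sub>E Sec G x)"
    using assms(1,2) by (intro PiE_cong) auto
  then show ?thesis unfolding nat_maps_def using assms(1,3,4) cat_cod[OF S] by auto
qed

text \<open>\<open>R'\<close> acts through a bijection with \<open>R\<close>, so quantifying over
  scalars of \<open>R'\<close> on the transported modules is quantifying over scalars of
  \<open>R\<close> on the original ones.\<close>

lemma transport_mod_hom_iff:
  assumes i: "ring_sheaf_iso S R R' \<alpha>" and S: "is_category S"
  shows "mod_hom S R' (transport S (R, R', \<alpha>) F) (transport S (R, R', \<alpha>) G) \<eta> \<longleftrightarrow> mod_hom S R F G \<eta>"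
proof -
  let ?T = "transport S (R, R', \<alpha>)"
  have 1: "nat_maps S (?T F) (?T G) = nat_maps S F G"
    by (rule nat_maps_cong) (simp_all add: transport_carrier transport_sel(1) S)
  have 2: "(\<forall>r'\<in>Sec R' x. P (smult (Sect (?T F) x) r') (smult (Sect (?T G) x) r')) \<longleftrightarrow>
     (\<forall>r\<in>Sec R x. P (smult (Sect F x) r) (smult (Sect G x) r))" if x: "x \<in> Obj S" for x P
  proof -
    have "Sec R' x = \<alpha> x ` Sec R x" using ring_sheaf_isoD(4)[OF i x] by (simp add: bij_betw_def)
    then show ?thesis by (simp add: transport_smult[OF i x])
  qed
  have "is_linear S R' (?T F) (?T G) \<eta> \<longleftrightarrow> is_linear S R F G \<eta>"
    unfolding is_linear_def
  proof (rule ball_cong[OF HOL.refl])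
    fix x assume x: "x \<in> Obj S"
    show "(\<forall>m\<in>Sec (?T F) x.
      (\<forall>n\<in>Sec (?T F) x. \<eta> x (m \<oplus>\<^bsub>Sect (?T F) x\<^esub> n) = \<eta> x m \<oplus>\<^bsub>Sect (?T G) x\<^esub> \<eta> x n) \<and>
      (\<forall>r\<in>Sec R' x. \<eta> x (r \<odot>\<^bsub>Sect (?T F) x\<^esub> m) = r \<odot>\<^bsub>Sect (?T G) x\<^esub> \<eta> x m)) \<longleftrightarrow>
     (\<forall>m\<in>Sec F x. (\<forall>n\<in>Sec F x. \<eta> x (m \<oplus>\<^bsub>Sect F x\<^esub> n) = \<eta> x m \<oplus>\<^bsub>Sect G x\<^esub> \<eta> x n) \<and>
      (\<forall>r\<in>Sec R x. \<eta> x (r \<odot>\<^bsub>Sect F x\<^esub> m) = r \<odot>\<^bsub>Sect G x\<^esub> \<eta> x m))"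
      using 2[OF x, of "\<lambda>p q. \<eta> x (p m) = q (\<eta> x m)" for m] by (simp add: transport_carrier[OF x])
  qed
  with 1 show ?thesis by (simp add: mod_hom_def)
qed

lemma pull_ring_sheaf:
  assumes P: "is_functor S S' P" and R: "is_ring_sheaf S' R" and sh: "is_sheaf S (psh_pull S P R)"
  shows "is_ring_sheaf S (psh_pull S P R)"
  unfolding is_ring_sheaf_def
proof (intro conjI ballI sh)
  note S = functor_category(1)[OF P]
  show "ring (Sect (psh_pull S P R) x)" if x: "x \<in> Obj S" for x
    using R functor_ob[OF P x] x by (simp add: is_ring_sheaf_def psh_pull_sel)
  show "Restr (psh_pull S P R) f \<in> ring_hom (Sect (psh_pull S P R) (Cod S f)) (Sect (psh_pull S P R) (Dom S f))" if f: "f \<in> Arr S" for f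
    using R HomD[OF functor_hom[OF P Arr_Hom[OF f]]] f cat_dom[OF S f] cat_cod[OF S f]
    unfolding is_ring_sheaf_def by (auto simp: psh_pull_sel)
qed

lemma pull_module_sheaf:
  assumes P: "is_functor S S' P" and F: "is_module_sheaf S' R F" and sh: "is_sheaf S (psh_pull S P F)"
  shows "is_module_sheaf S (psh_pull S P R) (psh_pull S P F)"
proof (rule module_sheafI[OF sh])
  let ?F = "psh_pull S P F"
  note S = functor_category(1)[OF P]
  show "left_module (Sect (psh_pull S P R) x) (Sect ?F x)" if x: "x \<in> Obj S" for x
    using module_sheafD(2)[OF F functor_ob[OF P x]] x by (simp add: psh_pull_sel)
  show "smult (Sect ?F x) \<in> extensional (Sec (psh_pull S P R) x)" if x: "x \<in> Obj S" for x
    using module_sheafD(5)[OF F functor_ob[OF P x]] x by (simp add: psh_pull_sel)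
  fix f z w m assume f: "f \<in> Hom S z w" and m: "m \<in> Sec ?F w"
  note o = Hom_objD[OF S f] and fa = HomD[OF f]
  show "Restr ?F f (m \<oplus>\<^bsub>Sect ?F w\<^esub> n) = Restr ?F f m \<oplus>\<^bsub>Sect ?F z\<^esub> Restr ?F f n"
    if "n \<in> Sec ?F w" for n
    using module_sheafD(3)[OF F functor_hom[OF P f]] m that o fa by (simp add: psh_pull_sel)
  show "Restr ?F f (r \<odot>\<^bsub>Sect ?F w\<^esub> m) = Restr (psh_pull S P R) f r \<odot>\<^bsub>Sect ?F z\<^esub> Restr ?F f m"
    if "r \<in> Sec (psh_pull S P R) w" for r
    using module_sheafD(4)[OF F functor_hom[OF P f]] m that o fa by (simp add: psh_pull_sel)
qed

lemma pull_nat_maps: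
  assumes P: "is_functor S S' P" and e: "\<eta> \<in> nat_maps S' F G"
  shows "(\<lambda>x\<in>Obj S. \<eta> (FOb P x)) \<in> nat_maps S (psh_pull S P F) (psh_pull S P G)"
proof -
  have "\<eta> y \<in> Sec F y \<rightarrow>\<^sub>E Sec G y" if "y \<in> Obj S'" for y using e that by (auto simp: nat_maps_def)
  then have 1: "(\<lambda>x\<in>Obj S. \<eta> (FOb P x)) \<in> (\<Pi>\<^sub>E x\<in>Obj S. Sec (psh_pull S P F) x \<rightarrow>\<^sub>E Sec (psh_pull S P G) x)"
    using functor_ob[OF P] unfolding restrict_PiE_iff by (simp add: psh_pull_sel)
  note S = functor_category(1)[OF P]
  show ?thesis unfolding nat_maps_def
  proof (intro CollectI conjI 1 ballI)
    fix f m assume f: "f \<in> Arr S" and m: "m \<in> Sec (psh_pull S P F) (Cod S f)"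
    then show "(\<lambda>x\<in>Obj S. \<eta> (FOb P x)) (Dom S f) (Restr (psh_pull S P F) f m) =
      Restr (psh_pull S P G) f ((\<lambda>x\<in>Obj S. \<eta> (FOb P x)) (Cod S f) m)"
      using nat_mapsD(2)[OF e functor_hom[OF P Arr_Hom[OF f]]] cat_dom[OF S f] cat_cod[OF S f] by (simp add: psh_pull_sel)
  qed
qed

lemma pull_mod_hom:
  assumes P: "is_functor S S' P" and e: "mod_hom S' R F G \<eta>"
  shows "mod_hom S (psh_pull S P R) (psh_pull S P F) (psh_pull S P G) (\<lambda>x\<in>Obj S. \<eta> (FOb P x))"
  by (rule mod_homI[OF pull_nat_maps[OF P mod_homD(1)[OF e]]])
    (use mod_homD(4,5)[OF e functor_ob[OF P]] in \<open>simp_all add: psh_pull_sel\<close>)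

section \<open>Homotopy limits of categories\<close>

section \<open>Homotopy limits\<close>

lemma holim_Obj: "(x, \<theta>) \<in> Obj (holim K E) \<longleftrightarrow>
        x \<in> (\<Pi>\<^sub>E k\<in>Obj K. Obj (CatAt E k)) \<and> \<theta> \<in> extensional (Arr K) \<and>
        (\<forall>f\<in>Arr K. is_isomorphism (CatAt E (Cod K f)) (\<theta> f) \<and>
           \<theta> f \<in> Hom (CatAt E (Cod K f)) (FOb (FunAt E f) (x (Dom K f))) (x (Cod K f))) \<and>
        (\<forall>k\<in>Obj K. \<theta> (Ident K k) = Ident (CatAt E k) (x k)) \<and>
        (\<forall>f\<in>Arr K. \<forall>g\<in>Arr K. Dom K g = Cod K f \<longrightarrow>
           \<theta> (Comp K g f) = Comp (CatAt E (Cod K g)) (\<theta> g) (FAr (FunAt E g) (\<theta> f)))"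
  by (simp add: holim_def Let_def)

lemma holim_Hom: "(s, t, u) \<in> Hom (holim K E) a b \<longleftrightarrow> s = a \<and> t = b \<and> a \<in> Obj (holim K E) \<and> b \<in> Obj (holim K E) \<and>
          u \<in> (\<Pi>\<^sub>E k\<in>Obj K. Hom (CatAt E k) (fst a k) (fst b k)) \<and>
          (\<forall>f\<in>Arr K. Comp (CatAt E (Cod K f)) (u (Cod K f)) (snd a f) =
             Comp (CatAt E (Cod K f)) (snd b f) (FAr (FunAt E f) (u (Dom K f))))"
  by (cases a; cases b) (auto simp: holim_def Let_def Hom_def)

lemma holim_sel:
  "Ident (holim K E) a = (a, a, \<lambda>k\<in>Obj K. Ident (CatAt E k) (fst a k))"
  "Comp (holim K E) (s', t', v) (s, t, u) = (s, t', \<lambda>k\<in>Obj K. Comp (CatAt E k) (v k) (u k))"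
  by (cases a) (simp_all add: holim_def Let_def)

lemma holim_HomE:
  assumes "f \<in> Hom (holim K E) a b"
  obtains u where "f = (a, b, u)" "a \<in> Obj (holim K E)" "b \<in> Obj (holim K E)"
    "u \<in> (\<Pi>\<^sub>E k\<in>Obj K. Hom (CatAt E k) (fst a k) (fst b k))"
    "\<And>f. f \<in> Arr K \<Longrightarrow> Comp (CatAt E (Cod K f)) (u (Cod K f)) (snd a f) =
             Comp (CatAt E (Cod K f)) (snd b f) (FAr (FunAt E f) (u (Dom K f)))"
  using assms by (cases f) (simp add: holim_Hom)

lemma holim_iso_component:
  assumes i: "is_isomorphism (holim K E) (s, t, u)" and k: "k \<in> Obj K"
  shows "is_isomorphism (CatAt E k) (u k)"
proof -
  have h: "(s, t, u) \<in> Hom (holim K E) s t"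
    by (rule HomI) (use i in \<open>simp_all add: is_isomorphism_def\<close>, simp_all add: holim_def Let_def)
  obtain g where g: "g \<in> Hom (holim K E) t s" "Comp (holim K E) g (s, t, u) = Ident (holim K E) s"
    "Comp (holim K E) (s, t, u) g = Ident (holim K E) t" by (rule is_isomorphismE[OF i h])
  obtain v where v: "g = (t, s, v)" "v \<in> (\<Pi>\<^sub>E k\<in>Obj K. Hom (CatAt E k) (fst t k) (fst s k))" by (rule holim_HomE[OF g(1)])
  have uk: "u k \<in> Hom (CatAt E k) (fst s k) (fst t k)" using h k by (auto simp: holim_Hom)
  have vk: "v k \<in> Hom (CatAt E k) (fst t k) (fst s k)" using v k by auto
  have e: "(\<lambda>k\<in>Obj K. Comp (CatAt E k) (v k) (u k)) = (\<lambda>k\<in>Obj K. Ident (CatAt E k) (fst s k))"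
    "(\<lambda>k\<in>Obj K. Comp (CatAt E k) (u k) (v k)) = (\<lambda>k\<in>Obj K. Ident (CatAt E k) (fst t k))"
    using g(2,3) by (simp_all add: v(1) holim_sel)
  have "Comp (CatAt E k) (v k) (u k) = Ident (CatAt E k) (fst s k)" "Comp (CatAt E k) (u k) (v k) = Ident (CatAt E k) (fst t k)"
    using k fun_cong[OF e(1), of k] fun_cong[OF e(2), of k] by simp_all
  then show ?thesis by (rule is_isomorphismI[OF uk vk])
qed

locale cat_diagram =
  fixes K :: "('k, 'f) cat" and E :: "('k, 'f, 'o, 'a) cdiag"
  assumes K: "is_category K" and E_category: "\<And>k. k \<in> Obj K \<Longrightarrow> is_category (CatAt E k)"
    and E_functor: "\<And>f. f \<in> Arr K \<Longrightarrow> is_functor (CatAt E (Dom K f)) (CatAt E (Cod K f)) (FunAt E f)"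
begin

lemma ObD:
  assumes "a \<in> Obj (holim K E)"
  shows "k \<in> Obj K \<Longrightarrow> fst a k \<in> Obj (CatAt E k)"
    "f \<in> Arr K \<Longrightarrow> snd a f \<in> Hom (CatAt E (Cod K f)) (FOb (FunAt E f) (fst a (Dom K f))) (fst a (Cod K f))"
    "f \<in> Arr K \<Longrightarrow> is_isomorphism (CatAt E (Cod K f)) (snd a f)"
proof -
  obtain x \<theta> where a: "a = (x, \<theta>)" by (rule prod.exhaust)
  note h = assms[unfolded a holim_Obj]
  show "k \<in> Obj K \<Longrightarrow> fst a k \<in> Obj (CatAt E k)" using PiE_mem[OF conjunct1[OF h]] by (simp add: a)
  have h': "\<forall>f\<in>Arr K. is_isomorphism (CatAt E (Cod K f)) (\<theta> f) \<and>
           \<theta> f \<in> Hom (CatAt E (Cod K f)) (FOb (FunAt E f) (x (Dom K f))) (x (Cod K f))" using h by (elim conjE)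
  then show "f \<in> Arr K \<Longrightarrow> snd a f \<in> Hom (CatAt E (Cod K f)) (FOb (FunAt E f) (fst a (Dom K f))) (fst a (Cod K f))"
    "f \<in> Arr K \<Longrightarrow> is_isomorphism (CatAt E (Cod K f)) (snd a f)" by (simp_all add: a)
qed

lemma holim_category: "is_category (holim K E)"
proof (rule is_categoryI)
  show "Dom (holim K E) f \<in> Obj (holim K E) \<and> Cod (holim K E) f \<in> Obj (holim K E)" if "f \<in> Arr (holim K E)" for f
    using that by (auto simp: holim_def Let_def)
  show "Ident (holim K E) a \<in> Hom (holim K E) a a" if a: "a \<in> Obj (holim K E)" for a
    unfolding holim_sel holim_Hom
  proof (intro conjI HOL.refl a ballI)
    show "(\<lambda>k\<in>Obj K. Ident (CatAt E k) (fst a k)) \<in> (\<Pi>\<^sub>E k\<in>Obj K. Hom (CatAt E k) (fst a k) (fst a k))"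
      using cat_ident[OF E_category ObD(1)[OF a]] by auto
    fix f assume f: "f \<in> Arr K"
    note o = cat_dom[OF K f] cat_cod[OF K f]
    show "Comp (CatAt E (Cod K f)) ((\<lambda>k\<in>Obj K. Ident (CatAt E k) (fst a k)) (Cod K f)) (snd a f) =
         Comp (CatAt E (Cod K f)) (snd a f) (FAr (FunAt E f) ((\<lambda>k\<in>Obj K. Ident (CatAt E k) (fst a k)) (Dom K f)))"
      using o cat_unit_left[OF E_category[OF o(2)] ObD(2)[OF a f]] cat_unit_right[OF E_category[OF o(2)] ObD(2)[OF a f]]
        functor_ident[OF E_functor[OF f] ObD(1)[OF a o(1)]] by simp
  qed
  show "Comp (holim K E) g f \<in> Hom (holim K E) a c" if f: "f \<in> Hom (holim K E) a b" and g: "g \<in> Hom (holim K E) b c" for f g a b c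
  proof (rule holim_HomE[OF f], rule holim_HomE[OF g])
    fix u v
    assume u: "f = (a, b, u)" "a \<in> Obj (holim K E)" "b \<in> Obj (holim K E)" "u \<in> (\<Pi>\<^sub>E k\<in>Obj K. Hom (CatAt E k) (fst a k) (fst b k))"
      "\<And>f. f \<in> Arr K \<Longrightarrow> Comp (CatAt E (Cod K f)) (u (Cod K f)) (snd a f) = Comp (CatAt E (Cod K f)) (snd b f) (FAr (FunAt E f) (u (Dom K f)))"
    assume v: "g = (b, c, v)" "c \<in> Obj (holim K E)" "v \<in> (\<Pi>\<^sub>E k\<in>Obj K. Hom (CatAt E k) (fst b k) (fst c k))"
      "\<And>f. f \<in> Arr K \<Longrightarrow> Comp (CatAt E (Cod K f)) (v (Cod K f)) (snd b f) = Comp (CatAt E (Cod K f)) (snd c f) (FAr (FunAt E f) (v (Dom K f)))"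
    have uk: "u k \<in> Hom (CatAt E k) (fst a k) (fst b k)" and vk: "v k \<in> Hom (CatAt E k) (fst b k) (fst c k)" if "k \<in> Obj K" for k
      using u v that by auto
    show ?thesis unfolding u(1) v(1) holim_sel holim_Hom
    proof (intro conjI HOL.refl u v ballI)
      show "(\<lambda>k\<in>Obj K. Comp (CatAt E k) (v k) (u k)) \<in> (\<Pi>\<^sub>E k\<in>Obj K. Hom (CatAt E k) (fst a k) (fst c k))"
        using cat_comp[OF E_category uk vk] by auto
      fix f assume f: "f \<in> Arr K"
      note o = cat_dom[OF K f] cat_cod[OF K f]
      note D = E_category[OF o(2)] and Ff = E_functor[OF f]
      note fu = functor_hom[OF Ff uk[OF o(1)]] and fv = functor_hom[OF Ff vk[OF o(1)]]
      show "Comp (CatAt E (Cod K f)) ((\<lambda>k\<in>Obj K. Comp (CatAt E k) (v k) (u k)) (Cod K f)) (snd a f) =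
         Comp (CatAt E (Cod K f)) (snd c f) (FAr (FunAt E f) ((\<lambda>k\<in>Obj K. Comp (CatAt E k) (v k) (u k)) (Dom K f)))"
        using o cat_assoc[OF D ObD(2)[OF u(2) f] uk[OF o(2)] vk[OF o(2)]] u(5)[OF f] v(4)[OF f]
          cat_assoc[OF D fu ObD(2)[OF u(3) f] vk[OF o(2)]] cat_assoc[OF D fu fv ObD(2)[OF v(2) f]]
          functor_comp[OF Ff uk[OF o(1)] vk[OF o(1)]] by simp
    qed
  qed
  fix f a b assume f: "f \<in> Hom (holim K E) a b"
  obtain u where u: "f = (a, b, u)" "u \<in> (\<Pi>\<^sub>E k\<in>Obj K. Hom (CatAt E k) (fst a k) (fst b k))" by (rule holim_HomE[OF f])
  have uk: "u k \<in> Hom (CatAt E k) (fst a k) (fst b k)" if "k \<in> Obj K" for k using u that by auto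
  have ext: "(\<lambda>k\<in>Obj K. u k) = u" using u(2) by (intro extensional_restrict) (simp add: PiE_def)
  show "Comp (holim K E) f (Ident (holim K E) a) = f" "Comp (holim K E) (Ident (holim K E) b) f = f"
    using ext cat_unit_right[OF E_category uk] cat_unit_left[OF E_category uk]
    by (simp_all add: u(1) holim_sel cong: restrict_cong)
  fix g h c d assume g: "g \<in> Hom (holim K E) b c" and h: "h \<in> Hom (holim K E) c d"
  obtain v where v: "g = (b, c, v)" "v \<in> (\<Pi>\<^sub>E k\<in>Obj K. Hom (CatAt E k) (fst b k) (fst c k))" by (rule holim_HomE[OF g])
  obtain w where w: "h = (c, d, w)" "w \<in> (\<Pi>\<^sub>E k\<in>Obj K. Hom (CatAt E k) (fst c k) (fst d k))" by (rule holim_HomE[OF h])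
  have vk: "v k \<in> Hom (CatAt E k) (fst b k) (fst c k)" and wk: "w k \<in> Hom (CatAt E k) (fst c k) (fst d k)"
    if "k \<in> Obj K" for k using v w that by auto
  show "Comp (holim K E) h (Comp (holim K E) g f) = Comp (holim K E) (Comp (holim K E) h g) f"
    using cat_assoc[OF E_category uk vk wk]
    by (simp add: u(1) v(1) w(1) holim_sel cong: restrict_cong)
qed

text \<open>Inverses can be chosen in each component; their compatibility with the structure
  isomorphisms follows from that of \<open>u\<close> by cancellation.\<close>

lemma holim_isoI:
  assumes h: "(a, b, u) \<in> Hom (holim K E) a b" and i: "\<And>k. k \<in> Obj K \<Longrightarrow> is_isomorphism (CatAt E k) (u k)"
  shows "is_isomorphism (holim K E) (a, b, u)"
proof -
  have ab: "a \<in> Obj (holim K E)" "b \<in> Obj (holim K E)" and u: "u \<in> (\<Pi>\<^sub>E k\<in>Obj K. Hom (CatAt E k) (fst a k) (fst b k))"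
    and uc: "\<And>f. f \<in> Arr K \<Longrightarrow> Comp (CatAt E (Cod K f)) (u (Cod K f)) (snd a f) = Comp (CatAt E (Cod K f)) (snd b f) (FAr (FunAt E f) (u (Dom K f)))"
    using h by (auto simp: holim_Hom)
  have uk: "u k \<in> Hom (CatAt E k) (fst a k) (fst b k)" if "k \<in> Obj K" for k using u that by auto
  have "\<exists>v. \<forall>k\<in>Obj K. v k \<in> Hom (CatAt E k) (fst b k) (fst a k) \<and>
      Comp (CatAt E k) (v k) (u k) = Ident (CatAt E k) (fst a k) \<and> Comp (CatAt E k) (u k) (v k) = Ident (CatAt E k) (fst b k)"
  proof (rule bchoice, rule ballI)
    fix k assume k: "k \<in> Obj K"
    obtain g where "g \<in> Hom (CatAt E k) (fst b k) (fst a k)" "Comp (CatAt E k) g (u k) = Ident (CatAt E k) (fst a k)"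
      "Comp (CatAt E k) (u k) g = Ident (CatAt E k) (fst b k)" by (rule is_isomorphismE[OF i[OF k] uk[OF k]])
    then show "\<exists>v. v \<in> Hom (CatAt E k) (fst b k) (fst a k) \<and>
      Comp (CatAt E k) v (u k) = Ident (CatAt E k) (fst a k) \<and> Comp (CatAt E k) (u k) v = Ident (CatAt E k) (fst b k)"
      by (intro exI[of _ g] conjI)
  qed
  then obtain v0 where v0: "\<And>k. k \<in> Obj K \<Longrightarrow> v0 k \<in> Hom (CatAt E k) (fst b k) (fst a k)"
      "\<And>k. k \<in> Obj K \<Longrightarrow> Comp (CatAt E k) (v0 k) (u k) = Ident (CatAt E k) (fst a k)"
      "\<And>k. k \<in> Obj K \<Longrightarrow> Comp (CatAt E k) (u k) (v0 k) = Ident (CatAt E k) (fst b k)" by auto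
  define v where "v = restrict v0 (Obj K)"
  have v: "v k = v0 k" if "k \<in> Obj K" for k using that by (simp add: v_def)
  have g: "(b, a, v) \<in> Hom (holim K E) b a"
    unfolding holim_Hom
  proof (intro conjI HOL.refl ab ballI)
    show "v \<in> (\<Pi>\<^sub>E k\<in>Obj K. Hom (CatAt E k) (fst b k) (fst a k))" using v0(1) by (auto simp: v_def)
    fix f assume f: "f \<in> Arr K"
    note o = cat_dom[OF K f] cat_cod[OF K f]
    note D = E_category[OF o(2)] and Ff = E_functor[OF f]
    note h = ObD(2)[OF ab(1) f] ObD(2)[OF ab(2) f]
    note fu = functor_hom[OF Ff uk[OF o(1)]] and fv = functor_hom[OF Ff v0(1)[OF o(1)]]
    let ?D = "CatAt E (Cod K f)"
    \<comment> \<open>The identity is inserted on the right as the image under the transition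
      functor of \<open>u\<close> after \<open>v0\<close>; the compatibility of \<open>u\<close>
      then lets \<open>v0\<close> and \<open>u\<close> at \<open>Cod K f\<close> cancel.\<close>
    have "Comp ?D (v0 (Cod K f)) (snd b f) = Comp ?D (Comp ?D (v0 (Cod K f)) (snd b f)) (Comp ?D (FAr (FunAt E f) (u (Dom K f))) (FAr (FunAt E f) (v0 (Dom K f))))"
      using functor_comp[OF Ff v0(1)[OF o(1)] uk[OF o(1)]] v0(3)[OF o(1)] functor_ident[OF Ff ObD(1)[OF ab(2) o(1)]]
        cat_unit_right[OF D cat_comp[OF D h(2) v0(1)[OF o(2)]]] by simp
    also have "\<dots> = Comp ?D (Comp ?D (v0 (Cod K f)) (Comp ?D (snd b f) (FAr (FunAt E f) (u (Dom K f))))) (FAr (FunAt E f) (v0 (Dom K f)))"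
      using cat_assoc[OF D fv fu cat_comp[OF D h(2) v0(1)[OF o(2)]]] cat_assoc[OF D fu h(2) v0(1)[OF o(2)]] by simp
    also have "\<dots> = Comp ?D (Comp ?D (Comp ?D (v0 (Cod K f)) (u (Cod K f))) (snd a f)) (FAr (FunAt E f) (v0 (Dom K f)))"
      using uc[OF f] cat_assoc[OF D h(1) uk[OF o(2)] v0(1)[OF o(2)]] by simp
    also have "\<dots> = Comp ?D (snd a f) (FAr (FunAt E f) (v0 (Dom K f)))"
      using v0(2)[OF o(2)] cat_unit_left[OF D h(1)] by simp
    finally show "Comp ?D (v (Cod K f)) (snd b f) = Comp ?D (snd a f) (FAr (FunAt E f) (v (Dom K f)))"
      using v o by simp
  qed
  show ?thesis
    by (rule is_isomorphismI[OF h g]) (simp_all add: holim_sel v v0 cong: restrict_cong)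
qed

end

section \<open>The descent functor and its full faithfulness\<close>

section \<open>The descent functor\<close>

text \<open>Arrows of \<open>Mod\<close> carry their endpoints and are extensional. Composites
  obtained in different ways are cut off by different formulas, so they are compared on sections
  only.\<close>

lemma Mod_arr_eqI:
  assumes "(F, G, \<eta>) \<in> Hom (Mod S R) A B" "(F', G', \<zeta>) \<in> Hom (Mod S R) A B"
    "\<And>x m. x \<in> Obj S \<Longrightarrow> m \<in> Sec A x \<Longrightarrow> \<eta> x m = \<zeta> x m"
  shows "(F, G, \<eta>) = (F', G', \<zeta>)"
proof -
  have "F = A" "G = B" "F' = A" "G' = B" and n: "\<eta> \<in> nat_maps S A B" "\<zeta> \<in> nat_maps S A B"
    using assms(1,2) by (auto simp: Mod_Hom mod_hom_def)
  then show ?thesis using nat_maps_eqI[OF n assms(3)] by simp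
qed

lemma op_cat_sel [simp]:
  "Obj (op_cat I) = Obj I" "Arr (op_cat I) = Arr I" "Dom (op_cat I) = Cod I" "Cod (op_cat I) = Dom I"
  "Ident (op_cat I) = Ident I" "Comp (op_cat I) g f = Comp I f g"
  by (simp_all add: op_cat_def)

lemma op_cat_Hom: "f \<in> Hom (op_cat I) j i \<longleftrightarrow> f \<in> Hom I i j"
  by (auto simp: Hom_def)

lemma op_category:
  assumes I: "is_category I"
  shows "is_category (op_cat I)"
  by (rule is_categoryI)
    (use cat_dom[OF I] cat_cod[OF I] cat_ident[OF I] cat_comp[OF I] cat_unit_left[OF I] cat_unit_right[OF I]
      cat_assoc[OF I] in \<open>simp_all add: op_cat_Hom\<close>)

locale ringed_hocolim = pdiagram C I U
  for C :: "('c, 'a) site" and I :: "('i, 'j) cat" and U :: "('i, 'j, 'c, 'a, 'o, 'g) pdiag" +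
  fixes RI :: "('i, 'j, 'c, 'a, 'o, 'g, 'r) rdata"
    and R :: "(('i, 'j, 'c, 'o) hs_ob, ('i, 'j, 'c, 'a, 'o, 'g) hs_arr, 'r) rsheaf"
    and b :: "'i \<Rightarrow> ('c \<times> 'o, ('c, 'a, 'o, 'g) sl_arr, 'r) rsheaf_arr"
  assumes site: "is_site C"
    and R: "is_ring_sheaf (slice C (hocolim_psh C I U)) R"
    and b: "is_isomorphism (holim (op_cat I) (ShRing_diag C I U)) (ring_restr C I U R, RI, b)"
begin

lemma Cov_arr: "X \<in> Obj C \<Longrightarrow> c \<in> Cov C X \<Longrightarrow> u \<in> c \<Longrightarrow> u \<in> Hom C (Dom C u) X"
  by (rule site_cover_Hom[OF site])

lemma on_siteI: "gpsh_on C N \<Longrightarrow> gpsh_on_site C N"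
  by (intro gpsh_on_site.intro gpsh_on_site_axioms.intro) (auto intro: Cov_arr)

lemma U_on_site: "i \<in> Obj I \<Longrightarrow> gpsh_on_site C (DOb U i)"
  by (rule on_siteI[OF U_on])

lemma MM_on_site: "gpsh_on_site C MM"
  by (rule on_siteI[OF MM_on])

lemma hom_siteI: "gpsh_hom C N M \<phi> \<Longrightarrow> gpsh_hom_site C N M \<phi>"
  by (intro gpsh_hom_site.intro on_siteI) (auto simp: gpsh_hom_def)

abbreviation "Ri \<equiv> fst RI"
abbreviation "al \<equiv> snd RI"
abbreviation "RJ i \<equiv> psh_pull (Si i) (Jm i) R"
definition "rb i = snd (snd (b i))"
definition "ra \<phi> = snd (snd (al \<phi>))"
abbreviation "ED \<equiv> Mod_diag C I U RI"
text \<open>\<open>pm\<close> pulls a module back along \<open>\<phi>\<close> and transports it to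
  the ring at the source of \<open>\<phi>\<close>; \<open>tr i\<close> restricts a module on the
  homotopy colimit to \<open>U i\<close> and transports it along \<open>b i\<close>.\<close>

abbreviation "pm \<phi> F \<equiv> FOb (FunAt ED \<phi>) F"
abbreviation "tr i F \<equiv> transport (Si i) (b i) (psh_pull (Si i) (Jm i) F)"
abbreviation "\<Phi> \<equiv> descent_functor C I U RI b"
abbreviation "cmap \<equiv> canon_map C I U"

lemma b_Hom: "(ring_restr C I U R, RI, b) \<in> Hom (holim (op_cat I) (ShRing_diag C I U)) (ring_restr C I U R) RI"
  by (rule HomI) (use b in \<open>simp_all add: is_isomorphism_def\<close>, simp_all add: holim_def Let_def)

lemma ShRing_diag_sel: "CatAt (ShRing_diag C I U) i = ShRing (Si i)"
  "FOb (FunAt (ShRing_diag C I U) \<phi>) = psh_pull (Si (Dom I \<phi>)) (Tm \<phi>)"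
  "FAr (FunAt (ShRing_diag C I U) \<phi>) = psh_pull_arr (Si (Dom I \<phi>)) (Tm \<phi>)"
  by (simp_all add: ShRing_diag_def)

lemma ring_restr_sel: "i \<in> Obj I \<Longrightarrow> fst (ring_restr C I U R) i = RJ i"
  "\<phi> \<in> Hom I i j \<Longrightarrow> snd (ring_restr C I U R) \<phi> = (psh_pull (Si i) (Tm \<phi>) (RJ j), RJ i, cmap R \<phi>)"
  by (auto simp: ring_restr_def pull_incl_def ShRing_diag_sel Hom_def cat_cod[OF I] cat_dom[OF I])

lemma b_iso:
  assumes i: "i \<in> Obj I"
  shows "b i = (RJ i, Ri i, rb i)" "ring_sheaf_iso (Si i) (RJ i) (Ri i) (rb i)"
proof -
  have h: "b \<in> (\<Pi>\<^sub>E k\<in>Obj (op_cat I). Hom (CatAt (ShRing_diag C I U) k) (fst (ring_restr C I U R) k) (Ri k))"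
    using b_Hom[unfolded holim_Hom] by (elim conjE)
  have "b i \<in> Hom (ShRing (Si i)) (RJ i) (Ri i)"
    using PiE_mem[OF h, of i] i by (simp add: ShRing_diag_sel ring_restr_sel(1))
  moreover have "is_isomorphism (ShRing (Si i)) (b i)"
    using holim_iso_component[OF b, of i] i by (simp add: ShRing_diag_sel)
  ultimately obtain \<beta> where "b i = (RJ i, Ri i, \<beta>)" "ring_sheaf_iso (Si i) (RJ i) (Ri i) \<beta>" using ShRing_isoE by metis
  then show "b i = (RJ i, Ri i, rb i)" "ring_sheaf_iso (Si i) (RJ i) (Ri i) (rb i)" by (simp_all add: rb_def)
qed

lemma RI_Obj: "(Ri, al) \<in> Obj (holim (op_cat I) (ShRing_diag C I U))"
  using b_Hom[unfolded holim_Hom] by simp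

lemma al_iso:
  assumes \<phi>: "\<phi> \<in> Hom I i j"
  shows "al \<phi> = (psh_pull (Si i) (Tm \<phi>) (Ri j), Ri i, ra \<phi>)" "ring_sheaf_iso (Si i) (psh_pull (Si i) (Tm \<phi>) (Ri j)) (Ri i) (ra \<phi>)"
proof -
  have "\<forall>f\<in>Arr (op_cat I). is_isomorphism (CatAt (ShRing_diag C I U) (Cod (op_cat I) f)) (al f) \<and>
           al f \<in> Hom (CatAt (ShRing_diag C I U) (Cod (op_cat I) f)) (FOb (FunAt (ShRing_diag C I U) f) (Ri (Dom (op_cat I) f))) (Ri (Cod (op_cat I) f))"
    using RI_Obj[unfolded holim_Obj] by (elim conjE)
  then have "is_isomorphism (ShRing (Si i)) (al \<phi>)" "al \<phi> \<in> Hom (ShRing (Si i)) (psh_pull (Si i) (Tm \<phi>) (Ri j)) (Ri i)"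
    using HomD[OF \<phi>] by (auto simp: ShRing_diag_sel)
  then obtain \<beta> where "al \<phi> = (psh_pull (Si i) (Tm \<phi>) (Ri j), Ri i, \<beta>)" "ring_sheaf_iso (Si i) (psh_pull (Si i) (Tm \<phi>) (Ri j)) (Ri i) \<beta>"
    using ShRing_isoE by metis
  then show "al \<phi> = (psh_pull (Si i) (Tm \<phi>) (Ri j), Ri i, ra \<phi>)" "ring_sheaf_iso (Si i) (psh_pull (Si i) (Tm \<phi>) (Ri j)) (Ri i) (ra \<phi>)"
    by (simp_all add: ra_def)
qed

lemma ShRing_sel:
  "Ident (ShRing S) F = (F, F, norm_map S F (\<lambda>x m. m))"
  "Comp (ShRing S) (G', H, \<epsilon>) (F, G, \<eta>) = (F, H, norm_map S F (\<lambda>x m. \<epsilon> x (\<eta> x m)))"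
  by (simp_all add: ShRing_def psh_cat_sel)

lemma Tm_Obj: "\<phi> \<in> Hom I i j \<Longrightarrow> z \<in> Obj (Si i) \<Longrightarrow> FOb (Tm \<phi>) z \<in> Obj (Si j)"
  by (rule functor_ob[OF Tm_functor])

lemma Jm_Obj: "i \<in> Obj I \<Longrightarrow> z \<in> Obj (Si i) \<Longrightarrow> FOb (Jm i) z \<in> Obj SM"
  by (rule functor_ob[OF Jm_functor])

lemma ra_Ident:
  assumes i: "i \<in> Obj I" and z: "z \<in> Obj (Si i)" and r: "r \<in> Sec (Ri i) z"
  shows "ra (Ident I i) z r = r"
proof -
  have "\<forall>k\<in>Obj (op_cat I). al (Ident (op_cat I) k) = Ident (CatAt (ShRing_diag C I U) k) (Ri k)"
    using RI_Obj[unfolded holim_Obj] by (elim conjE)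
  then have "ra (Ident I i) = norm_map (Si i) (Ri i) (\<lambda>x m. m)" using i by (simp add: ra_def ShRing_diag_sel ShRing_sel)
  then show ?thesis using z r by simp
qed

lemma ra_Comp:
  assumes \<phi>: "\<phi> \<in> Hom I i j" and \<psi>: "\<psi> \<in> Hom I j k" and z: "z \<in> Obj (Si i)"
    and r: "r \<in> Sec (Ri k) (FOb (Tm \<psi>) (FOb (Tm \<phi>) z))"
  shows "ra (Comp I \<psi> \<phi>) z r = ra \<phi> z (ra \<psi> (FOb (Tm \<phi>) z) r)"
proof -
  have "\<forall>f\<in>Arr (op_cat I). \<forall>g\<in>Arr (op_cat I). Dom (op_cat I) g = Cod (op_cat I) f \<longrightarrow>
           al (Comp (op_cat I) g f) = Comp (CatAt (ShRing_diag C I U) (Cod (op_cat I) g)) (al g) (FAr (FunAt (ShRing_diag C I U) g) (al f))"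
    using RI_Obj[unfolded holim_Obj] by (elim conjE)
  then have "al (Comp I \<psi> \<phi>) = Comp (ShRing (Si i)) (al \<phi>) (psh_pull_arr (Si i) (Tm \<phi>) (al \<psi>))"
    using HomD[OF \<phi>] HomD[OF \<psi>] by (auto simp: ShRing_diag_sel)
  then have "ra (Comp I \<psi> \<phi>) = norm_map (Si i) (psh_pull (Si i) (Tm \<phi>) (psh_pull (Si j) (Tm \<psi>) (Ri k)))
      (\<lambda>x m. ra \<phi> x ((\<lambda>x\<in>Obj (Si i). ra \<psi> (FOb (Tm \<phi>) x)) x m))"
    unfolding al_iso(1)[OF \<phi>] al_iso(1)[OF \<psi>] psh_pull_arr_def prod.case ShRing_sel
    by (simp add: ra_def)
  then show ?thesis using z r Tm_Obj[OF \<phi> z] by (simp add: psh_pull_sel)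
qed

lemma canon_map_eq:
  assumes \<phi>: "\<phi> \<in> Hom I i j" and z: "z \<in> Obj (Si i)" and m: "m \<in> Sec F (FOb (Jm j) (FOb (Tm \<phi>) z))"
  shows "cmap F \<phi> z m = Restr F (can \<phi> z) m"
proof -
  have "fst (snd (can \<phi> z)) = FOb (Jm j) (FOb (Tm \<phi>) z)"
    using HomD[OF can_Hom[OF \<phi> z]] by (cases "can \<phi> z") (simp add: slice_sel(3) split: prod.splits)
  then show ?thesis using z m HomD[OF \<phi>] by (simp add: canon_map_def)
qed

text \<open>This is the condition that \<open>b\<close> is an arrow of the homotopy limit, evaluated
  on a section. It reconciles the two ways in which a scalar of \<open>R\<close> acts across a
  canonical arrow, and so gives the linearity of canonical maps and the semilinearity of the glued
  sheaf.\<close>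

lemma ra_rb:
  assumes \<phi>: "\<phi> \<in> Hom I i j" and z: "z \<in> Obj (Si i)" and r: "r \<in> Sec R (FOb (Jm j) (FOb (Tm \<phi>) z))"
  shows "ra \<phi> z (rb j (FOb (Tm \<phi>) z) r) = rb i z (Restr R (can \<phi> z) r)"
proof -
  have ij: "i \<in> Obj I" "j \<in> Obj I" using Hom_objD[OF I \<phi>] by auto
  have "\<forall>f\<in>Arr (op_cat I). Comp (CatAt (ShRing_diag C I U) (Cod (op_cat I) f)) (b (Cod (op_cat I) f)) (snd (ring_restr C I U R) f) =
             Comp (CatAt (ShRing_diag C I U) (Cod (op_cat I) f)) (al f) (FAr (FunAt (ShRing_diag C I U) f) (b (Dom (op_cat I) f)))"
    using b_Hom[unfolded holim_Hom] by (elim conjE)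
  then have "Comp (ShRing (Si i)) (b i) (snd (ring_restr C I U R) \<phi>) = Comp (ShRing (Si i)) (al \<phi>) (psh_pull_arr (Si i) (Tm \<phi>) (b j))"
    using HomD[OF \<phi>] by (auto simp: ShRing_diag_sel)
  then have "norm_map (Si i) (psh_pull (Si i) (Tm \<phi>) (RJ j)) (\<lambda>x m. rb i x (cmap R \<phi> x m)) =
    norm_map (Si i) (psh_pull (Si i) (Tm \<phi>) (RJ j)) (\<lambda>x m. ra \<phi> x ((\<lambda>x\<in>Obj (Si i). rb j (FOb (Tm \<phi>) x)) x m))"
    unfolding al_iso(1)[OF \<phi>] b_iso(1)[OF ij(1)] b_iso(1)[OF ij(2)] ring_restr_sel(2)[OF \<phi>] psh_pull_arr_def prod.case ShRing_sel
    by simp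
  from fun_cong[OF fun_cong[OF this], of z r] show ?thesis
    using z r Tm_Obj[OF \<phi> z] by (simp add: psh_pull_sel canon_map_eq[OF \<phi> z])
qed

subsection \<open>The diagram of module categories\<close>

lemma ED_sel: "CatAt ED i = Mod (Si i) (Ri i)"
  "\<phi> \<in> Hom I i j \<Longrightarrow> pm \<phi> F = transport (Si i) (al \<phi>) (psh_pull (Si i) (Tm \<phi>) F)"
  "\<phi> \<in> Hom I i j \<Longrightarrow> FAr (FunAt ED \<phi>) (F, G, \<eta>) = (pm \<phi> F, pm \<phi> G, \<lambda>x\<in>Obj (Si i). \<eta> (FOb (Tm \<phi>) x))"
  by (auto simp: Mod_diag_def case_prod_unfold Let_def ftr_comp_def transport_arr_def psh_pull_arr_def Hom_def)

lemma pm_sel: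
  assumes \<phi>: "\<phi> \<in> Hom I i j" and z: "z \<in> Obj (Si i)"
  shows "Sec (pm \<phi> F) z = Sec F (FOb (Tm \<phi>) z)"
    "add (Sect (pm \<phi> F) z) = add (Sect F (FOb (Tm \<phi>) z))"
  using z unfolding ED_sel(2)[OF \<phi>] al_iso(1)[OF \<phi>] by (simp_all add: transport_carrier psh_pull_sel)

lemma pm_Restr:
  assumes \<phi>: "\<phi> \<in> Hom I i j" and f: "f \<in> Hom (Si i) z w"
  shows "Restr (pm \<phi> F) f = Restr F (FAr (Tm \<phi>) f)"
  using HomD[OF f] unfolding ED_sel(2)[OF \<phi>] al_iso(1)[OF \<phi>] by (simp add: transport_sel psh_pull_sel)

text \<open>Stating the action on scalars of the form \<open>ra \<phi> z r\<close> avoids the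
  inverse map in \<open>transport\<close>; by \<open>ra_surj\<close> every scalar has this
  form.\<close>

lemma pm_smult:
  assumes \<phi>: "\<phi> \<in> Hom I i j" and z: "z \<in> Obj (Si i)" and r: "r \<in> Sec (Ri j) (FOb (Tm \<phi>) z)"
  shows "smult (Sect (pm \<phi> F) z) (ra \<phi> z r) = smult (Sect F (FOb (Tm \<phi>) z)) r"
  unfolding ED_sel(2)[OF \<phi>] al_iso(1)[OF \<phi>]
  using transport_smult[OF al_iso(2)[OF \<phi>] z, of r "psh_pull (Si i) (Tm \<phi>) F"] r z by (simp add: psh_pull_sel)

lemma tr_sel:
  assumes i: "i \<in> Obj I" and z: "z \<in> Obj (Si i)"
  shows "Sec (tr i F) z = Sec F (FOb (Jm i) z)"
    "add (Sect (tr i F) z) = add (Sect F (FOb (Jm i) z))"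
  using z unfolding b_iso(1)[OF i] by (simp_all add: transport_carrier psh_pull_sel)

lemma tr_Restr:
  assumes i: "i \<in> Obj I" and f: "f \<in> Hom (Si i) z w"
  shows "Restr (tr i F) f = Restr F (FAr (Jm i) f)"
  using HomD[OF f] unfolding b_iso(1)[OF i] by (simp add: transport_sel psh_pull_sel)

lemma tr_smult:
  assumes i: "i \<in> Obj I" and z: "z \<in> Obj (Si i)" and r: "r \<in> Sec R (FOb (Jm i) z)"
  shows "smult (Sect (tr i F) z) (rb i z r) = smult (Sect F (FOb (Jm i) z)) r"
  unfolding b_iso(1)[OF i]
  using transport_smult[OF b_iso(2)[OF i] z, of r "psh_pull (Si i) (Jm i) F"] r z by (simp add: psh_pull_sel)

lemma rb_surj:
  assumes i: "i \<in> Obj I" and z: "z \<in> Obj (Si i)" and r: "r \<in> Sec (Ri i) z"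
  obtains t where "t \<in> Sec R (FOb (Jm i) z)" "r = rb i z t"
  using ring_iso_surj[OF b_iso(2)[OF i] z r] z by (auto simp: psh_pull_sel)

lemma ra_surj:
  assumes \<phi>: "\<phi> \<in> Hom I i j" and z: "z \<in> Obj (Si i)" and r: "r \<in> Sec (Ri i) z"
  obtains t where "t \<in> Sec (Ri j) (FOb (Tm \<phi>) z)" "r = ra \<phi> z t"
  using ring_iso_surj[OF al_iso(2)[OF \<phi>] z r] z by (auto simp: psh_pull_sel)

lemma pm_module_sheaf:
  assumes \<phi>: "\<phi> \<in> Hom I i j" and F: "is_module_sheaf (Si j) (Ri j) F"
  shows "is_module_sheaf (Si i) (Ri i) (pm \<phi> F)"
proof -
  have i: "i \<in> Obj I" using Hom_objD[OF I \<phi>] by auto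
  show ?thesis unfolding ED_sel(2)[OF \<phi>] al_iso(1)[OF \<phi>]
    by (rule transport_module_sheaf[OF al_iso(2)[OF \<phi>] pull_module_sheaf[OF Tm_functor[OF \<phi>] F] Si_category[OF i]])
      (rule gpsh_hom_site.psh_pull_sheaf[OF hom_siteI[OF DAr_hom[OF \<phi>]] module_sheafD(1)[OF F]])
qed

lemma tr_module_sheaf:
  assumes i: "i \<in> Obj I" and F: "is_module_sheaf SM R F"
  shows "is_module_sheaf (Si i) (Ri i) (tr i F)"
  unfolding b_iso(1)[OF i]
  by (rule transport_module_sheaf[OF b_iso(2)[OF i] pull_module_sheaf[OF Jm_functor[OF i] F] Si_category[OF i]])
    (rule gpsh_hom_site.psh_pull_sheaf[OF hom_siteI[OF incl_hom[OF i]] module_sheafD(1)[OF F]])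

lemma pm_mod_hom:
  assumes \<phi>: "\<phi> \<in> Hom I i j" and e: "mod_hom (Si j) (Ri j) F G \<eta>"
  shows "mod_hom (Si i) (Ri i) (pm \<phi> F) (pm \<phi> G) (\<lambda>x\<in>Obj (Si i). \<eta> (FOb (Tm \<phi>) x))"
proof -
  have i: "i \<in> Obj I" using Hom_objD[OF I \<phi>] by auto
  show ?thesis unfolding ED_sel(2)[OF \<phi>] al_iso(1)[OF \<phi>] transport_mod_hom_iff[OF al_iso(2)[OF \<phi>] Si_category[OF i]]
    by (rule pull_mod_hom[OF Tm_functor[OF \<phi>] e])
qed

lemma tr_mod_hom:
  assumes i: "i \<in> Obj I" and e: "mod_hom SM R F G \<eta>"
  shows "mod_hom (Si i) (Ri i) (tr i F) (tr i G) (\<lambda>x\<in>Obj (Si i). \<eta> (FOb (Jm i) x))"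
  unfolding b_iso(1)[OF i] transport_mod_hom_iff[OF b_iso(2)[OF i] Si_category[OF i]]
  by (rule pull_mod_hom[OF Jm_functor[OF i] e])

lemma FunAt_functor:
  assumes \<phi>: "\<phi> \<in> Hom I i j"
  shows "is_functor (Mod (Si j) (Ri j)) (Mod (Si i) (Ri i)) (FunAt ED \<phi>)"
proof -
  have ij: "i \<in> Obj I" "j \<in> Obj I" using Hom_objD[OF I \<phi>] by auto
  note Ci = Mod_category[OF Si_category[OF ij(1)]] and Cj = Mod_category[OF Si_category[OF ij(2)]]
  show ?thesis
  proof (rule is_functorI[OF Cj Ci])
    show "pm \<phi> F \<in> Obj (Mod (Si i) (Ri i))" if "F \<in> Obj (Mod (Si j) (Ri j))" for F
      using pm_module_sheaf[OF \<phi>] that by simp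
    show hom: "FAr (FunAt ED \<phi>) f \<in> Hom (Mod (Si i) (Ri i)) (pm \<phi> F) (pm \<phi> G)"
      if f: "f \<in> Hom (Mod (Si j) (Ri j)) F G" for f F G
      by (rule Mod_HomE[OF f]) (simp add: ED_sel(3)[OF \<phi>] Mod_Hom pm_module_sheaf[OF \<phi>] pm_mod_hom[OF \<phi>])
    show "FAr (FunAt ED \<phi>) (Ident (Mod (Si j) (Ri j)) F) = Ident (Mod (Si i) (Ri i)) (pm \<phi> F)"
      if F: "F \<in> Obj (Mod (Si j) (Ri j))" for F
    proof -
      have h1: "FAr (FunAt ED \<phi>) (Ident (Mod (Si j) (Ri j)) F) \<in> Hom (Mod (Si i) (Ri i)) (pm \<phi> F) (pm \<phi> F)"
        by (rule hom[OF cat_ident[OF Cj F]])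
      have h2: "Ident (Mod (Si i) (Ri i)) (pm \<phi> F) \<in> Hom (Mod (Si i) (Ri i)) (pm \<phi> F) (pm \<phi> F)"
        by (rule cat_ident[OF Ci]) (use F in \<open>simp add: pm_module_sheaf[OF \<phi>]\<close>)
      show ?thesis
        unfolding Mod_sel ED_sel(3)[OF \<phi>]
        by (rule Mod_arr_eqI[OF h1[unfolded Mod_sel ED_sel(3)[OF \<phi>]] h2[unfolded Mod_sel]])
          (simp add: pm_sel[OF \<phi>] Tm_Obj[OF \<phi>])
    qed
    show "FAr (FunAt ED \<phi>) (Comp (Mod (Si j) (Ri j)) g f) = Comp (Mod (Si i) (Ri i)) (FAr (FunAt ED \<phi>) g) (FAr (FunAt ED \<phi>) f)"
      if f: "f \<in> Hom (Mod (Si j) (Ri j)) F G" and g: "g \<in> Hom (Mod (Si j) (Ri j)) G H" for f g F G H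
    proof -
      obtain \<eta> where f': "f = (F, G, \<eta>)" by (rule Mod_HomE[OF f])
      obtain \<epsilon> where g': "g = (G, H, \<epsilon>)" by (rule Mod_HomE[OF g])
      note h1 = hom[OF cat_comp[OF Cj f g]] and h2 = cat_comp[OF Ci hom[OF f] hom[OF g]]
      show ?thesis
        unfolding f' g' Mod_sel ED_sel(3)[OF \<phi>]
        by (rule Mod_arr_eqI[OF h1[unfolded f' g' Mod_sel ED_sel(3)[OF \<phi>]] h2[unfolded f' g' Mod_sel ED_sel(3)[OF \<phi>]]])
          (simp add: pm_sel[OF \<phi>] Tm_Obj[OF \<phi>])
    qed
  qed
qed

lemma ED_diagram: "cat_diagram (op_cat I) ED"
proof (intro cat_diagram.intro)
  show "is_category (op_cat I)" by (rule op_category[OF I])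
  show "is_category (CatAt ED k)" if "k \<in> Obj (op_cat I)" for k
    unfolding ED_sel(1) by (rule Mod_category[OF Si_category]) (use that in simp)
  show "is_functor (CatAt ED (Dom (op_cat I) f)) (CatAt ED (Cod (op_cat I) f)) (FunAt ED f)" if "f \<in> Arr (op_cat I)" for f
    unfolding ED_sel(1) op_cat_sel by (rule FunAt_functor[OF Arr_Hom]) (use that in simp)
qed

lemma msheaf_eqI:
  assumes "Sect F \<in> extensional A" "Sect G \<in> extensional A" "Restr F \<in> extensional B" "Restr G \<in> extensional B"
    "\<And>z. z \<in> A \<Longrightarrow> Sect F z = Sect G z" "\<And>f. f \<in> B \<Longrightarrow> Restr F f = Restr G f"
  shows "F = (G :: ('x, 'f, 'v, 'z) psh)"
  using extensionalityI[OF assms(1,2)] extensionalityI[OF assms(3,4)] assms(5,6) by (intro psh.equality) auto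

lemma presheaf_ext: "is_presheaf S F \<Longrightarrow> Sect F \<in> extensional (Obj S) \<and> Restr F \<in> extensional (Arr S)"
  by (simp add: is_presheaf_def)

text \<open>Equality holds on the nose because sections, restrictions and scalar multiplications are
  all extensional, and the ring isomorphism at an identity is the identity on sections.\<close>

lemma pm_Ident:
  assumes i: "i \<in> Obj I" and F: "is_module_sheaf (Si i) (Ri i) F"
  shows "pm (Ident I i) F = F"
proof -
  note id = cat_ident[OF I i]
  note e1 = presheaf_ext[OF module_sheaf_presheaf[OF F]] and e2 = presheaf_ext[OF module_sheaf_presheaf[OF pm_module_sheaf[OF id F]]]
  show ?thesis
  proof (rule msheaf_eqI)
    fix z assume z: "z \<in> Obj (Si i)"
    note bij = ring_sheaf_isoD(4)[OF al_iso(2)[OF id] z]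
    have s: "Sec (psh_pull (Si i) (Tm (Ident I i)) (Ri i)) z = Sec (Ri i) z"
      using z Tm_Ident_ob[OF i z] by (simp add: psh_pull_sel)
    have "inv_into (Sec (Ri i) z) (ra (Ident I i) z) r = r" if "r \<in> Sec (Ri i) z" for r
      using inv_into_f_f[of "ra (Ident I i) z" "Sec (Ri i) z" r] bij ra_Ident[OF i z that] that unfolding s bij_betw_def by simp
    then have "(\<lambda>r\<in>Sec (Ri i) z. smult (Sect F z) (inv_into (Sec (Ri i) z) (ra (Ident I i) z) r)) = smult (Sect F z)"
      using extensional_restrict[OF module_sheafD(5)[OF F z]] by (simp cong: restrict_cong)
    then show "Sect (pm (Ident I i) F) z = Sect F z"
      unfolding ED_sel(2)[OF id] al_iso(1)[OF id] transport_sel(2)[OF z] s by (simp add: psh_pull_sel z Tm_Ident_ob[OF i z])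
  next
    fix f assume "f \<in> Arr (Si i)"
    then show "Restr (pm (Ident I i) F) f = Restr F f" using pm_Restr[OF id Arr_Hom] Tm_Ident_ar[OF i Arr_Hom] by simp
  qed (use e1 e2 in auto)
qed

text \<open>An equality of sheaves, not only an isomorphism: in the cocycle condition of the
  homotopy limit, the two sides have these two sheaves as sources.\<close>

lemma pm_Comp:
  assumes \<phi>: "\<phi> \<in> Hom I i j" and \<psi>: "\<psi> \<in> Hom I j k" and F: "is_module_sheaf (Si k) (Ri k) F"
  shows "pm (Comp I \<psi> \<phi>) F = pm \<phi> (pm \<psi> F)"
proof -
  note c = cat_comp[OF I \<phi> \<psi>]
  note e1 = presheaf_ext[OF module_sheaf_presheaf[OF pm_module_sheaf[OF c F]]]
    and e2 = presheaf_ext[OF module_sheaf_presheaf[OF pm_module_sheaf[OF \<phi> pm_module_sheaf[OF \<psi> F]]]]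
  show ?thesis
  proof (rule msheaf_eqI)
    fix z assume z: "z \<in> Obj (Si i)"
    note w = Tm_Obj[OF \<phi> z]
    note bij = ring_sheaf_isoD(4)[OF al_iso(2)[OF c] z] ring_sheaf_isoD(4)[OF al_iso(2)[OF \<phi>] z] ring_sheaf_isoD(4)[OF al_iso(2)[OF \<psi>] w]
    let ?A = "Sec (Ri k) (FOb (Tm \<psi>) (FOb (Tm \<phi>) z))" and ?B = "Sec (Ri j) (FOb (Tm \<phi>) z)"
    have s: "Sec (psh_pull (Si i) (Tm (Comp I \<psi> \<phi>)) (Ri k)) z = ?A" "Sec (psh_pull (Si i) (Tm \<phi>) (Ri j)) z = ?B"
       "Sec (psh_pull (Si j) (Tm \<psi>) (Ri k)) (FOb (Tm \<phi>) z) = ?A"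
      using z w Tm_Comp_ob[OF \<phi> \<psi> z] by (simp_all add: psh_pull_sel)
    note bij' = bij[unfolded s]
    \<comment> \<open>The inverse of a composite is the composite of the inverses; writing
      \<open>r\<close> as the image of some \<open>p\<close> along both transition maps makes all
      three inverses explicit.\<close>
    have "inv_into ?B (ra \<phi> z) r \<in> ?B \<and> inv_into ?A (ra (Comp I \<psi> \<phi>) z) r = inv_into ?A (ra \<psi> (FOb (Tm \<phi>) z)) (inv_into ?B (ra \<phi> z) r)"
      if r: "r \<in> Sec (Ri i) z" for r
    proof -
      obtain q where q: "q \<in> ?B" "r = ra \<phi> z q" using ra_surj[OF \<phi> z r] .
      obtain p where p: "p \<in> ?A" "q = ra \<psi> (FOb (Tm \<phi>) z) p" using ra_surj[OF \<psi> w q(1)] .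
      have rp: "r = ra (Comp I \<psi> \<phi>) z p" using ra_Comp[OF \<phi> \<psi> z p(1)] p q by simp
      have "inv_into ?B (ra \<phi> z) r = q" unfolding q(2) by (rule inv_into_f_f[OF bij_betw_imp_inj_on[OF bij'(2)] q(1)])
      moreover have "inv_into ?A (ra \<psi> (FOb (Tm \<phi>) z)) q = p" unfolding p(2) by (rule inv_into_f_f[OF bij_betw_imp_inj_on[OF bij'(3)] p(1)])
      moreover have "inv_into ?A (ra (Comp I \<psi> \<phi>) z) r = p" unfolding rp by (rule inv_into_f_f[OF bij_betw_imp_inj_on[OF bij'(1)] p(1)])
      ultimately show ?thesis using q(1) by simp
    qed
    then have "(\<lambda>r\<in>Sec (Ri i) z. smult (Sect F (FOb (Tm \<psi>) (FOb (Tm \<phi>) z))) (inv_into ?A (ra (Comp I \<psi> \<phi>) z) r)) =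
       (\<lambda>r\<in>Sec (Ri i) z. (\<lambda>r\<in>?B. smult (Sect F (FOb (Tm \<psi>) (FOb (Tm \<phi>) z))) (inv_into ?A (ra \<psi> (FOb (Tm \<phi>) z)) r)) (inv_into ?B (ra \<phi> z) r))"
      by (intro restrict_ext) simp
    then show "Sect (pm (Comp I \<psi> \<phi>) F) z = Sect (pm \<phi> (pm \<psi> F)) z"
      unfolding ED_sel(2)[OF \<phi>] ED_sel(2)[OF \<psi>] ED_sel(2)[OF c] al_iso(1)[OF \<phi>] al_iso(1)[OF \<psi>] al_iso(1)[OF c] transport_sel(2)[OF z] s
      by (simp add: psh_pull_sel z w Tm_Comp_ob[OF \<phi> \<psi> z] transport_sel(2)[OF w] s)
  next
    fix f assume "f \<in> Arr (Si i)"
    then have f: "f \<in> Hom (Si i) (Dom (Si i) f) (Cod (Si i) f)" by (rule Arr_Hom)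
    show "Restr (pm (Comp I \<psi> \<phi>) F) f = Restr (pm \<phi> (pm \<psi> F)) f"
      by (simp add: pm_Restr[OF c f] pm_Restr[OF \<phi> f] pm_Restr[OF \<psi> functor_hom[OF Tm_functor[OF \<phi>] f]] Tm_Comp_ar[OF \<phi> \<psi> f])
  qed (use e1 e2 in auto)
qed

subsection \<open>Full faithfulness\<close>

lemma \<Phi>_ob: "FOb \<Phi> F = (\<lambda>i\<in>Obj I. tr i F, \<lambda>\<phi>\<in>Arr I. (pm \<phi> (tr (Cod I \<phi>) F), tr (Dom I \<phi>) F, cmap F \<phi>))"
  and \<Phi>_ar: "FAr \<Phi> (F, G, \<eta>) = (FOb \<Phi> F, FOb \<Phi> G, \<lambda>i\<in>Obj I. (tr i F, tr i G, \<lambda>x\<in>Obj (Si i). \<eta> (FOb (Jm i) x)))"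
  by (simp_all add: descent_functor_def Let_def pull_incl_def psh_pull_arr_def transport_arr_def)

text \<open>Restriction along \<open>can \<phi> z\<close> is semilinear over the restriction of
  \<open>R\<close>. By \<open>ra_rb\<close> the two transported actions of \<open>Ri i\<close>
  differ by exactly this restriction, so the map becomes linear; naturality is
  \<open>can_natural\<close>.\<close>

lemma canon_Hom:
  assumes \<phi>: "\<phi> \<in> Hom I i j" and F: "is_module_sheaf SM R F"
  shows "(pm \<phi> (tr j F), tr i F, cmap F \<phi>) \<in> Hom (Mod (Si i) (Ri i)) (pm \<phi> (tr j F)) (tr i F)"
proof -
  let ?p = "pm \<phi> (tr j F)"
  have ij: "i \<in> Obj I" "j \<in> Obj I" using Hom_objD[OF I \<phi>] by auto
  note S = Si_category[OF ij(1)] and P = module_sheaf_presheaf[OF F]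
  note M = pm_module_sheaf[OF \<phi> tr_module_sheaf[OF ij(2) F]]
  have sec: "Sec ?p z = Sec F (FOb (Jm j) (FOb (Tm \<phi>) z))" "Sec (tr i F) z = Sec F (FOb (Jm i) z)" if z: "z \<in> Obj (Si i)" for z
    by (simp_all add: pm_sel(1)[OF \<phi> z] tr_sel(1)[OF ij(2) Tm_Obj[OF \<phi> z]] tr_sel(1)[OF ij(1) z])
  have ad: "add (Sect ?p z) = add (Sect F (FOb (Jm j) (FOb (Tm \<phi>) z)))" "add (Sect (tr i F) z) = add (Sect F (FOb (Jm i) z))" if z: "z \<in> Obj (Si i)" for z
    by (simp_all add: pm_sel(2)[OF \<phi> z] tr_sel(2)[OF ij(2) Tm_Obj[OF \<phi> z]] tr_sel(2)[OF ij(1) z])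
  have "mod_hom (Si i) (Ri i) ?p (tr i F) (norm_map (Si i) ?p (\<lambda>z m. Restr F (can \<phi> z) m))"
  proof (rule mod_hom_norm[OF S M])
    fix z m assume z: "z \<in> Obj (Si i)" and m': "m \<in> Sec ?p z"
    have m: "m \<in> Sec F (FOb (Jm j) (FOb (Tm \<phi>) z))" using m' sec z by simp
    note cz = can_Hom[OF \<phi> z]
    show "Restr F (can \<phi> z) m \<in> Sec (tr i F) z" using sec(2)[OF z] psh_Restr_closed[OF P cz m] by simp
    show "Restr F (can \<phi> z) (m \<oplus>\<^bsub>Sect ?p z\<^esub> n) = Restr F (can \<phi> z) m \<oplus>\<^bsub>Sect (tr i F) z\<^esub> Restr F (can \<phi> z) n"
      if "n \<in> Sec ?p z" for n
      using module_sheafD(3)[OF F cz m] that sec ad z by simp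
    fix r assume r: "r \<in> Sec (Ri i) z"
    \<comment> \<open>A scalar of \<open>Ri i\<close> is traced back through the transition
      isomorphism and through \<open>b j\<close> to a scalar \<open>t\<close> of \<open>R\<close>,
      over which \<open>F\<close> is a module.\<close>
    obtain s where s: "s \<in> Sec (Ri j) (FOb (Tm \<phi>) z)" "r = ra \<phi> z s" using ra_surj[OF \<phi> z r] .
    obtain t where t: "t \<in> Sec R (FOb (Jm j) (FOb (Tm \<phi>) z))" "s = rb j (FOb (Tm \<phi>) z) t" using rb_surj[OF ij(2) Tm_Obj[OF \<phi> z] s(1)] .
    have rt: "Restr R (can \<phi> z) t \<in> Sec R (FOb (Jm i) z)" by (rule psh_Restr_closed[OF ring_sheaf_presheaf[OF R] cz t(1)])
    have "r \<odot>\<^bsub>Sect ?p z\<^esub> m = t \<odot>\<^bsub>Sect F (FOb (Jm j) (FOb (Tm \<phi>) z))\<^esub> m"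
      by (simp only: s(2) pm_smult[OF \<phi> z s(1)]) (simp only: t(2) tr_smult[OF ij(2) Tm_Obj[OF \<phi> z] t(1)])
    moreover have "r \<odot>\<^bsub>Sect (tr i F) z\<^esub> n = Restr R (can \<phi> z) t \<odot>\<^bsub>Sect F (FOb (Jm i) z)\<^esub> n" for n
      by (simp only: s(2) t(2) ra_rb[OF \<phi> z t(1)] tr_smult[OF ij(1) z rt])
    ultimately show "Restr F (can \<phi> z) (r \<odot>\<^bsub>Sect ?p z\<^esub> m) = r \<odot>\<^bsub>Sect (tr i F) z\<^esub> Restr F (can \<phi> z) m"
      using module_sheafD(4)[OF F cz m t(1)] by simp
  next
    fix f z w m assume f: "f \<in> Hom (Si i) z w" and m': "m \<in> Sec ?p w"
    note zw = Hom_objD[OF S f]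
    have m: "m \<in> Sec F (FOb (Jm j) (FOb (Tm \<phi>) w))" using m' sec zw by simp
    note Tf = functor_hom[OF Tm_functor[OF \<phi>] f]
    show "Restr F (can \<phi> z) (Restr ?p f m) = Restr (tr i F) f (Restr F (can \<phi> w) m)"
      using can_natural[OF \<phi> f] psh_Restr_Comp[OF P can_Hom[OF \<phi> conjunct1[OF zw]] functor_hom[OF Jm_functor[OF ij(2)] Tf] m]
        psh_Restr_Comp[OF P functor_hom[OF Jm_functor[OF ij(1)] f] can_Hom[OF \<phi> conjunct2[OF zw]] m]
      by (simp add: pm_Restr[OF \<phi> f] tr_Restr[OF ij(2) Tf] tr_Restr[OF ij(1) f])
  qed
  moreover have "norm_map (Si i) ?p (\<lambda>z m. Restr F (can \<phi> z) m) = cmap F \<phi>"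
  proof -
    have "fst (snd (can \<phi> z)) = FOb (Jm j) (FOb (Tm \<phi>) z)" if "z \<in> Obj (Si i)" for z
      using HomD[OF can_Hom[OF \<phi> that]] by (cases "can \<phi> z") (simp add: slice_sel(3) split: prod.splits)
    then show ?thesis unfolding norm_map_def canon_map_def using HomD[OF \<phi>] sec(1) by (auto intro!: restrict_ext)
  qed
  ultimately show ?thesis using M tr_module_sheaf[OF ij(1) F] by (simp add: Mod_Hom)
qed

text \<open>Canonical arrows are invertible in the site, and restriction along the inverse inverts
  the restriction; bijective components suffice by \<open>Mod_iso_iff\<close>.\<close>

lemma canon_iso:
  assumes \<phi>: "\<phi> \<in> Hom I i j" and F: "is_module_sheaf SM R F"
  shows "is_isomorphism (Mod (Si i) (Ri i)) (pm \<phi> (tr j F), tr i F, cmap F \<phi>)"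
proof -
  have ij: "i \<in> Obj I" "j \<in> Obj I" using Hom_objD[OF I \<phi>] by auto
  note P = module_sheaf_presheaf[OF F]
  have "bij_betw (cmap F \<phi> z) (Sec (pm \<phi> (tr j F)) z) (Sec (tr i F) z)" if z: "z \<in> Obj (Si i)" for z
  proof -
    obtain e where e: "e \<in> Hom SM (FOb (Jm j) (FOb (Tm \<phi>) z)) (FOb (Jm i) z)" "Comp SM e (can \<phi> z) = Ident SM (FOb (Jm i) z)"
      "Comp SM (can \<phi> z) e = Ident SM (FOb (Jm j) (FOb (Tm \<phi>) z))" by (rule can_inverse[OF \<phi> z])
    note cz = can_Hom[OF \<phi> z] and o = Jm_Obj[OF ij(1) z] Jm_Obj[OF ij(2) Tm_Obj[OF \<phi> z]]
    have sec: "Sec (pm \<phi> (tr j F)) z = Sec F (FOb (Jm j) (FOb (Tm \<phi>) z))" "Sec (tr i F) z = Sec F (FOb (Jm i) z)"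
      by (simp_all add: pm_sel(1)[OF \<phi> z] tr_sel(1)[OF ij(2) Tm_Obj[OF \<phi> z]] tr_sel(1)[OF ij(1) z])
    show ?thesis unfolding sec
      by (rule bij_betw_byWitness[of _ "Restr F e"])
        (use psh_Restr_Comp[OF P cz e(1)] psh_Restr_Comp[OF P e(1) cz] e(2,3) psh_Restr_Ident[OF P o(1)] psh_Restr_Ident[OF P o(2)]
          psh_Restr_closed[OF P cz] psh_Restr_closed[OF P e(1)] in \<open>auto simp: canon_map_eq[OF \<phi> z]\<close>)
  qed
  then show ?thesis using Mod_iso_iff[OF Si_category[OF ij(1)] canon_Hom[OF \<phi> F]] by blast
qed

lemma \<Phi>_Obj:
  assumes F: "is_module_sheaf SM R F"
  shows "FOb \<Phi> F \<in> Obj (holim (op_cat I) ED)"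
proof -
  let ?L = "(\<lambda>\<phi>\<in>Arr I. (pm \<phi> (tr (Cod I \<phi>) F), tr (Dom I \<phi>) F, cmap F \<phi>))"
  show ?thesis unfolding \<Phi>_ob holim_Obj
  proof (intro conjI ballI impI)
  show "(\<lambda>i\<in>Obj I. tr i F) \<in> (\<Pi>\<^sub>E k\<in>Obj (op_cat I). Obj (CatAt ED k))"
    using tr_module_sheaf[OF _ F] by (auto simp: ED_sel(1))
  show "?L \<in> extensional (Arr (op_cat I))" by simp
  fix \<phi> assume "\<phi> \<in> Arr (op_cat I)"
  then have \<phi>: "\<phi> \<in> Arr I" by simp
  note o = cat_dom[OF I \<phi>] cat_cod[OF I \<phi>]
  show "is_isomorphism (CatAt ED (Cod (op_cat I) \<phi>)) (?L \<phi>)"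
    using canon_iso[OF Arr_Hom[OF \<phi>] F] \<phi> by (simp add: ED_sel(1))
  show "?L \<phi>
    \<in> Hom (CatAt ED (Cod (op_cat I) \<phi>)) (pm \<phi> ((\<lambda>i\<in>Obj I. tr i F) (Dom (op_cat I) \<phi>))) ((\<lambda>i\<in>Obj I. tr i F) (Cod (op_cat I) \<phi>))"
    using canon_Hom[OF Arr_Hom[OF \<phi>] F] \<phi> o by (simp add: ED_sel(1))
  next
  fix i assume "i \<in> Obj (op_cat I)"
  then have i: "i \<in> Obj I" by simp
  note id = cat_ident[OF I i] and M = tr_module_sheaf[OF i F] and P = module_sheaf_presheaf[OF F]
  have "cmap F (Ident I i) = norm_map (Si i) (tr i F) (\<lambda>x m. m)"
  proof (rule nat_maps_eqI)
    show "cmap F (Ident I i) \<in> nat_maps (Si i) (tr i F) (tr i F)"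
      using canon_Hom[OF id F] pm_Ident[OF i M] by (auto simp: Mod_Hom dest: mod_homD(1))
    show "norm_map (Si i) (tr i F) (\<lambda>x m. m) \<in> nat_maps (Si i) (tr i F) (tr i F)"
      by (rule nat_mapsI[OF Si_category[OF i] module_sheaf_presheaf[OF M]]) simp_all
    show "cmap F (Ident I i) z m = norm_map (Si i) (tr i F) (\<lambda>x m. m) z m" if z: "z \<in> Obj (Si i)" and m: "m \<in> Sec (tr i F) z" for z m
      using canon_map_eq[OF id z, of m F] m z Tm_Ident_ob[OF i z] can_Ident[OF i z] psh_Restr_Ident[OF P Jm_Obj[OF i z]]
      by (simp add: tr_sel(1)[OF i z])
  qed
  then show "?L (Ident (op_cat I) i) =
     Ident (CatAt ED i) ((\<lambda>i\<in>Obj I. tr i F) i)"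
    using cat_identD[OF I i] i pm_Ident[OF i M] by (simp add: ED_sel(1) Mod_sel)
  next
  fix \<psi> \<phi> assume "\<psi> \<in> Arr (op_cat I)" "\<phi> \<in> Arr (op_cat I)" "Dom (op_cat I) \<phi> = Cod (op_cat I) \<psi>"
  then obtain i j k where \<phi>: "\<phi> \<in> Hom I i j" and \<psi>: "\<psi> \<in> Hom I j k" by (auto simp: Hom_def)
  note c = cat_comp[OF I \<phi> \<psi>] and P = module_sheaf_presheaf[OF F]
  have o: "i \<in> Obj I" "j \<in> Obj I" "k \<in> Obj I" using Hom_objD[OF I \<phi>] Hom_objD[OF I \<psi>] by auto
  note h = canon_Hom[OF \<phi> F] canon_Hom[OF \<psi> F] canon_Hom[OF c F]
  \<comment> \<open>The strict equality gives the two arrows to be compared the same source.\<close>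
  have pc: "pm (Comp I \<psi> \<phi>) (tr k F) = pm \<phi> (pm \<psi> (tr k F))" by (rule pm_Comp[OF \<phi> \<psi> tr_module_sheaf[OF o(3) F]])
  have "Comp (Mod (Si i) (Ri i)) (pm \<phi> (tr j F), tr i F, cmap F \<phi>) (FAr (FunAt ED \<phi>) (pm \<psi> (tr k F), tr j F, cmap F \<psi>))
     \<in> Hom (Mod (Si i) (Ri i)) (pm \<phi> (pm \<psi> (tr k F))) (tr i F)" (is "?c \<in> _")
    by (rule cat_comp[OF Mod_category[OF Si_category[OF o(1)]] functor_hom[OF FunAt_functor[OF \<phi>] h(2)] h(1)])
  note h2 = this
  have "(pm (Comp I \<psi> \<phi>) (tr k F), tr i F, cmap F (Comp I \<psi> \<phi>)) = ?c"
    unfolding pc ED_sel(3)[OF \<phi>] Mod_sel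
  proof (rule Mod_arr_eqI[OF h(3)[unfolded pc] h2[unfolded ED_sel(3)[OF \<phi>] Mod_sel]])
    fix z m assume z: "z \<in> Obj (Si i)" and m': "m \<in> Sec (pm \<phi> (pm \<psi> (tr k F))) z"
    note w = Tm_Obj[OF \<phi> z]
    have m: "m \<in> Sec F (FOb (Jm k) (FOb (Tm \<psi>) (FOb (Tm \<phi>) z)))"
      using m' by (simp add: pm_sel(1)[OF \<phi> z] pm_sel(1)[OF \<psi> w] tr_sel(1)[OF o(3) Tm_Obj[OF \<psi> w]])
    have "cmap F (Comp I \<psi> \<phi>) z m = Restr F (can \<phi> z) (Restr F (can \<psi> (FOb (Tm \<phi>) z)) m)"
      using canon_map_eq[OF c z, of m F] m Tm_Comp_ob[OF \<phi> \<psi> z] can_Comp[OF \<phi> \<psi> z] psh_Restr_Comp[OF P can_Hom[OF \<phi> z] can_Hom[OF \<psi> w] m] by simp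
    also have "\<dots> = cmap F \<phi> z (cmap F \<psi> (FOb (Tm \<phi>) z) m)"
      using canon_map_eq[OF \<psi> w m] canon_map_eq[OF \<phi> z psh_Restr_closed[OF P can_Hom[OF \<psi> w] m]] by simp
    finally show "cmap F (Comp I \<psi> \<phi>) z m = norm_map (Si i) (pm \<phi> (pm \<psi> (tr k F)))
        (\<lambda>x m. cmap F \<phi> x ((\<lambda>x\<in>Obj (Si i). cmap F \<psi> (FOb (Tm \<phi>) x)) x m)) z m"
      using z m' by simp
  qed
  then show "?L (Comp (op_cat I) \<phi> \<psi>) =
     Comp (CatAt ED (Cod (op_cat I) \<phi>)) (?L \<phi>)
       (FAr (FunAt ED \<phi>) (?L \<psi>))"
    using HomD[OF \<phi>] HomD[OF \<psi>] HomD[OF c] by (simp add: ED_sel(1))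
  qed
qed

end

context ringed_hocolim
begin

lemma SM_Obj_cases [consumes 1, case_names 1]:
  assumes "z \<in> Obj SM" and "\<And>i w. i \<in> Obj I \<Longrightarrow> w \<in> Obj (Si i) \<Longrightarrow> P (FOb (Jm i) w)"
  shows "P z"
  using SM_ObjE[OF assms(1)] assms(2) by metis

lemma Mod_SM: "is_category (Mod SM R)"
  by (rule Mod_category[OF SM_category])

lemma Mod_Si: "i \<in> Obj I \<Longrightarrow> is_category (Mod (Si i) (Ri i))"
  by (rule Mod_category[OF Si_category])

lemma tr_Hom:
  assumes i: "i \<in> Obj I" and h: "(F, G, \<eta>) \<in> Hom (Mod SM R) F G"
  shows "(tr i F, tr i G, \<lambda>x\<in>Obj (Si i). \<eta> (FOb (Jm i) x)) \<in> Hom (Mod (Si i) (Ri i)) (tr i F) (tr i G)"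
  using h by (simp add: Mod_Hom tr_module_sheaf[OF i] tr_mod_hom[OF i])

lemma fst_\<Phi>: "i \<in> Obj I \<Longrightarrow> fst (FOb \<Phi> F) i = tr i F"
  and snd_\<Phi>: "\<phi> \<in> Hom I i j \<Longrightarrow> snd (FOb \<Phi> F) \<phi> = (pm \<phi> (tr j F), tr i F, cmap F \<phi>)"
  unfolding \<Phi>_ob by (auto simp: Hom_def)

lemma sec_pt:
  assumes \<phi>: "\<phi> \<in> Hom I i j" and z: "z \<in> Obj (Si i)"
  shows "Sec (pm \<phi> (tr j F)) z = Sec F (FOb (Jm j) (FOb (Tm \<phi>) z))"
  using Hom_objD[OF I \<phi>] by (simp add: pm_sel(1)[OF \<phi> z] tr_sel(1)[OF _ Tm_Obj[OF \<phi> z]])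

text \<open>Compatibility with the structure isomorphisms is the naturality of \<open>\<eta>\<close>
  along canonical arrows.\<close>

lemma \<Phi>_Hom:
  assumes h: "(F, G, \<eta>) \<in> Hom (Mod SM R) F G"
  shows "FAr \<Phi> (F, G, \<eta>) \<in> Hom (holim (op_cat I) ED) (FOb \<Phi> F) (FOb \<Phi> G)"
  unfolding \<Phi>_ar holim_Hom
proof (intro conjI HOL.refl ballI)
  have F: "is_module_sheaf SM R F" and G: "is_module_sheaf SM R G" and e: "mod_hom SM R F G \<eta>" using h by (auto simp: Mod_Hom)
  show "FOb \<Phi> F \<in> Obj (holim (op_cat I) ED)" "FOb \<Phi> G \<in> Obj (holim (op_cat I) ED)" using \<Phi>_Obj F G by auto
  show "(\<lambda>i\<in>Obj I. (tr i F, tr i G, \<lambda>x\<in>Obj (Si i). \<eta> (FOb (Jm i) x))) \<in>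
      (\<Pi>\<^sub>E k\<in>Obj (op_cat I). Hom (CatAt ED k) (fst (FOb \<Phi> F) k) (fst (FOb \<Phi> G) k))"
    using tr_Hom[OF _ h] by (simp add: restrict_PiE_iff ED_sel(1) fst_\<Phi>)
  fix \<phi> assume "\<phi> \<in> Arr (op_cat I)"
  then obtain i j where \<phi>: "\<phi> \<in> Hom I i j" by (auto simp: Hom_def)
  have ij: "i \<in> Obj I" "j \<in> Obj I" using Hom_objD[OF I \<phi>] by auto
  note t = tr_Hom[OF ij(1) h] tr_Hom[OF ij(2) h]
  note h1 = cat_comp[OF Mod_Si[OF ij(1)] canon_Hom[OF \<phi> F] t(1)]
    and h2 = cat_comp[OF Mod_Si[OF ij(1)] functor_hom[OF FunAt_functor[OF \<phi>] t(2)] canon_Hom[OF \<phi> G]]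
  have "Comp (Mod (Si i) (Ri i)) (tr i F, tr i G, \<lambda>x\<in>Obj (Si i). \<eta> (FOb (Jm i) x)) (pm \<phi> (tr j F), tr i F, cmap F \<phi>) =
    Comp (Mod (Si i) (Ri i)) (pm \<phi> (tr j G), tr i G, cmap G \<phi>) (FAr (FunAt ED \<phi>) (tr j F, tr j G, \<lambda>x\<in>Obj (Si j). \<eta> (FOb (Jm j) x)))"
    unfolding ED_sel(3)[OF \<phi>] Mod_sel
  proof (rule Mod_arr_eqI[OF h1[unfolded Mod_sel] h2[unfolded ED_sel(3)[OF \<phi>] Mod_sel]])
    fix z m assume z: "z \<in> Obj (Si i)" and m': "m \<in> Sec (pm \<phi> (tr j F)) z"
    have m: "m \<in> Sec F (FOb (Jm j) (FOb (Tm \<phi>) z))" using m' sec_pt[OF \<phi> z, of F] by simp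
    have w: "FOb (Tm \<phi>) z \<in> Obj (Si j)" by (rule Tm_Obj[OF \<phi> z])
    have n: "\<eta> (FOb (Jm j) (FOb (Tm \<phi>) z)) m \<in> Sec G (FOb (Jm j) (FOb (Tm \<phi>) z))"
      by (rule mod_homD(2)[OF e Jm_Obj[OF ij(2) w] m])
    show "norm_map (Si i) (pm \<phi> (tr j F)) (\<lambda>x m. (\<lambda>x\<in>Obj (Si i). \<eta> (FOb (Jm i) x)) x (cmap F \<phi> x m)) z m =
      norm_map (Si i) (pm \<phi> (tr j F)) (\<lambda>x m. cmap G \<phi> x ((\<lambda>x\<in>Obj (Si i). (\<lambda>x\<in>Obj (Si j). \<eta> (FOb (Jm j) x)) (FOb (Tm \<phi>) x)) x m)) z m"
      using z m' w canon_map_eq[OF \<phi> z m] canon_map_eq[OF \<phi> z n] mod_homD(3)[OF e can_Hom[OF \<phi> z] m] by simp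
  qed
  then show "Comp (CatAt ED (Cod (op_cat I) \<phi>)) ((\<lambda>i\<in>Obj I. (tr i F, tr i G, \<lambda>x\<in>Obj (Si i). \<eta> (FOb (Jm i) x))) (Cod (op_cat I) \<phi>)) (snd (FOb \<Phi> F) \<phi>) =
    Comp (CatAt ED (Cod (op_cat I) \<phi>)) (snd (FOb \<Phi> G) \<phi>) (FAr (FunAt ED \<phi>) ((\<lambda>i\<in>Obj I. (tr i F, tr i G, \<lambda>x\<in>Obj (Si i). \<eta> (FOb (Jm i) x))) (Dom (op_cat I) \<phi>)))"
    using HomD[OF \<phi>] ij by (simp add: ED_sel(1) snd_\<Phi>[OF \<phi>])
qed

lemma \<Phi>_functor: "is_functor (Mod SM R) (holim (op_cat I) ED) \<Phi>"
proof (rule is_functorI[OF Mod_SM cat_diagram.holim_category[OF ED_diagram]])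
  show "FOb \<Phi> F \<in> Obj (holim (op_cat I) ED)" if "F \<in> Obj (Mod SM R)" for F using \<Phi>_Obj that by simp
  show hom: "FAr \<Phi> f \<in> Hom (holim (op_cat I) ED) (FOb \<Phi> F) (FOb \<Phi> G)" if f: "f \<in> Hom (Mod SM R) F G" for f F G
  proof (rule Mod_HomE[OF f])
    fix \<eta> assume e: "f = (F, G, \<eta>)"
    show ?thesis unfolding e by (rule \<Phi>_Hom[OF f[unfolded e]])
  qed
  show "FAr \<Phi> (Ident (Mod SM R) F) = Ident (holim (op_cat I) ED) (FOb \<Phi> F)" if F: "F \<in> Obj (Mod SM R)" for F
  proof -
    have "(tr i F, tr i F, \<lambda>x\<in>Obj (Si i). norm_map SM F (\<lambda>x m. m) (FOb (Jm i) x)) = Ident (Mod (Si i) (Ri i)) (tr i F)" if i: "i \<in> Obj I" for i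
    proof -
      have o: "tr i F \<in> Obj (Mod (Si i) (Ri i))" using tr_module_sheaf[OF i] F by simp
      show ?thesis unfolding Mod_sel
        by (rule Mod_arr_eqI[OF tr_Hom[OF i cat_ident[OF Mod_SM F, unfolded Mod_sel]] cat_ident[OF Mod_Si[OF i] o, unfolded Mod_sel]])
          (simp add: tr_sel(1)[OF i] Jm_Obj[OF i])
    qed
    then show ?thesis by (simp add: Mod_sel \<Phi>_ar holim_sel ED_sel(1) fst_\<Phi> cong: restrict_cong)
  qed
  show "FAr \<Phi> (Comp (Mod SM R) g f) = Comp (holim (op_cat I) ED) (FAr \<Phi> g) (FAr \<Phi> f)"
    if f: "f \<in> Hom (Mod SM R) F G" and g: "g \<in> Hom (Mod SM R) G H" for f g F G H
  proof -
    obtain \<eta> where f': "f = (F, G, \<eta>)" "is_module_sheaf SM R F" "is_module_sheaf SM R G" "mod_hom SM R F G \<eta>" by (rule Mod_HomE[OF f])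
    obtain \<epsilon> where g': "g = (G, H, \<epsilon>)" by (rule Mod_HomE[OF g])
    note fh = f[unfolded f'(1)] and gh = g[unfolded g']
    note ch = cat_comp[OF Mod_SM fh gh, unfolded Mod_sel]
    have "(tr i F, tr i H, \<lambda>x\<in>Obj (Si i). norm_map SM F (\<lambda>x m. \<epsilon> x (\<eta> x m)) (FOb (Jm i) x)) =
       Comp (Mod (Si i) (Ri i)) (tr i G, tr i H, \<lambda>x\<in>Obj (Si i). \<epsilon> (FOb (Jm i) x)) (tr i F, tr i G, \<lambda>x\<in>Obj (Si i). \<eta> (FOb (Jm i) x))" if i: "i \<in> Obj I" for i
      unfolding Mod_sel
      by (rule Mod_arr_eqI[OF tr_Hom[OF i ch] cat_comp[OF Mod_Si[OF i] tr_Hom[OF i fh] tr_Hom[OF i gh], unfolded Mod_sel]])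
        (simp add: tr_sel(1)[OF i] Jm_Obj[OF i])
    then show ?thesis unfolding f' g' Mod_sel \<Phi>_ar holim_sel by (simp add: ED_sel(1) Mod_sel cong: restrict_cong)
  qed
qed

text \<open>Every object of the site is the image of exactly one object of exactly one
  \<open>Si i\<close>; this recovers the index and the object.\<close>

definition sel :: "('i, 'j, 'c, 'o) hs_ob \<Rightarrow> 'i \<times> 'c \<times> 'o" where
  "sel z = (let c = hc_diagram.hrep I (TX (fst z)) (snd z) in (fst c, fst z, snd c))"

lemma sel_Jm: "i \<in> Obj I \<Longrightarrow> w \<in> Obj (Si i) \<Longrightarrow> sel (FOb (Jm i) w) = (i, w)"
proof -
  assume i: "i \<in> Obj I" and w: "w \<in> Obj (Si i)"
  obtain X x where w': "w = (X, x)" "X \<in> Obj C" "x \<in> Obj (GX X i)" using w by (auto simp: slice_sel)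
  show ?thesis using hc_diagram.hrep_hob[OF hc[OF w'(2)] i w'(3)] by (simp add: w' Jm_ob sel_def Let_def)
qed

text \<open>Faithfulness holds because every object of the site comes from some \<open>Si i\<close>.
  For fullness, the components of an arrow of the homotopy limit define a family object by object,
  and its naturality is tested on generating arrows.\<close>

lemma \<Phi>_ff:
  assumes F: "is_module_sheaf SM R F" and G: "is_module_sheaf SM R G"
  shows "bij_betw (FAr \<Phi>) (Hom (Mod SM R) F G) (Hom (holim (op_cat I) ED) (FOb \<Phi> F) (FOb \<Phi> G))"
  unfolding bij_betw_def
proof (intro conjI inj_onI subset_antisym subsetI)
  fix f g assume f: "f \<in> Hom (Mod SM R) F G" and g: "g \<in> Hom (Mod SM R) F G" and eq: "FAr \<Phi> f = FAr \<Phi> g"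
  obtain \<eta> where f': "f = (F, G, \<eta>)" by (rule Mod_HomE[OF f])
  obtain \<epsilon> where g': "g = (F, G, \<epsilon>)" by (rule Mod_HomE[OF g])
  have e: "(\<lambda>i\<in>Obj I. (tr i F, tr i G, \<lambda>x\<in>Obj (Si i). \<eta> (FOb (Jm i) x))) = (\<lambda>i\<in>Obj I. (tr i F, tr i G, \<lambda>x\<in>Obj (Si i). \<epsilon> (FOb (Jm i) x)))"
    using eq unfolding f' g' \<Phi>_ar by simp
  have e2: "\<eta> (FOb (Jm i) w) = \<epsilon> (FOb (Jm i) w)" if i: "i \<in> Obj I" and w: "w \<in> Obj (Si i)" for i w
  proof -
    have "(\<lambda>x\<in>Obj (Si i). \<eta> (FOb (Jm i) x)) = (\<lambda>x\<in>Obj (Si i). \<epsilon> (FOb (Jm i) x))" using fun_cong[OF e, of i] i by simp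
    from fun_cong[OF this, of w] w show ?thesis by simp
  qed
  show "f = g" unfolding f' g'
  proof (rule Mod_arr_eqI[OF f[unfolded f'] g[unfolded g']])
    fix z m assume "z \<in> Obj SM"
    then have "\<eta> z = \<epsilon> z" by (rule SM_Obj_cases) (rule e2)
    then show "\<eta> z m = \<epsilon> z m" by simp
  qed
next
  fix g assume "g \<in> FAr \<Phi> ` Hom (Mod SM R) F G"
  then show "g \<in> Hom (holim (op_cat I) ED) (FOb \<Phi> F) (FOb \<Phi> G)" using functor_hom[OF \<Phi>_functor] by auto
next
  note PF = module_sheaf_presheaf[OF F] and PG = module_sheaf_presheaf[OF G]
  fix g assume g: "g \<in> Hom (holim (op_cat I) ED) (FOb \<Phi> F) (FOb \<Phi> G)"
  obtain u where u1: "g = (FOb \<Phi> F, FOb \<Phi> G, u)" by (rule holim_HomE[OF g])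
  have u2: "u \<in> (\<Pi>\<^sub>E k\<in>Obj (op_cat I). Hom (CatAt ED k) (fst (FOb \<Phi> F) k) (fst (FOb \<Phi> G) k))"
    using g[unfolded u1 holim_Hom] by (elim conjE)
  have u3: "\<forall>f\<in>Arr (op_cat I). Comp (CatAt ED (Cod (op_cat I) f)) (u (Cod (op_cat I) f)) (snd (FOb \<Phi> F) f) =
             Comp (CatAt ED (Cod (op_cat I) f)) (snd (FOb \<Phi> G) f) (FAr (FunAt ED f) (u (Dom (op_cat I) f)))"
    using g[unfolded u1 holim_Hom] by (elim conjE)
  note u = u1 u2 u3[rule_format]
  define \<nu> where "\<nu> i = snd (snd (u i))" for i
  have ui: "u i = (tr i F, tr i G, \<nu> i)" "mod_hom (Si i) (Ri i) (tr i F) (tr i G) (\<nu> i)" if i: "i \<in> Obj I" for i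
  proof -
    have "u i \<in> Hom (Mod (Si i) (Ri i)) (tr i F) (tr i G)" using PiE_mem[OF u(2), of i] i by (simp add: ED_sel(1) fst_\<Phi>)
    then show "u i = (tr i F, tr i G, \<nu> i)" "mod_hom (Si i) (Ri i) (tr i F) (tr i G) (\<nu> i)"
      unfolding \<nu>_def by (auto elim!: Mod_HomE)
  qed
  \<comment> \<open>No compatibility between different indices is involved here: \<open>sel\<close>
    attaches a single index to each object.\<close>
  define \<eta> where "\<eta> z = (case sel z of (i, w) \<Rightarrow> \<nu> i w)" for z
  have \<eta>: "\<eta> (FOb (Jm i) w) = \<nu> i w" if "i \<in> Obj I" "w \<in> Obj (Si i)" for i w using sel_Jm[OF that] by (simp add: \<eta>_def)
  have \<eta>_closed: "\<eta> z m \<in> Sec G z" if z: "z \<in> Obj SM" and m: "m \<in> Sec F z" for z m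
    using z m
  proof (induction rule: SM_Obj_cases)
    case (1 i w)
    then show ?case using mod_homD(2)[OF ui(2)[OF 1(1)] 1(2), of m] by (simp add: \<eta> tr_sel(1))
  qed
  \<comment> \<open>Images of arrows of \<open>Si i\<close> use the naturality of
    \<open>\<nu> i\<close>, canonical arrows the compatibility of \<open>u\<close> with the
    structure isomorphisms. The endpoints are quantified inside so that the hypotheses apply to each
    factor.\<close>
  have nat: "\<forall>z w m. e \<in> Hom SM z w \<longrightarrow> m \<in> Sec F w \<longrightarrow> \<eta> z (Restr F e m) = Restr G e (\<eta> w m)" if "e \<in> Arr SM" for e
    using that
  proof (induction rule: SM_induct)
    case (Comp f g a b c)
    show ?case
    proof (intro allI impI)
      fix z w m assume h: "Comp SM g f \<in> Hom SM z w" and m: "m \<in> Sec F w"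
      have zw: "z = a" "w = c" using HomD[OF h] HomD[OF cat_comp[OF SM_category Comp(1,2)]] by auto
      have m: "m \<in> Sec F c" using m zw by simp
      have o: "c \<in> Obj SM" using Hom_objD[OF SM_category Comp(2)] by simp
      show "\<eta> z (Restr F (Comp SM g f) m) = Restr G (Comp SM g f) (\<eta> w m)"
        using Comp(3)[rule_format, OF Comp(1) psh_Restr_closed[OF PF Comp(2) m]] Comp(4)[rule_format, OF Comp(2) m]
          psh_Restr_Comp[OF PF Comp(1,2) m] psh_Restr_Comp[OF PG Comp(1,2) \<eta>_closed[OF o m]]
        unfolding zw by simp
    qed
  next
    case (inverse f g a b)
    show ?case
    proof (intro allI impI)
      fix z w m assume h: "g \<in> Hom SM z w" and m: "m \<in> Sec F w"
      have zw: "z = b" "w = a" using HomD[OF h] HomD[OF inverse(2)] by auto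
      have m: "m \<in> Sec F a" using m zw by simp
      have o: "a \<in> Obj SM" "b \<in> Obj SM" using Hom_objD[OF SM_category inverse(2)] by auto
      note gm = psh_Restr_closed[OF PF inverse(2) m]
      have fg: "Restr F f (Restr F g m) = m" 
        using psh_Restr_Comp[OF PF inverse(1,2) m] inverse(3) psh_Restr_Ident[OF PF o(1) m] by simp
      \<comment> \<open>Naturality along \<open>f\<close> at the section \<open>Restr F g m\<close>;
        restricting along \<open>g\<close> afterwards cancels \<open>f\<close>.\<close>
      have "\<eta> a m = Restr G f (\<eta> b (Restr F g m))" using inverse(5)[rule_format, OF inverse(1) gm] fg by simp
      then have "Restr G g (\<eta> a m) = Restr G (Comp SM f g) (\<eta> b (Restr F g m))"
        using psh_Restr_Comp[OF PG inverse(2,1) \<eta>_closed[OF o(2) gm]] by simp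
      then show "\<eta> z (Restr F g m) = Restr G g (\<eta> w m)"
        using inverse(4) psh_Restr_Ident[OF PG o(2) \<eta>_closed[OF o(2) gm]] unfolding zw by simp
    qed
  next
    case (incl i f z0 w0)
    show ?case
    proof (intro allI impI)
      fix z w m assume h: "FAr (Jm i) f \<in> Hom SM z w" and m: "m \<in> Sec F w"
      have zw: "z = FOb (Jm i) z0" "w = FOb (Jm i) w0" using HomD[OF h] HomD[OF functor_hom[OF Jm_functor[OF incl(1)] incl(2)]] by auto
      have o: "z0 \<in> Obj (Si i)" "w0 \<in> Obj (Si i)" using Hom_objD[OF Si_category[OF incl(1)] incl(2)] by auto
      show "\<eta> z (Restr F (FAr (Jm i) f) m) = Restr G (FAr (Jm i) f) (\<eta> w m)"
        using mod_homD(3)[OF ui(2)[OF incl(1)] incl(2), of m] m unfolding zw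
        by (simp add: \<eta> incl(1) o tr_sel(1) tr_Restr[OF incl(1,2)])
    qed
  next
    case (canon \<phi> i j z0)
    show ?case
    proof (intro allI impI)
      fix z w m assume h: "can \<phi> z0 \<in> Hom SM z w" and m: "m \<in> Sec F w"
      have ij: "i \<in> Obj I" "j \<in> Obj I" using Hom_objD[OF I canon(1)] by auto
      note T0 = Tm_Obj[OF canon]
      have zw: "z = FOb (Jm i) z0" "w = FOb (Jm j) (FOb (Tm \<phi>) z0)" using HomD[OF h] HomD[OF can_Hom[OF canon]] by auto
      have m: "m \<in> Sec F (FOb (Jm j) (FOb (Tm \<phi>) z0))" using m zw by simp
      have n: "\<nu> j (FOb (Tm \<phi>) z0) m \<in> Sec G (FOb (Jm j) (FOb (Tm \<phi>) z0))"
        using mod_homD(2)[OF ui(2)[OF ij(2)] T0, of m] m by (simp add: tr_sel(1)[OF ij(2) T0])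
      \<comment> \<open>The compatibility of \<open>u\<close> with the structure isomorphisms,
        evaluated at a section over \<open>z0\<close>, is naturality along
        \<open>can \<phi> z0\<close>.\<close>
      have "Comp (Mod (Si i) (Ri i)) (u i) (snd (FOb \<Phi> F) \<phi>) = Comp (Mod (Si i) (Ri i)) (snd (FOb \<Phi> G) \<phi>) (FAr (FunAt ED \<phi>) (u j))"
        using u(3)[of \<phi>] HomD[OF canon(1)] by (simp add: ED_sel(1))
      then have "norm_map (Si i) (pm \<phi> (tr j F)) (\<lambda>x m. \<nu> i x (cmap F \<phi> x m)) =
        norm_map (Si i) (pm \<phi> (tr j F)) (\<lambda>x m. cmap G \<phi> x ((\<lambda>x\<in>Obj (Si i). \<nu> j (FOb (Tm \<phi>) x)) x m))"
        unfolding snd_\<Phi>[OF canon(1)] ui(1)[OF ij(1)] ui(1)[OF ij(2)] ED_sel(3)[OF canon(1)] Mod_sel by (elim prod.inject[THEN iffD1, THEN conjunct2, THEN prod.inject[THEN iffD1], THEN conjunct2])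
      from fun_cong[OF fun_cong[OF this], of z0 m] show "\<eta> z (Restr F (can \<phi> z0) m) = Restr G (can \<phi> z0) (\<eta> w m)"
        using m n canon(2) unfolding zw
        by (simp add: \<eta> ij T0 sec_pt[OF canon] canon_map_eq[OF canon m] canon_map_eq[OF canon n])
    qed
  qed
  have mh: "mod_hom SM R F G (norm_map SM F \<eta>)"
  proof (rule mod_hom_norm[OF SM_category F \<eta>_closed])
    show "\<eta> z (Restr F f m) = Restr G f (\<eta> w m)" if "f \<in> Hom SM z w" "m \<in> Sec F w" for f z w m
      using nat[of f] HomD[OF that(1)] that by blast
    show "\<eta> z (m \<oplus>\<^bsub>Sect F z\<^esub> n) = \<eta> z m \<oplus>\<^bsub>Sect G z\<^esub> \<eta> z n" if z: "z \<in> Obj SM" and m: "m \<in> Sec F z" "n \<in> Sec F z" for z m n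
      using z m
    proof (induction rule: SM_Obj_cases)
      case (1 i w)
      then show ?case using mod_homD(4)[OF ui(2)[OF 1(1)] 1(2), of m n] by (simp add: \<eta> tr_sel)
    qed
    show "\<eta> z (r \<odot>\<^bsub>Sect F z\<^esub> m) = r \<odot>\<^bsub>Sect G z\<^esub> \<eta> z m" if z: "z \<in> Obj SM" and m: "m \<in> Sec F z" "r \<in> Sec R z" for z m r
      using z m
    proof (induction rule: SM_Obj_cases)
      case (1 i w)
      \<comment> \<open>A scalar \<open>r\<close> of \<open>R\<close> acts on the transported
        modules as \<open>rb i w r\<close>, over which \<open>\<nu> i\<close> is linear.\<close>
      have "rb i w r \<in> Sec (Ri i) w"
        using nat_mapsD(1)[OF ring_sheaf_isoD(5)[OF b_iso(2)[OF 1(1)]] 1(2), of r] 1 by (simp add: psh_pull_sel)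
      then show ?case using mod_homD(5)[OF ui(2)[OF 1(1)] 1(2), of m "rb i w r"] 1
        by (simp add: \<eta> tr_sel tr_smult[OF 1(1,2)])
    qed
  qed
  have fh: "(F, G, norm_map SM F \<eta>) \<in> Hom (Mod SM R) F G" using mh F G by (simp add: Mod_Hom)
  have "(\<lambda>i\<in>Obj I. (tr i F, tr i G, \<lambda>x\<in>Obj (Si i). norm_map SM F \<eta> (FOb (Jm i) x))) = u"
  proof (rule extensionalityI)
    show "u \<in> extensional (Obj I)" using u(2) by (simp add: PiE_def)
    show "(\<lambda>i\<in>Obj I. (tr i F, tr i G, \<lambda>x\<in>Obj (Si i). norm_map SM F \<eta> (FOb (Jm i) x))) i = u i" if i: "i \<in> Obj I" for i
    proof -
      have uh: "(tr i F, tr i G, \<nu> i) \<in> Hom (Mod (Si i) (Ri i)) (tr i F) (tr i G)"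
        using ui(2)[OF i] tr_module_sheaf[OF i F] tr_module_sheaf[OF i G] by (simp add: Mod_Hom)
      have "(tr i F, tr i G, \<lambda>x\<in>Obj (Si i). norm_map SM F \<eta> (FOb (Jm i) x)) = (tr i F, tr i G, \<nu> i)"
        by (rule Mod_arr_eqI[OF tr_Hom[OF i fh] uh]) (simp add: tr_sel(1)[OF i] Jm_Obj[OF i] \<eta>[OF i])
      then show ?thesis using i ui(1)[OF i] by simp
    qed
  qed simp
  then have "FAr \<Phi> (F, G, norm_map SM F \<eta>) = g" unfolding \<Phi>_ar u(1) by simp
  then show "g \<in> FAr \<Phi> ` Hom (Mod SM R) F G" using fh by blast
qed

end

section \<open>Essential surjectivity: gluing a descent datum to a sheaf of modules\<close>

section \<open>Gluing\<close>

context pdiagram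
begin

lemma Rst_hob: "h \<in> Hom C X Y \<Longrightarrow> i \<in> Obj I \<Longrightarrow> x \<in> Obj (GX Y i) \<Longrightarrow> FOb (Rst MM h) (hobX Y i x) = hobX X i (FOb (Rst (DOb U i) h) x)"
  using hc_transformation.F_hob[OF hct] by (simp add: MM_sel(2))

end

locale glueing = ringed_hocolim C I U RI R b
  for C :: "('c, 'a) site" and I :: "('i, 'j) cat" and U :: "('i, 'j, 'c, 'a, 'o, 'g) pdiag"
    and RI :: "('i, 'j, 'c, 'a, 'o, 'g, 'r) rdata"
    and R :: "(('i, 'j, 'c, 'o) hs_ob, ('i, 'j, 'c, 'a, 'o, 'g) hs_arr, 'r) rsheaf"
    and b :: "'i \<Rightarrow> ('c \<times> 'o, ('c, 'a, 'o, 'g) sl_arr, 'r) rsheaf_arr" +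
  fixes xs :: "'i \<Rightarrow> ('c \<times> 'o, ('c, 'a, 'o, 'g) sl_arr, 'r, 'm) msheaf"
    and th :: "'j \<Rightarrow> ('c \<times> 'o, ('c, 'a, 'o, 'g) sl_arr, 'r, 'm) msheaf_arr"
  assumes a_Obj: "(xs, th) \<in> Obj (holim (op_cat I) (Mod_diag C I U RI))"
begin

definition "ts \<phi> = snd (snd (th \<phi>))"

lemma xs_module: "i \<in> Obj I \<Longrightarrow> is_module_sheaf (Si i) (Ri i) (xs i)"
  using cat_diagram.ObD(1)[OF ED_diagram a_Obj, of i] by (simp add: ED_sel(1))

lemma xs_presheaf: "i \<in> Obj I \<Longrightarrow> is_presheaf (Si i) (xs i)"
  by (rule module_sheaf_presheaf[OF xs_module])

lemma th_Hom: "\<phi> \<in> Hom I i j \<Longrightarrow> th \<phi> \<in> Hom (Mod (Si i) (Ri i)) (pm \<phi> (xs j)) (xs i)"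
  using cat_diagram.ObD(2)[OF ED_diagram a_Obj, of \<phi>] by (auto simp: ED_sel(1) Hom_def[of I])

lemma th_eq: "\<phi> \<in> Hom I i j \<Longrightarrow> th \<phi> = (pm \<phi> (xs j), xs i, ts \<phi>)"
  and ts_hom: "\<phi> \<in> Hom I i j \<Longrightarrow> mod_hom (Si i) (Ri i) (pm \<phi> (xs j)) (xs i) (ts \<phi>)"
  using th_Hom[of \<phi> i j] unfolding ts_def by (auto elim!: Mod_HomE)

lemma ts_bij:
  assumes \<phi>: "\<phi> \<in> Hom I i j" and z: "z \<in> Obj (Si i)"
  shows "bij_betw (ts \<phi> z) (Sec (xs j) (FOb (Tm \<phi>) z)) (Sec (xs i) z)"
proof -
  have "is_isomorphism (Mod (Si i) (Ri i)) (pm \<phi> (xs j), xs i, ts \<phi>)"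
    using cat_diagram.ObD(3)[OF ED_diagram a_Obj, of \<phi>] HomD[OF \<phi>] th_eq[OF \<phi>] by (simp add: ED_sel(1))
  from psh_cat_iso_bij[OF this[unfolded Mod_def] z] show ?thesis by (simp add: pm_sel(1)[OF \<phi> z])
qed

lemma ts_closed: "\<phi> \<in> Hom I i j \<Longrightarrow> z \<in> Obj (Si i) \<Longrightarrow> m \<in> Sec (xs j) (FOb (Tm \<phi>) z) \<Longrightarrow> ts \<phi> z m \<in> Sec (xs i) z"
  using bij_betw_apply[OF ts_bij] .

lemma ts_natural:
  assumes \<phi>: "\<phi> \<in> Hom I i j" and f: "f \<in> Hom (Si i) z w" and m: "m \<in> Sec (xs j) (FOb (Tm \<phi>) w)"
  shows "ts \<phi> z (Restr (xs j) (FAr (Tm \<phi>) f) m) = Restr (xs i) f (ts \<phi> w m)"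
proof -
  have "i \<in> Obj I" using Hom_objD[OF I \<phi>] by simp
  then have w: "w \<in> Obj (Si i)" using Hom_objD[OF Si_category f] by simp
  show ?thesis using mod_homD(3)[OF ts_hom[OF \<phi>] f, of m] m by (simp add: pm_sel(1)[OF \<phi> w] pm_Restr[OF \<phi> f])
qed

lemma ts_add:
  assumes \<phi>: "\<phi> \<in> Hom I i j" and z: "z \<in> Obj (Si i)" and m: "m \<in> Sec (xs j) (FOb (Tm \<phi>) z)" "n \<in> Sec (xs j) (FOb (Tm \<phi>) z)"
  shows "ts \<phi> z (m \<oplus>\<^bsub>Sect (xs j) (FOb (Tm \<phi>) z)\<^esub> n) = ts \<phi> z m \<oplus>\<^bsub>Sect (xs i) z\<^esub> ts \<phi> z n"
  using mod_homD(4)[OF ts_hom[OF \<phi>] z, of m n] m by (simp add: pm_sel[OF \<phi> z])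

lemma ts_smult:
  assumes \<phi>: "\<phi> \<in> Hom I i j" and z: "z \<in> Obj (Si i)" and m: "m \<in> Sec (xs j) (FOb (Tm \<phi>) z)" and r: "r \<in> Sec (Ri j) (FOb (Tm \<phi>) z)"
  shows "ts \<phi> z (r \<odot>\<^bsub>Sect (xs j) (FOb (Tm \<phi>) z)\<^esub> m) = ra \<phi> z r \<odot>\<^bsub>Sect (xs i) z\<^esub> ts \<phi> z m"
proof -
  have "ra \<phi> z r \<in> Sec (Ri i) z"
    using nat_mapsD(1)[OF ring_sheaf_isoD(5)[OF al_iso(2)[OF \<phi>]] z, of r] r z by (simp add: psh_pull_sel)
  then show ?thesis using mod_homD(5)[OF ts_hom[OF \<phi>] z, of m "ra \<phi> z r"] m by (simp add: pm_sel[OF \<phi> z] pm_smult[OF \<phi> z r])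
qed

lemma ts_Ident:
  assumes i: "i \<in> Obj I" and z: "z \<in> Obj (Si i)" and m: "m \<in> Sec (xs i) z"
  shows "ts (Ident I i) z m = m"
proof -
  have "\<forall>k\<in>Obj (op_cat I). th (Ident (op_cat I) k) = Ident (CatAt ED k) (xs k)" using a_Obj[unfolded holim_Obj] by (elim conjE)
  then have "ts (Ident I i) = norm_map (Si i) (xs i) (\<lambda>x m. m)" using i by (simp add: ts_def ED_sel(1) Mod_sel)
  then show ?thesis using z m by simp
qed

lemma ts_Comp:
  assumes \<phi>: "\<phi> \<in> Hom I i j" and \<psi>: "\<psi> \<in> Hom I j k" and z: "z \<in> Obj (Si i)"
    and m: "m \<in> Sec (xs k) (FOb (Tm \<psi>) (FOb (Tm \<phi>) z))"
  shows "ts (Comp I \<psi> \<phi>) z m = ts \<phi> z (ts \<psi> (FOb (Tm \<phi>) z) m)"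
proof -
  have "\<forall>f\<in>Arr (op_cat I). \<forall>g\<in>Arr (op_cat I). Dom (op_cat I) g = Cod (op_cat I) f \<longrightarrow>
           th (Comp (op_cat I) g f) = Comp (CatAt ED (Cod (op_cat I) g)) (th g) (FAr (FunAt ED g) (th f))"
    using a_Obj[unfolded holim_Obj] by (elim conjE)
  then have "th (Comp I \<psi> \<phi>) = Comp (Mod (Si i) (Ri i)) (th \<phi>) (FAr (FunAt ED \<phi>) (th \<psi>))"
    using HomD[OF \<phi>] HomD[OF \<psi>] by (auto simp: ED_sel(1))
  then have e: "ts (Comp I \<psi> \<phi>) = norm_map (Si i) (pm \<phi> (pm \<psi> (xs k))) (\<lambda>x m. ts \<phi> x ((\<lambda>x\<in>Obj (Si i). ts \<psi> (FOb (Tm \<phi>) x)) x m))"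
    unfolding th_eq[OF \<phi>] th_eq[OF \<psi>] ED_sel(3)[OF \<phi>] Mod_sel by (simp add: ts_def[of "Comp I \<psi> \<phi>"])
  have "m \<in> Sec (pm \<phi> (pm \<psi> (xs k))) z" using m by (simp add: pm_sel(1)[OF \<phi> z] pm_sel(1)[OF \<psi> Tm_Obj[OF \<phi> z]])
  then show ?thesis using z by (simp add: e)
qed

abbreviation "Sx X \<equiv> (\<lambda>i y. Sec (xs i) (X, y))"
abbreviation "rhoX X \<equiv> (\<lambda>i g. Restr (xs i) (vert C (DOb U i) X g))"
abbreviation "theX X \<equiv> (\<lambda>\<phi> y. ts \<phi> (X, y))"

text \<open>The descent datum over a fixed \<open>X\<close>: restriction along vertical arrows gives
  \<open>\<rho>\<close>, and the transition maps give \<open>\<theta>\<close>, with their naturality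
  on vertical arrows and their cocycle condition as the axioms.\<close>

lemma action: "X \<in> Obj C \<Longrightarrow> hc_action I (GX X) (TX X) (Sx X) (rhoX X) (theX X)"
proof (intro hc_action.intro hc_action_axioms.intro)
  assume X: "X \<in> Obj C"
  show "hc_diagram I (GX X) (TX X)" by (rule hc[OF X])
  interpret D: hc_diagram I "GX X" "TX X" by (rule hc[OF X])
  have ob: "(X, y) \<in> Obj (Si i)" if "y \<in> Obj (GX X i)" for y i using X that by (simp add: slice_sel)
  fix i assume i: "i \<in> Obj I"
  note P = xs_presheaf[OF i] and on = U_on[OF i]
  show "rhoX X i g s \<in> Sx X i x" if "g \<in> Hom (GX X i) x y" "s \<in> Sx X i y" for g x y s
    by (rule psh_Restr_closed[OF P gpsh_on.vert_Hom[OF on X that(1)] that(2)])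
  show "rhoX X i (Ident (GX X i) x) s = s" if "x \<in> Obj (GX X i)" "s \<in> Sx X i x" for x s
    using gpsh_on.vert_Ident[OF on X that(1)] psh_Restr_Ident[OF P ob[OF that(1)] that(2)] by simp
  show "rhoX X i (Comp (GX X i) g' g) s = rhoX X i g (rhoX X i g' s)"
    if "g \<in> Hom (GX X i) x y" "g' \<in> Hom (GX X i) y z" "s \<in> Sx X i z" for g g' x y z s
    using gpsh_on.vert_Comp[OF on X that(1,2)] psh_Restr_Comp[OF P gpsh_on.vert_Hom[OF on X that(1)] gpsh_on.vert_Hom[OF on X that(2)] that(3)] by simp
  show "theX X (Ident I i) x s = s" if "x \<in> Obj (GX X i)" "s \<in> Sx X i x" for x s
    by (rule ts_Ident[OF i ob[OF that(1)] that(2)])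
next
  assume X: "X \<in> Obj C"
  have ob: "(X, y) \<in> Obj (Si i)" if "y \<in> Obj (GX X i)" for y i using X that by (simp add: slice_sel)
  fix \<phi> i j assume \<phi>: "\<phi> \<in> Hom I i j"
  have i: "i \<in> Obj I" using Hom_objD[OF I \<phi>] by simp
  show "bij_betw (theX X \<phi> x) (Sx X j (FOb (TX X \<phi>) x)) (Sx X i x)" if "x \<in> Obj (GX X i)" for x
    using ts_bij[OF \<phi> ob[OF that]] by (simp add: Tm_ob)
  show "theX X \<phi> x (rhoX X j (FAr (TX X \<phi>) g) s) = rhoX X i g (theX X \<phi> y s)"
    if "g \<in> Hom (GX X i) x y" "s \<in> Sx X j (FOb (TX X \<phi>) y)" for g x y s
    using ts_natural[OF \<phi> gpsh_on.vert_Hom[OF U_on[OF i] X that(1)], of s] that(2) gpsh_hom.slice_map_vert[OF DAr_hom[OF \<phi>] X that(1)]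
    by (simp add: Tm_ob)
  show "theX X (Comp I \<psi> \<phi>) x s = theX X \<phi> x (theX X \<psi> (FOb (TX X \<phi>) x) s)"
    if "\<psi> \<in> Hom I j k" "x \<in> Obj (GX X i)" "s \<in> Sx X k (FOb (TX X \<psi>) (FOb (TX X \<phi>) x))" for \<psi> k x s
    using ts_Comp[OF \<phi> that(1) ob[OF that(2)], of s] that(3) by (simp add: Tm_ob)
qed

abbreviation "act X \<equiv> hc_action.hact I (GX X) (TX X) (Sx X) (rhoX X) (theX X)"
abbreviation "SMX X \<equiv> hc_action.SM I (TX X) (Sx X)"

text \<open>Restriction of the homotopy colimit keeps the index of an object, so a cartesian arrow
  lives over the single \<open>U j\<close> read off its target, and \<open>xs j\<close> already
  knows how to restrict along it.\<close>

definition gcart :: "'a \<Rightarrow> ('i, 'j, 'o) hc_ob set \<Rightarrow> 'm \<Rightarrow> 'm" where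
  "gcart h c = (case hc_diagram.hrep I (TX (Cod C h)) c of (j, y) \<Rightarrow> Restr (xs j) (cart C (DOb U j) h y))"

lemma gcart_hob: "h \<in> Hom C X Y \<Longrightarrow> j \<in> Obj I \<Longrightarrow> y \<in> Obj (GX Y j) \<Longrightarrow> gcart h (hobX Y j y) = Restr (xs j) (cart C (DOb U j) h y)"
  using hc_diagram.hrep_hob[OF hc] Hom_objD[OF C] HomD[of h C X Y] by (simp add: gcart_def)

lemma SMX_hob: "X \<in> Obj C \<Longrightarrow> i \<in> Obj I \<Longrightarrow> x \<in> Obj (GX X i) \<Longrightarrow> SMX X (hobX X i x) = Sec (xs i) (X, x)"
  by (rule hc_action.SM_hob[OF action])

lemma gcart_closed:
  assumes h: "h \<in> Hom C X Y" and c: "c \<in> Obj (Val MM Y)" and s: "s \<in> SMX Y c"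
  shows "gcart h c s \<in> SMX X (FOb (Rst MM h) c)"
proof -
  have o: "X \<in> Obj C" "Y \<in> Obj C" using Hom_objD[OF C h] by auto
  obtain j y where y: "j \<in> Obj I" "y \<in> Obj (GX Y j)" "c = hobX Y j y" by (rule MM_ObE[OF o(2) c])
  note on = U_on[OF y(1)]
  show ?thesis
    using psh_Restr_closed[OF xs_presheaf[OF y(1)] gpsh_on.cart_Hom[OF on h y(2)], of s] s
      SMX_hob[OF o(1) y(1) gpsh_on.R_ob[OF on h y(2)]] SMX_hob[OF o(2) y(1,2)]
    by (simp add: y(3) gcart_hob[OF h y(1,2)] Rst_hob[OF h y(1,2)])
qed

lemma act_closed:
  assumes "X \<in> Obj C" "\<beta> \<in> Hom (Val MM X) a c" "s \<in> SMX X c"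
  shows "act X \<beta> s \<in> SMX X a"
  using hc_action.hact_closed[OF action[OF assms(1)]] assms by (simp add: MM_sel)

lemma act_Comp:
  assumes "X \<in> Obj C" "\<beta> \<in> Hom (Val MM X) a c" "\<gamma> \<in> Hom (Val MM X) c d" "s \<in> SMX X d"
  shows "act X (Comp (Val MM X) \<gamma> \<beta>) s = act X \<beta> (act X \<gamma> s)"
  using hc_action.hact_Comp[OF action[OF assms(1)]] assms by (simp add: MM_sel)

lemma act_Ident: "X \<in> Obj C \<Longrightarrow> a \<in> Obj (Val MM X) \<Longrightarrow> s \<in> SMX X a \<Longrightarrow> act X (Ident (Val MM X) a) s = s"
  using hc_action.hact_Ident[OF action] by (simp add: MM_sel)

text \<open>This exchange of vertical and cartesian restriction makes the glued restriction
  functorial. On arrows of a single \<open>U i\<close> it is \<open>vert_cart\<close>, on canonical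
  arrows the naturality of \<open>ts\<close> along cartesian lifts, and it passes to composites and
  inverses.\<close>

lemma act_gcart:
  assumes h: "h \<in> Hom C X Y" and \<beta>: "\<beta> \<in> Hom (Val MM Y) a c" and s: "s \<in> SMX Y c"
  shows "act X (FAr (Rst MM h) \<beta>) (gcart h c s) = gcart h a (act Y \<beta> s)"
proof -
  interpret M: gpsh_on C MM by (rule MM_on)
  have o: "X \<in> Obj C" "Y \<in> Obj C" using Hom_objD[OF C h] by auto
  interpret D: hc_diagram I "GX Y" "TX Y" by (rule hc[OF o(2)])
  interpret H: hc_transformation I "GX Y" "TX Y" "GX X" "TX X" "\<lambda>i. Rst (DOb U i) h" by (rule hct[OF h])
  note F = M.R_functor[OF h]
  have M: "D.M = Val MM Y" by (simp add: MM_sel)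
  have "\<beta> \<in> Arr D.M" using HomD[OF \<beta>] by (simp add: M)
  then have "\<forall>a c s. \<beta> \<in> Hom (Val MM Y) a c \<longrightarrow> s \<in> SMX Y c \<longrightarrow> act X (FAr (Rst MM h) \<beta>) (gcart h c s) = gcart h a (act Y \<beta> s)"
  proof (induction \<beta> rule: D.M_induct)
    case (Comp f g p q r)
    show ?case
    proof (intro allI impI)
      fix a c s assume hh: "Comp D.M g f \<in> Hom (Val MM Y) a c" and s: "s \<in> SMX Y c"
      have f: "f \<in> Hom (Val MM Y) p q" and g: "g \<in> Hom (Val MM Y) q r" using Comp(1,2) by (simp_all add: M)
      have ac: "a = p" "c = r" using HomD[OF hh[unfolded M]] HomD[OF cat_comp[OF M.V_category[OF o(2)] f g]] by auto
      have s: "s \<in> SMX Y r" using s ac by simp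
      have ro: "r \<in> Obj (Val MM Y)" using Hom_objD[OF M.V_category[OF o(2)] g] by simp
      have gs: "act Y g s \<in> SMX Y q" by (rule act_closed[OF o(2) g s])
      have "act X (FAr (Rst MM h) (Comp (Val MM Y) g f)) (gcart h r s) = act X (FAr (Rst MM h) f) (act X (FAr (Rst MM h) g) (gcart h r s))"
        unfolding functor_comp[OF F f g] by (rule act_Comp[OF o(1) functor_hom[OF F f] functor_hom[OF F g] gcart_closed[OF h ro s]])
      also have "\<dots> = gcart h p (act Y f (act Y g s))" using Comp(3)[rule_format, OF f gs] Comp(4)[rule_format, OF g s] by simp
      also have "\<dots> = gcart h p (act Y (Comp (Val MM Y) g f) s)" using act_Comp[OF o(2) f g s] by simp
      finally show "act X (FAr (Rst MM h) (Comp D.M g f)) (gcart h c s) = gcart h a (act Y (Comp D.M g f) s)" by (simp add: ac M)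
    qed
  next
    case (inverse f g p q)
    show ?case
    proof (intro allI impI)
      fix a c s assume hh: "g \<in> Hom (Val MM Y) a c" and s: "s \<in> SMX Y c"
      have f: "f \<in> Hom (Val MM Y) p q" and g: "g \<in> Hom (Val MM Y) q p"
        and fg: "Comp (Val MM Y) g f = Ident (Val MM Y) p" "Comp (Val MM Y) f g = Ident (Val MM Y) q" using inverse(1-4) by (simp_all add: M)
      have ac: "a = q" "c = p" using HomD[OF hh] HomD[OF g] by auto
      have s: "s \<in> SMX Y p" using s ac by simp
      have po: "p \<in> Obj (Val MM Y)" "q \<in> Obj (Val MM Y)" using Hom_objD[OF M.V_category[OF o(2)] g] by auto
      have gs: "act Y g s \<in> SMX Y q" by (rule act_closed[OF o(2) g s])
      have sf: "act Y f (act Y g s) = s" using act_Comp[OF o(2) f g s] fg(1) act_Ident[OF o(2) po(1) s] by simp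
      \<comment> \<open>The hypothesis for \<open>f\<close>, taken at the section
        \<open>act Y g s\<close>; acting by the image of \<open>g\<close> then cancels the image of
        \<open>f\<close>.\<close>
      have "gcart h p s = act X (FAr (Rst MM h) f) (gcart h q (act Y g s))" using inverse(5)[rule_format, OF f gs] sf by simp
      then have "act X (FAr (Rst MM h) g) (gcart h p s) = act X (FAr (Rst MM h) (Comp (Val MM Y) f g)) (gcart h q (act Y g s))"
        unfolding functor_comp[OF F g f] using act_Comp[OF o(1) functor_hom[OF F g] functor_hom[OF F f] gcart_closed[OF h po(2) gs]] by simp
      also have "\<dots> = gcart h q (act Y g s)"
        unfolding fg(2) functor_ident[OF F po(2)] by (rule act_Ident[OF o(1) functor_ob[OF F po(2)] gcart_closed[OF h po(2) gs]])
      finally show "act X (FAr (Rst MM h) g) (gcart h c s) = gcart h a (act Y g s)" by (simp add: ac)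
    qed
  next
    case (hinc i g x y)
    show ?case
    proof (intro allI impI)
      fix a c s assume hh: "D.hinc i g \<in> Hom (Val MM Y) a c" and s: "s \<in> SMX Y c"
      note i = hinc(1) and g = hinc(2) and on = U_on[OF hinc(1)]
      have ac: "a = D.hob i x" "c = D.hob i y" using HomD[OF hh[folded M]] HomD[OF D.hinc_Hom[OF i g]] by auto
      have xy: "x \<in> Obj (GX Y i)" "y \<in> Obj (GX Y i)" using Hom_objD[OF D.G_category[OF i] g] by auto
      have s: "s \<in> Sec (xs i) (Y, y)" using s SMX_hob[OF o(2) i xy(2)] ac by simp
      note hg = functor_hom[OF H.N_functor[OF i] g] and P = xs_presheaf[OF i]
      note cs = psh_Restr_closed[OF P gpsh_on.cart_Hom[OF on h xy(2)] s]
      have "act X (FAr (Rst MM h) (D.hinc i g)) (gcart h c s) = Restr (xs i) (vert C (DOb U i) X (FAr (Rst (DOb U i) h) g)) (Restr (xs i) (cart C (DOb U i) h y) s)"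
        using hc_action.hact_hinc[OF action[OF o(1)] i hg cs] H.F_hinc[OF i g]
        by (simp add: ac gcart_hob[OF h i xy(2)] MM_sel(2)[OF h])
      also have "\<dots> = Restr (xs i) (cart C (DOb U i) h x) (Restr (xs i) (vert C (DOb U i) Y g) s)"
        using gpsh_on.vert_cart[OF on h g] psh_Restr_Comp[OF P gpsh_on.cart_Hom[OF on h xy(1)] gpsh_on.vert_Hom[OF on o(2) g] s]
          psh_Restr_Comp[OF P gpsh_on.vert_Hom[OF on o(1) hg] gpsh_on.cart_Hom[OF on h xy(2)] s] by simp
      also have "\<dots> = gcart h a (act Y (D.hinc i g) s)"
        using hc_action.hact_hinc[OF action[OF o(2)] i g s] by (simp add: ac gcart_hob[OF h i xy(1)])
      finally show "act X (FAr (Rst MM h) (D.hinc i g)) (gcart h c s) = gcart h a (act Y (D.hinc i g) s)" .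
    qed
  next
    case (hcan \<phi> i j x)
    show ?case
    proof (intro allI impI)
      fix a c s assume hh: "D.hcan \<phi> x \<in> Hom (Val MM Y) a c" and s: "s \<in> SMX Y c"
      note \<phi> = hcan(1) and x = hcan(2)
      have ij: "i \<in> Obj I" "j \<in> Obj I" using Hom_objD[OF I \<phi>] by auto
      have ac: "a = D.hob i x" "c = D.hob j (FOb (TX Y \<phi>) x)" using HomD[OF hh[folded M]] HomD[OF D.hcan_Hom[OF \<phi> x]] by auto
      note Tx = D.T_ob[OF \<phi> x]
      have s: "s \<in> Sec (xs j) (Y, FOb (TX Y \<phi>) x)" using s SMX_hob[OF o(2) ij(2) Tx] ac by simp
      note hx = functor_ob[OF H.N_functor[OF ij(1)] x] and e = H.N_ob[OF \<phi> x]
      have cs: "Restr (xs j) (cart C (DOb U j) h (FOb (TX Y \<phi>) x)) s \<in> Sec (xs j) (X, FOb (TX X \<phi>) (FOb (Rst (DOb U i) h) x))"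
        unfolding e by (rule psh_Restr_closed[OF xs_presheaf[OF ij(2)] gpsh_on.cart_Hom[OF U_on[OF ij(2)] h Tx] s])
      have "act X (FAr (Rst MM h) (D.hcan \<phi> x)) (gcart h c s) = ts \<phi> (X, FOb (Rst (DOb U i) h) x) (Restr (xs j) (cart C (DOb U j) h (FOb (TX Y \<phi>) x)) s)"
        using hc_action.hact_hcan[OF action[OF o(1)] \<phi> hx cs] H.F_hcan[OF \<phi> x]
        by (simp add: ac gcart_hob[OF h ij(2) Tx] MM_sel(2)[OF h])
      also have "\<dots> = Restr (xs i) (cart C (DOb U i) h x) (ts \<phi> (Y, x) s)"
        using ts_natural[OF \<phi> gpsh_on.cart_Hom[OF U_on[OF ij(1)] h x], of s] s gpsh_hom.slice_map_cart[OF DAr_hom[OF \<phi>] h x]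
        by (simp add: Tm_ob)
      also have "\<dots> = gcart h a (act Y (D.hcan \<phi> x) s)"
        using hc_action.hact_hcan[OF action[OF o(2)] \<phi> x s] by (simp add: ac gcart_hob[OF h ij(1) x])
      finally show "act X (FAr (Rst MM h) (D.hcan \<phi> x)) (gcart h c s) = gcart h a (act Y (D.hcan \<phi> x) s)" .
    qed
  qed
  then show ?thesis using \<beta> s by blast
qed

text \<open>Over the image of \<open>w\<close> in \<open>Si i\<close> the sections are those of
  \<open>xs i\<close> over \<open>w\<close>, with scalars restricted along \<open>rb\<close> so that
  \<open>R\<close> acts. An arrow restricts first by its cartesian part and then by its vertical
  part, the latter through the action of the homotopy colimit.\<close>

definition glue :: "(('i, 'j, 'c, 'o) hs_ob, ('i, 'j, 'c, 'a, 'o, 'g) hs_arr, 'r, 'm) msheaf" where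
  "glue = \<lparr>
     Sect = (\<lambda>z\<in>Obj SM. case sel z of (i, w) \<Rightarrow>
       (Sect (xs i) w)\<lparr>smult := (\<lambda>r\<in>Sec R z. smult (Sect (xs i) w) (rb i w r))\<rparr>),
     Restr = (\<lambda>e\<in>Arr SM. case e of ((X, a), (Y, c), h, \<alpha>) \<Rightarrow> \<lambda>s. act X \<alpha> (gcart h c s))\<rparr>"

lemma glue_Sect: "i \<in> Obj I \<Longrightarrow> w \<in> Obj (Si i) \<Longrightarrow> Sect glue (FOb (Jm i) w) =
    (Sect (xs i) w)\<lparr>smult := (\<lambda>r\<in>Sec R (FOb (Jm i) w). smult (Sect (xs i) w) (rb i w r))\<rparr>"
  by (simp add: glue_def Jm_Obj sel_Jm)

lemma glue_Sec: "i \<in> Obj I \<Longrightarrow> w \<in> Obj (Si i) \<Longrightarrow> Sec glue (FOb (Jm i) w) = Sec (xs i) w"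
  by (simp add: glue_Sect)

lemma glue_SMX: 
  assumes "X \<in> Obj C" "c \<in> Obj (Val MM X)"
  shows "Sec glue (X, c) = SMX X c"
proof -
  obtain i x where x: "i \<in> Obj I" "x \<in> Obj (GX X i)" "c = hobX X i x" by (rule MM_ObE[OF assms])
  have "(X, x) \<in> Obj (Si i)" using assms(1) x(2) by (simp add: slice_sel)
  from glue_Sec[OF x(1) this] show ?thesis using SMX_hob[OF assms(1) x(1,2)] x(3) by (simp add: Jm_ob[OF assms(1)])
qed

lemma glue_Restr:
  assumes "((X, a), (Y, c), h, \<alpha>) \<in> Hom SM (X, a) (Y, c)"
  shows "Restr glue ((X, a), (Y, c), h, \<alpha>) s = act X \<alpha> (gcart h c s)"
  using HomD[OF assms] by (simp add: glue_def)

lemma gcart_Comp: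
  assumes h: "h \<in> Hom C X Y" and k: "k \<in> Hom C Y Z" and c: "c \<in> Obj (Val MM Z)" and s: "s \<in> SMX Z c"
  shows "gcart (Comp C k h) c s = gcart h (FOb (Rst MM k) c) (gcart k c s)"
proof -
  have o: "Y \<in> Obj C" "Z \<in> Obj C" using Hom_objD[OF C k] by auto
  obtain j y where y: "j \<in> Obj I" "y \<in> Obj (GX Z j)" "c = hobX Z j y" by (rule MM_ObE[OF o(2) c])
  note on = U_on[OF y(1)]
  note ky = gpsh_on.R_ob[OF on k y(2)]
  have s: "s \<in> Sec (xs j) (Z, y)" using s SMX_hob[OF o(2) y(1,2)] y(3) by simp
  show ?thesis
    using psh_Restr_Comp[OF xs_presheaf[OF y(1)] gpsh_on.cart_Hom[OF on h ky] gpsh_on.cart_Hom[OF on k y(2)] s] gpsh_on.cart_Comp[OF on h k y(2)]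
    by (simp add: y(3) gcart_hob[OF cat_comp[OF C h k] y(1,2)] gcart_hob[OF k y(1,2)] Rst_hob[OF k y(1,2)] gcart_hob[OF h y(1) ky])
qed

lemma gcart_Ident:
  assumes X: "X \<in> Obj C" and c: "c \<in> Obj (Val MM X)" and s: "s \<in> SMX X c"
  shows "gcart (Ident C X) c s = s"
proof -
  obtain j y where y: "j \<in> Obj I" "y \<in> Obj (GX X j)" "c = hobX X j y" by (rule MM_ObE[OF X c])
  have s: "s \<in> Sec (xs j) (X, y)" using s SMX_hob[OF X y(1,2)] y(3) by simp
  have ob: "(X, y) \<in> Obj (Si j)" using X y(2) by (simp add: slice_sel)
  show ?thesis
    using psh_Restr_Ident[OF xs_presheaf[OF y(1)] ob s] gpsh_on.cart_Ident[OF U_on[OF y(1)] X y(2)]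
    by (simp add: y(3) gcart_hob[OF cat_ident[OF C X] y(1,2)])
qed

lemma glue_presheaf: "is_presheaf SM glue"
  unfolding is_presheaf_def
proof (intro conjI ballI impI)
  interpret M: gpsh_on C MM by (rule MM_on)
  show "Sect glue \<in> extensional (Obj SM)" "Restr glue \<in> extensional (Arr SM)" by (simp_all add: glue_def)
  have closed: "Restr glue e s \<in> Sec glue z" if e: "e \<in> Hom SM z w" and s: "s \<in> Sec glue w" for e z w s
  proof -
    obtain X x where z: "z = (X, x)" by (rule prod.exhaust)
    obtain Y y where w: "w = (Y, y)" by (rule prod.exhaust)
    obtain h \<alpha> where a: "e = ((X, x), (Y, y), h, \<alpha>)" "X \<in> Obj C" "x \<in> Obj (Val MM X)" "Y \<in> Obj C" "y \<in> Obj (Val MM Y)"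
       "h \<in> Hom C X Y" "\<alpha> \<in> Hom (Val MM X) x (FOb (Rst MM h) y)" by (rule slice_HomE[OF e[unfolded z w]])
    have s: "s \<in> SMX Y y" using s glue_SMX[OF a(4,5)] w by simp
    show ?thesis using act_closed[OF a(2,7) gcart_closed[OF a(6,5) s]] glue_SMX[OF a(2,3)]
      by (simp add: a(1) z glue_Restr[OF e[unfolded z w a(1)]])
  qed
  show "Restr glue f \<in> Sec glue (Cod SM f) \<rightarrow> Sec glue (Dom SM f)" if f: "f \<in> Arr SM" for f
    using closed[OF Arr_Hom[OF f]] by auto
  show "Restr glue (Ident SM z) m = m" if z: "z \<in> Obj SM" and m: "m \<in> Sec glue z" for z m
  proof -
    obtain X x where z': "z = (X, x)" "X \<in> Obj C" "x \<in> Obj (Val MM X)" using z by (auto simp: slice_sel)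
    have m: "m \<in> SMX X x" using m glue_SMX[OF z'(2,3)] z'(1) by simp
    show ?thesis
      using glue_Restr[OF cat_ident[OF SM_category z, unfolded z'(1) slice_sel]] gcart_Ident[OF z'(2,3) m] act_Ident[OF z'(2,3) m]
      by (simp add: z'(1) slice_sel)
  qed
  show "Restr glue (Comp SM g f) m = Restr glue f (Restr glue g m)"
    if f: "f \<in> Arr SM" and g: "g \<in> Arr SM" and fg: "Dom SM g = Cod SM f" and m: "m \<in> Sec glue (Cod SM g)" for f g m
  proof -
    obtain X x Y y where fh: "f \<in> Hom SM (X, x) (Y, y)" by (rule slice_ArrE[OF f])
    obtain Y' y' Z z where gh': "g \<in> Hom SM (Y', y') (Z, z)" by (rule slice_ArrE[OF g])
    have gh: "g \<in> Hom SM (Y, y) (Z, z)" using gh' fg HomD[OF fh] HomD[OF gh'] by (metis)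
    obtain h \<alpha> where a: "f = ((X, x), (Y, y), h, \<alpha>)" "X \<in> Obj C" "x \<in> Obj (Val MM X)" "Y \<in> Obj C" "y \<in> Obj (Val MM Y)"
       "h \<in> Hom C X Y" "\<alpha> \<in> Hom (Val MM X) x (FOb (Rst MM h) y)" by (rule slice_HomE[OF fh])
    obtain k \<beta> where c: "g = ((Y, y), (Z, z), k, \<beta>)" "Y \<in> Obj C" "y \<in> Obj (Val MM Y)" "Z \<in> Obj C" "z \<in> Obj (Val MM Z)"
       "k \<in> Hom C Y Z" "\<beta> \<in> Hom (Val MM Y) y (FOb (Rst MM k) z)" by (rule slice_HomE[OF gh])
    have m: "m \<in> SMX Z z" using m glue_SMX[OF c(4,5)] HomD[OF gh] by simp
    note kz = M.R_ob[OF c(6,5)] and km = gcart_closed[OF c(6,5) m]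
    note hb = functor_hom[OF M.R_functor[OF a(6)] c(7)]
    have gf: "Comp SM g f = ((X, x), (Z, z), Comp C k h, Comp (Val MM X) (FAr (Rst MM h) \<beta>) \<alpha>)" by (simp add: a(1) c(1) slice_sel)
    have "Restr glue (Comp SM g f) m = act X (Comp (Val MM X) (FAr (Rst MM h) \<beta>) \<alpha>) (gcart h (FOb (Rst MM k) z) (gcart k z m))"
      unfolding gf using glue_Restr[OF cat_comp[OF SM_category fh gh, unfolded gf]] gcart_Comp[OF a(6) c(6,5) m] by simp
    also have "\<dots> = act X \<alpha> (act X (FAr (Rst MM h) \<beta>) (gcart h (FOb (Rst MM k) z) (gcart k z m)))"
      by (rule act_Comp[OF a(2,7) hb gcart_closed[OF a(6) kz km]])
    \<comment> \<open>The vertical part of \<open>g\<close> is exchanged with the cartesian part of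
      \<open>f\<close>.\<close>
    also have "\<dots> = act X \<alpha> (gcart h y (act Y \<beta> (gcart k z m)))" using act_gcart[OF a(6) c(7) km] by simp
    finally show ?thesis using glue_Restr[OF fh[unfolded a(1)]] glue_Restr[OF gh[unfolded c(1)]] by (simp add: a(1) c(1))
  qed
qed

text \<open>The image of an arrow of \<open>Si i\<close> splits into a cartesian and a vertical part
  that both stay over \<open>i\<close>, where \<open>gcart\<close> and the action are restrictions
  of \<open>xs i\<close>.\<close>

lemma glue_incl:
  assumes i: "i \<in> Obj I" and f: "f \<in> Hom (Si i) z w" and s: "s \<in> Sec (xs i) w"
  shows "Restr glue (FAr (Jm i) f) s = Restr (xs i) f s"
proof -
  obtain X x where z: "z = (X, x)" by (rule prod.exhaust)
  obtain Y y where w: "w = (Y, y)" by (rule prod.exhaust)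
  obtain h \<alpha> where a: "f = ((X, x), (Y, y), h, \<alpha>)" "X \<in> Obj C" "x \<in> Obj (GX X i)" "Y \<in> Obj C" "y \<in> Obj (GX Y i)"
       "h \<in> Hom C X Y" "\<alpha> \<in> Hom (GX X i) x (FOb (Rst (DOb U i) h) y)" by (rule slice_HomE[OF f[unfolded z w]])
  have s: "s \<in> Sec (xs i) (Y, y)" using s w by simp
  have e: "FAr (Jm i) f = ((X, hobX X i x), (Y, hobX Y i y), h, hincX X i \<alpha>)"
    using a(2,4) by (simp add: a(1) slice_map_sel incl_sel)
  have eh: "FAr (Jm i) f \<in> Hom SM (X, hobX X i x) (Y, hobX Y i y)"
    using functor_hom[OF Jm_functor[OF i] f] a(2,4) by (simp add: z w Jm_ob)
  note on = U_on[OF i] and P = xs_presheaf[OF i]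
  note ch = gpsh_on.cart_Hom[OF on a(6,5)] and vh = gpsh_on.vert_Hom[OF on a(2,7)]
  have "Restr glue (FAr (Jm i) f) s = act X (hincX X i \<alpha>) (Restr (xs i) (cart C (DOb U i) h y) s)"
    using glue_Restr[OF eh[unfolded e]] by (simp add: e gcart_hob[OF a(6) i a(5)])
  also have "\<dots> = Restr (xs i) (vert C (DOb U i) X \<alpha>) (Restr (xs i) (cart C (DOb U i) h y) s)"
    by (rule hc_action.hact_hinc[OF action[OF a(2)] i a(7) psh_Restr_closed[OF P ch s]])
  also have "\<dots> = Restr (xs i) f s"
    using psh_Restr_Comp[OF P vh ch s] gpsh_on.cart_vert[OF on f[unfolded z w a(1)]] by (simp add: a(1))
  finally show ?thesis .
qed

text \<open>A canonical arrow lies over an identity of \<open>C\<close>, so its cartesian part acts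
  trivially and \<open>hact_hcan\<close> leaves \<open>ts\<close>. Together with
  \<open>glue_incl\<close> this fixes \<open>glue\<close> on all generating arrows.\<close>

lemma glue_can:
  assumes \<phi>: "\<phi> \<in> Hom I i j" and z: "z \<in> Obj (Si i)" and s: "s \<in> Sec (xs j) (FOb (Tm \<phi>) z)"
  shows "Restr glue (can \<phi> z) s = ts \<phi> z s"
proof -
  obtain X x where w: "z = (X, x)" "X \<in> Obj C" "x \<in> Obj (GX X i)" using z by (auto simp: slice_sel)
  interpret D: hc_diagram I "GX X" "TX X" by (rule hc[OF w(2)])
  have ij: "i \<in> Obj I" "j \<in> Obj I" using Hom_objD[OF I \<phi>] by auto
  note Tx = D.T_ob[OF \<phi> w(3)]
  have s: "s \<in> Sec (xs j) (X, FOb (TX X \<phi>) x)" using s by (simp add: w(1) Tm_ob)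
  have e: "can \<phi> z = ((X, D.hob i x), (X, D.hob j (FOb (TX X \<phi>) x)), Ident C X, D.hcan \<phi> x)"
    using HomD[OF D.hcan_Hom[OF \<phi> w(3)]] by (simp add: w(1) can_vert[OF \<phi> w(2,3)] vert_def MM_sel)
  have eh: "can \<phi> z \<in> Hom SM (X, D.hob i x) (X, D.hob j (FOb (TX X \<phi>) x))"
    using can_Hom[OF \<phi> z] by (simp add: w(1) Jm_ob[OF w(2)] Tm_ob)
  have o: "D.hob j (FOb (TX X \<phi>) x) \<in> Obj (Val MM X)" using D.hob_Obj[OF ij(2) Tx] by (simp add: MM_sel)
  have "Restr glue (can \<phi> z) s = act X (D.hcan \<phi> x) s"
    using glue_Restr[OF eh[unfolded e]] gcart_Ident[OF w(2) o, of s] s SMX_hob[OF w(2) ij(2) Tx] by (simp add: e)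
  also have "\<dots> = ts \<phi> z s" using hc_action.hact_hcan[OF action[OF w(2)] \<phi> w(3) s] by (simp add: w(1))
  finally show ?thesis .
qed

text \<open>Cartesian lifts with target the image of \<open>x\<close> stay over the same
  \<open>U i\<close>, so gluing at that point is gluing for the sheaf \<open>xs i\<close> at
  \<open>x\<close>.\<close>

lemma glue_sheaf: "is_sheaf SM glue"
proof (rule gpsh_on_site.sheafI_cart_glues[OF MM_on_site glue_presheaf])
  fix X c assume X: "X \<in> Obj C" and c: "c \<in> Obj (Val MM X)"
  obtain i x where x: "i \<in> Obj I" "x \<in> Obj (GX X i)" "c = hobX X i x" by (rule MM_ObE[OF X c])
  have "cart_glues C (DOb U i) (xs i) X x \<longleftrightarrow> cart_glues C MM glue X (FOb (hc_incl I U i X) x)"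
  proof (rule gpsh_hom.cart_glues_iff[OF incl_hom[OF x(1)] Cov_arr[OF X] X x(2)])
    fix z assume z: "z \<in> Obj (Si i)"
    obtain V v where v: "z = (V, v)" by (rule prod.exhaust)
    show "Sec (xs i) z = Sec glue (FOb (slice_map (hc_incl I U i)) z)"
      using glue_Sec[OF x(1) z] by (simp add: v slice_map_sel)
  qed (simp_all add: glue_incl[OF x(1)])
  moreover have "cart_glues C (DOb U i) (xs i) X x"
    by (rule gpsh_on_site.sheaf_cart_glues[OF U_on_site[OF x(1)] module_sheafD(1)[OF xs_module[OF x(1)]] X x(2)])
  ultimately show "cart_glues C MM glue X c" by (simp add: x(3) incl_sel[OF X])
qed

end

context glueing
begin

lemma rb_closed: "i \<in> Obj I \<Longrightarrow> w \<in> Obj (Si i) \<Longrightarrow> r \<in> Sec R (FOb (Jm i) w) \<Longrightarrow> rb i w r \<in> Sec (Ri i) w"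
  using nat_mapsD(1)[OF ring_sheaf_isoD(5)[OF b_iso(2)], of i w r] by (simp add: psh_pull_sel)

lemma glue_left_module:
  assumes "z \<in> Obj SM"
  shows "left_module (Sect R z) (Sect glue z)"
  using assms
proof (induction rule: SM_Obj_cases)
  case (1 i w)
  have R: "ring (Sect R (FOb (Jm i) w))" and h: "rb i w \<in> ring_hom (Sect R (FOb (Jm i) w)) (Sect (Ri i) w)"
    using ring_sheaf_isoD(1)[OF b_iso(2)[OF 1(1)] 1(2)] ring_sheaf_isoD(3)[OF b_iso(2)[OF 1(1)] 1(2)] 1(2) by (simp_all add: psh_pull_sel)
  show ?case unfolding glue_Sect[OF 1]
    by (rule left_module_restrict_scalars[OF module_sheafD(2)[OF xs_module[OF 1(1)] 1(2)] R h])
qed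

lemma glue_smult: "i \<in> Obj I \<Longrightarrow> w \<in> Obj (Si i) \<Longrightarrow> r \<in> Sec R (FOb (Jm i) w) \<Longrightarrow>
    smult (Sect glue (FOb (Jm i) w)) r = smult (Sect (xs i) w) (rb i w r)"
  by (simp add: glue_Sect)

lemma glue_add: "i \<in> Obj I \<Longrightarrow> w \<in> Obj (Si i) \<Longrightarrow> add (Sect glue (FOb (Jm i) w)) = add (Sect (xs i) w)"
  by (simp add: glue_Sect)

definition "semilinear_at z w e \<longleftrightarrow> (\<forall>m\<in>Sec glue w.
        (\<forall>n\<in>Sec glue w. Restr glue e (m \<oplus>\<^bsub>Sect glue w\<^esub> n) = Restr glue e m \<oplus>\<^bsub>Sect glue z\<^esub> Restr glue e n) \<and>
        (\<forall>r\<in>Sec R w. Restr glue e (r \<odot>\<^bsub>Sect glue w\<^esub> m) = Restr R e r \<odot>\<^bsub>Sect glue z\<^esub> Restr glue e m))"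

lemma semilinear_atD:
  assumes "semilinear_at z w e" "m \<in> Sec glue w"
  shows "n \<in> Sec glue w \<Longrightarrow> Restr glue e (m \<oplus>\<^bsub>Sect glue w\<^esub> n) = Restr glue e m \<oplus>\<^bsub>Sect glue z\<^esub> Restr glue e n"
    "r \<in> Sec R w \<Longrightarrow> Restr glue e (r \<odot>\<^bsub>Sect glue w\<^esub> m) = Restr R e r \<odot>\<^bsub>Sect glue z\<^esub> Restr glue e m"
  using assms by (simp_all add: semilinear_at_def)

text \<open>Semilinearity over the restriction of \<open>R\<close> passes to composites and
  inverses, so generating arrows suffice. Over a single \<open>U i\<close> it is inherited from
  \<open>xs i\<close> and the naturality of \<open>rb\<close>, on canonical arrows from
  \<open>ts_add\<close>, \<open>ts_smult\<close> and \<open>ra_rb\<close>.\<close>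

lemma glue_semilinear:
  assumes "e \<in> Arr SM"
  shows "\<forall>z w. e \<in> Hom SM z w \<longrightarrow> semilinear_at z w e"
  using assms
proof (induction rule: SM_induct)
  note PG = glue_presheaf and PR = ring_sheaf_presheaf[OF R]
  case (Comp f g a b c)
  show ?case
  proof (intro allI impI)
    fix z w assume h: "Comp SM g f \<in> Hom SM z w"
    have zw: "z = a" "w = c" using HomD[OF h] HomD[OF cat_comp[OF SM_category Comp(1,2)]] by auto
    note lf = semilinear_atD[OF Comp(3)[rule_format, OF Comp(1)]] and lg = semilinear_atD[OF Comp(4)[rule_format, OF Comp(2)]]
    have o: "b \<in> Obj SM" "c \<in> Obj SM" using Hom_objD[OF SM_category Comp(2)] by auto
    note L = left_moduleD[OF glue_left_module[OF o(2)]]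
    note cl = psh_Restr_closed[OF PG Comp(2)] and clR = psh_Restr_closed[OF PR Comp(2)]
    note cc = psh_Restr_Comp[OF PG Comp(1,2)] and ccR = psh_Restr_Comp[OF PR Comp(1,2)]
    show "semilinear_at z w (Comp SM g f)"
      unfolding semilinear_at_def zw
    proof (intro ballI conjI)
      fix m assume m: "m \<in> Sec glue c"
      show "Restr glue (Comp SM g f) (m \<oplus>\<^bsub>Sect glue c\<^esub> n) = Restr glue (Comp SM g f) m \<oplus>\<^bsub>Sect glue a\<^esub> Restr glue (Comp SM g f) n"
        if n: "n \<in> Sec glue c" for n
        unfolding cc[OF L(4)[OF m n]] cc[OF m] cc[OF n] lg(1)[OF m n] by (rule lf(1)[OF cl[OF m] cl[OF n]])
      show "Restr glue (Comp SM g f) (r \<odot>\<^bsub>Sect glue c\<^esub> m) = Restr R (Comp SM g f) r \<odot>\<^bsub>Sect glue a\<^esub> Restr glue (Comp SM g f) m"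
        if r: "r \<in> Sec R c" for r
        unfolding cc[OF L(3)[OF r m]] cc[OF m] ccR[OF r] lg(2)[OF m r] by (rule lf(2)[OF cl[OF m] clR[OF r]])
    qed
  qed
next
  note PG = glue_presheaf and PR = ring_sheaf_presheaf[OF R]
  case (inverse f g a b)
  show ?case
  proof (intro allI impI)
    fix z w assume h: "g \<in> Hom SM z w"
    have zw: "z = b" "w = a" using HomD[OF h] HomD[OF inverse(2)] by auto
    note lf = semilinear_atD[OF inverse(5)[rule_format, OF inverse(1)]]
    have o: "a \<in> Obj SM" "b \<in> Obj SM" using Hom_objD[OF SM_category inverse(1)] by auto
    note L = left_moduleD[OF glue_left_module[OF o(2)]]
    note cl = psh_Restr_closed[OF PG inverse(2)] and clR = psh_Restr_closed[OF PR inverse(2)]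
    have fg: "Restr glue f (Restr glue g m) = m" if "m \<in> Sec glue a" for m
      using psh_Restr_Comp[OF PG inverse(1,2) that] inverse(3) psh_Restr_Ident[OF PG o(1) that] by simp
    have fgR: "Restr R f (Restr R g m) = m" if "m \<in> Sec R a" for m
      using psh_Restr_Comp[OF PR inverse(1,2) that] inverse(3) psh_Restr_Ident[OF PR o(1) that] by simp
    have gf: "Restr glue g (Restr glue f m) = m" if "m \<in> Sec glue b" for m
      using psh_Restr_Comp[OF PG inverse(2,1) that] inverse(4) psh_Restr_Ident[OF PG o(2) that] by simp
    show "semilinear_at z w g"
      unfolding semilinear_at_def zw
    proof (intro ballI conjI)
      fix m assume m: "m \<in> Sec glue a"
      show "Restr glue g (m \<oplus>\<^bsub>Sect glue a\<^esub> n) = Restr glue g m \<oplus>\<^bsub>Sect glue b\<^esub> Restr glue g n" if n: "n \<in> Sec glue a" for n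
        \<comment> \<open>The law for \<open>f\<close> is applied to sections already restricted
          along \<open>g\<close>, and restriction along \<open>g\<close> is then applied to both
          sides.\<close>
        using lf(1)[OF cl[OF m] cl[OF n]] gf[OF L(4)[OF cl[OF m] cl[OF n]]] by (simp add: fg m n)
      show "Restr glue g (r \<odot>\<^bsub>Sect glue a\<^esub> m) = Restr R g r \<odot>\<^bsub>Sect glue b\<^esub> Restr glue g m" if r: "r \<in> Sec R a" for r
        using lf(2)[OF cl[OF m] clR[OF r]] gf[OF L(3)[OF clR[OF r] cl[OF m]]] by (simp add: fg m fgR r)
    qed
  qed
next
  case (incl i f z0 w0)
  show ?case
  proof (intro allI impI)
    fix z w assume h: "FAr (Jm i) f \<in> Hom SM z w"
    note Jf = functor_hom[OF Jm_functor[OF incl(1)] incl(2)]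
    have zw: "z = FOb (Jm i) z0" "w = FOb (Jm i) w0" using HomD[OF h] HomD[OF Jf] by auto
    have o: "z0 \<in> Obj (Si i)" "w0 \<in> Obj (Si i)" using Hom_objD[OF Si_category[OF incl(1)] incl(2)] by auto
    note X = xs_module[OF incl(1)]
    note L = left_moduleD[OF module_sheafD(2)[OF X o(2)]]
    show "semilinear_at z w (FAr (Jm i) f)"
      unfolding semilinear_at_def zw glue_add[OF incl(1) o(2)] glue_add[OF incl(1) o(1)] glue_Sec[OF incl(1) o(2)]
    proof (intro ballI conjI)
      fix m assume m: "m \<in> Sec (xs i) w0"
      show "Restr glue (FAr (Jm i) f) (m \<oplus>\<^bsub>Sect (xs i) w0\<^esub> n) = Restr glue (FAr (Jm i) f) m \<oplus>\<^bsub>Sect (xs i) z0\<^esub> Restr glue (FAr (Jm i) f) n"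
        if n: "n \<in> Sec (xs i) w0" for n
        using module_sheafD(3)[OF X incl(2) m n] by (simp add: glue_incl[OF incl(1,2)] L(4) m n)
      fix r assume r: "r \<in> Sec R (FOb (Jm i) w0)"
      have rz: "Restr R (FAr (Jm i) f) r \<in> Sec R (FOb (Jm i) z0)" by (rule psh_Restr_closed[OF ring_sheaf_presheaf[OF R] Jf r])
      have "rb i z0 (Restr R (FAr (Jm i) f) r) = Restr (Ri i) f (rb i w0 r)"
        using nat_mapsD(2)[OF ring_sheaf_isoD(5)[OF b_iso(2)[OF incl(1)]] incl(2), of r] r o HomD[OF incl(2)] by (simp add: psh_pull_sel)
      then show "Restr glue (FAr (Jm i) f) (r \<odot>\<^bsub>Sect glue (FOb (Jm i) w0)\<^esub> m) =
         Restr R (FAr (Jm i) f) r \<odot>\<^bsub>Sect glue (FOb (Jm i) z0)\<^esub> Restr glue (FAr (Jm i) f) m"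
        using module_sheafD(4)[OF X incl(2) m rb_closed[OF incl(1) o(2) r]]
        by (simp add: glue_incl[OF incl(1,2)] L(3) m glue_smult[OF incl(1) o(2) r] glue_smult[OF incl(1) o(1) rz] rb_closed[OF incl(1) o(2) r])
    qed
  qed
next
  case (canon \<phi> i j z0)
  show ?case
  proof (intro allI impI)
    fix z w assume h: "can \<phi> z0 \<in> Hom SM z w"
    note ch = can_Hom[OF canon]
    have zw: "z = FOb (Jm i) z0" "w = FOb (Jm j) (FOb (Tm \<phi>) z0)" using HomD[OF h] HomD[OF ch] by auto
    have ij: "i \<in> Obj I" "j \<in> Obj I" using Hom_objD[OF I canon(1)] by auto
    note w0 = Tm_Obj[OF canon]
    note L = left_moduleD[OF module_sheafD(2)[OF xs_module[OF ij(2)] w0]]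
    show "semilinear_at z w (can \<phi> z0)"
      unfolding semilinear_at_def zw glue_add[OF ij(2) w0] glue_add[OF ij(1) canon(2)] glue_Sec[OF ij(2) w0]
    proof (intro ballI conjI)
      fix m assume m: "m \<in> Sec (xs j) (FOb (Tm \<phi>) z0)"
      show "Restr glue (can \<phi> z0) (m \<oplus>\<^bsub>Sect (xs j) (FOb (Tm \<phi>) z0)\<^esub> n) = Restr glue (can \<phi> z0) m \<oplus>\<^bsub>Sect (xs i) z0\<^esub> Restr glue (can \<phi> z0) n"
        if n: "n \<in> Sec (xs j) (FOb (Tm \<phi>) z0)" for n
        using ts_add[OF canon m n] by (simp add: glue_can[OF canon] L(4) m n)
      fix r assume r: "r \<in> Sec R (FOb (Jm j) (FOb (Tm \<phi>) z0))"
      have rz: "Restr R (can \<phi> z0) r \<in> Sec R (FOb (Jm i) z0)" by (rule psh_Restr_closed[OF ring_sheaf_presheaf[OF R] ch r])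
      show "Restr glue (can \<phi> z0) (r \<odot>\<^bsub>Sect glue (FOb (Jm j) (FOb (Tm \<phi>) z0))\<^esub> m) =
         Restr R (can \<phi> z0) r \<odot>\<^bsub>Sect glue (FOb (Jm i) z0)\<^esub> Restr glue (can \<phi> z0) m"
        using ts_smult[OF canon m rb_closed[OF ij(2) w0 r]] ra_rb[OF canon r]
        by (simp add: glue_can[OF canon] L(3) m glue_smult[OF ij(2) w0 r] glue_smult[OF ij(1) canon(2) rz] rb_closed[OF ij(2) w0 r])
    qed
  qed
qed

lemma glue_module: "is_module_sheaf SM R glue"
proof (rule module_sheafI[OF glue_sheaf glue_left_module])
  fix f z w m assume f: "f \<in> Hom SM z w" and m: "m \<in> Sec glue w"
  have "f \<in> Arr SM" using HomD[OF f] by simp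
  note l = semilinear_atD[OF glue_semilinear[OF this, rule_format, OF f] m]
  show "Restr glue f (m \<oplus>\<^bsub>Sect glue w\<^esub> n) = Restr glue f m \<oplus>\<^bsub>Sect glue z\<^esub> Restr glue f n" if "n \<in> Sec glue w" for n
    by (rule l(1)[OF that])
  show "Restr glue f (r \<odot>\<^bsub>Sect glue w\<^esub> m) = Restr R f r \<odot>\<^bsub>Sect glue z\<^esub> Restr glue f m" if "r \<in> Sec R w" for r
    by (rule l(2)[OF that])
next
  fix z assume "z \<in> Obj SM"
  then show "smult (Sect glue z) \<in> extensional (Sec R z)"
  proof (induction rule: SM_Obj_cases)
    case (1 i w)
    then show ?case by (simp add: glue_Sect extensional_def)
  qed
qed

text \<open>The identity on sections: the scalars of \<open>xs i\<close> were restricted along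
  \<open>rb\<close> in \<open>glue\<close> and are transported back by \<open>tr i\<close>, so this
  is linear.\<close>

definition "gc i = norm_map (Si i) (tr i glue) (\<lambda>z m. m)"

lemma tr_glue_Sec: "i \<in> Obj I \<Longrightarrow> z \<in> Obj (Si i) \<Longrightarrow> Sec (tr i glue) z = Sec (xs i) z"
  by (simp add: tr_sel(1) glue_Sec)

lemma gc_Hom:
  assumes i: "i \<in> Obj I"
  shows "(tr i glue, xs i, gc i) \<in> Hom (Mod (Si i) (Ri i)) (tr i glue) (xs i)"
proof -
  note M = tr_module_sheaf[OF i glue_module] and S = Si_category[OF i]
  have "mod_hom (Si i) (Ri i) (tr i glue) (xs i) (gc i)"
    unfolding gc_def
  proof (rule mod_hom_norm[OF S M])
    show "m \<in> Sec (xs i) x" if "x \<in> Obj (Si i)" "m \<in> Sec (tr i glue) x" for x m using that tr_glue_Sec[OF i] by simp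
    show "Restr (tr i glue) f m = Restr (xs i) f m" if f: "f \<in> Hom (Si i) z w" and m: "m \<in> Sec (tr i glue) w" for f z w m
      using m Hom_objD[OF S f] by (simp add: tr_Restr[OF i f] tr_glue_Sec[OF i] glue_incl[OF i f])
    show "m \<oplus>\<^bsub>Sect (tr i glue) x\<^esub> n = m \<oplus>\<^bsub>Sect (xs i) x\<^esub> n" if "x \<in> Obj (Si i)" for x m n
      using that by (simp add: tr_sel(2)[OF i] glue_add[OF i])
    show "r \<odot>\<^bsub>Sect (tr i glue) x\<^esub> m = r \<odot>\<^bsub>Sect (xs i) x\<^esub> m" if x: "x \<in> Obj (Si i)" and r: "r \<in> Sec (Ri i) x" for x m r
    proof -
      obtain t where t: "t \<in> Sec R (FOb (Jm i) x)" "r = rb i x t" by (rule rb_surj[OF i x r])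
      show ?thesis unfolding t(2) tr_smult[OF i x t(1)] glue_smult[OF i x t(1)] ..
    qed
  qed
  then show ?thesis using M xs_module[OF i] by (simp add: Mod_Hom)
qed

lemma gc_iso:
  assumes i: "i \<in> Obj I"
  shows "is_isomorphism (Mod (Si i) (Ri i)) (tr i glue, xs i, gc i)"
proof (rule Mod_iso_iff[OF Si_category[OF i] gc_Hom[OF i], THEN iffD2], rule ballI)
  fix z assume z: "z \<in> Obj (Si i)"
  show "bij_betw (gc i z) (Sec (tr i glue) z) (Sec (xs i) z)"
    using z by (auto simp: bij_betw_def inj_on_def gc_def image_def tr_glue_Sec[OF i z, symmetric])
qed

text \<open>The components \<open>gc\<close> are identities on sections, so their compatibility with
  the structure isomorphisms says that the canonical map of \<open>glue\<close> is
  \<open>ts\<close>, which is \<open>glue_can\<close>.\<close>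

lemma glue_iso:
  "\<exists>e\<in>Hom (holim (op_cat I) ED) (FOb \<Phi> glue) (xs, th). is_isomorphism (holim (op_cat I) ED) e"
proof
  let ?u = "\<lambda>i\<in>Obj I. (tr i glue, xs i, gc i)"
  show h: "(FOb \<Phi> glue, (xs, th), ?u) \<in> Hom (holim (op_cat I) ED) (FOb \<Phi> glue) (xs, th)"
    unfolding holim_Hom
  proof (intro conjI HOL.refl ballI \<Phi>_Obj[OF glue_module] a_Obj)
    show "?u \<in> (\<Pi>\<^sub>E k\<in>Obj (op_cat I). Hom (CatAt ED k) (fst (FOb \<Phi> glue) k) (fst (xs, th) k))"
      using gc_Hom by (simp add: restrict_PiE_iff ED_sel(1) fst_\<Phi>)
    fix \<phi> assume "\<phi> \<in> Arr (op_cat I)"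
    then obtain i j where \<phi>: "\<phi> \<in> Hom I i j" by (auto simp: Hom_def)
    have ij: "i \<in> Obj I" "j \<in> Obj I" using Hom_objD[OF I \<phi>] by auto
    note h1 = cat_comp[OF Mod_Si[OF ij(1)] canon_Hom[OF \<phi> glue_module] gc_Hom[OF ij(1)]]
      and h2 = cat_comp[OF Mod_Si[OF ij(1)] functor_hom[OF FunAt_functor[OF \<phi>] gc_Hom[OF ij(2)]] th_Hom[OF \<phi>]]
    have "Comp (Mod (Si i) (Ri i)) (tr i glue, xs i, gc i) (pm \<phi> (tr j glue), tr i glue, cmap glue \<phi>) =
       Comp (Mod (Si i) (Ri i)) (th \<phi>) (FAr (FunAt ED \<phi>) (tr j glue, xs j, gc j))"
      unfolding th_eq[OF \<phi>] ED_sel(3)[OF \<phi>] Mod_sel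
    proof (rule Mod_arr_eqI[OF h1[unfolded Mod_sel] h2[unfolded th_eq[OF \<phi>] ED_sel(3)[OF \<phi>] Mod_sel]])
      fix z m assume z: "z \<in> Obj (Si i)" and m': "m \<in> Sec (pm \<phi> (tr j glue)) z"
      note w = Tm_Obj[OF \<phi> z]
      have m: "m \<in> Sec glue (FOb (Jm j) (FOb (Tm \<phi>) z))" using m' sec_pt[OF \<phi> z, of glue] by simp
      have mx: "m \<in> Sec (xs j) (FOb (Tm \<phi>) z)" using m glue_Sec[OF ij(2) w] by simp
      have "cmap glue \<phi> z m = ts \<phi> z m" using canon_map_eq[OF \<phi> z m] glue_can[OF \<phi> z mx] by simp
      moreover have "ts \<phi> z m \<in> Sec (tr i glue) z" using ts_closed[OF \<phi> z mx] tr_glue_Sec[OF ij(1) z] by simp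
      moreover have "m \<in> Sec (tr j glue) (FOb (Tm \<phi>) z)" using mx tr_glue_Sec[OF ij(2) w] by simp
      ultimately show "norm_map (Si i) (pm \<phi> (tr j glue)) (\<lambda>x m. gc i x (cmap glue \<phi> x m)) z m =
        norm_map (Si i) (pm \<phi> (tr j glue)) (\<lambda>x m. ts \<phi> x ((\<lambda>x\<in>Obj (Si i). gc j (FOb (Tm \<phi>) x)) x m)) z m"
        using z w m' by (simp add: gc_def)
    qed
    then show "Comp (CatAt ED (Cod (op_cat I) \<phi>)) (?u (Cod (op_cat I) \<phi>)) (snd (FOb \<Phi> glue) \<phi>) =
       Comp (CatAt ED (Cod (op_cat I) \<phi>)) (snd (xs, th) \<phi>) (FAr (FunAt ED \<phi>) (?u (Dom (op_cat I) \<phi>)))"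
      using HomD[OF \<phi>] ij by (simp add: ED_sel(1) snd_\<Phi>[OF \<phi>])
  qed
  show "is_isomorphism (holim (op_cat I) ED) (FOb \<Phi> glue, (xs, th), ?u)"
    by (rule cat_diagram.holim_isoI[OF ED_diagram h]) (use gc_iso in \<open>simp add: ED_sel(1)\<close>)
qed

end

lemma (in ringed_hocolim) \<Phi>_ff_ess_surj: "ff_ess_surj (Mod SM R) (holim (op_cat I) ED) \<Phi>"
  unfolding ff_ess_surj_def
proof (intro conjI ballI \<Phi>_functor)
  show "bij_betw (FAr \<Phi>) (Hom (Mod SM R) F G) (Hom (holim (op_cat I) ED) (FOb \<Phi> F) (FOb \<Phi> G))"
    if "F \<in> Obj (Mod SM R)" "G \<in> Obj (Mod SM R)" for F G
    by (rule \<Phi>_ff) (use that in simp_all)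
  fix a assume a: "a \<in> Obj (holim (op_cat I) ED)"
  obtain xs th where xt: "a = (xs, th)" by (rule prod.exhaust)
  interpret glueing C I U RI R b xs th by unfold_locales (use a xt in simp)
  show "\<exists>F\<in>Obj (Mod SM R). \<exists>e\<in>Hom (holim (op_cat I) ED) (FOb \<Phi> F) a. is_isomorphism (holim (op_cat I) ED) e"
    unfolding xt by (rule bexI[of _ glue]) (use glue_iso glue_module in simp_all)
qed

section \<open>Quasi-coherence and its invariance under semilinear isomorphisms\<close>

section \<open>Quasi-coherence\<close>

text \<open>Stability of covers in the weak form suited to slices: after base change, some cover has
  members that factor through the given ones, and covers of the members can be composed to some
  cover.\<close>

locale covering_site =
  fixes S :: "('x, 'f) site"
  assumes cat: "is_category S"
    and cover_Hom: "\<And>x c f. x \<in> Obj S \<Longrightarrow> c \<in> Cov S x \<Longrightarrow> f \<in> c \<Longrightarrow> f \<in> Hom S (Dom S f) x"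
    and cover_refine: "\<And>x z c f. c \<in> Cov S x \<Longrightarrow> f \<in> Hom S z x \<Longrightarrow>
        \<exists>e\<in>Cov S z. \<forall>g\<in>e. \<exists>h\<in>c. \<exists>k\<in>Hom S (Dom S g) (Dom S h). Comp S f g = Comp S h k"
    and cover_Comp: "\<And>x c d. x \<in> Obj S \<Longrightarrow> c \<in> Cov S x \<Longrightarrow> (\<And>f. f \<in> c \<Longrightarrow> d f \<in> Cov S (Dom S f)) \<Longrightarrow>
        \<exists>e\<in>Cov S x. \<forall>g\<in>e. \<exists>f\<in>c. \<exists>k\<in>d f. g = Comp S f k"

lemmas covering_siteD = covering_site.cat covering_site.cover_Hom covering_site.cover_refine covering_site.cover_Comp

lemma slice_ArrE':
  assumes "e \<in> Arr (slice C N)" "Cod (slice C N) e = (X, x)" "gpsh_on C N"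
  obtains V v u \<alpha> where "e = ((V, v), (X, x), u, \<alpha>)" "e \<in> Hom (slice C N) (V, v) (X, x)" "V \<in> Obj C" "v \<in> Obj (Val N V)"
     "u \<in> Hom C V X" "\<alpha> \<in> Hom (Val N V) v (FOb (Rst N u) x)"
proof -
  obtain V v Y y where h: "e \<in> Hom (slice C N) (V, v) (Y, y)" by (rule slice_ArrE[OF assms(1)])
  have Y: "Y = X" "y = x" using HomD[OF h] assms(2) by auto
  obtain u \<alpha> where "e = ((V, v), (Y, y), u, \<alpha>)" "V \<in> Obj C" "v \<in> Obj (Val N V)" "Y \<in> Obj C" "y \<in> Obj (Val N Y)"
     "u \<in> Hom C V Y" "\<alpha> \<in> Hom (Val N V) v (FOb (Rst N u) y)" by (rule slice_HomE[OF h])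
  with that h show thesis unfolding Y by blast
qed

text \<open>For base change, the cover is pulled back in \<open>C\<close> and lifted by cartesian
  arrows; the fibres being groupoids, the vertical component of the factorisation can be solved for.
  For composition, the site axiom of \<open>C\<close> is applied to the images.\<close>

lemma slice_covering_site:
  assumes site: "is_site C" and pb: "has_pullbacks C" and on: "gpsh_on C N"
  shows "covering_site (slice C N)"
proof -
  interpret gpsh_on C N by (rule on)
  note Cov_hom = site_cover_Hom[OF site]
  have ax3: "\<forall>X\<in>Obj C. \<forall>c\<in>Cov C X. \<forall>g\<in>Arr C. \<forall>p. Cod C g = X \<and>
        (\<forall>u\<in>c. \<exists>q. is_pullback C u g q (p u)) \<longrightarrow> p ` c \<in> Cov C (Dom C g)" using site unfolding is_site_def by (elim conjE)
  have ax4: "\<forall>X\<in>Obj C. \<forall>c\<in>Cov C X. \<forall>d. (\<forall>u\<in>c. d u \<in> Cov C (Dom C u)) \<longrightarrow>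
        {Comp C u v | u v. u \<in> c \<and> v \<in> d u} \<in> Cov C X" using site unfolding is_site_def by (elim conjE)
  have Cv: "e \<in> Arr S \<and> Cod S e = (X, x)" if "c \<in> Cov S (X, x)" "e \<in> c" for c X x e using that by (simp add: slice_Cov)
  have base: "\<exists>e\<in>Cov S z. \<forall>g\<in>e. \<exists>h\<in>c. \<exists>k\<in>Hom S (Dom S g) (Dom S h). Comp S f g = Comp S h k"
    if c: "c \<in> Cov S xx" and f: "f \<in> Hom S z xx" for xx z f c
  proof -
    obtain X x where xx: "xx = (X, x)" by (rule prod.exhaust)
    obtain Z z' where z: "z = (Z, z')" by (rule prod.exhaust)
    obtain g \<alpha> where a: "f = ((Z, z'), (X, x), g, \<alpha>)" "Z \<in> Obj C" "z' \<in> Obj (Val N Z)" "X \<in> Obj C" "x \<in> Obj (Val N X)"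
       "g \<in> Hom C Z X" "\<alpha> \<in> Hom (Val N Z) z' (FOb (Rst N g) x)" by (rule slice_HomE[OF f[unfolded z xx]])
    define c0 where "c0 = (\<lambda>(s, t, h, \<alpha>). h) ` c"
    have c0: "c0 \<in> Cov C X" using c unfolding xx slice_Cov c0_def by simp
    have "\<forall>u\<in>c0. \<exists>pq. is_pullback C u g (snd pq) (fst pq)"
    proof
      fix u assume "u \<in> c0"
      then have u: "u \<in> Hom C (Dom C u) X" using Cov_hom[OF a(4) c0] by simp
      then have "\<exists>p q. is_pullback C u g p q" using pb HomD[OF u] HomD[OF a(6)] unfolding has_pullbacks_def by simp
      then show "\<exists>pq. is_pullback C u g (snd pq) (fst pq)" by auto
    qed
    then obtain pq where pq: "\<forall>u\<in>c0. is_pullback C u g (snd (pq u)) (fst (pq u))" by (rule bchoice[THEN exE])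
    define p where "p u = fst (pq u)" for u
    define q where "q u = snd (pq u)" for u
    have pb': "p u \<in> Hom C (Dom C (p u)) Z \<and> q u \<in> Hom C (Dom C (p u)) (Dom C u) \<and> Comp C u (q u) = Comp C g (p u)" if "u \<in> c0" for u
    proof -
      have u: "is_pullback C u g (q u) (p u)" using pq that by (simp add: p_def q_def)
      then have 1: "q u \<in> Hom C (Dom C (q u)) (Dom C u)" "p u \<in> Hom C (Dom C (q u)) (Dom C g)" "Comp C u (q u) = Comp C g (p u)"
        unfolding is_pullback_def by auto
      then show ?thesis using HomD[OF 1(2)] HomD[OF a(6)] by simp
    qed
    have "p ` c0 \<in> Cov C (Dom C g)"
      by (rule ax3[rule_format, OF a(4) c0]) (use HomD[OF a(6)] pq in \<open>auto simp: p_def\<close>)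
    then have pc: "p ` c0 \<in> Cov C Z" using HomD[OF a(6)] by simp
    \<comment> \<open>The pulled back cover of \<open>C\<close>, lifted by cartesian arrows with
      target \<open>z\<close>.\<close>
    let ?e = "(\<lambda>u. cart C N (p u) z') ` c0"
    have ch: "cart C N (p u) z' \<in> Hom S (Dom C (p u), FOb (Rst N (p u)) z') (Z, z')" if "u \<in> c0" for u
      using cart_Hom[OF conjunct1[OF pb'[OF that]] a(3)] .
    have "(\<lambda>(s, t, h, \<alpha>). h) ` ?e = p ` c0" by (force simp: cart_def)
    then have e: "?e \<in> Cov S z" unfolding z slice_Cov using pc HomD[OF ch] by auto
    moreover have "\<exists>h\<in>c. \<exists>k\<in>Hom S (Dom S w) (Dom S h). Comp S f w = Comp S h k" if "w \<in> ?e" for w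
    proof -
      from that obtain u where u: "u \<in> c0" "w = cart C N (p u) z'" by blast
      from u(1) obtain h where h: "h \<in> c" "u = (\<lambda>(s, t, h, \<alpha>). h) h" unfolding c0_def by blast
      note hc = Cv[OF c[unfolded xx] h(1)]
      obtain V v u' \<beta> where hh: "h = ((V, v), (X, x), u', \<beta>)" "h \<in> Hom S (V, v) (X, x)" "V \<in> Obj C" "v \<in> Obj (Val N V)"
         "u' \<in> Hom C V X" "\<beta> \<in> Hom (Val N V) v (FOb (Rst N u') x)" by (rule slice_ArrE'[OF conjunct1[OF hc] conjunct2[OF hc] on])
      have uu: "u' = u" using h(2) hh(1) by simp
      note hh = hh[unfolded uu]
      have V: "Dom C u = V" using HomD[OF hh(5)] by simp
      let ?T = "Dom C (p u)"
      have pu: "p u \<in> Hom C ?T Z" and qu: "q u \<in> Hom C ?T V" and eq: "Comp C u (q u) = Comp C g (p u)" using pb'[OF u(1)] V by auto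
      have T: "?T \<in> Obj C" using Hom_objD[OF C pu] by simp
      note Rp = functor_hom[OF R_functor[OF pu] a(7)] and Rq = functor_hom[OF R_functor[OF qu] hh(6)]
      have same: "FOb (Rst N (p u)) (FOb (Rst N g) x) = FOb (Rst N (q u)) (FOb (Rst N u) x)"
        using R_comp_ob[OF pu a(6,5)] R_comp_ob[OF qu hh(5) a(5)] eq by simp
      \<comment> \<open>The square commutes in \<open>C\<close> only. Inverting the restricted
        \<open>\<beta>\<close> in the fibre corrects the vertical discrepancy between
        \<open>f\<close> and the member \<open>h\<close> of the cover.\<close>
      obtain \<gamma> where g: "\<gamma> \<in> Hom (Val N ?T) (FOb (Rst N (q u)) (FOb (Rst N u) x)) (FOb (Rst N (q u)) v)"
        "Comp (Val N ?T) (FAr (Rst N (q u)) \<beta>) \<gamma> = Ident (Val N ?T) (FOb (Rst N (q u)) (FOb (Rst N u) x))"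
        using groupoid_inverse[OF V_groupoid[OF T] Rq] by metis
      note VT = V_category[OF T]
      have Rp': "FAr (Rst N (p u)) \<alpha> \<in> Hom (Val N ?T) (FOb (Rst N (p u)) z') (FOb (Rst N (q u)) (FOb (Rst N u) x))" using Rp same by simp
      define \<delta> where "\<delta> = Comp (Val N ?T) \<gamma> (FAr (Rst N (p u)) \<alpha>)"
      have d: "\<delta> \<in> Hom (Val N ?T) (FOb (Rst N (p u)) z') (FOb (Rst N (q u)) v)" unfolding \<delta>_def by (rule cat_comp[OF VT Rp' g(1)])
      let ?k = "((?T, FOb (Rst N (p u)) z'), (V, v), q u, \<delta>)"
      have k: "?k \<in> Hom S (?T, FOb (Rst N (p u)) z') (V, v)"
        unfolding slice_Hom using T R_ob[OF pu a(3)] hh(3,4) qu d by simp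
      have "Comp (Val N ?T) (FAr (Rst N (q u)) \<beta>) \<delta> = FAr (Rst N (p u)) \<alpha>"
        unfolding \<delta>_def using cat_assoc[OF VT Rp' g(1) Rq] g(2) cat_unit_left[OF VT Rp'] by simp
      then have "Comp S f w = Comp S h ?k"
        unfolding u(2) a(1) hh(1) cart_def slice_sel using eq cat_unit_right[OF VT Rp] by simp
      moreover have "Dom S w = (?T, FOb (Rst N (p u)) z')" "Dom S h = (V, v)" using HomD[OF ch[OF u(1)]] HomD[OF hh(2)] u(2) by auto
      ultimately show ?thesis using k h(1) by metis
    qed
    ultimately show ?thesis by blast
  qed
  have comp: "\<exists>e\<in>Cov S xx. \<forall>g\<in>e. \<exists>f\<in>c. \<exists>k\<in>d f. g = Comp S f k"
    if xx: "xx \<in> Obj S" and c: "c \<in> Cov S xx" and d: "\<And>f. f \<in> c \<Longrightarrow> d f \<in> Cov S (Dom S f)" for xx c d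
  proof -
    obtain X x where xx': "xx = (X, x)" "X \<in> Obj C" using xx by (auto simp: slice_sel)
    let ?h = "\<lambda>(s, t, h, \<alpha>). h"
    have c0: "?h ` c \<in> Cov C X" using c unfolding xx' slice_Cov by simp
    \<comment> \<open>The site axiom takes one cover for each arrow of \<open>C\<close>, whereas
      several members of \<open>c\<close> may lie over the same arrow; one of them is
      selected.\<close>
    define se where "se = inv_into c ?h"
    have se: "se u \<in> c" "?h (se u) = u" if "u \<in> ?h ` c" for u
      using inv_into_into[OF that] f_inv_into_f[OF that] by (simp_all add: se_def)
    have co: "g \<in> Hom S (Dom S g) (Dom S f) \<and> ?h (Comp S f g) = Comp C (?h f) (?h g) \<and> f \<in> Hom S (Dom S f) xx \<and> fst (Dom S f) = Dom C (?h f)"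
      if fg: "f \<in> c" "g \<in> d f" for f g
    proof -
      note fc = Cv[OF c[unfolded xx'] fg(1)]
      obtain V v u \<alpha> where f: "f = ((V, v), (X, x), u, \<alpha>)" "f \<in> Hom S (V, v) (X, x)" "V \<in> Obj C" "v \<in> Obj (Val N V)" "u \<in> Hom C V X"
        "\<alpha> \<in> Hom (Val N V) v (FOb (Rst N u) x)" by (rule slice_ArrE'[OF conjunct1[OF fc] conjunct2[OF fc] on])
      have df: "d f \<in> Cov S (V, v)" using d fg(1) HomD[OF f(2)] by metis
      note gc = Cv[OF df fg(2)]
      obtain W w k \<beta> where g: "g = ((W, w), (V, v), k, \<beta>)" "g \<in> Hom S (W, w) (V, v)" "W \<in> Obj C" "w \<in> Obj (Val N W)" "k \<in> Hom C W V"
        "\<beta> \<in> Hom (Val N W) w (FOb (Rst N k) v)" by (rule slice_ArrE'[OF conjunct1[OF gc] conjunct2[OF gc] on])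
      show ?thesis using HomD[OF f(2)] HomD[OF g(2)] f(2) g(2) HomD[OF f(5)] by (simp add: xx' f(1) g(1) slice_sel)
    qed
    define e where "e = {Comp S (se u) k | u k. u \<in> ?h ` c \<and> k \<in> d (se u)}"
    have du: "?h ` d (se u) \<in> Cov C (Dom C u)" if u: "u \<in> ?h ` c" for u
    proof -
      note fc = Cv[OF c[unfolded xx'] se(1)[OF u]]
      obtain V v u' \<alpha> where f: "se u = ((V, v), (X, x), u', \<alpha>)" "se u \<in> Hom S (V, v) (X, x)" "V \<in> Obj C" "v \<in> Obj (Val N V)" "u' \<in> Hom C V X"
        "\<alpha> \<in> Hom (Val N V) v (FOb (Rst N u') x)" by (rule slice_ArrE'[OF conjunct1[OF fc] conjunct2[OF fc] on])
      have "u' = u" using se(2)[OF u] f(1) by simp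
      then have "Dom C u = V" using HomD[OF f(5)] by simp
      moreover have "d (se u) \<in> Cov S (V, v)" using d se(1)[OF u] HomD[OF f(2)] by metis
      ultimately show ?thesis by (simp add: slice_Cov)
    qed
    have "?h ` e = {Comp C u v | u v. u \<in> ?h ` c \<and> v \<in> ?h ` d (se u)}"
    proof (intro Set.set_eqI iffI)
      fix y assume "y \<in> ?h ` e"
      then obtain u k where uk: "u \<in> ?h ` c" "k \<in> d (se u)" "y = ?h (Comp S (se u) k)" unfolding e_def by blast
      have "y = Comp C u (?h k)" using co[OF se(1)[OF uk(1)] uk(2)] uk(3) se(2)[OF uk(1)] by simp
      then show "y \<in> {Comp C u v | u v. u \<in> ?h ` c \<and> v \<in> ?h ` d (se u)}" using uk by blast
    next
      fix y assume "y \<in> {Comp C u v | u v. u \<in> ?h ` c \<and> v \<in> ?h ` d (se u)}"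
      then obtain u k where uk: "u \<in> ?h ` c" "k \<in> d (se u)" "y = Comp C u (?h k)" by blast
      have "y = ?h (Comp S (se u) k)" using co[OF se(1)[OF uk(1)] uk(2)] uk(3) se(2)[OF uk(1)] by simp
      then show "y \<in> ?h ` e" using uk unfolding e_def by blast
    qed
    moreover have "{Comp C u v | u v. u \<in> ?h ` c \<and> v \<in> ?h ` d (se u)} \<in> Cov C X"
      by (rule mp[OF ax4[THEN bspec, OF xx'(2), THEN bspec, OF c0, THEN spec]]) (use du in blast)
    moreover have "g \<in> Arr S \<and> Cod S g = xx" if "g \<in> e" for g
    proof -
      from that obtain u k where uk: "u \<in> ?h ` c" "k \<in> d (se u)" "g = Comp S (se u) k" unfolding e_def by blast
      note cc = co[OF se(1)[OF uk(1)] uk(2)]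
      show ?thesis using HomD[OF cat_comp[OF slice_category conjunct1[OF cc]]] cc uk(3) by blast
    qed
    ultimately have "e \<in> Cov S xx" unfolding xx' slice_Cov by simp
    moreover have "\<exists>f\<in>c. \<exists>k\<in>d f. g = Comp S f k" if "g \<in> e" for g using that se(1) unfolding e_def by blast
    ultimately show ?thesis by blast
  qed
  have hom: "f \<in> Hom S (Dom S f) xx" if "xx \<in> Obj S" "c \<in> Cov S xx" "f \<in> c" for xx c f
    using that Cv by (cases xx) (auto simp: Hom_def)
  show ?thesis by (rule covering_site.intro[OF slice_category hom base comp])
qed

subsection \<open>Free sheaves\<close>

lemma free_sheaf_sel:
  "x \<in> Obj S \<Longrightarrow> Sec (free_sheaf S R A) x = {s \<in> A \<rightarrow>\<^sub>E Sec R x. \<exists>c\<in>Cov S x. \<forall>f\<in>c.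
                    finite {a \<in> A. Restr R f (s a) \<noteq> \<zero>\<^bsub>Sect R (Dom S f)\<^esub>}}"
  "x \<in> Obj S \<Longrightarrow> add (Sect (free_sheaf S R A) x) = (\<lambda>s t. \<lambda>a\<in>A. s a \<oplus>\<^bsub>Sect R x\<^esub> t a)"
  "x \<in> Obj S \<Longrightarrow> r \<in> Sec R x \<Longrightarrow> smult (Sect (free_sheaf S R A) x) r = (\<lambda>s. \<lambda>a\<in>A. r \<otimes>\<^bsub>Sect R x\<^esub> s a)"
  "f \<in> Arr S \<Longrightarrow> Restr (free_sheaf S R A) f = (\<lambda>s. \<lambda>a\<in>A. Restr R f (s a))"
  by (simp_all add: free_sheaf_def)

text \<open>The closure properties asked of the target terms when an exact sequence is transferred
  along semilinear isomorphisms.\<close>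

definition closed_sheaf :: "('x, 'f) site \<Rightarrow> ('x, 'f, 'r) rsheaf \<Rightarrow> ('x, 'f, 'r, 'm) msheaf \<Rightarrow> bool" where
  "closed_sheaf S R F \<longleftrightarrow> (\<forall>x\<in>Obj S. \<forall>m\<in>Sec F x. (\<forall>n\<in>Sec F x. m \<oplus>\<^bsub>Sect F x\<^esub> n \<in> Sec F x) \<and> (\<forall>r\<in>Sec R x. r \<odot>\<^bsub>Sect F x\<^esub> m \<in> Sec F x)) \<and>
     (\<forall>z w f. f \<in> Hom S z w \<longrightarrow> (\<forall>m\<in>Sec F w. Restr F f m \<in> Sec F z))"

lemma closed_sheafD:
  assumes "closed_sheaf S R F"
  shows "x \<in> Obj S \<Longrightarrow> m \<in> Sec F x \<Longrightarrow> n \<in> Sec F x \<Longrightarrow> m \<oplus>\<^bsub>Sect F x\<^esub> n \<in> Sec F x"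
    "x \<in> Obj S \<Longrightarrow> m \<in> Sec F x \<Longrightarrow> r \<in> Sec R x \<Longrightarrow> r \<odot>\<^bsub>Sect F x\<^esub> m \<in> Sec F x"
    "f \<in> Hom S z w \<Longrightarrow> m \<in> Sec F w \<Longrightarrow> Restr F f m \<in> Sec F z"
  using assms unfolding closed_sheaf_def by auto

lemma ring_sheafD:
  assumes "is_ring_sheaf S R"
  shows "is_presheaf S R" "x \<in> Obj S \<Longrightarrow> ring (Sect R x)"
    "f \<in> Hom S z w \<Longrightarrow> Restr R f \<in> ring_hom (Sect R w) (Sect R z)"
  using assms by (auto simp: is_ring_sheaf_def is_sheaf_def Hom_def)

text \<open>Local finiteness of the support has to be kept. Scalar multiplication does not enlarge
  the support, a sum needs a common refinement of two covers, and restriction needs a cover of the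
  source that factors through the given one.\<close>

lemma free_sheaf_closed:
  assumes S: "covering_site S" and R: "is_ring_sheaf S R"
  shows "closed_sheaf S R (free_sheaf S R A)"
proof -
  note SC = covering_siteD(1)[OF S] and P = ring_sheafD(1)[OF R]
  let ?sup = "\<lambda>x s f. {a \<in> A. Restr R f (s a) \<noteq> \<zero>\<^bsub>Sect R (Dom S f)\<^esub>}"
  \<comment> \<open>Supports can only shrink under restriction, since restriction maps send zero to
    zero.\<close>
  have sub: "?sup x s (Comp S f k) \<subseteq> ?sup x s f"
    if "f \<in> Hom S y x" "k \<in> Hom S w y" "s \<in> A \<rightarrow>\<^sub>E Sec R x" for f k w y x s
  proof
    fix a assume a: "a \<in> ?sup x s (Comp S f k)"
    have sa: "s a \<in> Sec R x" using a that(3) by auto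
    have o: "y \<in> Obj S" "w \<in> Obj S" using Hom_objD[OF SC that(2)] by auto
    have "Restr R k \<zero>\<^bsub>Sect R y\<^esub> = \<zero>\<^bsub>Sect R w\<^esub>"
      by (rule ring_hom_zero[OF ring_sheafD(3)[OF R that(2)] ring_sheafD(2)[OF R o(1)] ring_sheafD(2)[OF R o(2)]])
    then show "a \<in> ?sup x s f"
      using a psh_Restr_Comp[OF P that(2,1) sa] HomD[OF that(1)] HomD[OF that(2)] HomD[OF cat_comp[OF SC that(2,1)]] by auto
  qed
  \<comment> \<open>A common refinement: \<open>d\<close> is pulled back to each member of
    \<open>c\<close>, and the resulting covers are composed with \<open>c\<close>.\<close>
  have cr: "\<exists>e\<in>Cov S x. \<forall>g\<in>e. (\<exists>f\<in>c. \<exists>k\<in>Hom S (Dom S g) (Dom S f). g = Comp S f k) \<and> (\<exists>f\<in>d. \<exists>k\<in>Hom S (Dom S g) (Dom S f). g = Comp S f k)"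
    if x: "x \<in> Obj S" and c: "c \<in> Cov S x" and d: "d \<in> Cov S x" for x c d
  proof -
    note ch = covering_siteD(2)[OF S x c]
    have "\<forall>f\<in>c. \<exists>e. e \<in> Cov S (Dom S f) \<and> (\<forall>g\<in>e. \<exists>h\<in>d. \<exists>k\<in>Hom S (Dom S g) (Dom S h). Comp S f g = Comp S h k)"
      using covering_siteD(3)[OF S d ch] by blast
    then obtain E where E: "\<forall>f\<in>c. E f \<in> Cov S (Dom S f) \<and> (\<forall>g\<in>E f. \<exists>h\<in>d. \<exists>k\<in>Hom S (Dom S g) (Dom S h). Comp S f g = Comp S h k)"
      by (rule bchoice[THEN exE])
    obtain e where e: "e \<in> Cov S x" "\<forall>g\<in>e. \<exists>f\<in>c. \<exists>k\<in>E f. g = Comp S f k"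
      using covering_siteD(4)[OF S x c, of E] E by blast
    have "(\<exists>f\<in>c. \<exists>k\<in>Hom S (Dom S g) (Dom S f). g = Comp S f k) \<and> (\<exists>f\<in>d. \<exists>k\<in>Hom S (Dom S g) (Dom S f). g = Comp S f k)" if "g \<in> e" for g
    proof -
      obtain f k where fk: "f \<in> c" "k \<in> E f" "g = Comp S f k" using e(2) \<open>g \<in> e\<close> by blast
      have fo: "Dom S f \<in> Obj S" using Hom_objD[OF SC ch[OF fk(1)]] by simp
      have Ef: "E f \<in> Cov S (Dom S f)" using E fk(1) by simp
      have k: "k \<in> Hom S (Dom S k) (Dom S f)" by (rule covering_siteD(2)[OF S fo Ef fk(2)])
      have Dg: "Dom S g = Dom S k" using HomD[OF cat_comp[OF SC k ch[OF fk(1)]]] fk(3) by simp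
      obtain h l where hl: "h \<in> d" "l \<in> Hom S (Dom S k) (Dom S h)" "Comp S f k = Comp S h l" using E fk(1,2) by blast
      show ?thesis using fk k hl unfolding Dg by blast
    qed
    then show ?thesis using e(1) by blast
  qed
  show ?thesis unfolding closed_sheaf_def
  proof (intro conjI ballI allI impI)
    fix x s assume x: "x \<in> Obj S" and s: "s \<in> Sec (free_sheaf S R A) x"
    interpret Rx: ring "Sect R x" by (rule ring_sheafD(2)[OF R x])
    have s1: "s \<in> A \<rightarrow>\<^sub>E Sec R x" using s x by (simp add: free_sheaf_sel)
    obtain c where c: "c \<in> Cov S x" "\<forall>f\<in>c. finite (?sup x s f)" using s x by (auto simp: free_sheaf_sel)
    note ch = covering_siteD(2)[OF S x c(1)]
    show "r \<odot>\<^bsub>Sect (free_sheaf S R A) x\<^esub> s \<in> Sec (free_sheaf S R A) x" if r: "r \<in> Sec R x" for r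
    proof -
      have "finite (?sup x (\<lambda>a\<in>A. r \<otimes>\<^bsub>Sect R x\<^esub> s a) f)" if f: "f \<in> c" for f
      proof (rule finite_subset)
        have o: "Dom S f \<in> Obj S" using Hom_objD[OF SC ch[OF f]] by simp
        interpret Rf: ring "Sect R (Dom S f)" by (rule ring_sheafD(2)[OF R o])
        note hf = ring_sheafD(3)[OF R ch[OF f]]
        show "?sup x (\<lambda>a\<in>A. r \<otimes>\<^bsub>Sect R x\<^esub> s a) f \<subseteq> ?sup x s f"
        proof
          fix a assume a: "a \<in> ?sup x (\<lambda>a\<in>A. r \<otimes>\<^bsub>Sect R x\<^esub> s a) f"
          then have aA: "a \<in> A" by simp
          have "Restr R f (r \<otimes>\<^bsub>Sect R x\<^esub> s a) = Restr R f r \<otimes>\<^bsub>Sect R (Dom S f)\<^esub> Restr R f (s a)"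
            by (rule ring_hom_mult[OF hf r PiE_mem[OF s1 aA]])
          then show "a \<in> ?sup x s f" using a aA Rf.r_null[OF ring_hom_closed[OF hf r]] by auto
        qed
        show "finite (?sup x s f)" using c(2) f by simp
      qed
      moreover have "(\<lambda>a\<in>A. r \<otimes>\<^bsub>Sect R x\<^esub> s a) \<in> A \<rightarrow>\<^sub>E Sec R x"
        by (rule restrict_PiE_iff[THEN iffD2]) (intro ballI Rx.m_closed r PiE_mem[OF s1])
      ultimately show ?thesis unfolding free_sheaf_sel(1)[OF x] free_sheaf_sel(3)[OF x r] using c(1) by blast
    qed
    show "s \<oplus>\<^bsub>Sect (free_sheaf S R A) x\<^esub> t \<in> Sec (free_sheaf S R A) x" if t: "t \<in> Sec (free_sheaf S R A) x" for t
    proof -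
      have t1: "t \<in> A \<rightarrow>\<^sub>E Sec R x" using t x by (simp add: free_sheaf_sel)
      obtain d where d: "d \<in> Cov S x" "\<forall>f\<in>d. finite (?sup x t f)" using t x by (auto simp: free_sheaf_sel)
      note dh = covering_siteD(2)[OF S x d(1)]
      obtain e where e: "e \<in> Cov S x" "\<And>g. g \<in> e \<Longrightarrow> (\<exists>f\<in>c. \<exists>k\<in>Hom S (Dom S g) (Dom S f). g = Comp S f k) \<and> (\<exists>f\<in>d. \<exists>k\<in>Hom S (Dom S g) (Dom S f). g = Comp S f k)"
        using cr[OF x c(1) d(1)] by blast
      note eh = covering_siteD(2)[OF S x e(1)]
      have "finite (?sup x (\<lambda>a\<in>A. s a \<oplus>\<^bsub>Sect R x\<^esub> t a) g)" if g: "g \<in> e" for g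
      proof (rule finite_subset)
        have o: "Dom S g \<in> Obj S" using Hom_objD[OF SC eh[OF g]] by simp
        interpret Rf: ring "Sect R (Dom S g)" by (rule ring_sheafD(2)[OF R o])
        note hf = ring_sheafD(3)[OF R eh[OF g]]
        show "?sup x (\<lambda>a\<in>A. s a \<oplus>\<^bsub>Sect R x\<^esub> t a) g \<subseteq> ?sup x s g \<union> ?sup x t g"
        proof
          fix a assume a: "a \<in> ?sup x (\<lambda>a\<in>A. s a \<oplus>\<^bsub>Sect R x\<^esub> t a) g"
          then have aA: "a \<in> A" by simp
          have "Restr R g (s a \<oplus>\<^bsub>Sect R x\<^esub> t a) = Restr R g (s a) \<oplus>\<^bsub>Sect R (Dom S g)\<^esub> Restr R g (t a)"
            by (rule ring_hom_add[OF hf PiE_mem[OF s1 aA] PiE_mem[OF t1 aA]])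
          then show "a \<in> ?sup x s g \<union> ?sup x t g" using a aA by auto
        qed
        obtain f k where fk: "f \<in> c" "k \<in> Hom S (Dom S g) (Dom S f)" "g = Comp S f k" using e(2)[OF g] by blast
        obtain f' k' where fk': "f' \<in> d" "k' \<in> Hom S (Dom S g) (Dom S f')" "g = Comp S f' k'" using e(2)[OF g] by blast
        have "finite (?sup x s g)" using sub[OF ch[OF fk(1)] fk(2) s1] c(2) fk(1) unfolding fk(3)[symmetric] by (blast intro: finite_subset)
        moreover have "finite (?sup x t g)" using sub[OF dh[OF fk'(1)] fk'(2) t1] d(2) fk'(1) unfolding fk'(3)[symmetric] by (blast intro: finite_subset)
        ultimately show "finite (?sup x s g \<union> ?sup x t g)" by simp
      qed
      moreover have "(\<lambda>a\<in>A. s a \<oplus>\<^bsub>Sect R x\<^esub> t a) \<in> A \<rightarrow>\<^sub>E Sec R x"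
        by (rule restrict_PiE_iff[THEN iffD2]) (intro ballI Rx.a_closed PiE_mem[OF s1] PiE_mem[OF t1])
      ultimately show ?thesis unfolding free_sheaf_sel(1,2)[OF x] using e(1) by blast
    qed
  next
    fix z w f s assume f: "f \<in> Hom S z w" and s: "s \<in> Sec (free_sheaf S R A) w"
    have o: "z \<in> Obj S" "w \<in> Obj S" using Hom_objD[OF SC f] by auto
    have s1: "s \<in> A \<rightarrow>\<^sub>E Sec R w" using s o by (simp add: free_sheaf_sel)
    obtain c where c: "c \<in> Cov S w" "\<forall>f\<in>c. finite (?sup w s f)" using s o by (auto simp: free_sheaf_sel)
    note ch = covering_siteD(2)[OF S o(2) c(1)]
    obtain e where e: "e \<in> Cov S z" "\<And>g. g \<in> e \<Longrightarrow> \<exists>h\<in>c. \<exists>k\<in>Hom S (Dom S g) (Dom S h). Comp S f g = Comp S h k"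
      using covering_siteD(3)[OF S c(1) f] by blast
    note eh = covering_siteD(2)[OF S o(1) e(1)]
    have "finite (?sup z (\<lambda>a\<in>A. Restr R f (s a)) g)" if g: "g \<in> e" for g
    proof -
      obtain h k where hk: "h \<in> c" "k \<in> Hom S (Dom S g) (Dom S h)" "Comp S f g = Comp S h k" using e(2)[OF g] by blast
      have D: "Dom S (Comp S h k) = Dom S g" using HomD[OF cat_comp[OF SC hk(2) ch[OF hk(1)]]] by simp
      have "Restr R g (Restr R f (s a)) = Restr R (Comp S h k) (s a)" if "a \<in> A" for a
        using psh_Restr_Comp[OF P eh[OF g] f PiE_mem[OF s1 that]] hk(3) by simp
      then have "?sup z (\<lambda>a\<in>A. Restr R f (s a)) g \<subseteq> ?sup w s h" using sub[OF ch[OF hk(1)] hk(2) s1] D by auto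
      moreover have "finite (?sup w s h)" using c(2) hk(1) by simp
      ultimately show ?thesis by (rule finite_subset)
    qed
    moreover have "(\<lambda>a\<in>A. Restr R f (s a)) \<in> A \<rightarrow>\<^sub>E Sec R z"
      by (rule restrict_PiE_iff[THEN iffD2]) (intro ballI psh_Restr_closed[OF P f] PiE_mem[OF s1])
    moreover have r: "Restr (free_sheaf S R A) f s = (\<lambda>a\<in>A. Restr R f (s a))" using HomD[OF f] by (simp add: free_sheaf_sel)
    ultimately show "Restr (free_sheaf S R A) f s \<in> Sec (free_sheaf S R A) z"
      unfolding r free_sheaf_sel(1)[OF o(1)] using e(1) by blast
  qed
qed

subsection \<open>Semilinear isomorphisms\<close>

definition slin_hom ::
  "('x, 'f) site \<Rightarrow> ('x, 'f, 'r) rsheaf \<Rightarrow> ('x \<Rightarrow> 'r \<Rightarrow> 'r) \<Rightarrow> ('x, 'f, 'r, 'm) msheaf \<Rightarrow> ('x, 'f, 'r, 'n) msheaf \<Rightarrow>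
   ('x \<Rightarrow> 'm \<Rightarrow> 'n) \<Rightarrow> bool" where
  "slin_hom S R \<sigma> F F' \<tau> \<longleftrightarrow>
     (\<forall>x\<in>Obj S. \<forall>m\<in>Sec F x. \<tau> x m \<in> Sec F' x \<and>
        (\<forall>n\<in>Sec F x. \<tau> x (m \<oplus>\<^bsub>Sect F x\<^esub> n) = \<tau> x m \<oplus>\<^bsub>Sect F' x\<^esub> \<tau> x n) \<and>
        (\<forall>r\<in>Sec R x. \<tau> x (r \<odot>\<^bsub>Sect F x\<^esub> m) = \<sigma> x r \<odot>\<^bsub>Sect F' x\<^esub> \<tau> x m)) \<and>
     (\<forall>z w f. f \<in> Hom S z w \<longrightarrow> (\<forall>m\<in>Sec F w. \<tau> z (Restr F f m) = Restr F' f (\<tau> w m)))"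

lemma slin_homD:
  assumes "slin_hom S R \<sigma> F F' \<tau>"
  shows "x \<in> Obj S \<Longrightarrow> m \<in> Sec F x \<Longrightarrow> \<tau> x m \<in> Sec F' x"
    "x \<in> Obj S \<Longrightarrow> m \<in> Sec F x \<Longrightarrow> n \<in> Sec F x \<Longrightarrow> \<tau> x (m \<oplus>\<^bsub>Sect F x\<^esub> n) = \<tau> x m \<oplus>\<^bsub>Sect F' x\<^esub> \<tau> x n"
    "x \<in> Obj S \<Longrightarrow> m \<in> Sec F x \<Longrightarrow> r \<in> Sec R x \<Longrightarrow> \<tau> x (r \<odot>\<^bsub>Sect F x\<^esub> m) = \<sigma> x r \<odot>\<^bsub>Sect F' x\<^esub> \<tau> x m"
    "f \<in> Hom S z w \<Longrightarrow> m \<in> Sec F w \<Longrightarrow> \<tau> z (Restr F f m) = Restr F' f (\<tau> w m)"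
  using assms unfolding slin_hom_def by auto

definition slin_iso where
  "slin_iso S R R' \<sigma> \<sigma>' F F' \<tau> \<tau>' \<longleftrightarrow> slin_hom S R \<sigma> F F' \<tau> \<and> slin_hom S R' \<sigma>' F' F \<tau>' \<and>
     (\<forall>x\<in>Obj S. (\<forall>m\<in>Sec F x. \<tau>' x (\<tau> x m) = m) \<and> (\<forall>m\<in>Sec F' x. \<tau> x (\<tau>' x m) = m))"

lemma slin_isoD:
  assumes "slin_iso S R R' \<sigma> \<sigma>' F F' \<tau> \<tau>'"
  shows "slin_hom S R \<sigma> F F' \<tau>" "slin_hom S R' \<sigma>' F' F \<tau>'"
    "x \<in> Obj S \<Longrightarrow> m \<in> Sec F x \<Longrightarrow> \<tau>' x (\<tau> x m) = m" "x \<in> Obj S \<Longrightarrow> n \<in> Sec F' x \<Longrightarrow> \<tau> x (\<tau>' x n) = n"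
  using assms unfolding slin_iso_def by auto

text \<open>Both directions are recorded, so that symmetry and stability under pullback can be read
  off the definition.\<close>

definition ring_iso_pair ::
  "('x, 'f) site \<Rightarrow> ('x, 'f, 'r) rsheaf \<Rightarrow> ('x, 'f, 'r) rsheaf \<Rightarrow> ('x \<Rightarrow> 'r \<Rightarrow> 'r) \<Rightarrow> ('x \<Rightarrow> 'r \<Rightarrow> 'r) \<Rightarrow> bool" where
  "ring_iso_pair S R R' \<sigma> \<sigma>' \<longleftrightarrow> is_ring_sheaf S R \<and> is_ring_sheaf S R' \<and>
     (\<forall>x\<in>Obj S. \<sigma> x \<in> ring_hom (Sect R x) (Sect R' x) \<and> \<sigma>' x \<in> ring_hom (Sect R' x) (Sect R x) \<and>
        (\<forall>r\<in>Sec R x. \<sigma>' x (\<sigma> x r) = r) \<and> (\<forall>r\<in>Sec R' x. \<sigma> x (\<sigma>' x r) = r)) \<and>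
     (\<forall>z w f. f \<in> Hom S z w \<longrightarrow> (\<forall>r\<in>Sec R w. \<sigma> z (Restr R f r) = Restr R' f (\<sigma> w r)) \<and>
        (\<forall>r\<in>Sec R' w. \<sigma>' z (Restr R' f r) = Restr R f (\<sigma>' w r)))"

lemma ring_iso_pairD:
  assumes "ring_iso_pair S R R' \<sigma> \<sigma>'"
  shows "is_ring_sheaf S R" "is_ring_sheaf S R'"
    "x \<in> Obj S \<Longrightarrow> \<sigma> x \<in> ring_hom (Sect R x) (Sect R' x)"
    "x \<in> Obj S \<Longrightarrow> r \<in> Sec R x \<Longrightarrow> \<sigma>' x (\<sigma> x r) = r" "x \<in> Obj S \<Longrightarrow> r' \<in> Sec R' x \<Longrightarrow> \<sigma> x (\<sigma>' x r') = r'"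
    "f \<in> Hom S z w \<Longrightarrow> s \<in> Sec R w \<Longrightarrow> \<sigma> z (Restr R f s) = Restr R' f (\<sigma> w s)"
  using assms unfolding ring_iso_pair_def by auto

lemma ring_iso_pair_sym: "ring_iso_pair S R R' \<sigma> \<sigma>' \<Longrightarrow> ring_iso_pair S R' R \<sigma>' \<sigma>"
  unfolding ring_iso_pair_def by auto

lemma ring_iso_pair_refl: "is_ring_sheaf S R \<Longrightarrow> ring_iso_pair S R R (\<lambda>x r. r) (\<lambda>x r. r)"
  unfolding ring_iso_pair_def by (auto simp: ring_hom_def)

lemma slin_iso_sym: "slin_iso S R R' \<sigma> \<sigma>' F F' \<tau> \<tau>' \<Longrightarrow> slin_iso S R' R \<sigma>' \<sigma> F' F \<tau>' \<tau>"
  unfolding slin_iso_def by auto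

lemma ring_sheaf_iso_pair:
  assumes S: "is_category S" and \<alpha>: "ring_sheaf_iso S R R' \<alpha>"
  shows "ring_iso_pair S R R' \<alpha> (\<lambda>x. inv_into (Sec R x) (\<alpha> x))"
  unfolding ring_iso_pair_def
proof (intro conjI ballI allI impI)
  note D = ring_sheaf_isoD[OF \<alpha>]
  show "is_ring_sheaf S R" "is_ring_sheaf S R'" by (rule D)+
  have i1: "inv_into (Sec R x) (\<alpha> x) (\<alpha> x r) = r" if "x \<in> Obj S" "r \<in> Sec R x" for x r
    by (rule inv_into_f_f[OF bij_betw_imp_inj_on[OF D(4)[OF that(1)]] that(2)])
  have i2: "\<alpha> x (inv_into (Sec R x) (\<alpha> x) r) = r" if "x \<in> Obj S" "r \<in> Sec R' x" for x r
    by (rule bij_betw_inv_into_right[OF D(4)[OF that(1)] that(2)])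
  have cl: "inv_into (Sec R x) (\<alpha> x) r \<in> Sec R x" if "x \<in> Obj S" "r \<in> Sec R' x" for x r
    by (rule bij_betwE[OF bij_betw_inv_into[OF D(4)[OF that(1)]], rule_format, OF that(2)])
  {
    fix x assume x: "x \<in> Obj S"
    show "\<alpha> x \<in> ring_hom (Sect R x) (Sect R' x)" by (rule D(3)[OF x])
    show "inv_into (Sec R x) (\<alpha> x) (\<alpha> x r) = r" if "r \<in> Sec R x" for r by (rule i1[OF x that])
    show "\<alpha> x (inv_into (Sec R x) (\<alpha> x) r) = r" if "r \<in> Sec R' x" for r by (rule i2[OF x that])
    show "inv_into (Sec R x) (\<alpha> x) \<in> ring_hom (Sect R' x) (Sect R x)" by (rule ring_hom_inv_into[OF D(1,3,4)[OF x]])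
  }
  fix z w f assume f: "f \<in> Hom S z w"
  show n: "\<alpha> z (Restr R f r) = Restr R' f (\<alpha> w r)" if "r \<in> Sec R w" for r by (rule nat_mapsD(2)[OF D(5) f that])
  show "inv_into (Sec R z) (\<alpha> z) (Restr R' f r) = Restr R f (inv_into (Sec R w) (\<alpha> w) r)" if r: "r \<in> Sec R' w" for r
  proof -
    have o: "z \<in> Obj S" "w \<in> Obj S" using Hom_objD[OF S f] by auto
    have "Restr R' f r = \<alpha> z (Restr R f (inv_into (Sec R w) (\<alpha> w) r))"
      using nat_mapsD(2)[OF D(5) f cl[OF o(2) r]] i2[OF o(2) r] by simp
    then show ?thesis using i1[OF o(1) psh_Restr_closed[OF ring_sheaf_presheaf[OF D(6)] f cl[OF o(2) r]]] by simp
  qed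
qed

text \<open>The map acts on coefficients. Local finiteness of the support survives because
  \<open>\<sigma>\<close> commutes with restriction and sends zero to zero.\<close>

lemma free_slin_hom:
  assumes S: "covering_site S" and p: "ring_iso_pair S R R' \<sigma> \<sigma>'"
  shows "slin_hom S R \<sigma> (free_sheaf S R A) (free_sheaf S R' A) (\<lambda>x s. \<lambda>a\<in>A. \<sigma> x (s a))"
  unfolding slin_hom_def
proof (intro conjI ballI allI impI)
  note SC = covering_siteD(1)[OF S] and D = ring_iso_pairD[OF p]
  {
    fix x s assume x: "x \<in> Obj S" and s: "s \<in> Sec (free_sheaf S R A) x"
    have s1: "s \<in> A \<rightarrow>\<^sub>E Sec R x" using s unfolding free_sheaf_sel(1)[OF x] by blast
    note h = D(3)[OF x]
    obtain c where c: "c \<in> Cov S x" "\<And>f. f \<in> c \<Longrightarrow> finite {a \<in> A. Restr R f (s a) \<noteq> \<zero>\<^bsub>Sect R (Dom S f)\<^esub>}"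
      using s unfolding free_sheaf_sel(1)[OF x] by blast
    have "finite {a \<in> A. Restr R' f ((\<lambda>a\<in>A. \<sigma> x (s a)) a) \<noteq> \<zero>\<^bsub>Sect R' (Dom S f)\<^esub>}" if f: "f \<in> c" for f
    proof (rule finite_subset[OF _ c(2)[OF f]])
      note fh = covering_siteD(2)[OF S x c(1) f]
      have o: "Dom S f \<in> Obj S" using Hom_objD[OF SC fh] by simp
      have z: "\<sigma> (Dom S f) \<zero>\<^bsub>Sect R (Dom S f)\<^esub> = \<zero>\<^bsub>Sect R' (Dom S f)\<^esub>"
        by (rule ring_hom_zero[OF D(3)[OF o] ring_sheafD(2)[OF D(1) o] ring_sheafD(2)[OF D(2) o]])
      have "Restr R' f (\<sigma> x (s a)) = \<sigma> (Dom S f) (Restr R f (s a))" if "a \<in> A" for a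
        using D(6)[OF fh PiE_mem[OF s1 that]] by simp
      then show "{a \<in> A. Restr R' f ((\<lambda>a\<in>A. \<sigma> x (s a)) a) \<noteq> \<zero>\<^bsub>Sect R' (Dom S f)\<^esub>} \<subseteq> {a \<in> A. Restr R f (s a) \<noteq> \<zero>\<^bsub>Sect R (Dom S f)\<^esub>}"
        using z by auto
    qed
    moreover have "(\<lambda>a\<in>A. \<sigma> x (s a)) \<in> A \<rightarrow>\<^sub>E Sec R' x"
      by (rule restrict_PiE_iff[THEN iffD2]) (intro ballI ring_hom_closed[OF h] PiE_mem[OF s1])
    ultimately show "(\<lambda>a\<in>A. \<sigma> x (s a)) \<in> Sec (free_sheaf S R' A) x" unfolding free_sheaf_sel(1)[OF x] using c(1) by blast
    fix t assume t: "t \<in> Sec (free_sheaf S R A) x"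
    have t1: "t \<in> A \<rightarrow>\<^sub>E Sec R x" using t unfolding free_sheaf_sel(1)[OF x] by blast
    have "\<sigma> x (s a \<oplus>\<^bsub>Sect R x\<^esub> t a) = \<sigma> x (s a) \<oplus>\<^bsub>Sect R' x\<^esub> \<sigma> x (t a)" if "a \<in> A" for a
      by (rule ring_hom_add[OF h PiE_mem[OF s1 that] PiE_mem[OF t1 that]])
    then show "(\<lambda>a\<in>A. \<sigma> x ((s \<oplus>\<^bsub>Sect (free_sheaf S R A) x\<^esub> t) a)) =
       (\<lambda>a\<in>A. \<sigma> x (s a)) \<oplus>\<^bsub>Sect (free_sheaf S R' A) x\<^esub> (\<lambda>a\<in>A. \<sigma> x (t a))"
      unfolding free_sheaf_sel(2)[OF x] by (intro restrict_ext) simp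
  next
    fix x s r assume x: "x \<in> Obj S" and s: "s \<in> Sec (free_sheaf S R A) x" and r: "r \<in> Sec R x"
    have s1: "s \<in> A \<rightarrow>\<^sub>E Sec R x" using s unfolding free_sheaf_sel(1)[OF x] by blast
    note h = D(3)[OF x]
    have "\<sigma> x (r \<otimes>\<^bsub>Sect R x\<^esub> s a) = \<sigma> x r \<otimes>\<^bsub>Sect R' x\<^esub> \<sigma> x (s a)" if "a \<in> A" for a
      by (rule ring_hom_mult[OF h r PiE_mem[OF s1 that]])
    then show "(\<lambda>a\<in>A. \<sigma> x ((r \<odot>\<^bsub>Sect (free_sheaf S R A) x\<^esub> s) a)) = \<sigma> x r \<odot>\<^bsub>Sect (free_sheaf S R' A) x\<^esub> (\<lambda>a\<in>A. \<sigma> x (s a))"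
      unfolding free_sheaf_sel(3)[OF x r] free_sheaf_sel(3)[OF x ring_hom_closed[OF h r]] by (intro restrict_ext) simp
  }
  fix z w f s assume f: "f \<in> Hom S z w" and s: "s \<in> Sec (free_sheaf S R A) w"
  have w: "w \<in> Obj S" using Hom_objD[OF SC f] by simp
  have s1: "s \<in> A \<rightarrow>\<^sub>E Sec R w" using s unfolding free_sheaf_sel(1)[OF w] by blast
  show "(\<lambda>a\<in>A. \<sigma> z (Restr (free_sheaf S R A) f s a)) = Restr (free_sheaf S R' A) f (\<lambda>a\<in>A. \<sigma> w (s a))"
    unfolding free_sheaf_sel(4)[OF conjunct1[OF HomD[OF f]]] using D(6)[OF f PiE_mem[OF s1]] by (intro restrict_ext) simp
qed

lemma free_slin_iso:
  assumes S: "covering_site S" and p: "ring_iso_pair S R R' \<sigma> \<sigma>'"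
  shows "slin_iso S R R' \<sigma> \<sigma>' (free_sheaf S R A) (free_sheaf S R' A) (\<lambda>x s. \<lambda>a\<in>A. \<sigma> x (s a)) (\<lambda>x s. \<lambda>a\<in>A. \<sigma>' x (s a))"
  unfolding slin_iso_def
proof (intro conjI ballI free_slin_hom[OF S p] free_slin_hom[OF S ring_iso_pair_sym[OF p]])
  fix x s assume x: "x \<in> Obj S"
  show "(\<lambda>a\<in>A. \<sigma>' x ((\<lambda>a\<in>A. \<sigma> x (s a)) a)) = s" if s: "s \<in> Sec (free_sheaf S R A) x"
  proof -
    have s1: "s \<in> A \<rightarrow>\<^sub>E Sec R x" using s unfolding free_sheaf_sel(1)[OF x] by blast
    show ?thesis using ring_iso_pairD(4)[OF p x PiE_mem[OF s1]] s1 by (intro extensionalityI[of _ A]) (auto simp: PiE_def)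
  qed
  show "(\<lambda>a\<in>A. \<sigma> x ((\<lambda>a\<in>A. \<sigma>' x (s a)) a)) = s" if s: "s \<in> Sec (free_sheaf S R' A) x"
  proof -
    have s1: "s \<in> A \<rightarrow>\<^sub>E Sec R' x" using s unfolding free_sheaf_sel(1)[OF x] by blast
    show ?thesis using ring_iso_pairD(5)[OF p x PiE_mem[OF s1]] s1 by (intro extensionalityI[of _ A]) (auto simp: PiE_def)
  qed
qed

text \<open>The twists by \<open>\<sigma>'\<close> on the way in and by \<open>\<sigma>\<close> on
  the way out cancel, so a linear map conjugated by semilinear ones is linear over the other
  ring.\<close>

lemma slin_conj:
  assumes S: "is_category S" and p: "ring_iso_pair S R R' \<sigma> \<sigma>'"
    and F: "slin_hom S R' \<sigma>' F' F \<tau>F'" and G: "slin_hom S R \<sigma> G G' \<tau>G"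
    and cF: "closed_sheaf S R' F'" and \<eta>: "\<eta> \<in> nat_maps S F G" "is_linear S R F G \<eta>"
  shows "norm_map S F' (\<lambda>x m. \<tau>G x (\<eta> x (\<tau>F' x m))) \<in> nat_maps S F' G'" (is "?n \<in> _")
    "is_linear S R' F' G' (norm_map S F' (\<lambda>x m. \<tau>G x (\<eta> x (\<tau>F' x m))))"
proof -
  note f = slin_homD[OF F] and g = slin_homD[OF G] and n = nat_mapsD[OF \<eta>(1)]
  show "?n \<in> nat_maps S F' G'"
  proof (rule nat_mapsI_closed[OF S closed_sheafD(3)[OF cF]])
    show "\<tau>G x (\<eta> x (\<tau>F' x m)) \<in> Sec G' x" if "x \<in> Obj S" "m \<in> Sec F' x" for x m
      by (rule g(1)[OF that(1) n(1)[OF that(1) f(1)[OF that]]])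
    show "\<tau>G z (\<eta> z (\<tau>F' z (Restr F' h m))) = Restr G' h (\<tau>G w (\<eta> w (\<tau>F' w m)))" if h: "h \<in> Hom S z w" and m: "m \<in> Sec F' w" for h z w m
    proof -
      have w: "w \<in> Obj S" using Hom_objD[OF S h] by simp
      show ?thesis unfolding f(4)[OF h m] n(2)[OF h f(1)[OF w m]] g(4)[OF h n(1)[OF w f(1)[OF w m]]] ..
    qed
  qed
  show "is_linear S R' F' G' ?n" unfolding is_linear_def
  proof (intro ballI conjI)
    fix x m assume x: "x \<in> Obj S" and m: "m \<in> Sec F' x"
    note lin = \<eta>(2)[unfolded is_linear_def, rule_format, OF x f(1)[OF x m]]
    note y = n(1)[OF x f(1)[OF x m]]
    show "?n x (m \<oplus>\<^bsub>Sect F' x\<^esub> k) =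
      ?n x m \<oplus>\<^bsub>Sect G' x\<^esub> ?n x k" if k: "k \<in> Sec F' x" for k
      unfolding norm_map_apply[OF x m] norm_map_apply[OF x k] norm_map_apply[OF x closed_sheafD(1)[OF cF x m k]]
        f(2)[OF x m k] conjunct1[OF lin, rule_format, OF f(1)[OF x k]] g(2)[OF x y n(1)[OF x f(1)[OF x k]]] ..
    show "?n x (r \<odot>\<^bsub>Sect F' x\<^esub> m) =
      r \<odot>\<^bsub>Sect G' x\<^esub> ?n x m" if r: "r \<in> Sec R' x" for r
    proof -
      have r': "\<sigma>' x r \<in> Sec R x" by (rule ring_hom_closed[OF ring_iso_pairD(3)[OF ring_iso_pair_sym[OF p] x] r])
      show ?thesis
        unfolding norm_map_apply[OF x m] norm_map_apply[OF x closed_sheafD(2)[OF cF x m r]]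
          f(3)[OF x m r] conjunct2[OF lin, rule_format, OF r'] g(3)[OF x y r'] ring_iso_pairD(5)[OF p x r] ..
    qed
  qed
qed

text \<open>\<open>slin_hom\<close> says nothing about zero; additivity makes the image of zero
  idempotent for addition, and cancellation in the group does the rest.\<close>

lemma slin_hom_zero:
  assumes t: "slin_hom S R \<sigma> H H' \<tau>" and x: "x \<in> Obj S" and a: "abelian_group (Sect H x)" "abelian_group (Sect H' x)"
  shows "\<tau> x \<zero>\<^bsub>Sect H x\<^esub> = \<zero>\<^bsub>Sect H' x\<^esub>"
proof -
  interpret H: abelian_group "Sect H x" by (rule a(1))
  interpret H': abelian_group "Sect H' x" by (rule a(2))
  note c = slin_homD(1)[OF t x H.zero_closed]
  have "\<tau> x \<zero>\<^bsub>Sect H x\<^esub> \<oplus>\<^bsub>Sect H' x\<^esub> \<tau> x \<zero>\<^bsub>Sect H x\<^esub> = \<tau> x \<zero>\<^bsub>Sect H x\<^esub>"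
    using slin_homD(2)[OF t x H.zero_closed H.zero_closed] by simp
  then show ?thesis using H'.add.r_cancel_one[OF c c] by simp
qed

text \<open>Both maps are conjugated by the semilinear isomorphisms. Exactness speaks of zero and of
  local membership in images, and these are preserved and reflected.\<close>

lemma right_exact_transfer:
  assumes S: "covering_site S" and p: "ring_iso_pair S R R' \<sigma> \<sigma>'"
    and F: "slin_iso S R R' \<sigma> \<sigma>' F F' \<tau>F \<tau>F'" and G: "slin_iso S R R' \<sigma> \<sigma>' G G' \<tau>G \<tau>G'"
    and H: "slin_iso S R R' \<sigma> \<sigma>' H H' \<tau>H \<tau>H'"
    and cl: "closed_sheaf S R' F'" "closed_sheaf S R' G'" "closed_sheaf S R' H'"
    and ab: "\<And>x. x \<in> Obj S \<Longrightarrow> abelian_group (Sect H x)" "\<And>x. x \<in> Obj S \<Longrightarrow> abelian_group (Sect H' x)"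
    and ex: "right_exact_seq S R F G H \<eta> \<theta>"
  shows "right_exact_seq S R' F' G' H' (norm_map S F' (\<lambda>x m. \<tau>G x (\<eta> x (\<tau>F' x m)))) (norm_map S G' (\<lambda>x m. \<tau>H x (\<theta> x (\<tau>G' x m))))"
    (is "right_exact_seq S R' F' G' H' ?\<eta> ?\<theta>")
proof -
  note SC = covering_siteD(1)[OF S] and e = ex[unfolded right_exact_seq_def]
  have e1: "\<eta> \<in> nat_maps S F G" "is_linear S R F G \<eta>" "\<theta> \<in> nat_maps S G H" "is_linear S R G H \<theta>" using e by blast+
  have e2: "\<theta> x m = \<zero>\<^bsub>Sect H x\<^esub> \<longleftrightarrow> (\<exists>c\<in>Cov S x. \<forall>f\<in>c. Restr G f m \<in> \<eta> (Dom S f) ` Sec F (Dom S f))"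
    if "x \<in> Obj S" "m \<in> Sec G x" for x m using e that by blast
  have e3: "\<exists>c\<in>Cov S x. \<forall>f\<in>c. Restr H f m \<in> \<theta> (Dom S f) ` Sec G (Dom S f)" if "x \<in> Obj S" "m \<in> Sec H x" for x m using e that by blast
  note f = slin_homD[OF slin_isoD(1)[OF F]] and f' = slin_homD[OF slin_isoD(2)[OF F]] and fi = slin_isoD(3,4)[OF F]
  note g = slin_homD[OF slin_isoD(1)[OF G]] and g' = slin_homD[OF slin_isoD(2)[OF G]] and gi = slin_isoD(3,4)[OF G]
  note h = slin_homD[OF slin_isoD(1)[OF H]] and h' = slin_homD[OF slin_isoD(2)[OF H]] and hi = slin_isoD(3,4)[OF H]
  note c\<eta> = nat_mapsD(1)[OF e1(1)] and c\<theta> = nat_mapsD(1)[OF e1(3)]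
  \<comment> \<open>Membership of a restriction in the image corresponds under the isomorphisms, so
    the same covers serve for both sequences.\<close>
  have img: "Restr G' u m \<in> ?\<eta> (Dom S u) ` Sec F' (Dom S u) \<longleftrightarrow> Restr G u (\<tau>G' x m) \<in> \<eta> (Dom S u) ` Sec F (Dom S u)"
    if x: "x \<in> Obj S" and m: "m \<in> Sec G' x" and u: "u \<in> Hom S (Dom S u) x" for x m u
  proof -
    have o: "Dom S u \<in> Obj S" using Hom_objD[OF SC u] by simp
    note r = closed_sheafD(3)[OF cl(2) u m]
    show ?thesis
    proof
      assume "Restr G' u m \<in> ?\<eta> (Dom S u) ` Sec F' (Dom S u)"
      then obtain l where l: "l \<in> Sec F' (Dom S u)" "Restr G' u m = ?\<eta> (Dom S u) l" by blast
      note l' = f'(1)[OF o l(1)]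
      have "Restr G u (\<tau>G' x m) = \<eta> (Dom S u) (\<tau>F' (Dom S u) l)"
        using l(2) unfolding norm_map_apply[OF o l(1)] g'(4)[OF u m, symmetric] using gi(1)[OF o c\<eta>[OF o l']] by simp
      then show "Restr G u (\<tau>G' x m) \<in> \<eta> (Dom S u) ` Sec F (Dom S u)" using l' by blast
    next
      assume "Restr G u (\<tau>G' x m) \<in> \<eta> (Dom S u) ` Sec F (Dom S u)"
      then obtain l where l: "l \<in> Sec F (Dom S u)" "Restr G u (\<tau>G' x m) = \<eta> (Dom S u) l" by blast
      note l' = f(1)[OF o l(1)]
      have "\<tau>G (Dom S u) (\<tau>G' (Dom S u) (Restr G' u m)) = ?\<eta> (Dom S u) (\<tau>F (Dom S u) l)"
        unfolding norm_map_apply[OF o l'] fi(1)[OF o l(1)] l(2)[symmetric] g'(4)[OF u m] ..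
      then have "Restr G' u m = ?\<eta> (Dom S u) (\<tau>F (Dom S u) l)" unfolding gi(2)[OF o r] .
      then show "Restr G' u m \<in> ?\<eta> (Dom S u) ` Sec F' (Dom S u)" using l' by blast
    qed
  qed
  show ?thesis unfolding right_exact_seq_def
  proof (intro conjI ballI)
    show "?\<eta> \<in> nat_maps S F' G'" "is_linear S R' F' G' ?\<eta>"
      by (rule slin_conj[OF SC p slin_isoD(2)[OF F] slin_isoD(1)[OF G] cl(1) e1(1,2)])+
    show "?\<theta> \<in> nat_maps S G' H'" "is_linear S R' G' H' ?\<theta>"
      by (rule slin_conj[OF SC p slin_isoD(2)[OF G] slin_isoD(1)[OF H] cl(2) e1(3,4)])+
  next
    fix x m assume x: "x \<in> Obj S" and m: "m \<in> Sec G' x"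
    note m' = g'(1)[OF x m]
    interpret Hx: abelian_group "Sect H x" by (rule ab(1)[OF x])
    have z: "\<tau>H x \<zero>\<^bsub>Sect H x\<^esub> = \<zero>\<^bsub>Sect H' x\<^esub>" by (rule slin_hom_zero[OF slin_isoD(1)[OF H] x ab(1)[OF x] ab(2)[OF x]])
    have "?\<theta> x m = \<zero>\<^bsub>Sect H' x\<^esub> \<longleftrightarrow> \<theta> x (\<tau>G' x m) = \<zero>\<^bsub>Sect H x\<^esub>"
      unfolding norm_map_apply[OF x m] using z hi(1)[OF x c\<theta>[OF x m']] hi(1)[OF x Hx.zero_closed] by metis
    also have "\<dots> \<longleftrightarrow> (\<exists>c\<in>Cov S x. \<forall>u\<in>c. Restr G u (\<tau>G' x m) \<in> \<eta> (Dom S u) ` Sec F (Dom S u))" by (rule e2[OF x m'])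
    also have "\<dots> \<longleftrightarrow> (\<exists>c\<in>Cov S x. \<forall>u\<in>c. Restr G' u m \<in> ?\<eta> (Dom S u) ` Sec F' (Dom S u))"
      by (rule bex_cong[OF HOL.refl], rule ball_cong[OF HOL.refl]) (rule img[OF x m covering_siteD(2)[OF S x], symmetric])
    finally show "?\<theta> x m = \<zero>\<^bsub>Sect H' x\<^esub> \<longleftrightarrow> (\<exists>c\<in>Cov S x. \<forall>u\<in>c. Restr G' u m \<in> ?\<eta> (Dom S u) ` Sec F' (Dom S u))" .
  next
    fix x m assume x: "x \<in> Obj S" and m: "m \<in> Sec H' x"
    obtain c where c: "c \<in> Cov S x" "\<forall>u\<in>c. Restr H u (\<tau>H' x m) \<in> \<theta> (Dom S u) ` Sec G (Dom S u)" using e3[OF x h'(1)[OF x m]] by blast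
    have "Restr H' u m \<in> ?\<theta> (Dom S u) ` Sec G' (Dom S u)" if uc: "u \<in> c" for u
    proof -
      note u = covering_siteD(2)[OF S x c(1) uc]
      have o: "Dom S u \<in> Obj S" using Hom_objD[OF SC u] by simp
      obtain l where l: "l \<in> Sec G (Dom S u)" "Restr H u (\<tau>H' x m) = \<theta> (Dom S u) l" using c(2) uc by blast
      note l' = g(1)[OF o l(1)]
      have "\<tau>H (Dom S u) (\<tau>H' (Dom S u) (Restr H' u m)) = ?\<theta> (Dom S u) (\<tau>G (Dom S u) l)"
        unfolding norm_map_apply[OF o l'] gi(1)[OF o l(1)] l(2)[symmetric] h'(4)[OF u m] ..
      then have "Restr H' u m = ?\<theta> (Dom S u) (\<tau>G (Dom S u) l)" unfolding hi(2)[OF o closed_sheafD(3)[OF cl(3) u m]] .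
      then show ?thesis using l' by blast
    qed
    then show "\<exists>c\<in>Cov S x. \<forall>u\<in>c. Restr H' u m \<in> ?\<theta> (Dom S u) ` Sec G' (Dom S u)" using c(1) by blast
  qed
qed

subsection \<open>Restriction to representables\<close>

lemma rep_sel:
  "Obj (Val (rep C V) W) = Hom C W V" "Arr (Val (rep C V) W) = Hom C W V" "Dom (Val (rep C V) W) f = f"
  "Cod (Val (rep C V) W) f = f" "Ident (Val (rep C V) W) f = f" "Comp (Val (rep C V) W) g f = f"
  "FOb (Rst (rep C V) h) f = Comp C f h" "FAr (Rst (rep C V) h) f = Comp C f h"
  by (simp_all add: rep_def)

lemma rep_Hom: "\<alpha> \<in> Hom (Val (rep C V) W) x y \<longleftrightarrow> \<alpha> \<in> Hom C W V \<and> x = \<alpha> \<and> y = \<alpha>"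
  by (auto simp: Hom_def[of "Val (rep C V) W"] rep_sel)

lemma rep_category: "is_category (Val (rep C V) W)"
  by (rule is_categoryI) (auto simp: rep_Hom, auto simp: rep_sel)

lemma rep_on:
  assumes C: "is_category C"
  shows "gpsh_on C (rep C V)"
proof (unfold_locales, rule C, unfold is_gpsh_def, intro conjI ballI impI)
  show "is_groupoid (Val (rep C V) X)" for X
    unfolding is_groupoid_def
  proof (intro conjI ballI rep_category)
    fix f assume f: "f \<in> Arr (Val (rep C V) X)"
    then have h: "f \<in> Hom (Val (rep C V) X) f f" by (simp add: rep_Hom rep_sel)
    show "is_isomorphism (Val (rep C V) X) f" by (rule is_isomorphismI[OF h h]) (simp_all add: rep_sel)
  qed
  fix h assume h: "h \<in> Arr C"
  show "is_functor (Val (rep C V) (Cod C h)) (Val (rep C V) (Dom C h)) (Rst (rep C V) h)"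
    by (rule is_functorI[OF rep_category rep_category]) (use cat_comp[OF C Arr_Hom[OF h]] in \<open>auto simp: rep_sel rep_Hom\<close>)
  fix k assume k: "k \<in> Arr C" "Dom C k = Cod C h"
  show "ftr_agree (Val (rep C V) (Cod C k)) (Rst (rep C V) (Comp C k h)) (ftr_comp (Rst (rep C V) h) (Rst (rep C V) k))"
    using cat_assoc[OF C Arr_Hom[OF h], of k "Cod C k"] k
    by (auto simp: ftr_agree_def ftr_comp_def rep_sel Hom_def)
next
  fix X assume X: "X \<in> Obj C"
  show "ftr_agree (Val (rep C V) X) (Rst (rep C V) (Ident C X)) ftr_id"
    using cat_unit_right[OF C] by (auto simp: ftr_agree_def ftr_id_def rep_sel)
qed

text \<open>The functor of sites induced by the restriction along \<open>u\<close> of the map that \<open>a\<close> represents.\<close>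

definition chart_map :: "('c, 'a, 'z) cat_scheme \<Rightarrow> ('c, 'a, 'o, 'g) gpsh \<Rightarrow> 'a \<Rightarrow> 'o \<Rightarrow> 'c \<Rightarrow> ('a, 'a, 'o, 'g) ftr" where
  "chart_map C N u a = (\<lambda>V. ftr_comp (yoneda N a V) (rep_map C u V))"

lemma chart_map_sel:
  "FOb (chart_map C N u a V) f = FOb (Rst N (Comp C u f)) a"
  "FAr (chart_map C N u a V) f = Ident (Val N V) (FOb (Rst N (Comp C u f)) a)"
  by (simp_all add: chart_map_def ftr_comp_def yoneda_def rep_map_def)

lemma (in gpsh_on) chart_map_hom:
  assumes u: "u \<in> Hom C V X" and a: "a \<in> Obj (Val N X)"
  shows "gpsh_hom C (rep C V) N (chart_map C N u a)"
proof (intro gpsh_hom.intro gpsh_hom_axioms.intro rep_on C gpsh_on_axioms, unfold is_gpsh_map_def, intro conjI ballI)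
  have ob: "FOb (Rst N (Comp C u f)) a \<in> Obj (Val N W)" if "f \<in> Hom C W V" for f W
    by (rule R_ob[OF cat_comp[OF C that u] a])
  fix W assume W: "W \<in> Obj C"
  show "is_functor (Val (rep C V) W) (Val N W) (chart_map C N u a W)"
  proof (rule is_functorI[OF rep_category V_category[OF W]])
    fix f x y assume "f \<in> Hom (Val (rep C V) W) x y"
    then show "FAr (chart_map C N u a W) f \<in> Hom (Val N W) (FOb (chart_map C N u a W) x) (FOb (chart_map C N u a W) y)"
      using cat_ident[OF V_category[OF W] ob] by (auto simp: rep_Hom chart_map_sel)
  next
    fix f g x y z assume "f \<in> Hom (Val (rep C V) W) x y" "g \<in> Hom (Val (rep C V) W) y z"
    then have f: "f \<in> Hom C W V" "g = f" by (auto simp: rep_Hom)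
    show "FAr (chart_map C N u a W) (Comp (Val (rep C V) W) g f) = Comp (Val N W) (FAr (chart_map C N u a W) g) (FAr (chart_map C N u a W) f)"
      using cat_unit_left[OF V_category[OF W] cat_ident[OF V_category[OF W] ob[OF f(1)]]] f(2) by (simp add: chart_map_sel rep_sel)
  qed (use ob in \<open>simp_all add: rep_sel chart_map_sel\<close>)
next
  fix h assume "h \<in> Arr C"
  then have h: "h \<in> Hom C (Dom C h) (Cod C h)" by (rule Arr_Hom)
  have e: "FOb (Rst N (Comp C u (Comp C f h))) a = FOb (Rst N h) (FOb (Rst N (Comp C u f)) a)" if f: "f \<in> Hom C (Cod C h) V" for f
    using R_comp_ob[OF h cat_comp[OF C f u] a] cat_assoc[OF C h f u] by simp
  have "FAr (Rst N h) (Ident (Val N (Cod C h)) (FOb (Rst N (Comp C u f)) a)) = Ident (Val N (Dom C h)) (FOb (Rst N h) (FOb (Rst N (Comp C u f)) a))"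
    if f: "f \<in> Hom C (Cod C h) V" for f
    by (rule functor_ident[OF R_functor[OF h] R_ob[OF cat_comp[OF C f u] a]])
  then show "ftr_agree (Val (rep C V) (Cod C h)) (ftr_comp (chart_map C N u a (Dom C h)) (Rst (rep C V) h))
      (ftr_comp (Rst N h) (chart_map C N u a (Cod C h)))"
    using e by (auto simp: ftr_agree_def ftr_comp_def rep_sel chart_map_sel)
qed

definition presented :: "'k itself \<Rightarrow> ('x, 'f) site \<Rightarrow> ('x, 'f, 'r) rsheaf \<Rightarrow> ('x, 'f, 'r, 'm) msheaf \<Rightarrow> bool" where
  "presented _ S R F \<longleftrightarrow> (\<exists>(A :: 'k set) (A' :: 'k set) p q. right_exact_seq S R (free_sheaf S R A) (free_sheaf S R A') F p q)"

lemma is_quasi_coherent_iff: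
  "is_quasi_coherent k C N R F \<longleftrightarrow> (\<forall>X\<in>Obj C. \<forall>a\<in>Obj (Val N X). \<exists>c\<in>Cov C X. \<forall>u\<in>c.
     presented k (slice C (rep C (Dom C u)))
        (psh_pull (slice C (rep C (Dom C u))) (slice_map (chart_map C N u a)) R)
        (psh_pull (slice C (rep C (Dom C u))) (slice_map (chart_map C N u a)) F))"
  by (simp add: is_quasi_coherent_def chart_map_def Let_def presented_def)

lemma slin_hom_pull:
  assumes P: "is_functor S' S P" and t: "slin_hom S R \<sigma> F F' \<tau>"
  shows "slin_hom S' (psh_pull S' P R) (\<lambda>x. \<sigma> (FOb P x)) (psh_pull S' P F) (psh_pull S' P F') (\<lambda>x. \<tau> (FOb P x))"
  unfolding slin_hom_def
proof (intro conjI ballI allI impI)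
  note t = slin_homD[OF t]
  {
    fix x m assume x: "x \<in> Obj S'" and m: "m \<in> Sec (psh_pull S' P F) x"
    note o = functor_ob[OF P x]
    have m': "m \<in> Sec F (FOb P x)" using m x by (simp add: psh_pull_sel)
    show "\<tau> (FOb P x) m \<in> Sec (psh_pull S' P F') x" using t(1)[OF o m'] x by (simp add: psh_pull_sel)
    show "\<tau> (FOb P x) (m \<oplus>\<^bsub>Sect (psh_pull S' P F) x\<^esub> n) = \<tau> (FOb P x) m \<oplus>\<^bsub>Sect (psh_pull S' P F') x\<^esub> \<tau> (FOb P x) n"
      if "n \<in> Sec (psh_pull S' P F) x" for n using t(2)[OF o m'] that x by (simp add: psh_pull_sel)
    show "\<tau> (FOb P x) (r \<odot>\<^bsub>Sect (psh_pull S' P F) x\<^esub> m) = \<sigma> (FOb P x) r \<odot>\<^bsub>Sect (psh_pull S' P F') x\<^esub> \<tau> (FOb P x) m"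
      if "r \<in> Sec (psh_pull S' P R) x" for r using t(3)[OF o m'] that x by (simp add: psh_pull_sel)
  }
  fix z w f m assume f: "f \<in> Hom S' z w" and m: "m \<in> Sec (psh_pull S' P F) w"
  have w: "w \<in> Obj S'" using Hom_objD[OF functor_category(1)[OF P] f] by simp
  show "\<tau> (FOb P z) (Restr (psh_pull S' P F) f m) = Restr (psh_pull S' P F') f (\<tau> (FOb P w) m)"
    using t(4)[OF functor_hom[OF P f]] m w HomD[OF f] by (simp add: psh_pull_sel)
qed

lemma slin_iso_pull:
  assumes P: "is_functor S' S P" and t: "slin_iso S R R' \<sigma> \<sigma>' F F' \<tau> \<tau>'"
  shows "slin_iso S' (psh_pull S' P R) (psh_pull S' P R') (\<lambda>x. \<sigma> (FOb P x)) (\<lambda>x. \<sigma>' (FOb P x))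
    (psh_pull S' P F) (psh_pull S' P F') (\<lambda>x. \<tau> (FOb P x)) (\<lambda>x. \<tau>' (FOb P x))"
  unfolding slin_iso_def
  by (intro conjI ballI slin_hom_pull[OF P slin_isoD(1)[OF t]] slin_hom_pull[OF P slin_isoD(2)[OF t]])
    (simp_all add: psh_pull_sel slin_isoD(3,4)[OF t functor_ob[OF P]])

lemma ring_iso_pair_pull:
  assumes P: "is_functor S' S P" and p: "ring_iso_pair S R R' \<sigma> \<sigma>'"
    and sh: "is_ring_sheaf S' (psh_pull S' P R)" "is_ring_sheaf S' (psh_pull S' P R')"
  shows "ring_iso_pair S' (psh_pull S' P R) (psh_pull S' P R') (\<lambda>x. \<sigma> (FOb P x)) (\<lambda>x. \<sigma>' (FOb P x))"
  unfolding ring_iso_pair_def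
proof (intro conjI ballI allI impI sh)
  note p' = ring_iso_pair_sym[OF p]
  show "\<sigma> (FOb P x) \<in> ring_hom (Sect (psh_pull S' P R) x) (Sect (psh_pull S' P R') x)"
    "\<sigma>' (FOb P x) \<in> ring_hom (Sect (psh_pull S' P R') x) (Sect (psh_pull S' P R) x)" if x: "x \<in> Obj S'" for x
    using ring_iso_pairD(3)[OF p functor_ob[OF P x]] ring_iso_pairD(3)[OF p' functor_ob[OF P x]] x by (simp_all add: psh_pull_sel)
  show "\<sigma>' (FOb P x) (\<sigma> (FOb P x) r) = r" if x: "x \<in> Obj S'" and "r \<in> Sec (psh_pull S' P R) x" for x r
    using ring_iso_pairD(4)[OF p functor_ob[OF P x]] that by (simp add: psh_pull_sel)
  show "\<sigma> (FOb P x) (\<sigma>' (FOb P x) r) = r" if x: "x \<in> Obj S'" and "r \<in> Sec (psh_pull S' P R') x" for x r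
    using ring_iso_pairD(5)[OF p functor_ob[OF P x]] that by (simp add: psh_pull_sel)
  fix z w f assume f: "f \<in> Hom S' z w"
  have w: "w \<in> Obj S'" using Hom_objD[OF functor_category(1)[OF P] f] by simp
  note Pf = functor_hom[OF P f]
  show "\<sigma> (FOb P z) (Restr (psh_pull S' P R) f r) = Restr (psh_pull S' P R') f (\<sigma> (FOb P w) r)" if "r \<in> Sec (psh_pull S' P R) w" for r
    using ring_iso_pairD(6)[OF p Pf] that w HomD[OF f] by (simp add: psh_pull_sel)
  show "\<sigma>' (FOb P z) (Restr (psh_pull S' P R') f r) = Restr (psh_pull S' P R) f (\<sigma>' (FOb P w) r)" if "r \<in> Sec (psh_pull S' P R') w" for r
    using ring_iso_pairD(6)[OF p' Pf] that w HomD[OF f] by (simp add: psh_pull_sel)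
qed

lemma module_closed_sheaf:
  assumes F: "is_module_sheaf S R F"
  shows "closed_sheaf S R F"
  unfolding closed_sheaf_def
  by (intro conjI ballI allI impI left_moduleD(3,4)[OF module_sheafD(2)[OF F]] psh_Restr_closed[OF module_sheaf_presheaf[OF F]]; assumption)

text \<open>Free sheaves on the same index set over isomorphic rings are semilinearly isomorphic, so
  a presentation is carried over with its index sets.\<close>

lemma presented_transfer:
  fixes k :: "'k itself"
  assumes S: "covering_site S" and p: "ring_iso_pair S R R' \<sigma> \<sigma>'" and t: "slin_iso S R R' \<sigma> \<sigma>' F F' \<tau> \<tau>'"
    and F: "is_module_sheaf S R F" and F': "is_module_sheaf S R' F'" and pr: "presented k S R F"
  shows "presented k S R' F'"
proof -
  note rs = ring_iso_pairD(2)[OF p]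
  obtain A A' :: "'k set" and q r where ex: "right_exact_seq S R (free_sheaf S R A) (free_sheaf S R A') F q r"
    using pr unfolding presented_def by blast
  show ?thesis unfolding presented_def
    by (intro exI, rule right_exact_transfer[OF S p free_slin_iso[OF S p] free_slin_iso[OF S p] t
            free_sheaf_closed[OF S rs] free_sheaf_closed[OF S rs] module_closed_sheaf[OF F'] _ _ ex])
        (rule left_moduleD(2)[OF module_sheafD(2)[OF F]] left_moduleD(2)[OF module_sheafD(2)[OF F']]; assumption)+
qed

text \<open>Semilinear isomorphisms pull back along charts, so the same cover works and the
  presentations over its members are transferred.\<close>

lemma quasi_coherent_transfer:
  assumes site: "is_site C" and pb: "has_pullbacks C" and on: "gpsh_on C N"
    and p: "ring_iso_pair (slice C N) R R' \<sigma> \<sigma>'" and t: "slin_iso (slice C N) R R' \<sigma> \<sigma>' F F' \<tau> \<tau>'"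
    and F: "is_module_sheaf (slice C N) R F" and F': "is_module_sheaf (slice C N) R' F'"
    and qc: "is_quasi_coherent k C N R F"
  shows "is_quasi_coherent k C N R' F'"
  unfolding is_quasi_coherent_iff
proof (intro ballI)
  interpret gpsh_on C N by (rule on)
  fix X a assume X: "X \<in> Obj C" and a: "a \<in> Obj (Val N X)"
  note Cov_arr = site_cover_Hom[OF site]
  let ?S = "\<lambda>u. slice C (rep C (Dom C u))" and ?P = "\<lambda>u. slice_map (chart_map C N u a)"
  obtain c where c: "c \<in> Cov C X" and cq: "\<forall>u\<in>c. presented k (?S u) (psh_pull (?S u) (?P u) R) (psh_pull (?S u) (?P u) F)"
    using qc[unfolded is_quasi_coherent_iff, THEN bspec, OF X, THEN bspec, OF a] by (elim bexE)
  show "\<exists>c\<in>Cov C X. \<forall>u\<in>c. presented k (?S u) (psh_pull (?S u) (?P u) R') (psh_pull (?S u) (?P u) F')"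
  proof (intro bexI[OF _ c] ballI)
    fix u assume uc: "u \<in> c"
    interpret h: gpsh_hom C "rep C (Dom C u)" N "chart_map C N u a" by (rule chart_map_hom[OF Cov_arr[OF X c uc] a])
    interpret hs: gpsh_hom_site C "rep C (Dom C u)" N "chart_map C N u a"
      by unfold_locales (rule Cov_arr; assumption)
    note P = h.slice_map_functor
    have sh: "is_sheaf (slice C N) R" "is_sheaf (slice C N) R'"
      using ring_iso_pairD(1,2)[OF p] by (simp_all add: is_ring_sheaf_def)
    show "presented k (?S u) (psh_pull (?S u) (?P u) R') (psh_pull (?S u) (?P u) F')"
      by (rule presented_transfer[OF slice_covering_site[OF site pb rep_on[OF C]]
            ring_iso_pair_pull[OF P p pull_ring_sheaf[OF P ring_iso_pairD(1)[OF p] hs.psh_pull_sheaf[OF sh(1)]]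
              pull_ring_sheaf[OF P ring_iso_pairD(2)[OF p] hs.psh_pull_sheaf[OF sh(2)]]]
            slin_iso_pull[OF P t] pull_module_sheaf[OF P F hs.psh_pull_sheaf[OF module_sheafD(1)[OF F]]]
            pull_module_sheaf[OF P F' hs.psh_pull_sheaf[OF module_sheafD(1)[OF F']]] cq[THEN bspec, OF uc]])
  qed
qed

lemma full_subcat_Hom_iff: "f \<in> Hom (full_subcat C P) x y \<longleftrightarrow> f \<in> Hom C x y \<and> P x \<and> P y"
  by (auto simp: Hom_def full_subcat_sel)

lemma full_subcat_iso_Hom:
  "is_isomorphism (full_subcat C P) f \<and> f \<in> Hom (full_subcat C P) x y \<longleftrightarrow>
   is_isomorphism C f \<and> f \<in> Hom C x y \<and> P x \<and> P y"
  by (auto simp: full_subcat_is_isomorphism Hom_def full_subcat_sel)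

text \<open>Since each \<open>P k\<close> is invariant under isomorphism, the structure isomorphism
  at \<open>f\<close> forces its source, the image of \<open>x (Dom K f)\<close>, to satisfy
  \<open>P\<close> together with its target. The two categories are equal, so one and the same
  functor serves for both homotopy limits.\<close>

lemma (in cat_diagram) holim_full_subcat:
  assumes inv: "\<And>k y y' e. k \<in> Obj K \<Longrightarrow> e \<in> Hom (CatAt E k) y y' \<Longrightarrow> is_isomorphism (CatAt E k) e \<Longrightarrow> P k y' \<Longrightarrow> P k y"
    and E': "\<And>k. CatAt E' k = full_subcat (CatAt E k) (P k)" "FunAt E' = FunAt E"
  shows "holim K E' = full_subcat (holim K E) (\<lambda>a. \<forall>k\<in>Obj K. P k (fst a k))"
proof -
  have ob: "a \<in> Obj (holim K E') \<longleftrightarrow> a \<in> Obj (holim K E) \<and> (\<forall>k\<in>Obj K. P k (fst a k))" for a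
  proof -
    obtain x \<theta> where a: "a = (x, \<theta>)" by (rule prod.exhaust)
    have PiE: "x \<in> (\<Pi>\<^sub>E k\<in>Obj K. Obj (full_subcat (CatAt E k) (P k))) \<longleftrightarrow> x \<in> (\<Pi>\<^sub>E k\<in>Obj K. Obj (CatAt E k)) \<and> (\<forall>k\<in>Obj K. P k (x k))"
      by (auto simp: PiE_iff full_subcat_sel)
    \<comment> \<open>The target of \<open>\<theta> f\<close> satisfies \<open>P\<close>, hence so
      does its source by invariance, and both endpoints lie in the full subcategory.\<close>
    have h: "(is_isomorphism (full_subcat (CatAt E (Cod K f)) (P (Cod K f))) (\<theta> f) \<and>
        \<theta> f \<in> Hom (full_subcat (CatAt E (Cod K f)) (P (Cod K f))) (FOb (FunAt E f) (x (Dom K f))) (x (Cod K f))) \<longleftrightarrow>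
       is_isomorphism (CatAt E (Cod K f)) (\<theta> f) \<and> \<theta> f \<in> Hom (CatAt E (Cod K f)) (FOb (FunAt E f) (x (Dom K f))) (x (Cod K f))"
      if "f \<in> Arr K" "\<forall>k\<in>Obj K. P k (x k)" for f
      unfolding full_subcat_iso_Hom using inv cat_cod[OF K that(1)] that(2) by blast
    show ?thesis unfolding a holim_Obj E' PiE fst_conv full_subcat_sel using h by (auto simp del: full_subcat_is_isomorphism)
  qed
  have dc: "Dom (holim K E') = Dom (holim K E)" "Cod (holim K E') = Cod (holim K E)" "Ident (holim K E') = Ident (holim K E)"
    "Comp (holim K E') = Comp (holim K E)"
    by (simp_all add: holim_def Let_def E' full_subcat_sel)
  have st: "Dom (holim K E) (s, t, u) = s" "Cod (holim K E) (s, t, u) = t" for s t u by (simp_all add: holim_def Let_def)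
  have ar: "(s, t, u) \<in> Arr (holim K E') \<longleftrightarrow> (s, t, u) \<in> Arr (holim K E) \<and> (\<forall>k\<in>Obj K. P k (fst s k)) \<and> (\<forall>k\<in>Obj K. P k (fst t k))" for s t u
  proof -
    have AH: "(s, t, u) \<in> Arr (holim K D) \<longleftrightarrow> (s, t, u) \<in> Hom (holim K D) s t" for D :: "('k, 'f, 'o, 'a) cdiag"
      by (auto simp: Hom_def holim_def Let_def)
    have "u \<in> (\<Pi>\<^sub>E k\<in>Obj K. Hom (full_subcat (CatAt E k) (P k)) (fst s k) (fst t k)) \<longleftrightarrow> u \<in> (\<Pi>\<^sub>E k\<in>Obj K. Hom (CatAt E k) (fst s k) (fst t k))"
      if "\<forall>k\<in>Obj K. P k (fst s k)" "\<forall>k\<in>Obj K. P k (fst t k)"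
      using that by (auto simp: PiE_iff full_subcat_Hom_iff)
    then show ?thesis unfolding AH holim_Hom ob E' full_subcat_sel by blast
  qed
  show ?thesis
  proof (rule cat.equality)
    show "Obj (holim K E') = Obj (full_subcat (holim K E) (\<lambda>a. \<forall>k\<in>Obj K. P k (fst a k)))" using ob by (auto simp: full_subcat_sel)
    show "Arr (holim K E') = Arr (full_subcat (holim K E) (\<lambda>a. \<forall>k\<in>Obj K. P k (fst a k)))"
    proof -
      have "\<forall>a. a \<in> Arr (holim K E') \<longleftrightarrow> a \<in> Arr (full_subcat (holim K E) (\<lambda>a. \<forall>k\<in>Obj K. P k (fst a k)))"
        unfolding split_paired_All ar by (simp add: full_subcat_sel st)
      then show ?thesis by blast
    qed
  qed (simp_all add: full_subcat_sel dc)
qed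

lemma mod_hom_slin_hom: "mod_hom S R F G \<eta> \<Longrightarrow> slin_hom S R (\<lambda>x r. r) F G \<eta>"
  unfolding slin_hom_def using mod_homD[of S R F G \<eta>] by auto

lemma Mod_iso_slin_iso:
  assumes e: "e \<in> Hom (Mod S R) F G" and i: "is_isomorphism (Mod S R) e"
  obtains \<eta> \<epsilon> where "slin_iso S R R (\<lambda>x r. r) (\<lambda>x r. r) G F \<epsilon> \<eta>"
proof -
  obtain g where g: "g \<in> Hom (Mod S R) G F" "Comp (Mod S R) g e = Ident (Mod S R) F" "Comp (Mod S R) e g = Ident (Mod S R) G"
    by (rule is_isomorphismE[OF i e])
  obtain \<eta> where h: "e = (F, G, \<eta>)" "mod_hom S R F G \<eta>" by (rule Mod_HomE[OF e])
  obtain \<epsilon> where k: "g = (G, F, \<epsilon>)" "mod_hom S R G F \<epsilon>" by (rule Mod_HomE[OF g(1)])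
  have eq: "norm_map S F (\<lambda>x m. \<epsilon> x (\<eta> x m)) = norm_map S F (\<lambda>x m. m)" "norm_map S G (\<lambda>x m. \<eta> x (\<epsilon> x m)) = norm_map S G (\<lambda>x m. m)"
    using g(2,3) by (simp_all add: h(1) k(1) Mod_sel)
  have "\<epsilon> x (\<eta> x m) = m" if "x \<in> Obj S" "m \<in> Sec F x" for x m using fun_cong[OF fun_cong[OF eq(1)], of x m] that by simp
  moreover have "\<eta> x (\<epsilon> x m) = m" if "x \<in> Obj S" "m \<in> Sec G x" for x m using fun_cong[OF fun_cong[OF eq(2)], of x m] that by simp
  ultimately have "slin_iso S R R (\<lambda>x r. r) (\<lambda>x r. r) G F \<epsilon> \<eta>"
    unfolding slin_iso_def using mod_hom_slin_hom[OF h(2)] mod_hom_slin_hom[OF k(2)] by blast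
  then show thesis by (rule that)
qed

text \<open>A linear isomorphism is semilinear over the identity of the ring, so this is a case of
  \<open>quasi_coherent_transfer\<close>.\<close>

lemma quasi_coherent_iso:
  assumes site: "is_site C" "has_pullbacks C" "gpsh_on C N" and R: "is_ring_sheaf (slice C N) R"
    and e: "e \<in> Hom (Mod (slice C N) R) F G" "is_isomorphism (Mod (slice C N) R) e" and qc: "is_quasi_coherent k C N R G"
  shows "is_quasi_coherent k C N R F"
proof -
  obtain \<eta> \<epsilon> where s: "slin_iso (slice C N) R R (\<lambda>x r. r) (\<lambda>x r. r) G F \<epsilon> \<eta>" by (rule Mod_iso_slin_iso[OF e])
  have m: "is_module_sheaf (slice C N) R F" "is_module_sheaf (slice C N) R G" by (rule Mod_HomE[OF e(1)], assumption)+
  show ?thesis by (rule quasi_coherent_transfer[OF site ring_iso_pair_refl[OF R] s m(2,1) qc])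
qed

text \<open>Transport only relabels the scalars along \<open>\<alpha>\<close>, so the identity on
  sections is semilinear over \<open>\<alpha>\<close>.\<close>

lemma transport_slin_iso:
  assumes S: "is_category S" and \<alpha>: "ring_sheaf_iso S R R' \<alpha>"
  shows "slin_iso S R R' \<alpha> (\<lambda>x. inv_into (Sec R x) (\<alpha> x)) F (transport S (R, R', \<alpha>) F) (\<lambda>x m. m) (\<lambda>x m. m)"
  unfolding slin_iso_def slin_hom_def
proof (intro conjI ballI allI impI)
  show "\<And>x m r. x \<in> Obj S \<Longrightarrow> r \<in> Sec R x \<Longrightarrow> r \<odot>\<^bsub>Sect F x\<^esub> m = \<alpha> x r \<odot>\<^bsub>Sect (transport S (R, R', \<alpha>) F) x\<^esub> m"
    by (simp add: transport_smult[OF \<alpha>])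
qed (simp_all add: transport_sel)

lemma psh_pull_pull:
  assumes P: "is_functor S S' P" and "\<And>z. z \<in> Obj S \<Longrightarrow> FOb Q z = FOb P' (FOb P z)" "\<And>f. f \<in> Arr S \<Longrightarrow> FAr Q f = FAr P' (FAr P f)"
  shows "psh_pull S Q F = psh_pull S P (psh_pull S' P' F)"
  using assms(2,3) functor_ob[OF P] functor_hom[OF P Arr_Hom] unfolding psh_pull_def by (auto simp: Hom_def intro!: restrict_ext)

context ringed_hocolim
begin

text \<open>The chart at the class of \<open>x\<close> factors strictly through the inclusion of
  \<open>U i\<close>, because restriction of that class is the class of the restriction of
  \<open>x\<close>.\<close>

lemma chart_map_incl:
  assumes i: "i \<in> Obj I" and X: "X \<in> Obj C" and x: "x \<in> Obj (GX X i)" and u: "u \<in> Hom C V X"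
  shows "psh_pull (slice C (rep C V)) (slice_map (chart_map C MM u (hobX X i x))) F =
    psh_pull (slice C (rep C V)) (slice_map (chart_map C (DOb U i) u x)) (psh_pull (Si i) (Jm i) F)"
proof (rule psh_pull_pull)
  interpret UU: gpsh_on C "DOb U i" by (rule U_on[OF i])
  interpret h: gpsh_hom C "DOb U i" MM "hc_incl I U i" by (rule incl_hom[OF i])
  show "is_functor (slice C (rep C V)) (Si i) (slice_map (chart_map C (DOb U i) u x))"
    by (rule gpsh_hom.slice_map_functor[OF UU.chart_map_hom[OF u x]])
  have ob: "FOb (Rst MM (Comp C u f)) (hobX X i x) = hobX W i (FOb (Rst (DOb U i) (Comp C u f)) x)" if "f \<in> Hom C W V" for f W
    by (rule Rst_hob[OF cat_comp[OF C that u] i x])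
  show "FOb (slice_map (chart_map C MM u (hobX X i x))) z = FOb (Jm i) (FOb (slice_map (chart_map C (DOb U i) u x)) z)"
    if "z \<in> Obj (slice C (rep C V))" for z
    using that by (cases z) (simp add: slice_sel slice_map_sel chart_map_sel rep_sel incl_sel ob)
  show "FAr (slice_map (chart_map C MM u (hobX X i x))) e = FAr (Jm i) (FAr (slice_map (chart_map C (DOb U i) u x)) e)"
    if e: "e \<in> Arr (slice C (rep C V))" for e
  proof -
    obtain W f Y g where "e \<in> Hom (slice C (rep C V)) (W, f) (Y, g)" by (rule slice_ArrE[OF e])
    then obtain h \<alpha> where a: "e = ((W, f), (Y, g), h, \<alpha>)" "W \<in> Obj C" "f \<in> Obj (Val (rep C V) W)" "Y \<in> Obj C" "g \<in> Obj (Val (rep C V) Y)"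
      "h \<in> Hom C W Y" "\<alpha> \<in> Hom (Val (rep C V) W) f (FOb (Rst (rep C V) h) g)" by (rule slice_HomE)
    have f: "f \<in> Hom C W V" "g \<in> Hom C Y V" "\<alpha> = f" using a(3,5,7) by (auto simp: rep_sel rep_Hom)
    have "FAr (hc_incl I U i W) (Ident (GX W i) (FOb (Rst (DOb U i) (Comp C u f)) x)) =
      Ident (Val MM W) (FOb (hc_incl I U i W) (FOb (Rst (DOb U i) (Comp C u f)) x))"
      by (rule functor_ident[OF h.\<phi>_functor[OF a(2)] UU.R_ob[OF cat_comp[OF C f(1) u] x]])
    then show ?thesis using ob[OF f(1)] ob[OF f(2)] a(2,4) by (simp add: a(1) f(3) slice_map_sel chart_map_sel incl_sel)
  qed
qed

text \<open>Every object of the homotopy colimit over \<open>X\<close> comes from some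
  \<open>U i\<close>, so its charts are exactly the charts of the \<open>U i\<close>.\<close>

lemma quasi_coherent_MM_iff:
  "is_quasi_coherent k C MM R F \<longleftrightarrow> (\<forall>i\<in>Obj I. is_quasi_coherent k C (DOb U i) (RJ i) (psh_pull (Si i) (Jm i) F))"
proof -
  have MM_ob: "(\<forall>a\<in>Obj (Val MM X). Q a) \<longleftrightarrow> (\<forall>i\<in>Obj I. \<forall>x\<in>Obj (GX X i). Q (hobX X i x))" if X: "X \<in> Obj C" for X Q
  proof
    assume q: "\<forall>a\<in>Obj (Val MM X). Q a"
    show "\<forall>i\<in>Obj I. \<forall>x\<in>Obj (GX X i). Q (hobX X i x)"
    proof (intro ballI)
      fix i x assume i: "i \<in> Obj I" and x: "x \<in> Obj (GX X i)"
      have "FOb (hc_incl I U i X) x \<in> Obj (Val MM X)" by (rule functor_ob[OF gpsh_hom.\<phi>_functor[OF incl_hom[OF i] X] x])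
      then show "Q (hobX X i x)" using q by (simp add: incl_sel[OF X])
    qed
  next
    assume q: "\<forall>i\<in>Obj I. \<forall>x\<in>Obj (GX X i). Q (hobX X i x)"
    show "\<forall>a\<in>Obj (Val MM X). Q a"
    proof
      fix a assume "a \<in> Obj (Val MM X)"
      then obtain i x where "i \<in> Obj I" "x \<in> Obj (GX X i)" "a = hobX X i x" by (rule MM_ObE[OF X])
      then show "Q a" using q by simp
    qed
  qed
  let ?S = "\<lambda>u. slice C (rep C (Dom C u))"
  have "(\<exists>c\<in>Cov C X. \<forall>u\<in>c. presented k (?S u)
        (psh_pull (?S u) (slice_map (chart_map C MM u (hobX X i x))) R)
        (psh_pull (?S u) (slice_map (chart_map C MM u (hobX X i x))) F)) \<longleftrightarrow>
      (\<exists>c\<in>Cov C X. \<forall>u\<in>c. presented k (?S u)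
        (psh_pull (?S u) (slice_map (chart_map C (DOb U i) u x)) (RJ i))
        (psh_pull (?S u) (slice_map (chart_map C (DOb U i) u x)) (psh_pull (Si i) (Jm i) F)))"
    if X: "X \<in> Obj C" and i: "i \<in> Obj I" and x: "x \<in> Obj (GX X i)" for X i x
    by (rule bex_cong[OF HOL.refl], rule ball_cong[OF HOL.refl]) (simp only: chart_map_incl[OF i X x Cov_arr[OF X]])
  then show ?thesis unfolding is_quasi_coherent_iff by (simp add: MM_ob) blast
qed

text \<open>The components of the descent functor differ from the restrictions to the
  \<open>U i\<close> by transport along \<open>b i\<close>, a semilinear isomorphism, which respects
  quasi-coherence in both directions.\<close>

lemma quasi_coherent_descends:
  assumes pb: "has_pullbacks C" and F: "is_module_sheaf SM R F"
  shows "is_quasi_coherent k C MM R F \<longleftrightarrow> (\<forall>i\<in>Obj (op_cat I). is_quasi_coherent k C (DOb U i) (Ri i) (fst (FOb \<Phi> F) i))"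
proof -
  have "is_quasi_coherent k C (DOb U i) (RJ i) (psh_pull (Si i) (Jm i) F) \<longleftrightarrow> is_quasi_coherent k C (DOb U i) (Ri i) (tr i F)" if i: "i \<in> Obj I" for i
  proof -
    note p = ring_sheaf_iso_pair[OF Si_category[OF i] b_iso(2)[OF i]]
    note s = transport_slin_iso[OF Si_category[OF i] b_iso(2)[OF i], of "psh_pull (Si i) (Jm i) F", folded b_iso(1)[OF i]]
    have m: "is_module_sheaf (Si i) (RJ i) (psh_pull (Si i) (Jm i) F)"
      by (rule pull_module_sheaf[OF Jm_functor[OF i] F gpsh_hom_site.psh_pull_sheaf[OF hom_siteI[OF incl_hom[OF i]] module_sheafD(1)[OF F]]])
    note m' = tr_module_sheaf[OF i F]
    show ?thesis
      using quasi_coherent_transfer[OF site pb U_on[OF i] p s m m'] quasi_coherent_transfer[OF site pb U_on[OF i] ring_iso_pair_sym[OF p] slin_iso_sym[OF s] m' m]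
      by (rule iffI)
  qed
  then show ?thesis unfolding quasi_coherent_MM_iff by (simp add: fst_\<Phi>)
qed

text \<open>Both sides are full subcategories of the ones already compared: by definition for
  modules on the homotopy colimit, and by \<open>holim_full_subcat\<close> for the homotopy limit.
  The two conditions match under the descent functor by
  \<open>quasi_coherent_descends\<close>.\<close>

lemma descent_quasi_coherent:
  assumes pb: "has_pullbacks C"
  shows "ff_ess_surj (Mod_qc k C MM R) (holim (op_cat I) (Mod_qc_diag k C I U RI)) \<Phi>"
proof -
  interpret D: cat_diagram "op_cat I" ED by (rule ED_diagram)
  let ?P = "\<lambda>i. is_quasi_coherent k C (DOb U i) (Ri i)"
  have inv: "?P i y" if "i \<in> Obj (op_cat I)" "e \<in> Hom (CatAt ED i) y y'" "is_isomorphism (CatAt ED i) e" "?P i y'" for i y y' e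
    by (rule quasi_coherent_iso[OF site pb U_on ring_sheaf_isoD(7)[OF b_iso(2)] that(2,3)[unfolded ED_sel(1)] that(4)]) (use that(1) in simp_all)
  have h: "holim (op_cat I) (Mod_qc_diag k C I U RI) = full_subcat (holim (op_cat I) ED) (\<lambda>a. \<forall>i\<in>Obj (op_cat I). ?P i (fst a i))"
    by (rule D.holim_full_subcat[OF inv]) (simp_all add: Mod_qc_diag_def Mod_qc_def ED_sel)
  show ?thesis unfolding h Mod_qc_def
  proof (rule ff_ess_surj_full_subcat[OF \<Phi>_ff_ess_surj])
    show "is_quasi_coherent k C MM R F \<longleftrightarrow> (\<forall>i\<in>Obj (op_cat I). ?P i (fst (FOb \<Phi> F) i))" if "F \<in> Obj (Mod SM R)" for F
      by (rule quasi_coherent_descends[OF pb]) (use that in simp)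
    fix y y' e assume e: "e \<in> Hom (holim (op_cat I) ED) y y'" "is_isomorphism (holim (op_cat I) ED) e"
      and q: "\<forall>i\<in>Obj (op_cat I). ?P i (fst y' i)"
    obtain u where u: "e = (y, y', u)" "u \<in> (\<Pi>\<^sub>E i\<in>Obj (op_cat I). Hom (CatAt ED i) (fst y i) (fst y' i))" by (rule holim_HomE[OF e(1)])
    show "\<forall>i\<in>Obj (op_cat I). ?P i (fst y i)"
      by (intro ballI, rule inv[OF _ PiE_mem[OF u(2)] holim_iso_component[OF e(2)[unfolded u(1)]]]) (use q in simp_all)
  qed
qed

end

theorem proposition5p9:
  fixes C :: "('c, 'a) site"
    and I :: "('i, 'j) cat"
    and U :: "('i, 'j, 'c, 'a, 'o, 'g) pdiag"
    and RI :: "('i, 'j, 'c, 'a, 'o, 'g, 'r) rdata"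
    and R :: "(('i, 'j, 'c, 'o) hs_ob, ('i, 'j, 'c, 'a, 'o, 'g) hs_arr, 'r) rsheaf"
    and b :: "'i \<Rightarrow> ('c \<times> 'o, ('c, 'a, 'o, 'g) sl_arr, 'r) rsheaf_arr"
  assumes "is_site C" and "has_finite_products C" and "has_pullbacks C"
    and "is_category I"
    and "is_ringed_diag C I U RI"
    and "is_ring_sheaf (slice C (hocolim_psh C I U)) R"
    and "is_isomorphism (holim (op_cat I) (ShRing_diag C I U)) (ring_restr C I U R, RI, b)"
  defines "\<Phi> \<equiv> descent_functor C I U RI b"
  shows "is_equivalence
           (Mod (slice C (hocolim_psh C I U)) R :: ((('i, 'j, 'c, 'o) hs_ob, ('i, 'j, 'c, 'a, 'o, 'g) hs_arr, 'r, 'm) msheaf, _) cat)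
           (holim (op_cat I) (Mod_diag C I U RI)) \<Phi> \<and>
         is_equivalence
           (Mod_qc TYPE('k) C (hocolim_psh C I U) R)
           (holim (op_cat I) (Mod_qc_diag TYPE('k) C I U RI)) \<Phi>"
proof -
  have C: "is_category C" using assms(1) by (simp add: is_site_def)
  have U: "is_pdiag C I U" using assms(5) by (simp add: is_ringed_diag_def)
  interpret ringed_hocolim C I U RI R b
    by unfold_locales (rule C assms(4) U assms(1,6,7))+
  show ?thesis unfolding \<Phi>_def
    by (intro conjI ff_ess_surj_equivalence \<Phi>_ff_ess_surj descent_quasi_coherent assms(3))
qed

end
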